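(* Let $\Omega\subset\mathbb R^N$ be a bounded connected domain with $C^1$ boundary, let $1<p<q<\gamma<p^*$, and let $a,b\in L^\infty(\Omega)$ satisfy $a(x)\ge 0$ and $b(x)\ge\sigma_b$ for a.e. $x\in\Omega$, where $\sigma_b>0$ is a constant, with $a\not\equiv 0$. For $\lambda,\nu>0$ consider the problems $$(Q_\lambda)\qquad -\Delta_p u=\lambda a(x)|u|^{q-2}u-b(x)|u|^{\gamma-2}u\ \text{ in }\Omega,\qquad u=0\ \text{ on }\partial\Omega,$$ $$(R_\nu)\qquad -\Delta_p u=a(x)|u|^{q-2}u-\nu b(x)|u|^{\gamma-2}u\ \text{ in }\Omega,\qquad u=0\ \text{ on }\partial\Omega,$$ and set, with $\varepsilon_e^*$ defined in the context, $$\lambda_e^*=(\varepsilon_e^* )^{-(\gamma-q)/(\gamma-p)},\qquad \nu_e^*=(\varepsilon_e^* )^{(\gamma-q)/(q-p)} .$$ (1) Problem $(Q_\lambda)$ possesses a ground state $u_\lambda$ for every $\lambda\in(\lambda_e^*,+\infty)$, and problem $(R_\nu)$ possesses a ground state $u_\nu$ for every $\nu\in(0,\nu_e^* )$. (2) Suppose in addition that there is a constant $\sigma_a>0$ with $a(x)\ge\sigma_a$ for a.e. $x\in\Omega$, and set $\bar u_0(x)=(a(x)/b(x))^{1/(\gamma-q)}$. Let $u_\lambda$, $\lambda>\lambda_e^*$, be positive ground states of $(Q_\lambda)$ and let $u_\nu$, $0<\nu<\nu_e^*$, be positive ground states of $(R_\nu)$. Then, as $\lambda\to+\infty$, $$\lambda^{-1/(\gamma-q)}u_\lambda\to\bar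 u_0\ \text{ in measure in }\Omega,$$ $$\lambda^{-1/(\gamma-q)}u_\lambda-\bar u_0\to0\ \text{ strongly in }L^r(\Omega),\quad 1\le r<\gamma,$$ $$\lambda^{-1/(\gamma-q)}u_\lambda-\bar u_0\rightharpoonup0\ \text{ weakly in }L^\gamma(\Omega).$$ Similarly, as $\nu\to0^+$, $$\nu^{1/(\gamma-q)}u_\nu\to\bar u_0\ \text{ in measure in }\Omega,$$ $$\nu^{1/(\gamma-q)}u_\nu-\bar u_0\to0\ \text{ strongly in }L^r(\Omega),\quad 1\le r<\gamma,$$ $$\nu^{1/(\gamma-q)}u_\nu-\bar u_0\rightharpoonup0\ \text{ weakly in }L^\gamma(\Omega).$$ In particular, in both cases the weak convergence holds in $L^r(\Omega)$ for all $1<r\le\gamma$.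
   Context: $\Delta_p u=\operatorname{div}(|\nabla u|^{p-2}\nabla u)$ is the $p$-Laplacian. The critical exponent is $p^*=\frac{pN}{N-p}$ if $p<N$ and $p^*=+\infty$ if $p\ge N$. $W^{1,p}_0(\Omega)$ is the closure of $C_0^\infty(\Omega)$ in $W^{1,p}(\Omega)$. The energy functionals on $W^{1,p}_0(\Omega)$ of $(Q_\lambda)$ and $(R_\nu)$ are, respectively, $$\frac{1}{p}\int_\Omega|\nabla u|^p\,dx-\frac{\lambda}{q}\int_\Omega a|u|^q\,dx+\frac1\gamma\int_\Omega b|u|^\gamma\,dx,\qquad \frac{1}{p}\int_\Omega|\nabla u|^p\,dx-\frac{1}{q}\int_\Omega a|u|^q\,dx+\frac{\nu}{\gamma}\int_\Omega b|u|^\gamma\,dx .$$ A weak solution of either problem is a critical point in $W^{1,p}_0(\Omega)$ of its energy functional; a ground state is a weak solution whose energy is less than or equal to the energy of every weak solution of the same problem (the trivial solution included). "Positive" means $u>0$ in $\Omega$. Let $\mathcal D=\{u\in W^{1,p}_0(\Omega)\setminus\{0\}:\int_\Omega a|u|^q\,dx>0\}$ and $$\varepsilon_e^*=c_{e,p,q,\gamma}\sup_{u\in\mathcal D}\frac{\left(\int_\Omega a|u|^q\,dx\right)^{\frac{\gamma-p}{\gamma-q}}}{\int_\Omega|\nabla u|^p\,dx\,\left(\int_\Omega b|u|^\gamma\,dx\right)^{\frac{q-p}{\gamma-q}}},\qquad c_{e,p,q,\gamma}=\frac{p(\gamma-q)}{q(\gamma-p)}\left(\frac{\gamma(q-p)}{q(\gamma-p)}\right)^{\frac{q-p}{\gamma-q}}.$$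 *)

theory Defs
  imports "HOL-Analysis.Analysis"
begin

section \<open>Smooth functions and domains\<close>

primrec C_k :: "nat \<Rightarrow> ('a::euclidean_space \<Rightarrow> real) \<Rightarrow> bool" where
  "C_k 0 f \<longleftrightarrow> continuous_on UNIV f"
| "C_k (Suc k) f \<longleftrightarrow>
     (\<exists>G. (\<forall>x. GDERIV f x :> G x) \<and> (\<forall>i\<in>Basis. C_k k (\<lambda>x. G x \<bullet> i)))"

definition test_functions :: "'a::euclidean_space set \<Rightarrow> ('a \<Rightarrow> real) set" where
  "test_functions \<Omega> = {\<phi>. (\<forall>k. C_k k \<phi>) \<and>
     compact (closure {x. \<phi> x \<noteq> 0}) \<and> closure {x. \<phi> x \<noteq> 0} \<subseteq> \<Omega>}"

text \<open>Near each boundary point the set lies strictly on one side of a \<open>C\<^sup>1\<close> graph over the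
  hyperplane orthogonal to some unit vector \<open>e\<close>. The function \<open>g\<close> is only evaluated on this
  hyperplane.\<close>
definition C1_boundary :: "'a::euclidean_space set \<Rightarrow> bool" where
  "C1_boundary \<Omega> \<longleftrightarrow> (\<forall>x0\<in>frontier \<Omega>. \<exists>r>0. \<exists>e g. norm e = 1 \<and> C_k 1 g \<and>
     \<Omega> \<inter> ball x0 r = {x \<in> ball x0 r. g (x - (x \<bullet> e) *\<^sub>R e) < x \<bullet> e})"

definition bounded_C1_domain :: "'a::euclidean_space set \<Rightarrow> bool" where
  "bounded_C1_domain \<Omega> \<longleftrightarrow>
     open \<Omega> \<and> connected \<Omega> \<and> \<Omega> \<noteq> {} \<and> bounded \<Omega> \<and> C1_boundary \<Omega>"

section \<open>Lebesgue spaces\<close>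

text \<open>Elements of Lebesgue and Sobolev spaces are represented by functions; all notions below
  are invariant under almost everywhere equality on the domain.\<close>

definition Lp :: "real \<Rightarrow> 'a measure \<Rightarrow> ('a \<Rightarrow> 'b::real_normed_vector) set" where
  "Lp r M = {f. f \<in> borel_measurable M \<and> integrable M (\<lambda>x. norm (f x) powr r)}"

definition Lp_norm :: "real \<Rightarrow> 'a measure \<Rightarrow> ('a \<Rightarrow> 'b::real_normed_vector) \<Rightarrow> real" where
  "Lp_norm r M f = (\<integral>x. norm (f x) powr r \<partial>M) powr (1 / r)"

definition Linfty :: "'a measure \<Rightarrow> ('a \<Rightarrow> real) set" where
  "Linfty M = {f. f \<in> borel_measurable M \<and> (\<exists>C. AE x in M. \<bar>f x\<bar> \<le> C)}"

definition Lp_dual :: "real \<Rightarrow> 'a measure \<Rightarrow> (('a \<Rightarrow> real) \<Rightarrow> real) set" where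
  "Lp_dual r M = {\<Lambda>.
     (\<forall>f\<in>Lp r M. \<forall>g\<in>Lp r M. \<Lambda> (\<lambda>x. f x + g x) = \<Lambda> f + \<Lambda> g) \<and>
     (\<forall>c. \<forall>f\<in>Lp r M. \<Lambda> (\<lambda>x. c * f x) = c * \<Lambda> f) \<and>
     (\<exists>C. \<forall>f\<in>Lp r M. \<bar>\<Lambda> f\<bar> \<le> C * Lp_norm r M f)}"

definition tendsto_in_measure ::
  "'a measure \<Rightarrow> 'i filter \<Rightarrow> ('i \<Rightarrow> 'a \<Rightarrow> real) \<Rightarrow> ('a \<Rightarrow> real) \<Rightarrow> bool" where
  "tendsto_in_measure M F f g \<longleftrightarrow>
     g \<in> borel_measurable M \<and> (\<forall>\<^sub>F i in F. f i \<in> borel_measurable M) \<and>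
     (\<forall>\<delta>>0. ((\<lambda>i. emeasure M {x \<in> space M. \<bar>f i x - g x\<bar> \<ge> \<delta>}) \<longlongrightarrow> 0) F)"

definition tendsto_Lp ::
  "real \<Rightarrow> 'a measure \<Rightarrow> 'i filter \<Rightarrow> ('i \<Rightarrow> 'a \<Rightarrow> real) \<Rightarrow> ('a \<Rightarrow> real) \<Rightarrow> bool" where
  "tendsto_Lp r M F f g \<longleftrightarrow>
     g \<in> Lp r M \<and> (\<forall>\<^sub>F i in F. f i \<in> Lp r M) \<and>
     ((\<lambda>i. Lp_norm r M (\<lambda>x. f i x - g x)) \<longlongrightarrow> 0) F"

definition weakly_tendsto_Lp ::
  "real \<Rightarrow> 'a measure \<Rightarrow> 'i filter \<Rightarrow> ('i \<Rightarrow> 'a \<Rightarrow> real) \<Rightarrow> ('a \<Rightarrow> real) \<Rightarrow> bool" where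
  "weakly_tendsto_Lp r M F f g \<longleftrightarrow>
     g \<in> Lp r M \<and> (\<forall>\<^sub>F i in F. f i \<in> Lp r M) \<and>
     (\<forall>\<Lambda>\<in>Lp_dual r M. ((\<lambda>i. \<Lambda> (f i)) \<longlongrightarrow> \<Lambda> g) F)"

section \<open>Sobolev spaces\<close>

definition locally_integrable ::
  "'a::euclidean_space set \<Rightarrow> ('a \<Rightarrow> 'b::euclidean_space) \<Rightarrow> bool" where
  "locally_integrable \<Omega> f \<longleftrightarrow> f \<in> borel_measurable (lebesgue_on \<Omega>) \<and>
     (\<forall>K. compact K \<and> K \<subseteq> \<Omega> \<longrightarrow> integrable (lebesgue_on K) f)"

definition has_weak_gradient ::
  "'a::euclidean_space set \<Rightarrow> ('a \<Rightarrow> real) \<Rightarrow> ('a \<Rightarrow> 'a) \<Rightarrow> bool" where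
  "has_weak_gradient \<Omega> u G \<longleftrightarrow> locally_integrable \<Omega> u \<and> locally_integrable \<Omega> G \<and>
     (\<forall>\<phi>\<in>test_functions \<Omega>. \<forall>D. (\<forall>x. GDERIV \<phi> x :> D x) \<longrightarrow>
        (\<integral>x. u x *\<^sub>R D x \<partial>(lebesgue_on \<Omega>)) = - (\<integral>x. \<phi> x *\<^sub>R G x \<partial>(lebesgue_on \<Omega>)))"

text \<open>A weak gradient on an open set is unique up to almost everywhere equality, so the choice
  is immaterial in the integrals below.\<close>
definition weak_gradient :: "'a::euclidean_space set \<Rightarrow> ('a \<Rightarrow> real) \<Rightarrow> 'a \<Rightarrow> 'a" where
  "weak_gradient \<Omega> u = (SOME G. has_weak_gradient \<Omega> u G)"

definition W1p :: "real \<Rightarrow> 'a::euclidean_space set \<Rightarrow> ('a \<Rightarrow> real) set" where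
  "W1p p \<Omega> = {u. u \<in> Lp p (lebesgue_on \<Omega>) \<and>
     (\<exists>G. has_weak_gradient \<Omega> u G \<and> G \<in> Lp p (lebesgue_on \<Omega>))}"

definition W1p_norm :: "real \<Rightarrow> 'a::euclidean_space set \<Rightarrow> ('a \<Rightarrow> real) \<Rightarrow> real" where
  "W1p_norm p \<Omega> u =
     ((\<integral>x. \<bar>u x\<bar> powr p \<partial>(lebesgue_on \<Omega>)) +
      (\<integral>x. norm (weak_gradient \<Omega> u x) powr p \<partial>(lebesgue_on \<Omega>))) powr (1 / p)"

definition W1p_0 :: "real \<Rightarrow> 'a::euclidean_space set \<Rightarrow> ('a \<Rightarrow> real) set" where
  "W1p_0 p \<Omega> = {u \<in> W1p p \<Omega>.
     \<forall>\<epsilon>>0. \<exists>\<phi>\<in>test_functions \<Omega>. W1p_norm p \<Omega> (\<lambda>x. u x - \<phi> x) < \<epsilon>}"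

definition critical_exponent :: "real \<Rightarrow> nat \<Rightarrow> ereal" where
  "critical_exponent p N =
     (if p < real N then ereal (p * real N / (real N - p)) else \<infinity>)"

section \<open>Energy functionals, weak solutions and ground states\<close>

definition energy_Q ::
  "real \<Rightarrow> real \<Rightarrow> real \<Rightarrow> 'a::euclidean_space set \<Rightarrow> ('a \<Rightarrow> real) \<Rightarrow> ('a \<Rightarrow> real) \<Rightarrow>
   real \<Rightarrow> ('a \<Rightarrow> real) \<Rightarrow> real" where
  "energy_Q p q \<gamma> \<Omega> a b l u =
     1 / p * (\<integral>x. norm (weak_gradient \<Omega> u x) powr p \<partial>(lebesgue_on \<Omega>))
     - l / q * (\<integral>x. a x * \<bar>u x\<bar> powr q \<partial>(lebesgue_on \<Omega>))
     + 1 / \<gamma> * (\<integral>x. b x * \<bar>u x\<bar> powr \<gamma> \<partial>(lebesgue_on \<Omega>))"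

definition energy_R ::
  "real \<Rightarrow> real \<Rightarrow> real \<Rightarrow> 'a::euclidean_space set \<Rightarrow> ('a \<Rightarrow> real) \<Rightarrow> ('a \<Rightarrow> real) \<Rightarrow>
   real \<Rightarrow> ('a \<Rightarrow> real) \<Rightarrow> real" where
  "energy_R p q \<gamma> \<Omega> a b \<nu> u =
     1 / p * (\<integral>x. norm (weak_gradient \<Omega> u x) powr p \<partial>(lebesgue_on \<Omega>))
     - 1 / q * (\<integral>x. a x * \<bar>u x\<bar> powr q \<partial>(lebesgue_on \<Omega>))
     + \<nu> / \<gamma> * (\<integral>x. b x * \<bar>u x\<bar> powr \<gamma> \<partial>(lebesgue_on \<Omega>))"

text \<open>The Frechet derivative of \<open>E\<close> at \<open>u\<close> on the normed space \<open>W1p_0 p \<Omega>\<close> exists and vanishes.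
  The library's \<open>has_derivative\<close> does not apply, since this space is a set of functions and not
  a type.\<close>
definition critical_point ::
  "real \<Rightarrow> 'a::euclidean_space set \<Rightarrow> (('a \<Rightarrow> real) \<Rightarrow> real) \<Rightarrow> ('a \<Rightarrow> real) \<Rightarrow> bool" where
  "critical_point p \<Omega> E u \<longleftrightarrow> u \<in> W1p_0 p \<Omega> \<and>
     (\<forall>\<epsilon>>0. \<exists>\<delta>>0. \<forall>v\<in>W1p_0 p \<Omega>. W1p_norm p \<Omega> v < \<delta> \<longrightarrow>
        \<bar>E (\<lambda>x. u x + v x) - E u\<bar> \<le> \<epsilon> * W1p_norm p \<Omega> v)"

definition weak_solution_Q ::
  "real \<Rightarrow> real \<Rightarrow> real \<Rightarrow> 'a::euclidean_space set \<Rightarrow> ('a \<Rightarrow> real) \<Rightarrow> ('a \<Rightarrow> real) \<Rightarrow>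
   real \<Rightarrow> ('a \<Rightarrow> real) \<Rightarrow> bool" where
  "weak_solution_Q p q \<gamma> \<Omega> a b l u \<longleftrightarrow> critical_point p \<Omega> (energy_Q p q \<gamma> \<Omega> a b l) u"

definition weak_solution_R ::
  "real \<Rightarrow> real \<Rightarrow> real \<Rightarrow> 'a::euclidean_space set \<Rightarrow> ('a \<Rightarrow> real) \<Rightarrow> ('a \<Rightarrow> real) \<Rightarrow>
   real \<Rightarrow> ('a \<Rightarrow> real) \<Rightarrow> bool" where
  "weak_solution_R p q \<gamma> \<Omega> a b \<nu> u \<longleftrightarrow> critical_point p \<Omega> (energy_R p q \<gamma> \<Omega> a b \<nu>) u"

definition ground_state_Q ::
  "real \<Rightarrow> real \<Rightarrow> real \<Rightarrow> 'a::euclidean_space set \<Rightarrow> ('a \<Rightarrow> real) \<Rightarrow> ('a \<Rightarrow> real) \<Rightarrow>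
   real \<Rightarrow> ('a \<Rightarrow> real) \<Rightarrow> bool" where
  "ground_state_Q p q \<gamma> \<Omega> a b l u \<longleftrightarrow> weak_solution_Q p q \<gamma> \<Omega> a b l u \<and>
     (\<forall>v. weak_solution_Q p q \<gamma> \<Omega> a b l v \<longrightarrow>
        energy_Q p q \<gamma> \<Omega> a b l u \<le> energy_Q p q \<gamma> \<Omega> a b l v)"

definition ground_state_R ::
  "real \<Rightarrow> real \<Rightarrow> real \<Rightarrow> 'a::euclidean_space set \<Rightarrow> ('a \<Rightarrow> real) \<Rightarrow> ('a \<Rightarrow> real) \<Rightarrow>
   real \<Rightarrow> ('a \<Rightarrow> real) \<Rightarrow> bool" where
  "ground_state_R p q \<gamma> \<Omega> a b \<nu> u \<longleftrightarrow> weak_solution_R p q \<gamma> \<Omega> a b \<nu> u \<and>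
     (\<forall>v. weak_solution_R p q \<gamma> \<Omega> a b \<nu> v \<longrightarrow>
        energy_R p q \<gamma> \<Omega> a b \<nu> u \<le> energy_R p q \<gamma> \<Omega> a b \<nu> v)"

text \<open>Almost everywhere, since \<open>u\<close> stands for its equivalence class; a function that is positive
  at every point of the domain is covered.\<close>
definition positive_on :: "'a::euclidean_space set \<Rightarrow> ('a \<Rightarrow> real) \<Rightarrow> bool" where
  "positive_on \<Omega> u \<longleftrightarrow> (AE x in lebesgue_on \<Omega>. u x > 0)"

section \<open>The extremal constants\<close>

definition c_e :: "real \<Rightarrow> real \<Rightarrow> real \<Rightarrow> real" where
  "c_e p q \<gamma> = p * (\<gamma> - q) / (q * (\<gamma> - p)) *
     (\<gamma> * (q - p) / (q * (\<gamma> - p))) powr ((q - p) / (\<gamma> - q))"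

definition D_set ::
  "real \<Rightarrow> real \<Rightarrow> 'a::euclidean_space set \<Rightarrow> ('a \<Rightarrow> real) \<Rightarrow> ('a \<Rightarrow> real) set" where
  "D_set p q \<Omega> a = {u \<in> W1p_0 p \<Omega>. \<not> (AE x in lebesgue_on \<Omega>. u x = 0) \<and>
     (\<integral>x. a x * \<bar>u x\<bar> powr q \<partial>(lebesgue_on \<Omega>)) > 0}"

text \<open>The supremum is taken in the reals: under the standing assumptions the index set is
  nonempty, and the quotients are bounded by the interpolation inequality between \<open>L\<^sup>p\<close> and
  \<open>L\<^sup>\<gamma>\<close> together with the Poincare inequality.\<close>
definition eps_e ::
  "real \<Rightarrow> real \<Rightarrow> real \<Rightarrow> 'a::euclidean_space set \<Rightarrow> ('a \<Rightarrow> real) \<Rightarrow> ('a \<Rightarrow> real) \<Rightarrow> real" where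
  "eps_e p q \<gamma> \<Omega> a b = c_e p q \<gamma> *
     (SUP u\<in>D_set p q \<Omega> a.
        (\<integral>x. a x * \<bar>u x\<bar> powr q \<partial>(lebesgue_on \<Omega>)) powr ((\<gamma> - p) / (\<gamma> - q)) /
        ((\<integral>x. norm (weak_gradient \<Omega> u x) powr p \<partial>(lebesgue_on \<Omega>)) *
         (\<integral>x. b x * \<bar>u x\<bar> powr \<gamma> \<partial>(lebesgue_on \<Omega>)) powr ((q - p) / (\<gamma> - q))))"

definition lambda_e ::
  "real \<Rightarrow> real \<Rightarrow> real \<Rightarrow> 'a::euclidean_space set \<Rightarrow> ('a \<Rightarrow> real) \<Rightarrow> ('a \<Rightarrow> real) \<Rightarrow> real" where
  "lambda_e p q \<gamma> \<Omega> a b = eps_e p q \<gamma> \<Omega> a b powr (- (\<gamma> - q) / (\<gamma> - p))"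

definition nu_e ::
  "real \<Rightarrow> real \<Rightarrow> real \<Rightarrow> 'a::euclidean_space set \<Rightarrow> ('a \<Rightarrow> real) \<Rightarrow> ('a \<Rightarrow> real) \<Rightarrow> real" where
  "nu_e p q \<gamma> \<Omega> a b = eps_e p q \<gamma> \<Omega> a b powr ((\<gamma> - q) / (q - p))"

definition u0_bar ::
  "real \<Rightarrow> real \<Rightarrow> ('a \<Rightarrow> real) \<Rightarrow> ('a \<Rightarrow> real) \<Rightarrow> 'a \<Rightarrow> real" where
  "u0_bar q \<gamma> a b x = (a x / b x) powr (1 / (\<gamma> - q))"

end

theory Submission
  imports Defs "HOL-Complex_Analysis.Great_Picard" "HOL-Library.Diagonal_Subsequence"
begin

text \<open>
  Both problems are governed by the energy with general coefficients \<open>\<alpha>\<close> and \<open>\<beta>\<close> in front of the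
  \<open>a\<close>- and the \<open>b\<close>-term. It is coercive because \<open>q < \<gamma>\<close> and \<open>b\<close> is bounded below, so its infimum
  over the test functions is finite. A minimizing sequence is precompact in \<open>L\<^sup>\<gamma>\<close> (Rellich and
  interpolation with an exponent between \<open>\<gamma>\<close> and \<open>p\<^sup>*\<close>), and since midpoints have at least minimal
  energy, uniform convexity makes its gradients converge strongly. The minimizer is a critical
  point because the second difference of the energy is at most \<open>o(|v|)\<close>: the \<open>a\<close>-term enters
  with the favourable sign. Hence the ground states are exactly the global minimizers.

  With \<open>s = (\<alpha>/\<beta>)\<^bsup>1/(\<gamma>-q)\<^esup>\<close> the function \<open>w = u/s\<close> minimizes
  \<open>\<epsilon>/p \<integral>|\<nabla>w|\<^sup>p + \<integral>(b |w|\<^sup>\<gamma>/\<gamma> - a |w|\<^sup>q/q)\<close> with \<open>\<epsilon> = s\<^bsup>p-q\<^esup>/\<alpha> \<rightarrow> 0\<close>. The second integrand has the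
  pointwise strict minimizer \<open>(a/b)\<^bsup>1/(\<gamma>-q)\<^esup>\<close>, which test functions approximate, so the excess of the
  second integral tends to \<open>0\<close>; it controls \<open>\<integral>|w - (a/b)\<^bsup>1/(\<gamma>-q)\<^esup>|\<^sup>\<gamma>\<close>. The convergence is thus even
  strong in \<open>L\<^sup>\<gamma>\<close>, and all the asserted modes follow.
\<close>

section \<open>Power inequalities\<close>

text \<open>Test functions, extended by zero, are the only functions handled classically:
  translation, averaging and integration by parts take place on the whole space, and statements
  about \<open>W1p_0\<close> are limits of statements about test functions. The subcritical
  embedding comes from a bootstrap: control in L^s improves to L^r for every r < p + p s / N, and
  for p < N the fixed point of s -> p + p s / N is the critical exponent, which is where strict
  subcriticality enters.

  Minimizing sequences converge in norm, not merely weakly. The concave a-term is no obstacle in the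
  limit, as it is continuous in L^\<gamma>; only the gradient needs convexity.

  Criticality means Frechet differentiability with derivative zero. For a minimizer, E(u+v) - E(u)
  is nonnegative and at most E(u+v) + E(u-v) - 2 E(u), so an upper bound of second differences
  decides.

  The extremal constant acts through signs: \<open>lambda_e\<close> is nonnegative, so each
  admissible parameter of the first family is positive; \<open>eps_e\<close> is positive, so the
  admissible parameters of the second family fill a right neighbourhood of 0.\<close>

lemma powr_greater_tangent:
  fixes y r :: real
  assumes "1 < r" "0 \<le> y" "y \<noteq> 1"
  shows "1 + r * (y - 1) < y powr r"
proof (cases "y = 0")
  case True
  then show ?thesis using assms by simp
next
  case False
  then have y: "0 < y" using assms by simp
  have D: "((\<lambda>x. x powr r) has_real_derivative r * x powr (r - 1)) (at x)" if "0 < x" for x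
    using that by (rule has_real_derivative_powr)
  show ?thesis
  proof (cases "1 < y")
    case True
    obtain z where z: "1 < z" "z < y" "y powr r - 1 powr r = (y - 1) * (r * z powr (r - 1))"
      using MVT2[OF True, of "\<lambda>x. x powr r" "\<lambda>x. r * x powr (r - 1)"] D by force
    have "1 < z powr (r - 1)" using z assms by (simp add: gr_one_powr)
    then have "(y - 1) * r * 1 < (y - 1) * r * z powr (r - 1)"
      using True assms by (intro mult_strict_left_mono) auto
    then show ?thesis using z by (simp add: algebra_simps)
  next
    case False
    then have "y < 1" using assms by simp
    then obtain z where z: "y < z" "z < 1" "1 powr r - y powr r = (1 - y) * (r * z powr (r - 1))"
      using MVT2[of y 1 "\<lambda>x. x powr r" "\<lambda>x. r * x powr (r - 1)"] D y by force
    have "z powr (r - 1) < 1" using powr_less_mono2[of "r - 1" z 1] z assms y by simp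
    then have "(1 - y) * r * z powr (r - 1) < (1 - y) * r * 1"
      using \<open>y < 1\<close> assms by (intro mult_strict_left_mono) auto
    then show ?thesis using z by (simp add: algebra_simps)
  qed
qed

text \<open>After division by the midpoint the two arguments differ from 1 and add up to 2, so the
  linear terms of the two tangent inequalities at 1 cancel.\<close>

lemma powr_midpoint_strict:
  fixes s t r :: real
  assumes "1 < r" "0 \<le> s" "0 \<le> t" "s \<noteq> t"
  shows "((s + t) / 2) powr r < (s powr r + t powr r) / 2"
proof -
  define m where "m = (s + t) / 2"
  have m: "0 < m" using assms by (auto simp: m_def)
  have "1 + r * (s / m - 1) < (s / m) powr r" "1 + r * (t / m - 1) < (t / m) powr r"
    using assms m by (intro powr_greater_tangent; force simp: m_def field_simps)+
  then have "2 + r * ((s + t) / m - 2) < (s / m) powr r + (t / m) powr r"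
    by (simp add: algebra_simps add_divide_distrib)
  moreover have "(s + t) / m = 2" using m by (simp add: m_def field_simps)
  ultimately have "2 < (s powr r + t powr r) / m powr r"
    using m by (simp add: powr_divide add_divide_distrib)
  then show ?thesis using m by (simp add: field_simps m_def)
qed

lemma norm_powr_midpoint:
  fixes x y :: "'b::real_normed_vector"
  assumes "1 < r"
  shows "norm ((x + y) /\<^sub>R 2) powr r \<le> (norm x powr r + norm y powr r) / 2"
proof -
  have "norm ((x + y) /\<^sub>R 2) \<le> (norm x + norm y) / 2"
    by (simp add: norm_triangle_ineq)
  then have "norm ((x + y) /\<^sub>R 2) powr r \<le> ((norm x + norm y) / 2) powr r"
    using assms by (intro powr_mono2) auto
  also have "\<dots> \<le> (norm x powr r + norm y powr r) / 2"
    using powr_midpoint_strict[OF assms, of "norm x" "norm y"] by (cases "norm x = norm y") auto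
  finally show ?thesis .
qed

text \<open>Unequal norms reduce to the strict scalar inequality. For equal norms, equality in the
  triangle inequality would force the vectors to coincide; this is where an inner product is
  used.\<close>

lemma norm_powr_midpoint_strict:
  fixes x y :: "'b::real_inner"
  assumes "1 < r" "x \<noteq> y"
  shows "norm ((x + y) /\<^sub>R 2) powr r < (norm x powr r + norm y powr r) / 2"
proof (cases "norm x = norm y")
  case True
  have "norm (x + y) \<noteq> norm x + norm y"
  proof
    assume "norm (x + y) = norm x + norm y"
    then have "norm x *\<^sub>R y = norm y *\<^sub>R x" by (simp add: norm_triangle_eq)
    then show False using True assms by auto
  qed
  then have "norm (x + y) < norm x + norm y"
    using norm_triangle_ineq[of x y] by simp
  then have "norm ((x + y) /\<^sub>R 2) powr r < ((norm x + norm y) / 2) powr r"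
    using assms by (intro powr_less_mono2) auto
  then show ?thesis using True by simp
next
  case False
  have "norm ((x + y) /\<^sub>R 2) \<le> (norm x + norm y) / 2"
    by (simp add: norm_triangle_ineq)
  then have "norm ((x + y) /\<^sub>R 2) powr r \<le> ((norm x + norm y) / 2) powr r"
    using assms by (intro powr_mono2) auto
  with powr_midpoint_strict[OF assms(1) _ _ False] show ?thesis by simp
qed

text \<open>By homogeneity it suffices to argue on the compact unit sphere of pairs.\<close>
lemma norm_powr_uniformly_convex:
  fixes r \<epsilon> :: real
  assumes "1 < r" "0 < \<epsilon>"
  shows "\<exists>C\<ge>0. \<forall>x y::'b::euclidean_space. norm (x - y) powr r \<le> \<epsilon> * (norm x powr r + norm y powr r)
    + C * ((norm x powr r + norm y powr r) / 2 - norm ((x + y) /\<^sub>R 2) powr r)"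
proof -
  define d where "d z = (norm (fst z) powr r + norm (snd z) powr r) / 2 - norm ((fst z + snd z) /\<^sub>R 2) powr r"
    for z :: "'b \<times> 'b"
  define n where "n z = norm (fst z) powr r + norm (snd z) powr r" for z :: "'b \<times> 'b"
  define m where "m z = norm (fst z - snd z) powr r" for z :: "'b \<times> 'b"
  have cn: "continuous_on UNIV n" and cd: "continuous_on UNIV d" and cm: "continuous_on UNIV m"
    unfolding n_def d_def m_def using assms(1) by (auto intro!: continuous_intros continuous_on_powr')
  \<comment> \<open>On normalized pairs whose distance has r-th power at least \<epsilon> the
    midpoint defect \<open>d\<close> is positive, and compactness gives it a positive lower bound
    \<open>c\<close>.\<close>
  define S where "S = {z. n z = 1 \<and> \<epsilon> \<le> m z}"
  have le1: "norm (fst z) \<le> 1 \<and> norm (snd z) \<le> 1" if "n z = 1" for z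
  proof (rule ccontr)
    assume "\<not> ?thesis"
    then have "1 < norm (fst z) \<or> 1 < norm (snd z)" by auto
    then have "1 < norm (fst z) powr r \<or> 1 < norm (snd z) powr r"
      using assms by (auto simp: gr_one_powr)
    then show False using that unfolding n_def
      by (smt (verit) powr_ge_zero)
  qed
  have "closed S" unfolding S_def
    by (intro closed_Collect_conj closed_Collect_eq closed_Collect_le cn cm continuous_intros)
  moreover have "bounded S"
  proof (rule boundedI)
    fix z assume "z \<in> S"
    then have "n z = 1" by (simp add: S_def)
    from le1[OF this] show "norm z \<le> 2"
      using norm_Pair_le[of "fst z" "snd z"] by simp
  qed
  ultimately have S: "compact S" by (simp add: compact_eq_bounded_closed)
  have dpos: "0 < d z" if "z \<in> S" for z
  proof -
    have "fst z \<noteq> snd z" using that assms by (auto simp: S_def m_def)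
    from norm_powr_midpoint_strict[OF assms(1) this] show ?thesis by (simp add: d_def)
  qed
  obtain c where c: "0 < c" "\<And>z. z \<in> S \<Longrightarrow> c \<le> d z"
  proof (cases "S = {}")
    case True then show ?thesis using that[of 1] by simp
  next
    case False
    from continuous_attains_inf[OF S this continuous_on_subset[OF cd]]
    obtain z0 where "z0 \<in> S" "\<forall>z\<in>S. d z0 \<le> d z" by auto
    then show ?thesis using that[of "d z0"] dpos by auto
  qed
  have d0: "0 \<le> d z" for z
    using norm_powr_midpoint[OF assms(1), of "fst z" "snd z"] by (simp add: d_def)
  \<comment> \<open>On normalized pairs \<open>m\<close> is at most 2^r, because both norms are at
    most 1; dividing by \<open>c\<close> lets the defect pay for it on \<open>S\<close>. Off
    \<open>S\<close> the term with \<epsilon> suffices.\<close>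
  have *: "m z \<le> \<epsilon> * n z + (2 powr r / c) * d z" for z
  proof (cases "n z = 0")
    case True
    then have "norm (fst z) powr r = 0 \<and> norm (snd z) powr r = 0"
      unfolding n_def by (smt (verit) powr_ge_zero)
    then have "fst z = 0" "snd z = 0" by auto
    then show ?thesis using True c d0 by (simp add: m_def)
  next
    case False
    \<comment> \<open>Dividing a nonzero pair by \<open>t\<close> normalizes it; \<open>n\<close>,
      \<open>m\<close> and \<open>d\<close> all scale by t^r.\<close>
    define t where "t = n z powr (1 / r)"
    have nz: "0 < n z" using False unfolding n_def by (smt (verit) powr_ge_zero)
    have t: "0 < t" "t powr r = n z" using nz assms by (auto simp: t_def powr_powr)
    define w where "w = (fst z /\<^sub>R t, snd z /\<^sub>R t)"
    have zw: "fst z = t *\<^sub>R fst w" "snd z = t *\<^sub>R snd w" using t by (auto simp: w_def)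
    have hn: "n z = t powr r * n w"
      using t by (simp add: n_def zw powr_mult distrib_left)
    have hm: "m z = t powr r * m w"
      using t by (simp add: m_def zw powr_mult flip: scaleR_diff_right)
    have "(t *\<^sub>R fst w + t *\<^sub>R snd w) /\<^sub>R 2 = t *\<^sub>R ((fst w + snd w) /\<^sub>R 2)"
      by (simp add: algebra_simps)
    then have hd: "d z = t powr r * d w"
      using t by (simp only: d_def zw norm_scaleR powr_mult) (simp add: algebra_simps add_divide_distrib)
    have nw: "n w = 1" using hn t nz by simp
    have "m w \<le> \<epsilon> + 2 powr r / c * d w"
    proof (cases "\<epsilon> \<le> m w")
      case True
      then have "c \<le> d w" using c nw by (simp add: S_def)
      then have "2 powr r / c * c \<le> 2 powr r / c * d w"
        using c by (intro mult_left_mono) auto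
      moreover have "norm (fst w - snd w) \<le> 2"
        using le1[OF nw] norm_triangle_ineq4[of "fst w" "snd w"] by simp
      then have "m w \<le> 2 powr r" using assms by (auto simp: m_def intro!: powr_mono2)
      ultimately show ?thesis using c assms by simp
    next
      case False
      then show ?thesis using d0[of w] c by (smt (verit) divide_nonneg_pos mult_nonneg_nonneg powr_ge_zero)
    qed
    then have "t powr r * m w \<le> t powr r * (\<epsilon> + 2 powr r / c * d w)"
      by (intro mult_left_mono) auto
    then show ?thesis by (simp add: hm hd hn nw algebra_simps)
  qed
  show ?thesis
  proof (intro exI[of _ "2 powr r / c"] conjI allI)
    show "0 \<le> 2 powr r / c" using c by simp
    show "norm (x - y) powr r \<le> \<epsilon> * (norm x powr r + norm y powr r)
      + 2 powr r / c * ((norm x powr r + norm y powr r) / 2 - norm ((x + y) /\<^sub>R 2) powr r)" for x y :: 'b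
      using *[of "(x, y)"] by (simp add: m_def n_def d_def)
  qed
qed

section \<open>Perturbation of powers of the norm\<close>

lemma norm_add_powr_le:
  fixes x y :: "'b::real_normed_vector"
  assumes "0 < r"
  shows "norm (x + y) powr r \<le> 2 powr r * (norm x powr r + norm y powr r)"
proof -
  have "norm (x + y) powr r \<le> (2 * max (norm x) (norm y)) powr r"
    using assms norm_triangle_ineq[of x y] by (intro powr_mono2) auto
  also have "\<dots> = 2 powr r * max (norm x) (norm y) powr r" by (simp add: powr_mult)
  also have "\<dots> \<le> 2 powr r * (norm x powr r + norm y powr r)"
    by (intro mult_left_mono) (auto simp: max_def)
  finally show ?thesis .
qed

text \<open>If |y| <= d |x|, the norm changes by a factor between 1 - d and 1 + d, whose r-th powers
  are within \<epsilon> of 1 once d is small. Otherwise both norms are at most (1/d + 1) |y|, which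
  gives the constant.\<close>

lemma norm_powr_continuity:
  fixes r \<epsilon> :: real
  assumes "0 < r" "0 < \<epsilon>"
  shows "\<exists>C\<ge>0. \<forall>x y::'b::real_normed_vector.
    \<bar>norm (x + y) powr r - norm x powr r\<bar> \<le> \<epsilon> * norm x powr r + C * norm y powr r"
proof -
  have "((\<lambda>d::real. (1 + d) powr r - 1) \<longlongrightarrow> (1 + 0) powr r - 1) (at_right 0)"
    by (intro tendsto_intros) auto
  moreover have "((\<lambda>d::real. 1 - (1 - d) powr r) \<longlongrightarrow> 1 - (1 - 0) powr r) (at_right 0)"
    by (intro tendsto_intros) auto
  ultimately have "\<forall>\<^sub>F d::real in at_right 0. (1 + d) powr r - 1 < \<epsilon>"
    "\<forall>\<^sub>F d::real in at_right 0. 1 - (1 - d) powr r < \<epsilon>"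
    using assms by (auto intro!: order_tendstoD(2)[where y=0])
  moreover have "\<forall>\<^sub>F d::real in at_right 0. d < 1" "\<forall>\<^sub>F d::real in at_right 0. 0 < d"
    by (auto intro: eventually_at_right_less eventually_at_rightI)
  ultimately have "\<forall>\<^sub>F d::real in at_right 0. (1 + d) powr r - 1 < \<epsilon> \<and> 1 - (1 - d) powr r < \<epsilon> \<and> d < 1 \<and> 0 < d"
    by (intro eventually_conj) auto
  then obtain d :: real where d: "0 < d" "d < 1" "(1 + d) powr r - 1 < \<epsilon>" "1 - (1 - d) powr r < \<epsilon>"
    using eventually_happens'[OF trivial_limit_at_right_real] by blast
  show ?thesis
  proof (intro exI[of _ "(1 / d + 1) powr r"] conjI allI)
    show "0 \<le> (1 / d + 1) powr r" by simp
    fix x y :: 'b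
    show "\<bar>norm (x + y) powr r - norm x powr r\<bar> \<le> \<epsilon> * norm x powr r + (1 / d + 1) powr r * norm y powr r"
    proof (cases "norm y \<le> d * norm x")
      case True
      have "norm (x + y) \<le> (1 + d) * norm x" "(1 - d) * norm x \<le> norm (x + y)"
        using True norm_triangle_ineq[of x y] norm_diff_ineq[of x y] by (auto simp: algebra_simps)
      then have "norm (x + y) powr r \<le> ((1 + d) * norm x) powr r"
        "((1 - d) * norm x) powr r \<le> norm (x + y) powr r"
        using assms d by (auto intro!: powr_mono2)
      then have "norm (x + y) powr r \<le> (1 + d) powr r * norm x powr r"
        "(1 - d) powr r * norm x powr r \<le> norm (x + y) powr r"
        by (auto simp: powr_mult)
      moreover have "(1 + d) powr r * norm x powr r \<le> (1 + \<epsilon>) * norm x powr r"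
        "(1 - \<epsilon>) * norm x powr r \<le> (1 - d) powr r * norm x powr r"
        using d by (auto intro!: mult_right_mono)
      ultimately have "\<bar>norm (x + y) powr r - norm x powr r\<bar> \<le> \<epsilon> * norm x powr r"
        by (auto simp: algebra_simps abs_le_iff)
      then show ?thesis by (smt (verit) mult_nonneg_nonneg powr_ge_zero)
    next
      case False
      then have "norm x \<le> norm y / d" using d by (simp add: field_simps)
      then have "norm (x + y) \<le> (1 / d + 1) * norm y" "norm x \<le> (1 / d + 1) * norm y"
        using norm_triangle_ineq[of x y] norm_ge_zero[of y] unfolding distrib_right by (simp_all del: norm_ge_zero)
      then have "norm (x + y) powr r \<le> ((1 / d + 1) * norm y) powr r"
        "norm x powr r \<le> ((1 / d + 1) * norm y) powr r"
        using assms by (auto intro!: powr_mono2)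
      then have "\<bar>norm (x + y) powr r - norm x powr r\<bar> \<le> (1 / d + 1) powr r * norm y powr r"
        unfolding powr_mult by (smt (verit) powr_ge_zero)
      then show ?thesis using assms by (simp add: add_increasing)
    qed
  qed
qed

text \<open>At a minimizer this one-sided bound already implies that the Frechet derivative vanishes, so no
  formula for the derivative of the energy is needed.\<close>
lemma norm_powr_second_difference:
  fixes r \<epsilon> :: real
  assumes "1 < r" "0 < \<epsilon>"
  shows "\<exists>C\<ge>0. \<forall>x y::'b::real_inner.
    norm (x + y) powr r + norm (x - y) powr r - 2 * norm x powr r
      \<le> \<epsilon> * (norm x powr (r - 1) * norm y) + C * norm y powr r"
proof -
  \<comment> \<open>Only the first-order expansion of the scalar power at 1 is used; it also serves
    exponents below 2, where the second derivative of the power of the norm is singular at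
    0.\<close>
  have "((\<lambda>x. x powr r) has_real_derivative r * 1 powr (r - 1)) (at 1)"
    by (rule has_real_derivative_powr) simp
  then have "((\<lambda>x. x powr r) has_derivative (\<lambda>h. r * h)) (at 1)"
    by (simp add: has_field_derivative_def mult_commute_abs)
  then obtain d0 where d0: "0 < d0"
    "\<And>y. \<bar>y - 1\<bar> < d0 \<Longrightarrow> \<bar>y powr r - 1 - r * (y - 1)\<bar> \<le> \<epsilon> / 8 * \<bar>y - 1\<bar>"
    unfolding has_derivative_at_alt using assms(2) by (force dest: spec[of _ "\<epsilon> / 8"])
  \<comment> \<open>The bound d0/4 keeps the ratio 1 + k + e^2/2 below inside the range of the
    expansion, and r d <= \<epsilon>/2 absorbs the quadratic remainder r e^2.\<close>
  define d where "d = min (min 1 (d0 / 4)) (\<epsilon> / (2 * r))"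
  have d: "0 < d" "d \<le> 1" "2 * d < d0" "r * d \<le> \<epsilon> / 2"
  proof -
    have "d \<le> \<epsilon> / (2 * r)" by (simp add: d_def)
    then show "r * d \<le> \<epsilon> / 2" using assms by (simp add: field_simps)
    have "d \<le> d0 / 4" by (simp add: d_def)
    then show "2 * d < d0" using d0 by simp
  qed (use d0 assms in \<open>auto simp: d_def\<close>)
  have near: "norm (x + y) powr r + norm (x - y) powr r - 2 * norm x powr r \<le> \<epsilon> * (norm x powr (r - 1) * norm y)"
    if y: "norm y \<le> d * norm x" for x y :: 'b
  proof (cases "x = 0")
    case True then show ?thesis using y by simp
  next
    case False
    define e where "e = norm y / norm x"
    define c where "c = (x \<bullet> y) / (norm x)\<^sup>2"
    have nx: "0 < norm x" using False by simp
    have e: "0 \<le> e" "e \<le> d" "norm y = e * norm x"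
      using y nx by (auto simp: e_def field_simps)
    have c: "\<bar>c\<bar> \<le> e"
    proof -
      have "\<bar>x \<bullet> y\<bar> \<le> norm x * norm y" by (rule Cauchy_Schwarz_ineq2)
      then show ?thesis using nx by (simp add: c_def e_def field_simps power2_eq_square)
    qed
    \<comment> \<open>Here k is the component of w along x in units of |x|, and 1 + 2k + e^2 <= (1 +
      k + e^2/2)^2 linearizes the square root. The values k = c for y and k = -c for -y cancel in
      the sum.\<close>
    have key: "norm (x + w) \<le> norm x * (1 + k + e\<^sup>2 / 2)"
      if "x \<bullet> w = k * (norm x)\<^sup>2" "norm w = e * norm x" "\<bar>k\<bar> \<le> e" for w k
    proof -
      have "(norm (x + w))\<^sup>2 = (norm x)\<^sup>2 * (1 + 2 * k + e\<^sup>2)"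
      proof -
        have "(norm (x + w))\<^sup>2 = (norm x)\<^sup>2 + 2 * (x \<bullet> w) + (norm w)\<^sup>2"
          by (simp add: power2_norm_eq_inner inner_add_left inner_add_right inner_commute)
        then show ?thesis using that(1,2) by (simp add: algebra_simps power_mult_distrib)
      qed
      also have "\<dots> \<le> (norm x)\<^sup>2 * (1 + k + e\<^sup>2 / 2)\<^sup>2"
      proof (intro mult_left_mono)
        have "(1 + k + e\<^sup>2 / 2)\<^sup>2 = 1 + 2 * k + e\<^sup>2 + (k + e\<^sup>2 / 2)\<^sup>2"
          by (simp add: power2_eq_square algebra_simps)
        then show "1 + 2 * k + e\<^sup>2 \<le> (1 + k + e\<^sup>2 / 2)\<^sup>2" by simp
      qed simp
      also have "\<dots> = (norm x * (1 + k + e\<^sup>2 / 2))\<^sup>2" by (simp add: power_mult_distrib)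
      finally show ?thesis
      proof (rule power2_le_imp_le)
        show "0 \<le> norm x * (1 + k + e\<^sup>2 / 2)" using that e d by (intro mult_nonneg_nonneg) (auto simp: abs_le_iff)
      qed
    qed
    have e2: "e\<^sup>2 \<le> d * e" using e by (simp add: power2_eq_square mult_right_mono)
    have e2': "e\<^sup>2 \<le> e" using e e2 d by (smt (verit) mult_left_le_one_le)
    have pw: "norm (x + w) powr r \<le> norm x powr r * (1 + r * (k + e\<^sup>2 / 2) + \<epsilon> / 8 * (2 * e))"
      if "x \<bullet> w = k * (norm x)\<^sup>2" "norm w = e * norm x" "\<bar>k\<bar> \<le> e" for w k
    proof -
      have "0 \<le> e\<^sup>2" by simp
      then have s: "\<bar>k + e\<^sup>2 / 2\<bar> \<le> 2 * e" using that(3) e2' e by linarith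
      then have "\<bar>(1 + k + e\<^sup>2 / 2) - 1\<bar> < d0" using e d by (simp add: add.assoc)
      have s1: "(1 + k + e\<^sup>2 / 2) - 1 = k + e\<^sup>2 / 2" by simp
      have "(1 + k + e\<^sup>2 / 2) powr r \<le> 1 + r * (k + e\<^sup>2 / 2) + \<epsilon> / 8 * \<bar>k + e\<^sup>2 / 2\<bar>"
        using abs_le_D1[OF d0(2)[OF \<open>\<bar>(1 + k + e\<^sup>2 / 2) - 1\<bar> < d0\<close>]] unfolding s1 by linarith
      also have "\<epsilon> / 8 * \<bar>k + e\<^sup>2 / 2\<bar> \<le> \<epsilon> / 8 * (2 * e)"
        using s assms by (intro mult_left_mono) auto
      finally have *: "(1 + k + e\<^sup>2 / 2) powr r \<le> 1 + r * (k + e\<^sup>2 / 2) + \<epsilon> / 8 * (2 * e)" by simp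
      have "norm (x + w) powr r \<le> (norm x * (1 + k + e\<^sup>2 / 2)) powr r"
        using key[OF that] assms by (intro powr_mono2) auto
      also have "\<dots> \<le> norm x powr r * (1 + r * (k + e\<^sup>2 / 2) + \<epsilon> / 8 * (2 * e))"
        unfolding powr_mult by (intro mult_left_mono *) auto
      finally show ?thesis .
    qed
    have "norm (x + y) powr r \<le> norm x powr r * (1 + r * (c + e\<^sup>2 / 2) + \<epsilon> / 8 * (2 * e))"
      using pw[of y c] e c nx by (simp add: c_def)
    moreover have "norm (x - y) powr r \<le> norm x powr r * (1 + r * (- c + e\<^sup>2 / 2) + \<epsilon> / 8 * (2 * e))"
      using pw[of "- y" "- c"] e c nx by (simp add: c_def)
    ultimately have "norm (x + y) powr r + norm (x - y) powr r - 2 * norm x powr r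
       \<le> norm x powr r * (r * e\<^sup>2 + \<epsilon> / 2 * e)"
      by (simp add: algebra_simps)
    also have "\<dots> \<le> norm x powr r * (\<epsilon> * e)"
    proof (intro mult_left_mono)
      have "r * e\<^sup>2 \<le> r * (d * e)" using e2 assms by (intro mult_left_mono) auto
      also have "\<dots> \<le> \<epsilon> / 2 * e" using mult_right_mono[OF d(4) e(1)] by (simp add: mult.assoc)
      finally show "r * e\<^sup>2 + \<epsilon> / 2 * e \<le> \<epsilon> * e" by simp
    qed simp
    also have "\<dots> = \<epsilon> * (norm x powr (r - 1) * norm y)"
      using e nx by (simp add: powr_diff)
    finally show ?thesis .
  qed
  show ?thesis
  proof (intro exI[of _ "2 * (1 / d + 1) powr r"] conjI allI)
    show "0 \<le> 2 * (1 / d + 1) powr r" by simp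
    fix x y :: 'b
    show "norm (x + y) powr r + norm (x - y) powr r - 2 * norm x powr r
      \<le> \<epsilon> * (norm x powr (r - 1) * norm y) + 2 * (1 / d + 1) powr r * norm y powr r"
    proof (cases "norm y \<le> d * norm x")
      case True
      have "0 \<le> 2 * (1 / d + 1) powr r * norm y powr r" by simp
      then show ?thesis using near[OF True] by linarith
    next
      case False
      then have "norm x \<le> norm y / d" using d by (simp add: field_simps)
      then have "norm (x + y) \<le> (1 / d + 1) * norm y" "norm (x - y) \<le> (1 / d + 1) * norm y"
        using norm_triangle_ineq[of x y] norm_triangle_ineq4[of x y]
        by (auto simp: algebra_simps add_increasing2)
      then have "norm (x + y) powr r \<le> ((1 / d + 1) * norm y) powr r"
        "norm (x - y) powr r \<le> ((1 / d + 1) * norm y) powr r"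
        using assms by (auto intro!: powr_mono2)
      moreover have "0 \<le> norm x powr r" by simp
      ultimately have "norm (x + y) powr r + norm (x - y) powr r - 2 * norm x powr r
        \<le> 2 * (1 / d + 1) powr r * norm y powr r"
        unfolding powr_mult mult.assoc by linarith
      moreover have "0 \<le> \<epsilon> * (norm x powr (r - 1) * norm y)" using assms by simp
      ultimately show ?thesis by linarith
    qed
  qed
qed

text \<open>Interpolation inequalities with a free threshold \<open>T\<close> replace Hoelder's inequality: integrate and
  optimize in \<open>T\<close>.\<close>
lemma powr_le_interpolate:
  fixes t T :: real
  assumes "0 \<le> t" "0 < T" "p \<le> q" "q \<le> g" "0 < p"
  shows "t powr q \<le> T powr (q - p) * t powr p + T powr (q - g) * t powr g"
proof (cases "t = 0")
  case True then show ?thesis using assms by simp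
next
  case False
  then have t: "0 < t" using assms by simp
  show ?thesis
  proof (cases "t \<le> T")
    case True
    have "t powr q = t powr (q - p) * t powr p" using t by (simp flip: powr_add)
    also have "\<dots> \<le> T powr (q - p) * t powr p"
      using True assms by (intro mult_right_mono powr_mono2) auto
    finally show ?thesis by (smt (verit) mult_nonneg_nonneg powr_ge_zero)
  next
    case False
    have "t powr q = t powr (q - g) * t powr g" using t by (simp flip: powr_add)
    also have "\<dots> \<le> T powr (q - g) * t powr g"
      using False assms by (intro mult_right_mono powr_mono2') auto
    finally show ?thesis by (smt (verit) mult_nonneg_nonneg powr_ge_zero)
  qed
qed

lemma powr_le_threshold:
  fixes t T :: real
  assumes "0 \<le> t" "0 < T" "0 \<le> r" "r \<le> s"
  shows "t powr r \<le> T powr r + T powr (r - s) * t powr s"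
proof (cases "t \<le> T")
  case True
  then have "t powr r \<le> T powr r" using assms by (intro powr_mono2) auto
  then show ?thesis by (simp add: add_increasing2)
next
  case False
  then have "t powr r = t powr (r - s) * t powr s" using assms by (simp flip: powr_add)
  also have "\<dots> \<le> T powr (r - s) * t powr s"
    using False assms by (intro mult_right_mono powr_mono2') auto
  finally show ?thesis by (simp add: add_increasing)
qed

corollary le_threshold_powr:
  fixes t T :: real
  assumes "0 \<le> t" "0 < T" "1 \<le> p"
  shows "t \<le> T + T powr (1 - p) * t powr p"
  using powr_le_threshold[of t T 1 p] assms by simp

text \<open>A crude Young inequality: both factors are replaced by the larger of the two
  numbers.\<close>

lemma powr_diff_one_mult_le:
  fixes x y :: real
  assumes "0 \<le> x" "0 \<le> y" "1 < p"
  shows "x powr (p - 1) * y \<le> x powr p + y powr p"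
proof -
  define m where "m = max x y"
  have "x powr (p - 1) * y \<le> m powr (p - 1) * m"
    using assms by (intro mult_mono powr_mono2) (auto simp: m_def)
  also have "\<dots> = m powr p"
    using powr_mult_base[of m "p - 1"] assms by (auto simp: m_def max_def mult.commute)
  also have "\<dots> \<le> x powr p + y powr p" by (auto simp: m_def max_def)
  finally show ?thesis .
qed

section \<open>Smooth functions\<close>

lemma GDERIV_unique:
  assumes "GDERIV f x :> D" "GDERIV f x :> E"
  shows "D = E"
proof -
  have "(\<lambda>h. h \<bullet> D) = (\<lambda>h. h \<bullet> E)"
    using assms unfolding gderiv_def by (rule has_derivative_unique)
  then have "(D - E) \<bullet> D = (D - E) \<bullet> E" by (rule fun_cong)
  then have "(D - E) \<bullet> (D - E) = 0" by (simp add: inner_diff_right)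
  then show ?thesis by simp
qed

lemma GDERIV_continuous:
  assumes "\<And>x. GDERIV f x :> G x"
  shows "continuous_on UNIV f"
  using assms unfolding gderiv_def
  by (intro continuous_at_imp_continuous_on ballI has_derivative_continuous) blast

lemma C_k_SucI:
  assumes "\<And>x. GDERIV f x :> G x" "\<And>i. i \<in> Basis \<Longrightarrow> C_k k (\<lambda>x. G x \<bullet> i)"
  shows "C_k (Suc k) f"
  using assms by auto

lemma C_k_SucD: "C_k (Suc k) f \<Longrightarrow> C_k k f"
proof (induction k arbitrary: f)
  case 0
  then show ?case by (auto intro: GDERIV_continuous)
next
  case (Suc k)
  from Suc.prems obtain G where G: "\<And>x. GDERIV f x :> G x"
    "\<And>i. i \<in> Basis \<Longrightarrow> C_k (Suc k) (\<lambda>x. G x \<bullet> i)" unfolding C_k.simps(2)[of "Suc k"] by blast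
  show ?case by (rule C_k_SucI[OF G(1)]) (use G(2) Suc.IH in blast)
qed

lemma C_k_const: "C_k k (\<lambda>x. c)"
proof (induction k arbitrary: c)
  case (Suc k)
  then show ?case by (intro C_k_SucI[of _ "\<lambda>x. 0"] GDERIV_const) simp
qed simp

lemma C_k_add: "C_k k f \<Longrightarrow> C_k k g \<Longrightarrow> C_k k (\<lambda>x. f x + g x)"
proof (induction k arbitrary: f g)
  case (Suc k)
  from Suc.prems obtain F G where "\<And>x. GDERIV f x :> F x" "\<And>i. i \<in> Basis \<Longrightarrow> C_k k (\<lambda>x. F x \<bullet> i)"
     "\<And>x. GDERIV g x :> G x" "\<And>i. i \<in> Basis \<Longrightarrow> C_k k (\<lambda>x. G x \<bullet> i)"
    unfolding C_k.simps by metis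
  then show ?case
    by (intro C_k_SucI[of _ "\<lambda>x. F x + G x"] GDERIV_add) (auto simp: inner_add_left intro: Suc.IH)
qed (auto intro: continuous_intros)

lemma C_k_mult: "C_k k f \<Longrightarrow> C_k k g \<Longrightarrow> C_k k (\<lambda>x. f x * g x)"
proof (induction k arbitrary: f g)
  case (Suc k)
  from Suc.prems obtain F G where *: "\<And>x. GDERIV f x :> F x" "\<And>i. i \<in> Basis \<Longrightarrow> C_k k (\<lambda>x. F x \<bullet> i)"
     "\<And>x. GDERIV g x :> G x" "\<And>i. i \<in> Basis \<Longrightarrow> C_k k (\<lambda>x. G x \<bullet> i)"
    unfolding C_k.simps by metis
  have "C_k k f" "C_k k g" using Suc.prems by (auto intro: C_k_SucD simp del: C_k.simps)
  with * show ?case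
    by (intro C_k_SucI[of _ "\<lambda>x. f x *\<^sub>R G x + g x *\<^sub>R F x"] GDERIV_mult)
      (auto simp: inner_add_left intro!: Suc.IH C_k_add)
qed (auto intro: continuous_intros)

lemma GDERIV_inner_const: "GDERIV (\<lambda>x. x \<bullet> v) x :> v"
  unfolding gderiv_def by (auto intro!: derivative_eq_intros)

lemma C_k_inner_const: "C_k k (\<lambda>x. x \<bullet> v)"
  by (cases k) (auto intro!: continuous_intros GDERIV_inner_const C_k_const exI[of _ "\<lambda>x. v"])

text \<open>Polynomials are the source of smooth functions here: Stone-Weierstrass approximates by
  them, and a bump is \<open>flat_exp\<close> of a quadratic polynomial.\<close>

lemma C_k_real_polynomial_function:
  fixes f :: "'a::euclidean_space \<Rightarrow> real"
  shows "real_polynomial_function f \<Longrightarrow> C_k k f"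
proof (induction rule: real_polynomial_function.induct)
  case (linear f)
  interpret bounded_linear f by fact
  have "f x = x \<bullet> (\<Sum>i\<in>Basis. f i *\<^sub>R i)" for x
  proof -
    have "f x = f (\<Sum>i\<in>Basis. (x \<bullet> i) *\<^sub>R i)" by (simp add: euclidean_representation)
    also have "\<dots> = (\<Sum>i\<in>Basis. (x \<bullet> i) * f i)" by (simp add: sum scaleR)
    finally show ?thesis by (simp add: inner_sum_right mult.commute)
  qed
  then have "f = (\<lambda>x. x \<bullet> (\<Sum>i\<in>Basis. f i *\<^sub>R i))" by blast
  then show ?case using C_k_inner_const by metis
qed (auto intro: C_k_const C_k_add C_k_mult)

text \<open>The span of this family is closed under differentiation.\<close>
definition flat_exp :: "nat \<Rightarrow> real \<Rightarrow> real" where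
  "flat_exp m t = (if 0 < t then inverse t ^ m * exp (- inverse t) else 0)"

lemma flat_exp_tendsto_0: "((\<lambda>t::real. inverse t ^ m * exp (- inverse t)) \<longlongrightarrow> 0) (at_right 0)"
proof -
  have "((\<lambda>t. inverse t ^ m / exp (inverse t)) \<longlongrightarrow> (0::real)) (at_right 0)"
    by (rule filterlim_compose[OF tendsto_power_div_exp_0 filterlim_inverse_at_top_right])
  moreover have "inverse t ^ m / exp (inverse t) = inverse t ^ m * exp (- inverse t)" for t :: real
    by (simp add: exp_minus divide_inverse)
  ultimately show ?thesis by (simp only:)
qed

lemma flat_exp_DERIV: "(flat_exp m has_real_derivative - real m * flat_exp (Suc m) t + flat_exp (Suc (Suc m)) t) (at t)"
proof -
  consider "0 < t" | "t < 0" | "t = 0" by linarith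
  then show ?thesis
  proof cases
    case 1
    have "((\<lambda>t. inverse t ^ m * exp (- inverse t)) has_real_derivative
        - real m * flat_exp (Suc m) t + flat_exp (Suc (Suc m)) t) (at t)"
      using 1 by (auto intro!: derivative_eq_intros simp: flat_exp_def power2_eq_square)
        (cases m; simp add: field_simps power2_eq_square)
    then show ?thesis
      by (rule has_field_derivative_transform_within_open[where S="{0<..}"])
        (use 1 in \<open>auto simp: flat_exp_def\<close>)
  next
    case 2
    have "((\<lambda>t. 0) has_real_derivative - real m * flat_exp (Suc m) t + flat_exp (Suc (Suc m)) t) (at t)"
      using 2 by (simp add: flat_exp_def)
    then show ?thesis
      by (rule has_field_derivative_transform_within_open[where S="{..<0}"])
        (use 2 in \<open>auto simp: flat_exp_def\<close>)
  next
    case 3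
    \<comment> \<open>Dividing by h raises the power of 1/h by one, so the right-hand limit is
      \<open>flat_exp_tendsto_0\<close> with exponent \<open>Suc m\<close>; the left-hand quotient
      vanishes.\<close>
    have "((\<lambda>h. flat_exp m h / h) \<longlongrightarrow> 0) (at 0)"
    proof (rule filterlim_split_at)
      have "\<forall>\<^sub>F h in at_left 0. 0 = flat_exp m h / h"
        by (auto simp: eventually_at_filter flat_exp_def)
      then show "((\<lambda>h. flat_exp m h / h) \<longlongrightarrow> 0) (at_left 0)"
        by (rule Lim_transform_eventually[rotated]) simp
      have "\<forall>\<^sub>F h in at_right 0. inverse h ^ Suc m * exp (- inverse h) = flat_exp m h / h"
        by (auto simp: eventually_at_filter flat_exp_def field_simps)
      then show "((\<lambda>h. flat_exp m h / h) \<longlongrightarrow> 0) (at_right 0)"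
        by (rule Lim_transform_eventually[rotated]) (rule flat_exp_tendsto_0)
    qed
    then show ?thesis using 3 by (simp add: DERIV_def flat_exp_def)
  qed
qed

lemma C_k_flat_exp:
  fixes P :: "'a::euclidean_space \<Rightarrow> real"
  assumes P: "\<And>k. C_k k P"
  shows "C_k k (\<lambda>x. flat_exp m (P x))"
proof (induction k arbitrary: m)
  case 0
  have "continuous_on UNIV (flat_exp m)"
    by (rule DERIV_continuous_on) (rule has_field_derivative_at_within[OF flat_exp_DERIV])
  moreover have "continuous_on UNIV P" using P[of 0] by simp
  ultimately show ?case by (simp add: continuous_on_compose2)
next
  case (Suc k)
  from P[of "Suc k"] obtain G where G: "\<And>x. GDERIV P x :> G x" "\<And>i. i \<in> Basis \<Longrightarrow> C_k k (\<lambda>x. G x \<bullet> i)"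
    by auto
  show ?case
  proof (rule C_k_SucI)
    show "GDERIV (\<lambda>x. flat_exp m (P x)) x :>
        (- real m * flat_exp (Suc m) (P x) + flat_exp (Suc (Suc m)) (P x)) *\<^sub>R G x" for x
      by (rule GDERIV_DERIV_compose[OF G(1) flat_exp_DERIV])
    show "C_k k (\<lambda>x. ((- real m * flat_exp (Suc m) (P x) + flat_exp (Suc (Suc m)) (P x)) *\<^sub>R G x) \<bullet> i)"
      if "i \<in> Basis" for i
      unfolding inner_scaleR_left by (intro C_k_mult C_k_add C_k_const Suc.IH G(2) that)
  qed
qed

section \<open>Test functions\<close>

lemma test_functionsI:
  assumes "\<And>k. C_k k \<phi>" "compact K" "K \<subseteq> \<Omega>" "\<And>x. x \<notin> K \<Longrightarrow> \<phi> x = 0"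
  shows "\<phi> \<in> test_functions \<Omega>"
proof -
  have "closure {x. \<phi> x \<noteq> 0} \<subseteq> K"
    using assms by (intro closure_minimal) (auto simp: compact_imp_closed)
  moreover from this have "compact (closure {x. \<phi> x \<noteq> 0})"
    using assms(2) by (metis compact_Int_closed closed_closure inf.absorb_iff2 )
  ultimately show ?thesis using assms by (auto simp: test_functions_def)
qed

lemma test_functionsE:
  assumes "\<phi> \<in> test_functions \<Omega>"
  obtains K where "\<And>k. C_k k \<phi>" "compact K" "K \<subseteq> \<Omega>" "\<And>x. x \<notin> K \<Longrightarrow> \<phi> x = 0"
proof (rule that)
  show "compact (closure {x. \<phi> x \<noteq> 0})" "closure {x. \<phi> x \<noteq> 0} \<subseteq> \<Omega>" "C_k k \<phi>" for k
    using assms by (auto simp: test_functions_def)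
  show "\<phi> x = 0" if "x \<notin> closure {x. \<phi> x \<noteq> 0}" for x
    using that closure_subset[of "{x. \<phi> x \<noteq> 0}"] by auto
qed

lemma test_functions_mult_smooth:
  assumes "\<phi> \<in> test_functions \<Omega>" "\<And>k. C_k k f"
  shows "(\<lambda>x. f x * \<phi> x) \<in> test_functions \<Omega>"
proof -
  from assms(1) obtain K where K: "\<And>k. C_k k \<phi>" "compact K" "K \<subseteq> \<Omega>" "\<And>x. x \<notin> K \<Longrightarrow> \<phi> x = 0"
    by (rule test_functionsE) (rule that)
  show ?thesis
    by (rule test_functionsI[of _ K]) (use K in \<open>auto intro: C_k_mult assms(2)\<close>)
qed

lemma test_functions_cmult: "\<phi> \<in> test_functions \<Omega> \<Longrightarrow> (\<lambda>x. c * \<phi> x) \<in> test_functions \<Omega>"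
  by (rule test_functions_mult_smooth[OF _ C_k_const])

lemma test_functions_add:
  assumes "\<phi> \<in> test_functions \<Omega>" "\<psi> \<in> test_functions \<Omega>"
  shows "(\<lambda>x. \<phi> x + \<psi> x) \<in> test_functions \<Omega>"
proof -
  from assms(1) obtain K where K: "\<And>k. C_k k \<phi>" "compact K" "K \<subseteq> \<Omega>" "\<And>x. x \<notin> K \<Longrightarrow> \<phi> x = 0"
    by (rule test_functionsE) (rule that)
  from assms(2) obtain L where L: "\<And>k. C_k k \<psi>" "compact L" "L \<subseteq> \<Omega>" "\<And>x. x \<notin> L \<Longrightarrow> \<psi> x = 0"
    by (rule test_functionsE) (rule that)
  show ?thesis
    by (rule test_functionsI[of _ "K \<union> L"]) (use K L in \<open>auto intro: C_k_add\<close>)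
qed

lemma test_functions_diff:
  assumes "\<phi> \<in> test_functions \<Omega>" "\<psi> \<in> test_functions \<Omega>"
  shows "(\<lambda>x. \<phi> x - \<psi> x) \<in> test_functions \<Omega>"
  using test_functions_add[OF assms(1) test_functions_cmult[OF assms(2), of "-1"]] by simp

lemma test_functions_zero: "(\<lambda>x. 0) \<in> test_functions \<Omega>"
  by (rule test_functionsI[of _ "{}"]) (auto intro: C_k_const)

text \<open>The argument of \<open>flat_exp\<close> is a polynomial that is positive exactly inside
  the open ball, so the composition is smooth and supported in the closed ball. Letting n grow
  drives the values inside the ball to 1, which later yields an exhaustion.\<close>

lemma test_functions_bump:
  assumes "cball c r \<subseteq> \<Omega>" "0 \<le> r" "0 < n"
  shows "(\<lambda>x. flat_exp 0 (n * (r\<^sup>2 - (norm (x - c))\<^sup>2))) \<in> test_functions \<Omega>"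
proof (rule test_functionsI)
  show "compact (cball c r)" by simp
  show "cball c r \<subseteq> \<Omega>" by fact
  have "real_polynomial_function (\<lambda>x. n * (r\<^sup>2 - (\<Sum>i\<in>Basis. (x \<bullet> i - c \<bullet> i) ^ 2)))"
    by (intro real_polynomial_function.intros real_polynomial_function_diff real_polynomial_function_sum
         real_polynomial_function_power bounded_linear_inner_left) auto
  moreover have "(norm (x - c))\<^sup>2 = (\<Sum>i\<in>Basis. (x \<bullet> i - c \<bullet> i) ^ 2)" for x
    unfolding norm_conv_dist by (subst euclidean_dist_l2) (simp add: L2_set_def sum_nonneg dist_real_def inner_diff_left)
  ultimately have P: "real_polynomial_function (\<lambda>x. n * (r\<^sup>2 - (norm (x - c))\<^sup>2))" by simp
  show "C_k k (\<lambda>x. flat_exp 0 (n * (r\<^sup>2 - (norm (x - c))\<^sup>2)))" for k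
    by (rule C_k_flat_exp) (rule C_k_real_polynomial_function[OF P])
  fix x assume "x \<notin> cball c r"
  then have "r < norm (x - c)" by (simp add: dist_norm norm_minus_commute)
  show "flat_exp 0 (n * (r\<^sup>2 - (norm (x - c))\<^sup>2)) = 0"
  proof -
    have "r\<^sup>2 \<le> (norm (x - c))\<^sup>2" using \<open>r < norm (x - c)\<close> assms by (intro power_mono) auto
    then show ?thesis using assms by (simp add: flat_exp_def mult_nonneg_nonpos not_less)
  qed
qed

section \<open>Classical gradients and compactly supported C^1 functions\<close>

definition grad :: "('a::euclidean_space \<Rightarrow> real) \<Rightarrow> 'a \<Rightarrow> 'a" where
  "grad f x = (SOME D. GDERIV f x :> D)"

lemma grad_eqI: "GDERIV f x :> D \<Longrightarrow> grad f x = D"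
  unfolding grad_def by (rule some_equality) (auto intro: GDERIV_unique)

lemma GDERIV_grad:
  assumes "C_k (Suc k) f"
  shows "GDERIV f x :> grad f x" "\<And>i. i \<in> Basis \<Longrightarrow> C_k k (\<lambda>x. grad f x \<bullet> i)"
proof -
  from assms obtain G where G: "\<And>x. GDERIV f x :> G x" "\<And>i. i \<in> Basis \<Longrightarrow> C_k k (\<lambda>x. G x \<bullet> i)"
    by auto
  then have "grad f = G" by (intro ext grad_eqI) auto
  with G show "GDERIV f x :> grad f x" "\<And>i. i \<in> Basis \<Longrightarrow> C_k k (\<lambda>x. grad f x \<bullet> i)" by auto
qed

lemma continuous_on_grad:
  assumes "C_k (Suc 0) f"
  shows "continuous_on UNIV (grad f)"
proof -
  have "continuous_on UNIV (\<lambda>x. \<Sum>i\<in>Basis. (grad f x \<bullet> i) *\<^sub>R i)"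
    using GDERIV_grad(2)[OF assms] by (intro continuous_on_sum continuous_on_scaleR continuous_on_const) auto
  then show ?thesis by (simp add: euclidean_representation)
qed

text \<open>The class makes no reference to the domain: test functions extended by zero belong to
  it, so they can be translated, multiplied and averaged on the whole space.\<close>

definition C1c :: "('a::euclidean_space \<Rightarrow> real) \<Rightarrow> bool" where
  "C1c f \<longleftrightarrow> (\<forall>x. GDERIV f x :> grad f x) \<and> continuous_on UNIV (grad f) \<and>
     (\<exists>K. compact K \<and> (\<forall>x. x \<notin> K \<longrightarrow> f x = 0 \<and> grad f x = 0))"

lemma grad_eq_0_outside:
  assumes "closed K" "\<And>x. x \<notin> K \<Longrightarrow> f x = 0" "x \<notin> K"
  shows "grad f x = 0"
proof (rule grad_eqI)
  have "((\<lambda>x. 0) has_derivative (\<lambda>h. 0)) (at x)" by simp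
  then have "(f has_derivative (\<lambda>h. 0)) (at x)"
    by (rule has_derivative_transform_within_open[of _ _ _ _ "- K"]) (use assms in auto)
  then show "GDERIV f x :> 0" by (simp add: gderiv_def)
qed

lemma test_functions_C1c:
  assumes "\<phi> \<in> test_functions \<Omega>"
  shows "C1c \<phi>"
proof -
  from assms obtain K where K: "\<And>k. C_k k \<phi>" "compact K" "K \<subseteq> \<Omega>" "\<And>x. x \<notin> K \<Longrightarrow> \<phi> x = 0"
    by (rule test_functionsE) (rule that)
  show ?thesis unfolding C1c_def
    using GDERIV_grad(1)[OF K(1)] continuous_on_grad[OF K(1)] K(2,4) grad_eq_0_outside[of K \<phi>]
    by (auto simp: compact_imp_closed)
qed

lemma test_functions_outside:
  assumes "\<phi> \<in> test_functions \<Omega>" "x \<notin> \<Omega>"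
  shows "\<phi> x = 0" "grad \<phi> x = 0"
proof -
  from assms obtain K where K: "\<And>k. C_k k \<phi>" "compact K" "K \<subseteq> \<Omega>" "\<And>x. x \<notin> K \<Longrightarrow> \<phi> x = 0"
    by (elim test_functionsE) (rule that)
  show "\<phi> x = 0" "grad \<phi> x = 0"
    using grad_eq_0_outside[of K \<phi> x] K assms by (auto simp: compact_imp_closed)
qed

lemma C1c_GDERIV: "C1c f \<Longrightarrow> GDERIV f x :> grad f x"
  by (simp add: C1c_def)

lemma C1c_continuous: "C1c f \<Longrightarrow> continuous_on UNIV f" "C1c f \<Longrightarrow> continuous_on UNIV (grad f)"
  by (auto simp: C1c_def intro: GDERIV_continuous)

lemma grad_add: "C1c f \<Longrightarrow> C1c g \<Longrightarrow> grad (\<lambda>x. f x + g x) x = grad f x + grad g x"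
  by (intro grad_eqI GDERIV_add C1c_GDERIV)

lemma grad_diff: "C1c f \<Longrightarrow> C1c g \<Longrightarrow> grad (\<lambda>x. f x - g x) x = grad f x - grad g x"
  by (intro grad_eqI GDERIV_diff C1c_GDERIV)

lemma grad_cmult:
  assumes "C1c f" shows "grad (\<lambda>x. c * f x) x = c *\<^sub>R grad f x"
proof (rule grad_eqI)
  show "GDERIV (\<lambda>x. c * f x) x :> c *\<^sub>R grad f x"
    using GDERIV_mult[OF GDERIV_const[of c] C1c_GDERIV[OF assms], of x] by simp
qed

lemma grad_mult: "C1c f \<Longrightarrow> C1c g \<Longrightarrow> grad (\<lambda>x. f x * g x) x = f x *\<^sub>R grad g x + g x *\<^sub>R grad f x"
  by (intro grad_eqI GDERIV_mult C1c_GDERIV)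

lemma C1c_mult:
  assumes "C1c f" "C1c g"
  shows "C1c (\<lambda>x. f x * g x)"
proof -
  obtain K where K: "compact K" "\<And>x. x \<notin> K \<Longrightarrow> f x = 0 \<and> grad f x = 0"
    using assms by (auto simp: C1c_def)
  have "continuous_on UNIV (\<lambda>x. f x *\<^sub>R grad g x + g x *\<^sub>R grad f x)"
    using assms by (intro continuous_intros C1c_continuous)
  then have "continuous_on UNIV (grad (\<lambda>x. f x * g x))"
    using grad_mult[OF assms] by presburger
  moreover have "GDERIV (\<lambda>x. f x * g x) x :> grad (\<lambda>x. f x * g x) x" for x
    unfolding grad_mult[OF assms] by (intro GDERIV_mult C1c_GDERIV assms)
  ultimately show ?thesis
    unfolding C1c_def using K grad_mult[OF assms] by (intro conjI exI[of _ K]) auto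
qed

lemma compact_support_bounded:
  fixes f :: "'a::euclidean_space \<Rightarrow> 'b::real_normed_vector"
  assumes "continuous_on UNIV f" "compact K" "\<And>x. x \<notin> K \<Longrightarrow> f x = 0"
  obtains M where "0 \<le> M" "\<And>x. norm (f x) \<le> M"
proof -
  have "compact (f ` K)" using assms by (meson compact_continuous_image continuous_on_subset subset_UNIV)
  then obtain M where "\<And>y. y \<in> f ` K \<Longrightarrow> norm y \<le> M"
    using compact_imp_bounded bounded_iff by metis
  then have "norm (f x) \<le> max M 0" for x using assms(3)[of x] by (cases "x \<in> K") (force simp: le_max_iff_disj)+
  then show ?thesis using that[of "max M 0"] by auto
qed

lemma compact_support_integrable:
  fixes f :: "'a::euclidean_space \<Rightarrow> 'b::euclidean_space"
  assumes "continuous_on UNIV f" "compact K" "\<And>x. x \<notin> K \<Longrightarrow> f x = 0"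
  shows "integrable lborel f"
proof -
  have "integrable lborel (\<lambda>x. indicator K x *\<^sub>R f x)"
    using assms by (intro borel_integrable_compact) (auto intro: continuous_on_subset)
  moreover have "(\<lambda>x. indicator K x *\<^sub>R f x) = f" using assms(3) by (auto simp: indicator_def)
  ultimately show ?thesis by simp
qed

lemma C1c_integrable:
  fixes f :: "'a::euclidean_space \<Rightarrow> real"
  assumes "C1c f"
  shows "integrable lborel f" "integrable lborel (grad f)"
    "0 < r \<Longrightarrow> integrable lborel (\<lambda>x. norm (f x) powr r)"
    "0 < r \<Longrightarrow> integrable lborel (\<lambda>x. norm (grad f x) powr r)"
proof -
  obtain K where K: "compact K" "\<And>x. x \<notin> K \<Longrightarrow> f x = 0 \<and> grad f x = 0"
    using assms by (auto simp: C1c_def)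
  note c = C1c_continuous[OF assms]
  show "integrable lborel f" "integrable lborel (grad f)"
    using c K by (auto intro!: compact_support_integrable[of _ K])
  show "integrable lborel (\<lambda>x. norm (f x) powr r)" if "0 < r"
    using c K that
    by (intro compact_support_integrable[of _ K]) (auto intro!: continuous_intros continuous_on_powr' simp del: real_norm_def)
  show "integrable lborel (\<lambda>x. norm (grad f x) powr r)" if "0 < r"
    using c K that by (intro compact_support_integrable[of _ K]) (auto intro!: continuous_intros continuous_on_powr')
qed

lemma C1c_measurable [measurable_dest]: "C1c f \<Longrightarrow> f \<in> borel_measurable borel" "C1c f \<Longrightarrow> grad f \<in> borel_measurable borel"
  by (auto intro: borel_measurable_continuous_onI C1c_continuous)

section \<open>Translation invariance of Lebesgue measure\<close>

lemma lborel_distr_translation: "distr lborel borel (\<lambda>x. x + z) = (lborel :: 'a::euclidean_space measure)"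
  using lborel_affine[of 1 z] by (simp add: density_1 add.commute)

lemma integral_lborel_translation:
  fixes f :: "'a::euclidean_space \<Rightarrow> 'b::euclidean_space"
  assumes "f \<in> borel_measurable borel"
  shows "(\<integral>x. f (x + z) \<partial>lborel) = (\<integral>x. f x \<partial>lborel)"
proof -
  have "(\<integral>x. f x \<partial>lborel) = (\<integral>x. f x \<partial>distr lborel borel (\<lambda>x. x + z))"
    by (simp only: lborel_distr_translation)
  also have "\<dots> = (\<integral>x. f (x + z) \<partial>lborel)"
    using assms by (intro integral_distr) auto
  finally show ?thesis by simp
qed

lemma integrable_lborel_translation:
  fixes f :: "'a::euclidean_space \<Rightarrow> 'b::euclidean_space"
  assumes "integrable lborel f"
  shows "integrable lborel (\<lambda>x. f (x + z))"
proof -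
  have "integrable (distr lborel borel (\<lambda>x. x + z)) f"
    using assms by (simp only: lborel_distr_translation)
  then show ?thesis by (rule integrable_distr[rotated]) simp
qed

section \<open>Translation estimates\<close>

lemma C1c_supportE:
  assumes "C1c f"
  obtains R where "0 < R" "\<And>x. R < norm x \<Longrightarrow> f x = 0 \<and> grad f x = 0"
proof -
  obtain K where K: "compact K" "\<And>x. x \<notin> K \<Longrightarrow> f x = 0 \<and> grad f x = 0"
    using assms by (auto simp: C1c_def)
  then obtain R where "0 < R" "\<And>x. x \<in> K \<Longrightarrow> norm x \<le> R"
    using compact_imp_bounded bounded_pos by metis
  then show ?thesis using K that[of R] by fastforce
qed

lemma C1c_lipschitz:
  assumes "C1c f"
  obtains L where "0 \<le> L" "\<And>x y. \<bar>f x - f y\<bar> \<le> L * norm (x - y)"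
proof -
  obtain K where K: "compact K" "\<And>x. x \<notin> K \<Longrightarrow> f x = 0 \<and> grad f x = 0"
    using assms by (auto simp: C1c_def)
  obtain L where L: "0 \<le> L" "\<And>x. norm (grad f x) \<le> L"
    using compact_support_bounded[OF C1c_continuous(2)[OF assms] K(1)] K(2) by blast
  have "norm (f x - f y) \<le> L * norm (x - y)" for x y
  proof (rule differentiable_bound[of UNIV f "\<lambda>x h. h \<bullet> grad f x"])
    show "(f has_derivative (\<lambda>h. h \<bullet> grad f x)) (at x within UNIV)" for x
      using C1c_GDERIV[OF assms] by (simp add: gderiv_def)
    show "onorm (\<lambda>h. h \<bullet> grad f x) \<le> L" for x
    proof (rule onorm_le)
      show "norm (h \<bullet> grad f x) \<le> L * norm h" for h
        using Cauchy_Schwarz_ineq2[of h "grad f x"] mult_left_mono[OF L(2)[of x], of "norm h"]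
        by (simp add: mult.commute)
    qed
  qed auto
  then show ?thesis using that L by auto
qed

text \<open>Dyadic steps fit the doubling argument of the translation estimate. The Lipschitz bound
  and a common support ball dominate all quotients by a multiple of an indicator, so integrals pass
  to the limit.\<close>

lemma C1c_difference_quotient:
  fixes f :: "'a::euclidean_space \<Rightarrow> real" and z :: 'a
  assumes "C1c f"
  defines "Q \<equiv> \<lambda>k x. 2 ^ k * (f (x + z /\<^sub>R 2 ^ k) - f x)"
  shows "(\<lambda>k. Q k x) \<longlonglongrightarrow> z \<bullet> grad f x"
    and "\<exists>M R. 0 \<le> M \<and> (\<forall>k x. \<bar>Q k x\<bar> \<le> M * indicator (cball 0 R) x)"
proof -
  have "((\<lambda>t. f (x + t *\<^sub>R z)) has_derivative (\<lambda>t. (t *\<^sub>R z) \<bullet> grad f (x + 0 *\<^sub>R z))) (at 0)"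
    by (rule has_derivative_compose[where g=f and f="\<lambda>t. x + t *\<^sub>R z" and f'="\<lambda>t. t *\<^sub>R z"])
      (auto intro!: derivative_eq_intros C1c_GDERIV[OF assms(1), unfolded gderiv_def])
  then have "((\<lambda>t. f (x + t *\<^sub>R z)) has_real_derivative (z \<bullet> grad f x)) (at 0)"
    by (simp add: has_field_derivative_def mult_commute_abs)
  then have "((\<lambda>h. (f (x + h *\<^sub>R z) - f x) / h) \<longlongrightarrow> z \<bullet> grad f x) (at 0)"
    by (simp add: DERIV_def)
  moreover have "filterlim (\<lambda>k. inverse (2::real) ^ k) (at 0) sequentially"
    unfolding filterlim_at by (auto intro: LIMSEQ_power_zero)
  ultimately have "(\<lambda>k. (f (x + (inverse 2 ^ k) *\<^sub>R z) - f x) / inverse 2 ^ k) \<longlonglongrightarrow> z \<bullet> grad f x"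
    by (rule filterlim_compose)
  then show "(\<lambda>k. Q k x) \<longlonglongrightarrow> z \<bullet> grad f x"
    by (simp add: Q_def field_simps power_inverse)
  obtain L where L: "0 \<le> L" "\<And>x y. \<bar>f x - f y\<bar> \<le> L * norm (x - y)"
    using C1c_lipschitz[OF assms(1)] by blast
  obtain R where R: "0 < R" "\<And>x. R < norm x \<Longrightarrow> f x = 0 \<and> grad f x = 0"
    using C1c_supportE[OF assms(1)] by blast
  have "\<bar>Q k x\<bar> \<le> (L * norm z) * indicator (cball 0 (R + norm z)) x" for k x
  proof (cases "norm x \<le> R + norm z")
    case True
    have "\<bar>Q k x\<bar> \<le> 2 ^ k * (L * norm (z /\<^sub>R 2 ^ k))"
      unfolding Q_def abs_mult using L(2)[of "x + z /\<^sub>R 2 ^ k" x] by (simp add: mult_left_mono)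
    also have "\<dots> = L * norm z" by (simp add: field_simps)
    finally show ?thesis using True by simp
  next
    case False
    have "norm (z /\<^sub>R 2 ^ k) \<le> norm z"
      using mult_right_mono[of "inverse (2 ^ k :: real)" 1 "norm z"] by (simp add: field_simps)
    moreover have "norm x - norm (z /\<^sub>R 2 ^ k) \<le> norm (x + z /\<^sub>R 2 ^ k)" by (rule norm_diff_ineq)
    ultimately have "R < norm (x + z /\<^sub>R 2 ^ k)" "R < norm x" using False norm_ge_zero[of z] by linarith+
    then show ?thesis using R(2) False by (simp add: Q_def)
  qed
  then show "\<exists>M R. 0 \<le> M \<and> (\<forall>k x. \<bar>Q k x\<bar> \<le> M * indicator (cball 0 R) x)"
    using L(1) by (meson mult_nonneg_nonneg norm_ge_zero)
qed

lemma integrable_indicator_cball [simp]: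
  "integrable lborel (indicator (cball c R) :: 'a::euclidean_space \<Rightarrow> real)"
  by (intro integrable_real_indicator emeasure_lborel_cball_finite) auto

text \<open>Translation invariance makes the integral of each difference quotient vanish, and
  dominated convergence carries this over to the directional derivative.\<close>

lemma C1c_integral_grad:
  fixes f :: "'a::euclidean_space \<Rightarrow> real"
  assumes "C1c f"
  shows "(\<integral>x. grad f x \<partial>lborel) = 0"
proof -
  have "z \<bullet> (\<integral>x. grad f x \<partial>lborel) = 0" for z
  proof -
    define Q where "Q k x = 2 ^ k * (f (x + z /\<^sub>R 2 ^ k) - f x)" for k x
    from C1c_difference_quotient(2)[OF assms, of z] obtain M R where M: "\<And>k x. \<bar>Q k x\<bar> \<le> M * indicator (cball 0 R) x"
      unfolding Q_def by blast
    have [measurable]: "f \<in> borel_measurable borel" "grad f \<in> borel_measurable borel"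
      using assms by (auto dest: C1c_measurable)
    have "(\<lambda>k. \<integral>x. Q k x \<partial>lborel) \<longlonglongrightarrow> (\<integral>x. z \<bullet> grad f x \<partial>lborel)"
    proof (rule integral_dominated_convergence)
      show "AE x in lborel. (\<lambda>k. Q k x) \<longlonglongrightarrow> z \<bullet> grad f x"
        using C1c_difference_quotient(1)[OF assms] by (simp add: Q_def)
      show "AE x in lborel. norm (Q k x) \<le> M * indicator (cball 0 R) x" for k
        using M by simp
    qed (auto simp: Q_def)
    moreover have "(\<integral>x. Q k x \<partial>lborel) = 0" for k
    proof -
      have "integrable lborel f" by (rule C1c_integrable[OF assms])
      then show ?thesis
        unfolding Q_def by (simp add: integrable_lborel_translation integral_lborel_translation)
    qed
    ultimately have "(\<integral>x. z \<bullet> grad f x \<partial>lborel) = 0" by (simp add: LIMSEQ_const_iff)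
    then show ?thesis by (subst (asm) integral_inner_right) (use C1c_integrable[OF assms] in auto)
  qed
  then show ?thesis by (metis inner_eq_zero_iff)
qed

text \<open>The gradient of the product f g integrates to zero.\<close>

lemma C1c_integration_by_parts:
  assumes "C1c f" "C1c g"
  shows "(\<integral>x. f x *\<^sub>R grad g x \<partial>lborel) = - (\<integral>x. g x *\<^sub>R grad f x \<partial>lborel)"
proof -
  obtain K L where K: "compact K" "\<And>x. x \<notin> K \<Longrightarrow> f x = 0 \<and> grad f x = 0"
    and L: "compact L" "\<And>x. x \<notin> L \<Longrightarrow> g x = 0 \<and> grad g x = 0"
    using assms by (auto simp: C1c_def)
  have "integrable lborel (\<lambda>x. f x *\<^sub>R grad g x)" "integrable lborel (\<lambda>x. g x *\<^sub>R grad f x)"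
    using K L assms by (auto intro!: compact_support_integrable[of _ K] continuous_intros C1c_continuous)
  moreover have "(\<integral>x. f x *\<^sub>R grad g x + g x *\<^sub>R grad f x \<partial>lborel) = 0"
    using C1c_integral_grad[OF C1c_mult[OF assms]] grad_mult[OF assms] by simp
  ultimately show ?thesis by (simp add: add_eq_0_iff2)
qed

lemma C1c_translation_integrable:
  fixes f :: "'a::euclidean_space \<Rightarrow> real"
  assumes "C1c f" "0 < r"
  shows "integrable lborel (\<lambda>x. \<bar>f (x + z) - f x\<bar> powr r)"
proof -
  obtain R where R: "0 < R" "\<And>x. R < norm x \<Longrightarrow> f x = 0 \<and> grad f x = 0"
    using C1c_supportE[OF assms(1)] by blast
  have "continuous_on UNIV f" using assms(1) by (rule C1c_continuous)
  then have c: "continuous_on UNIV (\<lambda>x. f (x + z))"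
    by (rule continuous_on_compose2) (auto intro!: continuous_intros)
  show ?thesis
  proof (rule compact_support_integrable[of _ "cball 0 (R + norm z)"])
    show "continuous_on UNIV (\<lambda>x. \<bar>f (x + z) - f x\<bar> powr r)"
      using assms c by (intro continuous_on_powr' continuous_intros c C1c_continuous(1)[OF assms(1)]) auto
    show "\<bar>f (x + z) - f x\<bar> powr r = 0" if "x \<notin> cball 0 (R + norm z)" for x
    proof -
      have "norm x - norm z \<le> norm (x + z)" by (rule norm_diff_ineq)
      moreover have "R + norm z < norm x" using that by simp
      ultimately have "R < norm (x + z)" "R < norm x" using norm_ge_zero[of z] by linarith+
      then show ?thesis using R by simp
    qed
  qed simp
qed

text \<open>The exact convexity constant 2^(r-1) matters: it turns into a factor 2^r per doubling of
  the shift, which is precisely the homogeneity of the translation estimate, so arbitrarily many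
  doublings lose nothing.\<close>

lemma abs_add_powr_le_half:
  fixes s t :: real
  assumes "1 \<le> r"
  shows "\<bar>s + t\<bar> powr r \<le> 2 powr (r - 1) * (\<bar>s\<bar> powr r + \<bar>t\<bar> powr r)"
proof (cases "r = 1")
  case False
  have "\<bar>s + t\<bar> powr r = 2 powr r * norm ((s + t) /\<^sub>R 2) powr r"
    by (simp add: powr_mult[symmetric] flip: abs_mult)
  also have "\<dots> \<le> 2 powr r * ((\<bar>s\<bar> powr r + \<bar>t\<bar> powr r) / 2)"
    using norm_powr_midpoint[of r s t] assms False by (intro mult_left_mono) auto
  finally show ?thesis by (simp add: powr_diff)
qed auto

text \<open>Doubling the shift multiplies the integral by at most 2^r. Hence the shift z is compared
  with z/2^k without loss, and as k grows the scaled differences converge to the directional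
  derivative, which Cauchy-Schwarz bounds by |z| |grad f|.\<close>

lemma C1c_translation_estimate:
  fixes f :: "'a::euclidean_space \<Rightarrow> real"
  assumes f: "C1c f" and r: "1 \<le> r"
  shows "(\<integral>x. \<bar>f (x + z) - f x\<bar> powr r \<partial>lborel) \<le> norm z powr r * (\<integral>x. norm (grad f x) powr r \<partial>lborel)"
proof -
  define D where "D z = (\<integral>x. \<bar>f (x + z) - f x\<bar> powr r \<partial>lborel)" for z
  note int = C1c_translation_integrable[OF f, of r]
  have [measurable]: "f \<in> borel_measurable borel" "grad f \<in> borel_measurable borel"
    using f by (auto dest: C1c_measurable)
  have dbl: "D (2 *\<^sub>R w) \<le> 2 powr r * D w" for w
  proof -
    have *: "(\<lambda>x. \<bar>f (x + 2 *\<^sub>R w) - f (x + w)\<bar> powr r) = (\<lambda>x. (\<lambda>y. \<bar>f (y + w) - f y\<bar> powr r) (x + w))"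
      by (simp add: algebra_simps scaleR_2)
    have i1: "integrable lborel (\<lambda>x. \<bar>f (x + 2 *\<^sub>R w) - f (x + w)\<bar> powr r)"
      unfolding * using int r by (intro integrable_lborel_translation) auto
    have "D (2 *\<^sub>R w) \<le> (\<integral>x. 2 powr (r - 1) * (\<bar>f (x + 2 *\<^sub>R w) - f (x + w)\<bar> powr r + \<bar>f (x + w) - f x\<bar> powr r) \<partial>lborel)"
      unfolding D_def
    proof (rule integral_mono)
      show "\<bar>f (x + 2 *\<^sub>R w) - f x\<bar> powr r \<le> 2 powr (r - 1) * (\<bar>f (x + 2 *\<^sub>R w) - f (x + w)\<bar> powr r + \<bar>f (x + w) - f x\<bar> powr r)" for x
        using abs_add_powr_le_half[OF r, of "f (x + 2 *\<^sub>R w) - f (x + w)" "f (x + w) - f x"] by simp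
    qed (use i1 int r in auto)
    also have "\<dots> = 2 powr (r - 1) * ((\<integral>x. \<bar>f (x + 2 *\<^sub>R w) - f (x + w)\<bar> powr r \<partial>lborel) + D w)"
      unfolding D_def using i1 int r by simp
    also have "(\<integral>x. \<bar>f (x + 2 *\<^sub>R w) - f (x + w)\<bar> powr r \<partial>lborel) = D w"
      unfolding * D_def by (rule integral_lborel_translation) measurable
    also have "2 powr (r - 1) * (D w + D w) = 2 powr r * D w"
      by (simp add: powr_diff)
    finally show ?thesis .
  qed
  have iter: "D z \<le> (2 ^ k) powr r * D (z /\<^sub>R 2 ^ k)" for k
  proof (induction k)
    case (Suc k)
    have "D (z /\<^sub>R 2 ^ k) \<le> 2 powr r * D (z /\<^sub>R 2 ^ Suc k)"
      using dbl[of "z /\<^sub>R 2 ^ Suc k"] by simp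
    then have "(2 ^ k) powr r * D (z /\<^sub>R 2 ^ k) \<le> (2 ^ k) powr r * (2 powr r * D (z /\<^sub>R 2 ^ Suc k))"
      by (intro mult_left_mono) auto
    with Suc have "D z \<le> (2 ^ k) powr r * (2 powr r * D (z /\<^sub>R 2 ^ Suc k))" by linarith
    also have "\<dots> = (2 ^ Suc k) powr r * D (z /\<^sub>R 2 ^ Suc k)" by (simp only: power_Suc powr_mult mult_ac)
    finally show ?case .
  qed simp
  define Q where "Q k x = 2 ^ k * (f (x + z /\<^sub>R 2 ^ k) - f x)" for k x
  from C1c_difference_quotient(2)[OF f, of z] obtain M R where M: "0 \<le> M" "\<And>k x. \<bar>Q k x\<bar> \<le> M * indicator (cball 0 R) x"
    unfolding Q_def by blast
  have "(\<lambda>k. \<integral>x. \<bar>Q k x\<bar> powr r \<partial>lborel) \<longlonglongrightarrow> (\<integral>x. \<bar>z \<bullet> grad f x\<bar> powr r \<partial>lborel)"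
  proof (rule integral_dominated_convergence)
    show "AE x in lborel. (\<lambda>k. \<bar>Q k x\<bar> powr r) \<longlonglongrightarrow> \<bar>z \<bullet> grad f x\<bar> powr r"
      using C1c_difference_quotient(1)[OF f, of _ z] r
      by (auto simp: Q_def intro!: tendsto_powr' tendsto_rabs)
    have "\<bar>Q k x\<bar> powr r \<le> M powr r * indicator (cball 0 R) x" for k x
    proof -
      have "\<bar>Q k x\<bar> powr r \<le> (M * indicator (cball 0 R) x) powr r"
        using M r by (intro powr_mono2) auto
      then show ?thesis by (auto simp: indicator_def split: if_splits)
    qed
    then show "AE x in lborel. norm (\<bar>Q k x\<bar> powr r) \<le> M powr r * indicator (cball 0 R) x" for k by simp
  qed (auto simp: Q_def)
  moreover have "D z \<le> (\<integral>x. \<bar>Q k x\<bar> powr r \<partial>lborel)" for k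
  proof -
    have "(\<integral>x. \<bar>Q k x\<bar> powr r \<partial>lborel) = (2 ^ k) powr r * D (z /\<^sub>R 2 ^ k)"
      by (simp add: Q_def D_def abs_mult powr_mult)
    then show ?thesis using iter[of k] by simp
  qed
  ultimately have "D z \<le> (\<integral>x. \<bar>z \<bullet> grad f x\<bar> powr r \<partial>lborel)"
    by (intro LIMSEQ_le_const) auto
  also have "\<dots> \<le> (\<integral>x. norm z powr r * norm (grad f x) powr r \<partial>lborel)"
  proof (rule integral_mono')
    show "integrable lborel (\<lambda>x. norm z powr r * norm (grad f x) powr r)"
      using C1c_integrable(4)[OF f, of r] r by simp
    show "\<bar>z \<bullet> grad f x\<bar> powr r \<le> norm z powr r * norm (grad f x) powr r" for x
      unfolding powr_mult[symmetric] using r by (intro powr_mono2 Cauchy_Schwarz_ineq2) auto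
  qed simp
  finally show ?thesis by (simp add: D_def)
qed

text \<open>A shift of length 2R + 1 moves the ball of radius R off itself, so f(x + z) = 0 wherever
  f(x) may be nonzero, and the translation estimate bounds f itself.\<close>

lemma C1c_poincare:
  fixes f :: "'a::euclidean_space \<Rightarrow> real"
  assumes f: "C1c f" and r: "1 \<le> r" and R: "0 < R" "\<And>x. R < norm x \<Longrightarrow> f x = 0"
  shows "(\<integral>x. \<bar>f x\<bar> powr r \<partial>lborel) \<le> (2 * R + 1) powr r * (\<integral>x. norm (grad f x) powr r \<partial>lborel)"
proof -
  obtain e :: 'a where e: "e \<in> Basis" using nonempty_Basis by blast
  define z where "z = (2 * R + 1) *\<^sub>R e"
  have z: "norm z = 2 * R + 1" using e R by (simp add: z_def)
  have "(\<integral>x. \<bar>f x\<bar> powr r \<partial>lborel) \<le> (\<integral>x. \<bar>f (x + z) - f x\<bar> powr r \<partial>lborel)"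
  proof (rule integral_mono')
    show "\<bar>f x\<bar> powr r \<le> \<bar>f (x + z) - f x\<bar> powr r" for x
    proof (cases "R < norm x")
      case False
      have "norm z - norm x \<le> norm (x + z)" using norm_diff_ineq[of z x] by (simp add: add.commute)
      then have "R < norm (x + z)" using False z R by linarith
      then show ?thesis using R by simp
    qed (use R in simp)
  qed (use C1c_translation_integrable[OF f] r in auto)
  also have "\<dots> \<le> norm z powr r * (\<integral>x. norm (grad f x) powr r \<partial>lborel)"
    by (rule C1c_translation_estimate[OF f r])
  finally show ?thesis by (simp add: z)
qed

section \<open>Averages over balls\<close>

text \<open>Ball averages play the role of a mollifier: they are bounded and Lipschitz in terms of
  integrals of f and its gradient, and their distance from f is controlled by translations.\<close>

definition avg :: "real \<Rightarrow> ('a::euclidean_space \<Rightarrow> real) \<Rightarrow> 'a \<Rightarrow> real" where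
  "avg h f x = (\<integral>z. indicator (cball 0 h) z * f (x + z) \<partial>lborel) / measure lborel (cball 0 h :: 'a set)"

text \<open>Jensen's inequality up to the factor 2^p, from the threshold inequality with the
  threshold (S/V)^(1/p) that makes its two terms equal.\<close>

lemma integral_powr_le:
  fixes g :: "'a \<Rightarrow> real"
  assumes A: "A \<in> sets M" "emeasure M A < \<infinity>" "0 < measure M A"
    and p: "1 \<le> p"
    and g: "integrable M (\<lambda>x. indicator A x * g x)" "integrable M (\<lambda>x. indicator A x * \<bar>g x\<bar> powr p)"
  shows "\<bar>\<integral>x. indicator A x * g x \<partial>M\<bar> powr p \<le> 2 powr p * measure M A powr (p - 1) * (\<integral>x. indicator A x * \<bar>g x\<bar> powr p \<partial>M)"
proof -
  define V where "V = measure M A"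
  define S where "S = (\<integral>x. indicator A x * \<bar>g x\<bar> powr p \<partial>M)"
  define I where "I = \<bar>\<integral>x. indicator A x * g x \<partial>M\<bar>"
  have V: "0 < V" using A by (simp add: V_def)
  have S: "0 \<le> S" by (simp add: S_def)
  have *: "I \<le> T * V + T powr (1 - p) * S" if T: "0 < T" for T
  proof -
    have "I \<le> (\<integral>x. \<bar>indicator A x * g x\<bar> \<partial>M)" unfolding I_def by (rule integral_abs_bound)
    also have "\<dots> \<le> (\<integral>x. T * indicator A x + T powr (1 - p) * (indicator A x * \<bar>g x\<bar> powr p) \<partial>M)"
    proof (rule integral_mono')
      show "\<bar>indicator A x * g x\<bar> \<le> T * indicator A x + T powr (1 - p) * (indicator A x * \<bar>g x\<bar> powr p)" for x
        using le_threshold_powr[OF abs_ge_zero T p, of "g x"] by (simp add: indicator_def)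
      show "integrable M (\<lambda>x. T * indicator A x + T powr (1 - p) * (indicator A x * \<bar>g x\<bar> powr p))"
        using A g by (intro Bochner_Integration.integrable_add integrable_mult_right integrable_real_indicator) auto
    qed (use T in auto)
    also have "\<dots> = T * V + T powr (1 - p) * S"
      using A g unfolding V_def S_def
      by (subst Bochner_Integration.integral_add) (auto intro!: integrable_mult_right integrable_real_indicator)
    finally show ?thesis .
  qed
  have "I powr p \<le> 2 powr p * V powr (p - 1) * S"
  proof (cases "S = 0")
    case True
    \<comment> \<open>For S = 0 only the linear term is left, and the threshold can be taken
      arbitrarily small.\<close>
    have "I \<le> 0 + e" if "0 < e" for e
      using *[of "e / V"] V that True by simp
    then have "I \<le> 0" by (rule field_le_epsilon)
    then have "I = 0" by (simp add: I_def)
    then show ?thesis using S p by simp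
  next
    case False
    then have S: "0 < S" using S by simp
    define T where "T = (S / V) powr (1 / p)"
    have T: "0 < T" "T powr p = S / V" using S V p by (auto simp: T_def powr_powr)
    have "T powr (1 - p) * S = T * V" using T S V by (simp add: powr_diff field_simps)
    then have "I \<le> 2 * (T * V)" using *[OF T(1)] by simp
    then have "I powr p \<le> (2 * (T * V)) powr p" using p by (intro powr_mono2) (auto simp: I_def)
    also have "\<dots> = 2 powr p * V powr (p - 1) * S"
      using T V S by (simp add: powr_mult powr_diff)
    finally show ?thesis .
  qed
  then show ?thesis by (simp add: I_def V_def S_def)
qed

lemma measure_cball_pos: "0 < h \<Longrightarrow> 0 < measure lborel (cball (x::'a::euclidean_space) h)"
  by (simp add: content_cball)

lemma C1c_indicator_integrable:
  fixes f :: "'a::euclidean_space \<Rightarrow> real"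
  assumes "continuous_on UNIV f"
  shows "integrable lborel (\<lambda>z. indicator (cball 0 h) z * f (x + z))"
proof -
  have "continuous_on UNIV (\<lambda>z. f (x + z))"
    using assms by (rule continuous_on_compose2) (auto intro!: continuous_intros)
  then have "integrable lborel (\<lambda>z. indicator (cball 0 h) z *\<^sub>R f (x + z))"
    by (intro borel_integrable_compact) (auto intro: continuous_on_subset)
  then show ?thesis by simp
qed

text \<open>The free constant c serves two purposes: c = 0 bounds the average, and c = f x measures
  its distance from f.\<close>

lemma avg_powr_le:
  fixes f :: "'a::euclidean_space \<Rightarrow> real"
  assumes f: "continuous_on UNIV f" and h: "0 < h" and p: "1 \<le> p"
  shows "\<bar>c - avg h f x\<bar> powr p \<le> 2 powr p / measure lborel (cball 0 h :: 'a set) *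
     (\<integral>z. indicator (cball 0 h) z * \<bar>c - f (x + z)\<bar> powr p \<partial>lborel)"
proof -
  let ?V = "measure lborel (cball 0 h :: 'a set)"
  have V: "0 < ?V" using measure_cball_pos[OF h] .
  have c1: "continuous_on UNIV (\<lambda>z. c - f z)" using f by (intro continuous_intros)
  have c2: "continuous_on UNIV (\<lambda>z. \<bar>c - f z\<bar> powr p)"
    using c1 p by (intro continuous_on_powr' continuous_intros f) auto
  have "(\<integral>z. indicator (cball 0 h) z * (c - f (x + z)) \<partial>lborel)
      = (\<integral>z. c * indicator (cball 0 h) z - indicator (cball 0 h) z * f (x + z) \<partial>lborel)"
    by (simp add: algebra_simps)
  also have "\<dots> = c * ?V - (\<integral>z. indicator (cball 0 h) z * f (x + z) \<partial>lborel)"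
    using C1c_indicator_integrable[OF f]
    by (subst Bochner_Integration.integral_diff) auto
  finally have eq: "c - avg h f x = (\<integral>z. indicator (cball 0 h) z * (c - f (x + z)) \<partial>lborel) / ?V"
    using V by (simp add: avg_def field_simps)
  have "\<bar>\<integral>z. indicator (cball 0 h) z * (c - f (x + z)) \<partial>lborel\<bar> powr p
    \<le> 2 powr p * ?V powr (p - 1) * (\<integral>z. indicator (cball 0 h) z * \<bar>c - f (x + z)\<bar> powr p \<partial>lborel)"
    using V emeasure_lborel_cball_finite[of "0::'a" h] p C1c_indicator_integrable[OF c1] C1c_indicator_integrable[OF c2]
    by (intro integral_powr_le) auto
  then have "\<bar>c - avg h f x\<bar> powr p \<le> 2 powr p * ?V powr (p - 1) * (\<integral>z. indicator (cball 0 h) z * \<bar>c - f (x + z)\<bar> powr p \<partial>lborel) / ?V powr p"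
    unfolding eq abs_divide powr_divide using V by (simp add: divide_right_mono)
  also have "\<dots> = 2 powr p / ?V * (\<integral>z. indicator (cball 0 h) z * \<bar>c - f (x + z)\<bar> powr p \<partial>lborel)"
    using V by (simp add: powr_diff)
  finally show ?thesis .
qed

lemma avg_bound:
  fixes f :: "'a::euclidean_space \<Rightarrow> real"
  assumes f: "C1c f" and h: "0 < h" and s: "1 \<le> s"
  shows "\<bar>avg h f x\<bar> powr s \<le> 2 powr s / measure lborel (cball 0 h :: 'a set) * (\<integral>z. \<bar>f z\<bar> powr s \<partial>lborel)"
proof -
  have i: "integrable lborel (\<lambda>z. \<bar>f z\<bar> powr s)" using C1c_integrable(3)[OF f, of s] s by simp
  have [measurable]: "f \<in> borel_measurable borel" using f by (auto dest: C1c_measurable)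
  have "\<bar>avg h f x\<bar> powr s \<le> 2 powr s / measure lborel (cball 0 h :: 'a set) *
     (\<integral>z. indicator (cball 0 h) z * \<bar>f (x + z)\<bar> powr s \<partial>lborel)"
    using avg_powr_le[OF C1c_continuous(1)[OF f] h s, of 0 x] by simp
  also have "\<dots> \<le> 2 powr s / measure lborel (cball 0 h :: 'a set) * (\<integral>z. \<bar>f (z + x)\<bar> powr s \<partial>lborel)"
    using integrable_lborel_translation[OF i, of x]
    by (intro mult_left_mono integral_mono') (auto simp: indicator_def add.commute)
  also have "(\<integral>z. \<bar>f (z + x)\<bar> powr s \<partial>lborel) = (\<integral>z. \<bar>f z\<bar> powr s \<partial>lborel)"
    by (rule integral_lborel_translation) measurable
  finally show ?thesis .
qed

text \<open>The difference of two averages is at most the L^1 distance between f and its translate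
  by x - y, over the volume of the ball; the translation estimate with exponent 1 applies.\<close>

lemma avg_lipschitz:
  fixes f :: "'a::euclidean_space \<Rightarrow> real"
  assumes f: "C1c f" and h: "0 < h"
  shows "\<bar>avg h f x - avg h f y\<bar> \<le> norm (x - y) * (\<integral>z. norm (grad f z) \<partial>lborel) / measure lborel (cball 0 h :: 'a set)"
proof -
  let ?V = "measure lborel (cball 0 h :: 'a set)"
  have V: "0 < ?V" using measure_cball_pos[OF h] .
  note i = C1c_indicator_integrable[OF C1c_continuous(1)[OF f]]
  have [measurable]: "f \<in> borel_measurable borel" using f by (auto dest: C1c_measurable)
  have ti: "integrable lborel (\<lambda>z. \<bar>f (z + (x - y)) - f z\<bar>)"
    using C1c_translation_integrable[OF f, of 1 "x - y"] by simp
  have *: "(\<lambda>z. \<bar>f (x + z) - f (y + z)\<bar>) = (\<lambda>z. (\<lambda>z. \<bar>f (z + (x - y)) - f z\<bar>) (z + y))"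
    by (simp add: algebra_simps)
  have "\<bar>avg h f x - avg h f y\<bar> = \<bar>\<integral>z. indicator (cball 0 h) z * f (x + z) - indicator (cball 0 h) z * f (y + z) \<partial>lborel\<bar> / ?V"
    using V i by (simp add: avg_def diff_divide_distrib[symmetric] abs_divide)
  also have "\<dots> \<le> (\<integral>z. \<bar>f (x + z) - f (y + z)\<bar> \<partial>lborel) / ?V"
  proof (rule divide_right_mono)
    have "\<bar>\<integral>z. indicator (cball 0 h) z * f (x + z) - indicator (cball 0 h) z * f (y + z) \<partial>lborel\<bar>
       \<le> (\<integral>z. \<bar>indicator (cball 0 h) z * f (x + z) - indicator (cball 0 h) z * f (y + z)\<bar> \<partial>lborel)"
      by (rule integral_abs_bound)
    also have "\<dots> \<le> (\<integral>z. \<bar>f (x + z) - f (y + z)\<bar> \<partial>lborel)"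
    proof (rule integral_mono')
      show "integrable lborel (\<lambda>z. \<bar>f (x + z) - f (y + z)\<bar>)"
        unfolding * by (rule integrable_lborel_translation[OF ti])
    qed (auto simp: indicator_def)
    finally show "\<bar>\<integral>z. indicator (cball 0 h) z * f (x + z) - indicator (cball 0 h) z * f (y + z) \<partial>lborel\<bar>
       \<le> (\<integral>z. \<bar>f (x + z) - f (y + z)\<bar> \<partial>lborel)" .
  qed simp
  also have "(\<integral>z. \<bar>f (x + z) - f (y + z)\<bar> \<partial>lborel) = (\<integral>z. \<bar>f (z + (x - y)) - f z\<bar> \<partial>lborel)"
    unfolding * by (rule integral_lborel_translation) measurable
  also have "\<dots> \<le> norm (x - y) * (\<integral>z. norm (grad f z) \<partial>lborel)"
    using C1c_translation_estimate[OF f, of 1 "x - y"] by simp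
  finally show ?thesis using V by (simp add: divide_right_mono)
qed

lemma avg_measurable:
  fixes f :: "'a::euclidean_space \<Rightarrow> real"
  assumes f: "C1c f" and h: "0 < h"
  shows "avg h f \<in> borel_measurable borel"
proof (rule borel_measurable_continuous_onI)
  define L where "L = (\<integral>z. norm (grad f z) \<partial>lborel) / measure lborel (cball 0 h :: 'a set)"
  have "L-lipschitz_on UNIV (avg h f)"
  proof (rule lipschitz_onI)
    show "dist (avg h f x) (avg h f y) \<le> L * dist x y" for x y
      using avg_lipschitz[OF f h, of x y] by (simp add: L_def dist_norm mult.commute)
  qed (simp add: L_def)
  then show "continuous_on UNIV (avg h f)" by (rule lipschitz_on_continuous_on)
qed

text \<open>By Tonelli the error is, up to 2^p, an average over |z| <= h of translation errors, each
  at most h^p times the gradient integral. Nonnegative integrals are used because integrability of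
  the error is not known beforehand.\<close>

lemma avg_approximation:
  fixes f :: "'a::euclidean_space \<Rightarrow> real"
  assumes f: "C1c f" and h: "0 < h" and p: "1 \<le> p"
  shows "(\<integral>\<^sup>+x. ennreal (\<bar>f x - avg h f x\<bar> powr p) \<partial>lborel)
    \<le> ennreal ((2 * h) powr p * (\<integral>x. norm (grad f x) powr p \<partial>lborel))"
proof -
  let ?V = "measure lborel (cball 0 h :: 'a set)"
  define G where "G = (\<integral>x. norm (grad f x) powr p \<partial>lborel)"
  have V: "0 < ?V" using measure_cball_pos[OF h] .
  have G: "0 \<le> G" by (simp add: G_def)
  have [measurable]: "f \<in> borel_measurable borel" using f by (auto dest: C1c_measurable)
  have cf: "continuous_on UNIV f" using f by (rule C1c_continuous)
  have mm: "(\<lambda>(x, z). ennreal (indicator (cball 0 h) z * \<bar>f (x + z) - f x\<bar> powr p)) \<in> borel_measurable (lborel \<Otimes>\<^sub>M lborel)"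
  proof -
    have "continuous_on UNIV (\<lambda>y. \<bar>f (fst y + snd y) - f (fst y)\<bar> powr p)"
      using p by (intro continuous_on_powr' continuous_intros continuous_on_compose2[OF cf]) auto
    then have m: "(\<lambda>y. ennreal (indicator (UNIV \<times> cball 0 h) y * \<bar>f (fst y + snd y) - f (fst y)\<bar> powr p)) \<in> borel_measurable borel"
      by (intro measurable_compose[OF _ measurable_ennreal] borel_measurable_times borel_measurable_indicator
          borel_measurable_continuous_onI borel_closed closed_Times) auto
    have s: "sets (lborel \<Otimes>\<^sub>M lborel) = sets (borel :: ('a \<times> 'a) measure)"
      unfolding borel_prod[symmetric] by (rule sets_pair_measure_cong) auto
    have e: "(\<lambda>(x, z). ennreal (indicator (cball 0 h) z * \<bar>f (x + z) - f x\<bar> powr p))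
       = (\<lambda>y. ennreal (indicator (UNIV \<times> cball 0 h) y * \<bar>f (fst y + snd y) - f (fst y)\<bar> powr p))"
      by (auto simp: fun_eq_iff indicator_def)
    show ?thesis unfolding e measurable_cong_sets[OF s refl] by (rule m)
  qed
  have pt: "ennreal (\<bar>f x - avg h f x\<bar> powr p) \<le> ennreal (2 powr p / ?V) *
     (\<integral>\<^sup>+z. ennreal (indicator (cball 0 h) z * \<bar>f (x + z) - f x\<bar> powr p) \<partial>lborel)" for x
  proof -
    have c: "continuous_on UNIV (\<lambda>z. \<bar>f x - f z\<bar> powr p)"
      using cf p by (intro continuous_on_powr' continuous_intros) auto
    have "\<bar>f x - avg h f x\<bar> powr p \<le> 2 powr p / ?V *
       (\<integral>z. indicator (cball 0 h) z * \<bar>f x - f (x + z)\<bar> powr p \<partial>lborel)"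
      by (rule avg_powr_le[OF cf h p])
    then have "ennreal (\<bar>f x - avg h f x\<bar> powr p) \<le> ennreal (2 powr p / ?V) *
       ennreal (\<integral>z. indicator (cball 0 h) z * \<bar>f x - f (x + z)\<bar> powr p \<partial>lborel)"
      using V by (subst ennreal_mult[symmetric]) (auto simp: ennreal_leI)
    also have "ennreal (\<integral>z. indicator (cball 0 h) z * \<bar>f x - f (x + z)\<bar> powr p \<partial>lborel)
       = (\<integral>\<^sup>+z. ennreal (indicator (cball 0 h) z * \<bar>f x - f (x + z)\<bar> powr p) \<partial>lborel)"
      using C1c_indicator_integrable[OF c] by (intro nn_integral_eq_integral[symmetric]) auto
    finally show ?thesis by (simp add: abs_minus_commute)
  qed
  have "(\<integral>\<^sup>+x. ennreal (\<bar>f x - avg h f x\<bar> powr p) \<partial>lborel)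
    \<le> (\<integral>\<^sup>+x. ennreal (2 powr p / ?V) * (\<integral>\<^sup>+z. ennreal (indicator (cball 0 h) z * \<bar>f (x + z) - f x\<bar> powr p) \<partial>lborel) \<partial>lborel)"
    by (intro nn_integral_mono pt)
  also have "\<dots> = ennreal (2 powr p / ?V) * (\<integral>\<^sup>+x. (\<integral>\<^sup>+z. ennreal (indicator (cball 0 h) z * \<bar>f (x + z) - f x\<bar> powr p) \<partial>lborel) \<partial>lborel)"
    using lborel.borel_measurable_nn_integral[OF mm] by (intro nn_integral_cmult) simp
  also have "(\<integral>\<^sup>+x. (\<integral>\<^sup>+z. ennreal (indicator (cball 0 h) z * \<bar>f (x + z) - f x\<bar> powr p) \<partial>lborel) \<partial>lborel)
     = (\<integral>\<^sup>+z. (\<integral>\<^sup>+x. ennreal (indicator (cball 0 h) z * \<bar>f (x + z) - f x\<bar> powr p) \<partial>lborel) \<partial>lborel)"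
    by (rule lborel_pair.Fubini'[symmetric, OF mm])
  also have "\<dots> \<le> (\<integral>\<^sup>+z. ennreal (h powr p * G) * indicator (cball 0 h) (z::'a) \<partial>lborel)"
  proof (intro nn_integral_mono)
    fix z :: 'a
    show "(\<integral>\<^sup>+x. ennreal (indicator (cball 0 h) z * \<bar>f (x + z) - f x\<bar> powr p) \<partial>lborel) \<le> ennreal (h powr p * G) * indicator (cball 0 h) z"
    proof (cases "z \<in> cball 0 h")
      case True
      then have "(\<integral>\<^sup>+x. ennreal (indicator (cball 0 h) z * \<bar>f (x + z) - f x\<bar> powr p) \<partial>lborel)
        = ennreal (\<integral>x. \<bar>f (x + z) - f x\<bar> powr p \<partial>lborel)"
        using C1c_translation_integrable[OF f, of p z] p by (subst nn_integral_eq_integral[symmetric]) auto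
      also have "\<dots> \<le> ennreal (norm z powr p * G)"
        unfolding G_def by (intro ennreal_leI C1c_translation_estimate f p)
      also have "\<dots> \<le> ennreal (h powr p * G)"
        using True p G by (intro ennreal_leI mult_right_mono powr_mono2) auto
      finally show ?thesis using True by simp
    qed simp
  qed
  also have "\<dots> = ennreal (h powr p * G) * ennreal ?V"
    using emeasure_lborel_cball_finite[of "0::'a" h]
    by (subst nn_integral_cmult_indicator) (simp_all add: emeasure_eq_ennreal_measure)
  also have "ennreal (2 powr p / ?V) * (ennreal (h powr p * G) * ennreal ?V) = ennreal ((2 * h) powr p * G)"
    using V G by (simp add: ennreal_mult[symmetric] powr_mult)
  finally show ?thesis by (simp add: G_def mult_left_mono)
qed

section \<open>The subcritical Sobolev inequality\<close>

definition unit_energy :: "real \<Rightarrow> real \<Rightarrow> ('a::euclidean_space \<Rightarrow> real) set" where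
  "unit_energy p R = {f. C1c f \<and> (\<forall>x. R < norm x \<longrightarrow> f x = 0) \<and>
     (\<integral>x. \<bar>f x\<bar> powr p \<partial>lborel) + (\<integral>x. norm (grad f x) powr p \<partial>lborel) \<le> 1}"

text \<open>Choosing the radius \<open>h\<close> of the averages so that \<open>|avg h f| \<le> t/2\<close>, the level set \<open>{|f| > t}\<close> is
  contained in \<open>{|f - avg h f| > t/2}\<close>, whose measure is at most a multiple of \<open>(h/t)\<^sup>p\<close>.\<close>
lemma level_set_estimate:
  assumes p: "1 \<le> p" and s: "1 \<le> s" and C: "0 < C"
    and bound: "\<And>f::'a::euclidean_space \<Rightarrow> real. f \<in> unit_energy p R \<Longrightarrow> (\<integral>x. \<bar>f x\<bar> powr s \<partial>lborel) \<le> C"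
  shows "\<exists>c\<ge>0. \<forall>f\<in>(unit_energy p R :: ('a \<Rightarrow> real) set). \<forall>t>0.
    emeasure lborel {x. t < \<bar>f x\<bar>} \<le> ennreal (c * t powr - (p + p * s / DIM('a)))"
proof -
  define N where "N = real DIM('a)"
  define \<omega> where "\<omega> = unit_ball_vol N"
  have N: "0 < N" by (simp add: N_def)
  have \<omega>: "0 < \<omega>" using N by (simp add: \<omega>_def)
  \<comment> \<open>\<open>avg_bound\<close> gives |avg h f| <= t/2 when the ball has volume 4^s C /
    t^s; solving for its radius yields h = c1 t^(-s/N).\<close>
  define c1 where "c1 = (4 powr s * C / \<omega>) powr (1 / N)"
  define c where "c = 4 powr p * c1 powr p"
  have c1: "0 < c1" using C \<omega> by (simp add: c1_def)
  have "emeasure lborel {x. t < \<bar>f x\<bar>} \<le> ennreal (c * t powr - (p + p * s / N))"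
    if f: "f \<in> unit_energy p R" and t: "0 < t" for f :: "'a \<Rightarrow> real" and t
  proof -
    have f1: "C1c f" and fi: "(\<integral>x. norm (grad f x) powr p \<partial>lborel) \<le> 1"
    proof -
      show "C1c f" using f by (simp add: unit_energy_def)
      have "0 \<le> (\<integral>x. \<bar>f x\<bar> powr p \<partial>lborel)" by simp
      moreover have "(\<integral>x. \<bar>f x\<bar> powr p \<partial>lborel) + (\<integral>x. norm (grad f x) powr p \<partial>lborel) \<le> 1"
        using f by (simp add: unit_energy_def)
      ultimately show "(\<integral>x. norm (grad f x) powr p \<partial>lborel) \<le> 1" by linarith
    qed
    have [measurable]: "f \<in> borel_measurable borel" using f1 by (auto dest: C1c_measurable)
    define h where "h = c1 * t powr (- s / N)"
    have h: "0 < h" using c1 t by (simp add: h_def)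
    have [measurable]: "avg h f \<in> borel_measurable borel" by (rule avg_measurable[OF f1 h])
    have V: "measure lborel (cball 0 h :: 'a set) = 4 powr s * C / t powr s"
    proof -
      have "measure lborel (cball 0 h :: 'a set) = \<omega> * h powr N"
        using h N by (simp add: content_cball \<omega>_def N_def powr_realpow)
      also have "h powr N = (4 powr s * C / \<omega>) * t powr (- s)"
        unfolding h_def c1_def powr_mult using N C \<omega> by (simp add: powr_powr)
      finally show ?thesis using \<omega> by (simp add: powr_minus_divide)
    qed
    have small: "\<bar>avg h f x\<bar> \<le> t / 2" for x
    proof -
      have "\<bar>avg h f x\<bar> powr s \<le> 2 powr s / measure lborel (cball 0 h :: 'a set) * (\<integral>z. \<bar>f z\<bar> powr s \<partial>lborel)"
        by (rule avg_bound[OF f1 h s])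
      also have "\<dots> \<le> 2 powr s / measure lborel (cball 0 h :: 'a set) * C"
        by (intro mult_left_mono bound f) auto
      also have "\<dots> = (t / 2) powr s"
      proof -
        have "(4::real) powr s = 2 powr s * 2 powr s" by (simp flip: powr_mult)
        then show ?thesis unfolding V using C t by (simp add: powr_divide field_simps)
      qed
      finally show ?thesis using t s powr_less_mono2[of s "t / 2" "\<bar>avg h f x\<bar>"] by linarith
    qed
    have "{x. t < \<bar>f x\<bar>} \<subseteq> {x\<in>space lborel. 1 \<le> ennreal ((2 / t) powr p) * ennreal (\<bar>f x - avg h f x\<bar> powr p)}"
    proof clarsimp
      fix x assume x: "t < \<bar>f x\<bar>"
      then have "t / 2 \<le> \<bar>f x - avg h f x\<bar>" using small[of x] by linarith
      then have "1 \<le> 2 / t * \<bar>f x - avg h f x\<bar>" using t by (simp add: field_simps)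
      then have "1 \<le> (2 / t * \<bar>f x - avg h f x\<bar>) powr p" using p by (intro ge_one_powr_ge_zero) auto
      then have "1 \<le> (2 / t) powr p * \<bar>f x - avg h f x\<bar> powr p" by (simp only: powr_mult)
      then show "1 \<le> ennreal ((2 / t) powr p) * ennreal (\<bar>f x - avg h f x\<bar> powr p)"
        by (simp add: ennreal_mult[symmetric] del: ennreal_1 add: ennreal_1[symmetric])
    qed
    then have "emeasure lborel {x. t < \<bar>f x\<bar>} \<le> emeasure lborel {x\<in>space lborel. 1 \<le> ennreal ((2 / t) powr p) * ennreal (\<bar>f x - avg h f x\<bar> powr p)}"
      by (rule emeasure_mono) measurable
    also have "\<dots> \<le> ennreal ((2 / t) powr p) * (\<integral>\<^sup>+x. ennreal (\<bar>f x - avg h f x\<bar> powr p) \<partial>lborel)"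
      using nn_integral_Markov_inequality[of "\<lambda>x. ennreal (\<bar>f x - avg h f x\<bar> powr p)" "space lborel" lborel "ennreal ((2 / t) powr p)"]
      by simp
    also have "\<dots> \<le> ennreal ((2 / t) powr p) * ennreal ((2 * h) powr p * (\<integral>x. norm (grad f x) powr p \<partial>lborel))"
      by (intro mult_left_mono avg_approximation f1 h p) simp
    also have "\<dots> \<le> ennreal ((2 / t) powr p) * ennreal ((2 * h) powr p * 1)"
      using fi by (intro mult_left_mono ennreal_leI) auto
    also have "\<dots> = ennreal ((2 / t) powr p * (2 * h) powr p)" by (simp add: ennreal_mult)
    also have "(2 / t) powr p * (2 * h) powr p = c * t powr - (p + p * s / N)"
    proof -
      have "(2 / t) powr p * (2 * h) powr p = (4 * c1) powr p * (t powr (- s / N) / t) powr p"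
        unfolding powr_mult[symmetric] h_def by (simp add: field_simps)
      also have "t powr (- s / N) / t = t powr (- s / N - 1)" using t by (simp add: powr_diff)
      also have "(t powr (- s / N - 1)) powr p = t powr - (p + p * s / N)"
      proof -
        have "(- s / N - 1) * p = - (p + p * s / N)" using N by (simp add: field_simps)
        then show ?thesis by (simp only: powr_powr)
      qed
      finally show ?thesis by (simp add: c_def powr_mult)
    qed
    finally show ?thesis .
  qed
  then show ?thesis unfolding N_def by (intro exI[of _ c]) (auto simp: c_def)
qed

text \<open>Dyadic layer cake.\<close>
lemma weak_to_strong:
  fixes f :: "'a::euclidean_space \<Rightarrow> real"
  assumes f: "f \<in> borel_measurable borel" and r: "0 < r" "r < m" and c: "0 \<le> c"
    and out: "\<And>x. R < norm x \<Longrightarrow> f x = 0"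
    and weak: "\<And>t. 0 < t \<Longrightarrow> emeasure lborel {x. t < \<bar>f x\<bar>} \<le> ennreal (c * t powr - m)"
  shows "(\<integral>\<^sup>+x. ennreal (\<bar>f x\<bar> powr r) \<partial>lborel) \<le> ennreal (measure lborel (cball 0 R :: 'a set) + 2 powr r * c / (1 - 2 powr (r - m)))"
proof -
  note [measurable] = f
  have q: "2 powr (r - m) < (1::real)" "0 \<le> 2 powr (r - m)" using r by (auto simp: powr_less_one)
  have pt: "ennreal (\<bar>f x\<bar> powr r) \<le> indicator (cball 0 R) x +
     (\<Sum>k. ennreal ((2 ^ Suc k) powr r) * indicator {x. 2 ^ k < \<bar>f x\<bar>} x)" for x
  proof (cases "\<bar>f x\<bar> \<le> 1")
    case True
    show ?thesis
    proof (cases "R < norm x")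
      case True then show ?thesis using out by simp
    next
      case False
      have "\<bar>f x\<bar> powr r \<le> 1" using True r by (intro powr_le1) auto
      then have "ennreal (\<bar>f x\<bar> powr r) \<le> 1" by (simp add: ennreal_le_1)
      then show ?thesis using False by (simp add: add_increasing2)
    qed
  next
    case False
    \<comment> \<open>The dyadic level with 2^k < |f x| <= 2^(k+1): this one term of the series
      already dominates |f x|^r. Values at most 1 are left to the indicator of the ball.\<close>
    define k where "k = (LEAST k. \<bar>f x\<bar> \<le> 2 ^ Suc k)"
    have ex: "\<exists>k. \<bar>f x\<bar> \<le> 2 ^ Suc k"
    proof -
      obtain n where "\<bar>f x\<bar> < 2 ^ n" using real_arch_pow[of 2 "\<bar>f x\<bar>"] by auto
      then have "\<bar>f x\<bar> \<le> 2 ^ Suc n" by simp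
      then show ?thesis ..
    qed
    then have k1: "\<bar>f x\<bar> \<le> 2 ^ Suc k" unfolding k_def by (rule LeastI_ex)
    have k2: "2 ^ k < \<bar>f x\<bar>"
    proof (cases k)
      case 0 then show ?thesis using False by simp
    next
      case (Suc j)
      then have "\<not> \<bar>f x\<bar> \<le> 2 ^ Suc j" using not_less_Least[of j "\<lambda>k. \<bar>f x\<bar> \<le> 2 ^ Suc k"] by (simp add: k_def)
      then show ?thesis using Suc by simp
    qed
    have "ennreal (\<bar>f x\<bar> powr r) \<le> ennreal ((2 ^ Suc k) powr r) * indicator {x. 2 ^ k < \<bar>f x\<bar>} x"
      using k1 k2 r by (simp add: ennreal_leI powr_mono2)
    also have "\<dots> = (\<Sum>j\<in>{k}. ennreal ((2 ^ Suc j) powr r) * indicator {x. 2 ^ j < \<bar>f x\<bar>} x)"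
      by (simp only: sum.insert finite.emptyI sum.empty empty_iff not_False_eq_True add_0_right)
    also have "\<dots> \<le> (\<Sum>k. ennreal ((2 ^ Suc k) powr r) * indicator {x. 2 ^ k < \<bar>f x\<bar>} x)"
      by (rule sum_le_suminf) auto
    finally show ?thesis by (simp add: add_increasing)
  qed
  have "(\<integral>\<^sup>+x. ennreal (\<bar>f x\<bar> powr r) \<partial>lborel) \<le> (\<integral>\<^sup>+x. indicator (cball 0 R) x +
     (\<Sum>k. ennreal ((2 ^ Suc k) powr r) * indicator {x. 2 ^ k < \<bar>f x\<bar>} x) \<partial>lborel)"
    by (intro nn_integral_mono pt)
  also have "\<dots> = emeasure lborel (cball 0 R :: 'a set) + (\<Sum>k. ennreal ((2 ^ Suc k) powr r) * emeasure lborel {x. 2 ^ k < \<bar>f x\<bar>})"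
  proof -
    have "(\<lambda>x. ennreal ((2 ^ Suc k) powr r) * indicator {x. 2 ^ k < \<bar>f x\<bar>} x) \<in> borel_measurable lborel" for k :: nat
      by measurable
    moreover have "(indicator (cball 0 R) :: 'a \<Rightarrow> ennreal) \<in> borel_measurable borel"
      by (intro borel_measurable_indicator) auto
    ultimately show ?thesis
      by (subst nn_integral_add) (auto simp: nn_integral_suminf nn_integral_cmult_indicator)
  qed
  also have "\<dots> \<le> ennreal (measure lborel (cball 0 R :: 'a set)) + (\<Sum>k. ennreal (2 powr r * c * (2 powr (r - m)) ^ k))"
  proof (intro add_mono suminf_le)
    show "emeasure lborel (cball 0 R :: 'a set) \<le> ennreal (measure lborel (cball 0 R :: 'a set))"
      using emeasure_lborel_cball_finite[of "0::'a" R] by (simp add: emeasure_eq_ennreal_measure)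
    fix k
    have "ennreal ((2 ^ Suc k) powr r) * emeasure lborel {x. 2 ^ k < \<bar>f x\<bar>} \<le> ennreal ((2 ^ Suc k) powr r) * ennreal (c * (2 ^ k) powr - m)"
      by (intro mult_left_mono weak) auto
    also have "\<dots> = ennreal ((2 ^ Suc k) powr r * (c * (2 ^ k) powr - m))"
      using c by (simp add: ennreal_mult)
    also have "(2 ^ Suc k) powr r * (c * (2 ^ k) powr - m) = 2 powr r * c * (2 powr (r - m)) ^ k"
    proof -
      have "(2 ^ k) powr r * (2 ^ k) powr - m = (2 ^ k :: real) powr (r - m)" by (simp flip: powr_add)
      also have "\<dots> = (2 powr (r - m)) ^ k"
        by (simp add: powr_realpow[symmetric] powr_powr mult.commute)
      finally show ?thesis by (simp add: powr_mult mult_ac)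
    qed
    finally show "ennreal ((2 ^ Suc k) powr r) * emeasure lborel {x. 2 ^ k < \<bar>f x\<bar>} \<le> ennreal (2 powr r * c * (2 powr (r - m)) ^ k)" .
  qed auto
  also have "(\<Sum>k. ennreal (2 powr r * c * (2 powr (r - m)) ^ k)) = ennreal (\<Sum>k. 2 powr r * c * (2 powr (r - m)) ^ k)"
    using q c by (intro suminf_ennreal2) (auto intro!: summable_mult summable_geometric)
  also have "(\<Sum>k. 2 powr r * c * (2 powr (r - m)) ^ k) = 2 powr r * c / (1 - 2 powr (r - m))"
    using q by (simp add: suminf_mult summable_geometric suminf_geometric)
  finally show ?thesis
    using q c by (simp add: ennreal_plus)
qed

text \<open>Control in L^s gives weak control with exponent p + p s / N, hence strong control
  strictly below it. For p < N the map s -> p + p s / N has the fixed point p N / (N - p), so each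
  step gains while s is subcritical.\<close>

lemma sobolev_step:
  assumes p: "1 \<le> p" and s: "1 \<le> s" and r: "0 < r" "r < p + p * s / DIM('a)"
    and bound: "\<exists>C. \<forall>f\<in>(unit_energy p R :: ('a::euclidean_space \<Rightarrow> real) set). (\<integral>x. \<bar>f x\<bar> powr s \<partial>lborel) \<le> C"
  shows "\<exists>C. \<forall>f\<in>(unit_energy p R :: ('a \<Rightarrow> real) set). (\<integral>x. \<bar>f x\<bar> powr r \<partial>lborel) \<le> C"
proof -
  from bound obtain C0 where C0: "\<And>f::'a \<Rightarrow> real. f \<in> unit_energy p R \<Longrightarrow> (\<integral>x. \<bar>f x\<bar> powr s \<partial>lborel) \<le> C0"
    by blast
  have C1: "0 < max C0 1" by simp
  have C2: "(\<integral>x. \<bar>f x\<bar> powr s \<partial>lborel) \<le> max C0 1" if "f \<in> unit_energy p R" for f :: "'a \<Rightarrow> real"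
    using C0[OF that] by simp
  have "\<exists>c\<ge>0. \<forall>f\<in>(unit_energy p R :: ('a \<Rightarrow> real) set). \<forall>t>0.
       emeasure lborel {x. t < \<bar>f x\<bar>} \<le> ennreal (c * t powr - (p + p * s / DIM('a)))"
    by (rule level_set_estimate[OF p s C1]) (rule C2)
  then obtain c where c: "0 \<le> c" "\<forall>f\<in>(unit_energy p R :: ('a \<Rightarrow> real) set). \<forall>t>0.
       emeasure lborel {x. t < \<bar>f x\<bar>} \<le> ennreal (c * t powr - (p + p * s / DIM('a)))"
    by (elim exE conjE) (rule that)
  define m where "m = p + p * s / DIM('a)"
  show ?thesis
  proof (intro exI ballI)
    fix f :: "'a \<Rightarrow> real" assume f: "f \<in> unit_energy p R"
    then have f1: "C1c f" "\<And>x. R < norm x \<Longrightarrow> f x = 0" by (auto simp: unit_energy_def)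
    have "(\<integral>\<^sup>+x. ennreal (\<bar>f x\<bar> powr r) \<partial>lborel) \<le> ennreal (measure lborel (cball 0 R :: 'a set) + 2 powr r * c / (1 - 2 powr (r - m)))"
      by (rule weak_to_strong) (use f1 r c f in \<open>auto simp: m_def dest: C1c_measurable\<close>)
    moreover have "(\<integral>\<^sup>+x. ennreal (\<bar>f x\<bar> powr r) \<partial>lborel) = ennreal (\<integral>x. \<bar>f x\<bar> powr r \<partial>lborel)"
      using C1c_integrable(3)[OF f1(1), of r] r by (intro nn_integral_eq_integral) auto
    moreover have "0 \<le> 2 powr r * c / (1 - 2 powr (r - m))"
      using r c by (intro divide_nonneg_nonneg mult_nonneg_nonneg) (auto simp: m_def powr_less_one less_imp_le)
    ultimately show "(\<integral>x. \<bar>f x\<bar> powr r \<partial>lborel) \<le> measure lborel (cball 0 R :: 'a set) + 2 powr r * c / (1 - 2 powr (r - m))"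
      by (simp add: ennreal_plus[symmetric] del: ennreal_plus)
  qed
qed

text \<open>The iteration is replaced by a supremum: if the attainable exponents stayed below g, one
  step from an exponent close to their supremum would exceed it.\<close>

lemma sobolev_unit:
  assumes p: "1 \<le> p" "p \<le> g" and crit: "ereal g < critical_exponent p DIM('a)"
  shows "\<exists>C. \<forall>f\<in>(unit_energy p R :: ('a::euclidean_space \<Rightarrow> real) set). (\<integral>x. \<bar>f x\<bar> powr g \<partial>lborel) \<le> C"
proof -
  define N where "N = real DIM('a)"
  have N: "0 < N" by (simp add: N_def)
  define P where "P s \<longleftrightarrow> (\<exists>C. \<forall>f\<in>(unit_energy p R :: ('a \<Rightarrow> real) set). (\<integral>x. \<bar>f x\<bar> powr s \<partial>lborel) \<le> C)" for s
  define S where "S = {s. p \<le> s \<and> s \<le> g \<and> P s}"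
  have "P p" unfolding P_def
  proof (intro exI[of _ 1] ballI)
    fix f :: "'a \<Rightarrow> real" assume "f \<in> unit_energy p R"
    then have "(\<integral>x. \<bar>f x\<bar> powr p \<partial>lborel) + (\<integral>x. norm (grad f x) powr p \<partial>lborel) \<le> 1"
      by (simp add: unit_energy_def)
    moreover have "0 \<le> (\<integral>x. norm (grad f x) powr p \<partial>lborel)" by simp
    ultimately show "(\<integral>x. \<bar>f x\<bar> powr p \<partial>lborel) \<le> 1" by linarith
  qed
  then have pS: "p \<in> S" using p by (simp add: S_def)
  have bS: "bdd_above S" by (rule bdd_aboveI[of _ g]) (simp add: S_def)
  define \<sigma> where "\<sigma> = Sup S"
  have \<sigma>: "p \<le> \<sigma>" "\<sigma> \<le> g"
    using pS bS by (auto simp: \<sigma>_def S_def intro: cSup_upper cSup_least)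
  \<comment> \<open>\<theta> is the gain of one step taken at \<sigma>; it is positive since
    \<sigma> <= g lies below the critical exponent.\<close>
  define \<theta> where "\<theta> = p + p * \<sigma> / N - \<sigma>"
  have \<theta>: "0 < \<theta>"
  proof (cases "p < N")
    case True
    then have "g < p * N / (N - p)" using crit by (simp add: critical_exponent_def N_def)
    then have "g * (N - p) < p * N" using True by (simp add: pos_less_divide_eq)
    moreover have "\<sigma> * (N - p) \<le> g * (N - p)" using \<sigma> True by (intro mult_right_mono) auto
    ultimately have "\<sigma> * (N - p) < p * N" by simp
    then show ?thesis using N by (simp add: \<theta>_def field_simps)
  next
    case False
    then have "\<sigma> * 1 \<le> \<sigma> * (p / N)" using N \<sigma> p by (intro mult_left_mono) (auto simp: field_simps)
    then show ?thesis using p by (simp add: \<theta>_def field_simps)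
  qed
  \<comment> \<open>An exponent within \<theta> N/(2p) of the supremum loses at most \<theta>/2 of
    the gain, so \<sigma> + \<theta>/4 remains reachable.\<close>
  have "\<sigma> - \<theta> * N / (2 * p) < \<sigma>" using \<theta> N p by simp
  then have "\<exists>s\<in>S. \<sigma> - \<theta> * N / (2 * p) < s"
    using less_cSup_iff[of S "\<sigma> - \<theta> * N / (2 * p)"] pS bS unfolding \<sigma>_def by blast
  then obtain s where s: "s \<in> S" "\<sigma> - \<theta> * N / (2 * p) < s" by blast
  define r where "r = min g (\<sigma> + \<theta> / 4)"
  have "p * (\<sigma> - \<theta> * N / (2 * p)) / N < p * s / N"
    using s p N by (intro divide_strict_right_mono mult_strict_left_mono) auto
  moreover have "p * (\<sigma> - \<theta> * N / (2 * p)) / N = p * \<sigma> / N - \<theta> / 2"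
    using p N by (simp add: field_simps)
  ultimately have "\<sigma> + \<theta> / 2 < p + p * s / N" using \<theta>_def by linarith
  then have r: "r < p + p * s / N" "p \<le> r" "r \<le> g" using \<theta> \<sigma> p by (auto simp: r_def min_def)
  have "P r" unfolding P_def
    by (rule sobolev_step[of p s]) (use p s r in \<open>auto simp: S_def P_def N_def\<close>)
  then have "r \<in> S" using r by (simp add: S_def)
  then have "r \<le> \<sigma>" unfolding \<sigma>_def using bS by (rule cSup_upper)
  then have "r = g" using \<theta> by (auto simp: r_def min_def split: if_splits)
  then show ?thesis using \<open>P r\<close> by (simp add: P_def)
qed

lemma C1c_cmult: "C1c f \<Longrightarrow> C1c (\<lambda>x. c * f x)"
proof -
  assume f: "C1c f"
  then have g: "grad (\<lambda>x. c * f x) = (\<lambda>x. c *\<^sub>R grad f x)" by (auto simp: grad_cmult)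
  from f have "GDERIV (\<lambda>x. c * f x) x :> c *\<^sub>R grad f x" for x
    using GDERIV_mult[OF GDERIV_const[of c] C1c_GDERIV[OF f], of x] by simp
  with f show ?thesis unfolding C1c_def g by (auto intro!: continuous_intros)
qed

text \<open>Homogeneity removes the normalization. The scale k is a positive upper bound of the norm
  rather than the norm itself, so dividing by it is legitimate also for f = 0.\<close>

lemma sobolev_inequality:
  assumes p: "1 \<le> p" "p \<le> g" and crit: "ereal g < critical_exponent p DIM('a::euclidean_space)"
  shows "\<exists>C\<ge>0. \<forall>f::'a \<Rightarrow> real. \<forall>k>0. C1c f \<longrightarrow> (\<forall>x. R < norm x \<longrightarrow> f x = 0) \<longrightarrow>
    (\<integral>x. \<bar>f x\<bar> powr p \<partial>lborel) + (\<integral>x. norm (grad f x) powr p \<partial>lborel) \<le> k powr p \<longrightarrow>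
    (\<integral>x. \<bar>f x\<bar> powr g \<partial>lborel) \<le> C * k powr g"
proof -
  from sobolev_unit[OF p crit, of R] obtain C where
    C: "\<And>f::'a \<Rightarrow> real. f \<in> unit_energy p R \<Longrightarrow> (\<integral>x. \<bar>f x\<bar> powr g \<partial>lborel) \<le> C" by blast
  show ?thesis
  proof (intro exI[of _ "max C 0"] conjI allI impI)
    fix f :: "'a \<Rightarrow> real" and k :: real
    assume k: "0 < k" and f: "C1c f" "\<forall>x. R < norm x \<longrightarrow> f x = 0"
      and le: "(\<integral>x. \<bar>f x\<bar> powr p \<partial>lborel) + (\<integral>x. norm (grad f x) powr p \<partial>lborel) \<le> k powr p"
    define u where "u x = (1 / k) * f x" for x
    have gu: "grad u x = (1 / k) *\<^sub>R grad f x" for x unfolding u_def by (rule grad_cmult[OF f(1)])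
    have iu: "(\<integral>x. \<bar>u x\<bar> powr r \<partial>lborel) = (\<integral>x. \<bar>f x\<bar> powr r \<partial>lborel) / k powr r" for r
      using k by (simp add: u_def abs_mult powr_divide)
    have ig: "(\<integral>x. norm (grad u x) powr r \<partial>lborel) = (\<integral>x. norm (grad f x) powr r \<partial>lborel) / k powr r" for r
      using k by (simp add: gu powr_divide)
    have "u \<in> unit_energy p R"
      unfolding unit_energy_def mem_Collect_eq iu ig add_divide_distrib[symmetric]
      using f k le C1c_cmult[OF f(1), of "1 / k"] by (auto simp: u_def[abs_def])
    from C[OF this] have "(\<integral>x. \<bar>f x\<bar> powr g \<partial>lborel) \<le> C * k powr g"
      unfolding iu using k by (simp add: pos_divide_le_eq)
    also have "\<dots> \<le> max C 0 * k powr g" by (intro mult_right_mono) auto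
    finally show "(\<integral>x. \<bar>f x\<bar> powr g \<partial>lborel) \<le> max C 0 * k powr g" .
  qed simp
qed

section \<open>Rellich compactness\<close>

lemma nn_integral_add_indicator:
  assumes [measurable]: "F \<in> borel_measurable M" "G \<in> borel_measurable M" "A \<in> sets M"
  shows "(\<integral>\<^sup>+x. F x + (G x + c * indicator A x) \<partial>M) = (\<integral>\<^sup>+x. F x \<partial>M) + ((\<integral>\<^sup>+x. G x \<partial>M) + c * emeasure M A)"
  by (simp add: nn_integral_add nn_integral_cmult_indicator)

text \<open>At a fixed accuracy e the functions may be replaced, uniformly in n, by their averages
  over a small radius. The averages are uniformly bounded and Lipschitz, so Arzela-Ascoli yields a
  subsequence converging uniformly on the supporting ball.\<close>

lemma rellich_step:
  fixes f :: "nat \<Rightarrow> 'a::euclidean_space \<Rightarrow> real"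
  assumes p: "1 < p" and e: "0 < e"
    and f: "\<And>n. C1c (f n)" "\<And>n x. R < norm x \<Longrightarrow> f n x = 0"
    and B: "\<And>n. (\<integral>x. \<bar>f n x\<bar> powr p \<partial>lborel) + (\<integral>x. norm (grad (f n) x) powr p \<partial>lborel) \<le> B"
  shows "\<exists>k::nat \<Rightarrow> nat. strict_mono k \<and> (\<exists>N. \<forall>m\<ge>N. \<forall>n\<ge>N. (\<integral>x. \<bar>f (k m) x - f (k n) x\<bar> powr p \<partial>lborel) \<le> e)"
proof -
  \<comment> \<open>4^p is a constant for splitting f_m - f_n into three terms through both
    averages. The radius \<open>h\<close> then makes each approximation error contribute at most
    e/4, and \<eta> makes the difference of the averages contribute at most e/2.\<close>
  define c where "c = 4 powr p"
  have c: "0 < c" by (simp add: c_def)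
  have int0: "0 \<le> (\<integral>x. \<bar>f n x\<bar> powr p \<partial>lborel)" "0 \<le> (\<integral>x. norm (grad (f n) x) powr p \<partial>lborel)" for n by auto
  have Bg: "(\<integral>x. norm (grad (f n) x) powr p \<partial>lborel) \<le> B" and Bf: "(\<integral>x. \<bar>f n x\<bar> powr p \<partial>lborel) \<le> B" for n
    using B[of n] int0[of n] by linarith+
  have B0: "0 \<le> B" using Bf[of 0] int0(1)[of 0] by linarith
  define h where "h = (e / (4 * c * (B + 1))) powr (1 / p) / 2"
  have h: "0 < h" "(2 * h) powr p = e / (4 * c * (B + 1))"
    using e c B0 p by (auto simp: h_def powr_powr)
  define V where "V = measure lborel (cball 0 h :: 'a set)"
  have V: "0 < V" using measure_cball_pos[OF h(1)] by (simp add: V_def)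
  define W where "W = measure lborel (cball 0 R :: 'a set)"
  have W: "emeasure lborel (cball 0 R :: 'a set) = ennreal W"
    using emeasure_lborel_cball_finite[of "0::'a" R] by (simp add: emeasure_eq_ennreal_measure W_def)
  have W0: "0 \<le> W" by (simp add: W_def)
  define M where "M = (2 powr p / V * B) powr (1 / p)"
  have bound: "norm (avg h (f n) x) \<le> M" for n x
  proof -
    have "\<bar>avg h (f n) x\<bar> powr p \<le> 2 powr p / V * (\<integral>x. \<bar>f n x\<bar> powr p \<partial>lborel)"
      unfolding V_def using p by (intro avg_bound f h) auto
    also have "\<dots> \<le> 2 powr p / V * B" using V by (intro mult_left_mono Bf) auto
    finally have "(\<bar>avg h (f n) x\<bar> powr p) powr (1 / p) \<le> M"
      unfolding M_def using p by (intro powr_mono2) auto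
    then show ?thesis using p by (simp add: powr_powr)
  qed
  \<comment> \<open>On the ball t <= 1 + t^p turns the p-th power bound into the L^1 bound W + B for
    the gradients; the added 1 keeps the Lipschitz constant positive.\<close>
  define L where "L = (W + B) / V + 1"
  have L: "0 < L" using W0 B0 V by (simp add: L_def add_nonneg_pos)
  have lip: "\<bar>avg h (f n) x - avg h (f n) y\<bar> \<le> L * norm (x - y)" for n x y
  proof -
    have "(\<integral>z. norm (grad (f n) z) \<partial>lborel) \<le> (\<integral>z. indicator (cball 0 R) z + norm (grad (f n) z) powr p \<partial>lborel)"
    proof (rule integral_mono')
      show "integrable lborel (\<lambda>z. indicator (cball 0 R) z + norm (grad (f n) z) powr p)"
        using C1c_integrable(4)[OF f(1), of p] p by (intro Bochner_Integration.integrable_add) auto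
      show "norm (grad (f n) z) \<le> indicator (cball 0 R) z + norm (grad (f n) z) powr p" for z
      proof (cases "R < norm z")
        case True
        have "grad (f n) z = 0"
          by (rule grad_eq_0_outside[of "cball 0 R"]) (use f True in auto)
        then show ?thesis by simp
      next
        case False
        then show ?thesis using le_threshold_powr[of "norm (grad (f n) z)" 1 p] p by simp
      qed
    qed auto
    also have "\<dots> = W + (\<integral>z. norm (grad (f n) z) powr p \<partial>lborel)"
      using C1c_integrable(4)[OF f(1), of p] p
      by (subst Bochner_Integration.integral_add) (auto simp: W_def)
    also have "\<dots> \<le> W + B" using Bg by simp
    finally have *: "(\<integral>z. norm (grad (f n) z) \<partial>lborel) \<le> W + B" .
    have "\<bar>avg h (f n) x - avg h (f n) y\<bar> \<le> norm (x - y) * (\<integral>z. norm (grad (f n) z) \<partial>lborel) / V"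
      unfolding V_def by (rule avg_lipschitz[OF f(1) h(1)])
    also have "\<dots> \<le> norm (x - y) * (W + B) / V"
      using V * by (intro divide_right_mono mult_left_mono) auto
    also have "\<dots> \<le> L * norm (x - y)" by (simp add: L_def algebra_simps)
    finally show ?thesis .
  qed
  obtain g k where k: "strict_mono (k :: nat \<Rightarrow> nat)"
    "\<And>e. 0 < e \<Longrightarrow> \<exists>N. \<forall>n x. N \<le> n \<and> x \<in> cball 0 R \<longrightarrow> norm (avg h (f (k n)) x - g x) < e"
  proof (rule Arzela_Ascoli[of "cball (0::'a) R" "\<lambda>n. avg h (f n)" M])
    show "\<exists>d>0. \<forall>n y. y \<in> cball 0 R \<and> norm (x - y) < d \<longrightarrow> norm (avg h (f n) x - avg h (f n) y) < e"
      if "0 < e" for x e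
    proof (intro exI[of _ "e / L"] conjI allI impI)
      show "0 < e / L" using that L by simp
      fix n y assume "y \<in> cball 0 R \<and> norm (x - y) < e / L"
      then have "L * norm (x - y) < e" using L by (simp add: field_simps)
      then show "norm (avg h (f n) x - avg h (f n) y) < e" using lip[of n x y] by simp
    qed
  qed (use bound in auto)
  define \<eta> where "\<eta> = (e / (2 * c * (W + 1))) powr (1 / p) / 2"
  have \<eta>: "0 < \<eta>" "(2 * \<eta>) powr p = e / (2 * c * (W + 1))"
    using e c W0 p by (auto simp: \<eta>_def powr_powr)
  obtain N where N: "\<And>n x. N \<le> n \<Longrightarrow> x \<in> cball 0 R \<Longrightarrow> norm (avg h (f (k n)) x - g x) < \<eta>"
    using k(2)[OF \<eta>(1)] by blast
  have "(\<integral>x. \<bar>f (k m) x - f (k n) x\<bar> powr p \<partial>lborel) \<le> e" if mn: "N \<le> m" "N \<le> n" for m n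
  proof -
    have [measurable]: "f i \<in> borel_measurable borel" "avg h (f i) \<in> borel_measurable borel" for i
      using f(1) h(1) by (auto dest: C1c_measurable intro: avg_measurable)
    have pt: "\<bar>f (k m) x - f (k n) x\<bar> powr p \<le> c * \<bar>f (k m) x - avg h (f (k m)) x\<bar> powr p
       + (c * \<bar>f (k n) x - avg h (f (k n)) x\<bar> powr p + c * (2 * \<eta>) powr p * indicator (cball 0 R) x)" for x
    proof (cases "R < norm x")
      case True
      then show ?thesis using f(2) c p by simp
    next
      case False
      have 1: "\<bar>avg h (f (k m)) x - avg h (f (k n)) x\<bar> \<le> 2 * \<eta>"
        using N[OF mn(1), of x] N[OF mn(2), of x] False by simp
      define A where "A = f (k m) x - avg h (f (k m)) x"
      define D where "D = f (k n) x - avg h (f (k n)) x"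
      define E where "E = avg h (f (k m)) x - avg h (f (k n)) x"
      have le3: "\<bar>A - D + E\<bar> powr p \<le> c * \<bar>A\<bar> powr p + (c * \<bar>D\<bar> powr p + c * \<bar>E\<bar> powr p)"
      proof -
        define m where "m = max \<bar>A\<bar> (max \<bar>D\<bar> \<bar>E\<bar>)"
        have "\<bar>A - D + E\<bar> powr p \<le> (4 * m) powr p" using p by (intro powr_mono2) (auto simp: m_def)
        also have "\<dots> = c * m powr p" by (simp add: powr_mult c_def)
        also have "m powr p \<le> \<bar>A\<bar> powr p + (\<bar>D\<bar> powr p + \<bar>E\<bar> powr p)"
          by (auto simp: m_def max_def)
        finally show ?thesis using c by (simp add: algebra_simps)
      qed
      have "\<bar>E\<bar> powr p \<le> (2 * \<eta>) powr p" using 1 p by (auto simp: E_def intro!: powr_mono2)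
      then have "c * \<bar>E\<bar> powr p \<le> c * (2 * \<eta>) powr p" using c by simp
      moreover have "A - D + E = f (k m) x - f (k n) x" by (simp add: A_def D_def E_def)
      ultimately show ?thesis using le3 False by (simp add: A_def[symmetric] D_def[symmetric])
    qed
    have nn: "(\<integral>\<^sup>+x. ennreal (c * \<bar>f i x - avg h (f i) x\<bar> powr p) \<partial>lborel) \<le> ennreal (e / 4)" for i
    proof -
      have "(\<integral>\<^sup>+x. ennreal (c * \<bar>f i x - avg h (f i) x\<bar> powr p) \<partial>lborel)
         = ennreal c * (\<integral>\<^sup>+x. ennreal (\<bar>f i x - avg h (f i) x\<bar> powr p) \<partial>lborel)"
        using c by (simp add: ennreal_mult nn_integral_cmult)
      also have "\<dots> \<le> ennreal c * ennreal ((2 * h) powr p * (\<integral>x. norm (grad (f i) x) powr p \<partial>lborel))"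
        using p by (intro mult_left_mono avg_approximation f h) auto
      also have "\<dots> \<le> ennreal c * ennreal ((2 * h) powr p * B)"
        using Bg by (intro mult_left_mono ennreal_leI) auto
      also have "\<dots> = ennreal (c * ((2 * h) powr p * B))" using c B0 by (simp add: ennreal_mult)
      also have "\<dots> \<le> ennreal (e / 4)"
      proof (rule ennreal_leI)
        have "c * ((2 * h) powr p * B) = e / 4 * (B / (B + 1))" unfolding h using c by simp
        also have "\<dots> \<le> e / 4 * 1" using e B0 by (intro mult_left_mono) auto
        finally show "c * ((2 * h) powr p * B) \<le> e / 4" by simp
      qed
      finally show ?thesis .
    qed
    have i: "integrable lborel (\<lambda>x. \<bar>f (k m) x - f (k n) x\<bar> powr p)"
      using f p
      by (intro compact_support_integrable[of _ "cball 0 R"])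
        (auto intro!: continuous_on_powr' continuous_on_diff continuous_on_rabs continuous_on_const C1c_continuous(1)[OF f(1)])
    have "ennreal (\<integral>x. \<bar>f (k m) x - f (k n) x\<bar> powr p \<partial>lborel) = (\<integral>\<^sup>+x. ennreal (\<bar>f (k m) x - f (k n) x\<bar> powr p) \<partial>lborel)"
      using i by (intro nn_integral_eq_integral[symmetric]) auto
    also have "\<dots> \<le> (\<integral>\<^sup>+x. ennreal (c * \<bar>f (k m) x - avg h (f (k m)) x\<bar> powr p)
       + (ennreal (c * \<bar>f (k n) x - avg h (f (k n)) x\<bar> powr p) + ennreal (c * (2 * \<eta>) powr p) * indicator (cball 0 R) x) \<partial>lborel)"
    proof (rule nn_integral_mono)
      fix x
      have "ennreal (\<bar>f (k m) x - f (k n) x\<bar> powr p) \<le> ennreal (c * \<bar>f (k m) x - avg h (f (k m)) x\<bar> powr p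
       + (c * \<bar>f (k n) x - avg h (f (k n)) x\<bar> powr p + c * (2 * \<eta>) powr p * indicator (cball 0 R) x))"
        by (rule ennreal_leI[OF pt])
      then show "ennreal (\<bar>f (k m) x - f (k n) x\<bar> powr p) \<le> ennreal (c * \<bar>f (k m) x - avg h (f (k m)) x\<bar> powr p)
       + (ennreal (c * \<bar>f (k n) x - avg h (f (k n)) x\<bar> powr p) + ennreal (c * (2 * \<eta>) powr p) * indicator (cball 0 R) x)"
        using c by (cases "x \<in> cball 0 R") (simp_all add: ennreal_plus)
    qed
    also have "\<dots> = (\<integral>\<^sup>+x. ennreal (c * \<bar>f (k m) x - avg h (f (k m)) x\<bar> powr p) \<partial>lborel)
       + ((\<integral>\<^sup>+x. ennreal (c * \<bar>f (k n) x - avg h (f (k n)) x\<bar> powr p) \<partial>lborel) + ennreal (c * (2 * \<eta>) powr p) * ennreal W)"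
      by (subst nn_integral_add_indicator, measurable, simp only: W)
    also have "\<dots> \<le> ennreal (e / 4) + (ennreal (e / 4) + ennreal (e / 2))"
    proof (intro add_mono nn)
      have "ennreal (c * (2 * \<eta>) powr p) * ennreal W = ennreal (c * (2 * \<eta>) powr p * W)"
        using c W0 by (simp add: ennreal_mult)
      also have "\<dots> \<le> ennreal (e / 2)"
      proof (rule ennreal_leI)
        have "c * (2 * \<eta>) powr p * W = e / 2 * (W / (W + 1))" unfolding \<eta> using c by simp
        also have "\<dots> \<le> e / 2 * 1" using e W0 by (intro mult_left_mono) auto
        finally show "c * (2 * \<eta>) powr p * W \<le> e / 2" by simp
      qed
      finally show "ennreal (c * (2 * \<eta>) powr p) * ennreal W \<le> ennreal (e / 2)" .
    qed
    also have "\<dots> = ennreal e" using e by (simp add: ennreal_plus[symmetric] del: ennreal_plus)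
    finally show ?thesis using e by simp
  qed
  then show ?thesis using k(1) by blast
qed

text \<open>Diagonal extraction over the accuracies 1/(j+1). The Cauchy condition survives passing
  to subsequences because a strictly increasing index map satisfies i <= r i. The limit itself is
  supplied later by completeness.\<close>

lemma rellich:
  fixes f :: "nat \<Rightarrow> 'a::euclidean_space \<Rightarrow> real"
  assumes p: "1 < p"
    and f: "\<And>n. C1c (f n)" "\<And>n x. R < norm x \<Longrightarrow> f n x = 0"
    and B: "\<And>n. (\<integral>x. \<bar>f n x\<bar> powr p \<partial>lborel) + (\<integral>x. norm (grad (f n) x) powr p \<partial>lborel) \<le> B"
  obtains k :: "nat \<Rightarrow> nat" where "strict_mono k"
    "\<And>e. 0 < e \<Longrightarrow> \<exists>N. \<forall>m\<ge>N. \<forall>n\<ge>N. (\<integral>x. \<bar>f (k m) x - f (k n) x\<bar> powr p \<partial>lborel) \<le> e"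
proof -
  define P where "P j s \<longleftrightarrow> (\<exists>N. \<forall>m\<ge>N. \<forall>n\<ge>N. (\<integral>x. \<bar>f (s m) x - f (s n) x\<bar> powr p \<partial>lborel) \<le> inverse (real (Suc j)))"
    for j and s :: "nat \<Rightarrow> nat"
  interpret subseqs P
  proof
    fix n and s :: "nat \<Rightarrow> nat"
    show "\<exists>r'. strict_mono r' \<and> P n (s \<circ> r')"
      using rellich_step[OF p, of "inverse (real (Suc n))" "\<lambda>n. f (s n)" R B] f B by (auto simp: P_def)
  qed
  have stable: "P n (s \<circ> r)" if "strict_mono r" "P n s" for r s n
  proof -
    from that(2) obtain N where N: "\<And>i j. N \<le> i \<Longrightarrow> N \<le> j \<Longrightarrow> (\<integral>x. \<bar>f (s i) x - f (s j) x\<bar> powr p \<partial>lborel) \<le> inverse (real (Suc n))"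
      unfolding P_def by blast
    have "N \<le> r i" if "N \<le> i" for i using seq_suble[OF \<open>strict_mono r\<close>, of i] that by simp
    then show ?thesis unfolding P_def comp_def using N by blast
  qed
  show thesis
  proof (rule that[OF subseq_diagseq])
    fix e :: real assume "0 < e"
    then obtain j where j: "inverse (real (Suc j)) < e" using reals_Archimedean by blast
    have "P j (diagseq \<circ> ((+) (Suc j)))" by (rule diagseq_holds[OF stable])
    then obtain N where N: "\<And>m n. N \<le> m \<Longrightarrow> N \<le> n \<Longrightarrow>
       (\<integral>x. \<bar>f (diagseq (Suc j + m)) x - f (diagseq (Suc j + n)) x\<bar> powr p \<partial>lborel) \<le> inverse (real (Suc j))"
      unfolding P_def comp_def by blast
    show "\<exists>N. \<forall>m\<ge>N. \<forall>n\<ge>N. (\<integral>x. \<bar>f (diagseq m) x - f (diagseq n) x\<bar> powr p \<partial>lborel) \<le> e"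
    proof (intro exI[of _ "Suc j + N"] allI impI)
      fix m n assume mn: "Suc j + N \<le> m" "Suc j + N \<le> n"
      show "(\<integral>x. \<bar>f (diagseq m) x - f (diagseq n) x\<bar> powr p \<partial>lborel) \<le> e"
      proof -
        have "(\<integral>x. \<bar>f (diagseq m) x - f (diagseq n) x\<bar> powr p \<partial>lborel) \<le> inverse (real (Suc j))"
          using N[of "m - Suc j" "n - Suc j"] mn by (simp del: of_nat_Suc)
        then show ?thesis using j by linarith
      qed
    qed
  qed
qed

section \<open>Lebesgue spaces\<close>

lemma LpD:
  assumes "f \<in> Lp r M"
  shows "f \<in> borel_measurable M" "integrable M (\<lambda>x. norm (f x) powr r)"
  using assms by (auto simp: Lp_def)

lemma Lp_bound:
  fixes f :: "'a \<Rightarrow> 'b::euclidean_space"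
  assumes "f \<in> borel_measurable M" "integrable M g" "\<And>x. norm (f x) powr r \<le> g x"
  shows "f \<in> Lp r M"
proof -
  note [measurable] = assms(1)
  have "integrable M (\<lambda>x. norm (f x) powr r)"
    by (rule Bochner_Integration.integrable_bound[OF assms(2)])
      (use assms(3) in \<open>auto intro!: AE_I2 intro: order_trans[OF _ abs_ge_self]\<close>)
  then show ?thesis by (simp add: Lp_def)
qed

lemma Lp_add:
  fixes f g :: "'a \<Rightarrow> 'b::euclidean_space"
  assumes "0 < r" "f \<in> Lp r M" "g \<in> Lp r M"
  shows "(\<lambda>x. f x + g x) \<in> Lp r M"
proof (rule Lp_bound)
  show "norm (f x + g x) powr r \<le> 2 powr r * (norm (f x) powr r + norm (g x) powr r)" for x
    by (rule norm_add_powr_le[OF assms(1)])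
qed (use LpD[OF assms(2)] LpD[OF assms(3)] in auto)

lemma Lp_scaleR:
  fixes f :: "'a \<Rightarrow> 'b::euclidean_space"
  assumes "f \<in> Lp r M"
  shows "(\<lambda>x. c *\<^sub>R f x) \<in> Lp r M"
  using LpD[OF assms] by (auto simp: Lp_def powr_mult)

lemma Lp_cmult: "f \<in> Lp r M \<Longrightarrow> (\<lambda>x. c * f x :: real) \<in> Lp r M"
  using Lp_scaleR[of f r M c] by simp

lemma Lp_diff:
  fixes f g :: "'a \<Rightarrow> 'b::euclidean_space"
  assumes "0 < r" "f \<in> Lp r M" "g \<in> Lp r M"
  shows "(\<lambda>x. f x - g x) \<in> Lp r M"
  using Lp_add[OF assms(1,2) Lp_scaleR[OF assms(3), of "-1"]] by simp

lemma Lp_cong_AE: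
  fixes f g :: "'a \<Rightarrow> 'b::euclidean_space"
  assumes "f \<in> Lp r M" "g \<in> borel_measurable M" "AE x in M. f x = g x"
  shows "g \<in> Lp r M"
proof -
  note [measurable] = assms(2) LpD(1)[OF assms(1)]
  have "integrable M (\<lambda>x. norm (g x) powr r)"
    by (rule integrable_cong_AE_imp[OF LpD(2)[OF assms(1)]]) (use assms(3) in auto)
  then show ?thesis by (simp add: Lp_def)
qed

lemma Lp_mono:
  fixes f :: "'a \<Rightarrow> 'b::euclidean_space"
  assumes "finite_measure M" "0 < r" "r \<le> s" "f \<in> Lp s M"
  shows "f \<in> Lp r M"
proof (rule Lp_bound)
  interpret finite_measure M by fact
  show "norm (f x) powr r \<le> 1 + norm (f x) powr s" for x
    using powr_le_threshold[of "norm (f x)" 1 r s] assms by simp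
  show "integrable M (\<lambda>x. 1 + norm (f x) powr s)" using LpD[OF assms(4)] by simp
qed (use LpD[OF assms(4)] in auto)

lemma Lp_integrable:
  fixes f :: "'a \<Rightarrow> 'b::euclidean_space"
  assumes "finite_measure M" "1 \<le> s" "f \<in> Lp s M"
  shows "integrable M f"
proof -
  have "f \<in> Lp 1 M" using assms by (intro Lp_mono[of M 1 s]) auto
  then show ?thesis using integrable_norm_cancel by (auto simp: Lp_def)
qed

text \<open>A substitute for Hoelder's inequality on a finite measure space: the threshold makes the
  constant part at most e/2, independently of the index.\<close>

lemma Lp_tendsto_mono:
  fixes f :: "'i \<Rightarrow> 'a \<Rightarrow> 'b::euclidean_space"
  assumes M: "finite_measure M" and r: "0 < r" "r \<le> s" and f: "\<forall>\<^sub>F i in F. f i \<in> Lp s M"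
    and lim: "((\<lambda>i. \<integral>x. norm (f i x) powr s \<partial>M) \<longlongrightarrow> 0) F"
  shows "((\<lambda>i. \<integral>x. norm (f i x) powr r \<partial>M) \<longlongrightarrow> 0) F"
proof (rule tendstoI)
  fix e :: real assume e: "0 < e"
  interpret finite_measure M by fact
  define \<mu> where "\<mu> = measure M (space M)"
  have \<mu>: "0 \<le> \<mu>" by (simp add: \<mu>_def)
  define T where "T = (e / (2 * (\<mu> + 1))) powr (1 / r)"
  have T: "0 < T" "T powr r = e / (2 * (\<mu> + 1))" using e \<mu> r by (auto simp: T_def powr_powr)
  have "((\<lambda>i. T powr r * \<mu> + T powr (r - s) * (\<integral>x. norm (f i x) powr s \<partial>M)) \<longlongrightarrow> T powr r * \<mu> + T powr (r - s) * 0) F"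
    by (intro tendsto_intros lim)
  moreover have "T powr r * \<mu> + T powr (r - s) * 0 < e"
  proof -
    have "T powr r * \<mu> = e / 2 * (\<mu> / (\<mu> + 1))" unfolding T by simp
    also have "\<dots> \<le> e / 2 * 1" using e \<mu> by (intro mult_left_mono) auto
    finally show ?thesis using e by simp
  qed
  ultimately have "\<forall>\<^sub>F i in F. T powr r * \<mu> + T powr (r - s) * (\<integral>x. norm (f i x) powr s \<partial>M) < e"
    by (rule order_tendstoD)
  with f show "\<forall>\<^sub>F i in F. dist (\<integral>x. norm (f i x) powr r \<partial>M) 0 < e"
  proof eventually_elim
    case (elim i)
    have "(\<integral>x. norm (f i x) powr r \<partial>M) \<le> (\<integral>x. T powr r + T powr (r - s) * norm (f i x) powr s \<partial>M)"
    proof (rule integral_mono)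
      show "integrable M (\<lambda>x. norm (f i x) powr r)"
        using Lp_mono[OF M r elim(1)] by (rule LpD)
      show "integrable M (\<lambda>x. T powr r + T powr (r - s) * norm (f i x) powr s)"
        using LpD(2)[OF elim(1)] by simp
      show "norm (f i x) powr r \<le> T powr r + T powr (r - s) * norm (f i x) powr s" for x
        using T r by (intro powr_le_threshold) auto
    qed
    also have "\<dots> = T powr r * \<mu> + T powr (r - s) * (\<integral>x. norm (f i x) powr s \<partial>M)"
      using LpD(2)[OF elim(1)] by (simp add: \<mu>_def)
    finally show ?case using elim by (simp add: dist_real_def)
  qed
qed

section \<open>Bounded weights and continuity of weighted power integrals\<close>

lemma LinftyE:
  assumes "a \<in> Linfty M"
  obtains A where "0 < A" "a \<in> borel_measurable M" "AE x in M. \<bar>a x\<bar> \<le> A"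
proof -
  from assms obtain C where C: "a \<in> borel_measurable M" "AE x in M. \<bar>a x\<bar> \<le> C"
    by (auto simp: Linfty_def)
  then have "AE x in M. \<bar>a x\<bar> \<le> max C 1" by auto
  then show ?thesis using C that[of "max C 1"] by simp
qed

lemma Linfty_1: "(\<lambda>x. 1) \<in> Linfty M"
  by (auto simp: Linfty_def)

lemma Linfty_mult_integrable:
  assumes "a \<in> Linfty M" "integrable M f"
  shows "integrable M (\<lambda>x. a x * f x :: real)"
proof -
  from assms(1) obtain A where A: "0 < A" "a \<in> borel_measurable M" "AE x in M. \<bar>a x\<bar> \<le> A" by (rule LinftyE)
  note [measurable] = A(2) borel_measurable_integrable[OF assms(2)]
  show ?thesis
  proof (rule Bochner_Integration.integrable_bound)
    show "integrable M (\<lambda>x. A * f x)" using assms by simp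
    show "AE x in M. norm (a x * f x) \<le> norm (A * f x)"
      using A(3) by eventually_elim (use A(1) in \<open>auto simp: abs_mult intro!: mult_right_mono\<close>)
  qed measurable
qed

lemma Linfty_weighted_integrable:
  fixes f :: "'a \<Rightarrow> 'b::euclidean_space"
  shows "a \<in> Linfty M \<Longrightarrow> f \<in> Lp r M \<Longrightarrow> integrable M (\<lambda>x. a x * norm (f x) powr r)"
  by (intro Linfty_mult_integrable LpD)

text \<open>Integrating \<open>norm_powr_continuity\<close> leaves \<delta> times a fixed integral
  plus a multiple of the error, so \<delta> is fixed first. The filter is arbitrary so that pairs of
  indices are covered as well as sequences.\<close>

lemma weighted_powr_tendsto:
  fixes f :: "'i \<Rightarrow> 'a \<Rightarrow> 'b::euclidean_space"
  assumes r: "0 < r" and a: "a \<in> Linfty M" and g: "g \<in> Lp r M"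
    and f: "\<forall>\<^sub>F i in F. f i \<in> Lp r M"
    and lim: "((\<lambda>i. \<integral>x. norm (g x - f i x) powr r \<partial>M) \<longlongrightarrow> 0) F"
  shows "((\<lambda>i. \<integral>x. a x * norm (f i x) powr r \<partial>M) \<longlongrightarrow> (\<integral>x. a x * norm (g x) powr r \<partial>M)) F"
proof (rule tendstoI)
  fix e :: real assume e: "0 < e"
  from a obtain A where A: "0 < A" "a \<in> borel_measurable M" "AE x in M. \<bar>a x\<bar> \<le> A" by (rule LinftyE)
  define I where "I = (\<integral>x. norm (g x) powr r \<partial>M)"
  have I: "0 \<le> I" by (simp add: I_def)
  define \<delta> where "\<delta> = e / (2 * A * (I + 1))"
  have \<delta>: "0 < \<delta>" "A * \<delta> * I < e"
  proof -
    show "0 < \<delta>" using e A I by (simp add: \<delta>_def)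
    have "A * \<delta> * I = e / 2 * (I / (I + 1))" unfolding \<delta>_def using A by simp
    also have "\<dots> \<le> e / 2 * 1" using e I by (intro mult_left_mono) auto
    finally show "A * \<delta> * I < e" using e by simp
  qed
  from norm_powr_continuity[OF r \<delta>(1), where ?'b='b] obtain C where C: "0 \<le> C"
    "\<And>x y::'b. \<bar>norm (x + y) powr r - norm x powr r\<bar> \<le> \<delta> * norm x powr r + C * norm y powr r" by blast
  have "((\<lambda>i. A * (\<delta> * I + C * (\<integral>x. norm (g x - f i x) powr r \<partial>M))) \<longlongrightarrow> A * (\<delta> * I + C * 0)) F"
    by (intro tendsto_intros lim)
  then have "\<forall>\<^sub>F i in F. A * (\<delta> * I + C * (\<integral>x. norm (g x - f i x) powr r \<partial>M)) < e"
    by (rule order_tendstoD) (use \<delta> in \<open>simp add: mult.assoc\<close>)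
  with f show "\<forall>\<^sub>F i in F. dist (\<integral>x. a x * norm (f i x) powr r \<partial>M) (\<integral>x. a x * norm (g x) powr r \<partial>M) < e"
  proof eventually_elim
    case (elim i)
    note d = Lp_diff[OF r g elim(1)]
    note i1 = LpD(2)[OF elim(1)] and i2 = LpD(2)[OF g] and i3 = LpD(2)[OF d]
    have "\<bar>(\<integral>x. a x * norm (f i x) powr r \<partial>M) - (\<integral>x. a x * norm (g x) powr r \<partial>M)\<bar>
       = \<bar>\<integral>x. a x * (norm (f i x) powr r - norm (g x) powr r) \<partial>M\<bar>"
      using Linfty_mult_integrable[OF a i1] Linfty_mult_integrable[OF a i2] by (simp add: algebra_simps)
    also have "\<dots> \<le> (\<integral>x. \<bar>a x * (norm (f i x) powr r - norm (g x) powr r)\<bar> \<partial>M)" by (rule integral_abs_bound)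
    also have "\<dots> \<le> (\<integral>x. A * (\<delta> * norm (g x) powr r + C * norm (g x - f i x) powr r) \<partial>M)"
    proof (rule integral_mono_AE)
      show "integrable M (\<lambda>x. \<bar>a x * (norm (f i x) powr r - norm (g x) powr r)\<bar>)"
        using i1 i2 by (intro integrable_abs Linfty_mult_integrable[OF a]) auto
      show "integrable M (\<lambda>x. A * (\<delta> * norm (g x) powr r + C * norm (g x - f i x) powr r))"
        using i2 i3 by auto
      show "AE x in M. \<bar>a x * (norm (f i x) powr r - norm (g x) powr r)\<bar> \<le> A * (\<delta> * norm (g x) powr r + C * norm (g x - f i x) powr r)"
        using A(3)
      proof eventually_elim
        case (elim x)
        have "\<bar>norm (f i x) powr r - norm (g x) powr r\<bar> \<le> \<delta> * norm (g x) powr r + C * norm (g x - f i x) powr r"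
          using C(2)[of "g x" "f i x - g x"] by (simp add: norm_minus_commute)
        with elim show ?case unfolding abs_mult using A by (intro mult_mono) auto
      qed
    qed
    also have "\<dots> = A * (\<delta> * I + C * (\<integral>x. norm (g x - f i x) powr r \<partial>M))"
      using i2 i3 by (simp add: I_def)
    finally show ?case using elim by (simp add: dist_real_def)
  qed
qed

lemma powr_tendsto:
  fixes f :: "'i \<Rightarrow> 'a \<Rightarrow> 'b::euclidean_space"
  assumes "0 < r" "g \<in> Lp r M" "\<forall>\<^sub>F i in F. f i \<in> Lp r M"
    "((\<lambda>i. \<integral>x. norm (g x - f i x) powr r \<partial>M) \<longlongrightarrow> 0) F"
  shows "((\<lambda>i. \<integral>x. norm (f i x) powr r \<partial>M) \<longlongrightarrow> (\<integral>x. norm (g x) powr r \<partial>M)) F"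
  using weighted_powr_tendsto[OF assms(1) Linfty_1 assms(2-4)] by simp

lemma powr_add_tendsto_0:
  fixes f :: "'i \<Rightarrow> 'a \<Rightarrow> 'b::euclidean_space"
  assumes r: "0 < r" and Lp: "\<forall>\<^sub>F i in F. f i \<in> Lp r M" "\<forall>\<^sub>F i in F. g i \<in> Lp r M"
    and lim: "((\<lambda>i. \<integral>x. norm (f i x) powr r \<partial>M) \<longlongrightarrow> 0) F" "((\<lambda>i. \<integral>x. norm (g i x) powr r \<partial>M) \<longlongrightarrow> 0) F"
  shows "((\<lambda>i. \<integral>x. norm (f i x + g i x) powr r \<partial>M) \<longlongrightarrow> 0) F"
proof (rule tendsto_sandwich[OF _ _ tendsto_const])
  show "((\<lambda>i. 2 powr r * ((\<integral>x. norm (f i x) powr r \<partial>M) + (\<integral>x. norm (g i x) powr r \<partial>M))) \<longlongrightarrow> 0) F"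
    using tendsto_mult_left[OF tendsto_add[OF lim], of "2 powr r"] by simp
  show "\<forall>\<^sub>F i in F. (\<integral>x. norm (f i x + g i x) powr r \<partial>M) \<le> 2 powr r * ((\<integral>x. norm (f i x) powr r \<partial>M) + (\<integral>x. norm (g i x) powr r \<partial>M))"
    using Lp
  proof eventually_elim
    case (elim i)
    have "(\<integral>x. norm (f i x + g i x) powr r \<partial>M) \<le> (\<integral>x. 2 powr r * (norm (f i x) powr r + norm (g i x) powr r) \<partial>M)"
      using LpD(2)[OF elim(1)] LpD(2)[OF elim(2)] LpD(2)[OF Lp_add[OF r elim]]
      by (intro integral_mono norm_add_powr_le r) auto
    also have "\<dots> = 2 powr r * ((\<integral>x. norm (f i x) powr r \<partial>M) + (\<integral>x. norm (g i x) powr r \<partial>M))"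
      using LpD(2)[OF elim(1)] LpD(2)[OF elim(2)] by simp
    finally show ?case .
  qed
qed simp

lemma integral_powr_eq_0_AE:
  fixes f :: "'a \<Rightarrow> 'b::euclidean_space"
  assumes "f \<in> Lp r M" "(\<integral>x. norm (f x) powr r \<partial>M) = 0"
  shows "AE x in M. f x = 0"
proof -
  have "AE x in M. norm (f x) powr r = 0"
    using integral_nonneg_eq_0_iff_AE[OF LpD(2)[OF assms(1)]] assms(2) by simp
  then show ?thesis by simp
qed

lemma nn_integral_powr_finite_Lp:
  fixes f :: "'a \<Rightarrow> 'b::euclidean_space"
  assumes [measurable]: "f \<in> borel_measurable M" and "(\<integral>\<^sup>+x. ennreal (norm (f x) powr r) \<partial>M) \<le> ennreal e" "0 \<le> e"
  shows "f \<in> Lp r M" "(\<integral>x. norm (f x) powr r \<partial>M) \<le> e"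
proof -
  have i: "integrable M (\<lambda>x. norm (f x) powr r)"
    using assms(2) by (intro integrableI_bounded) (auto simp: le_less_trans[OF _ ennreal_less_top])
  then show "f \<in> Lp r M" by (simp add: Lp_def)
  have "ennreal (\<integral>x. norm (f x) powr r \<partial>M) = (\<integral>\<^sup>+x. ennreal (norm (f x) powr r) \<partial>M)"
    using i by (intro nn_integral_eq_integral[symmetric]) auto
  then show "(\<integral>x. norm (f x) powr r \<partial>M) \<le> e" using assms by (metis ennreal_le_iff)
qed

text \<open>The Riesz-Fischer argument for integrals of r-th powers instead of norms, which covers
  every r > 0.\<close>

lemma Lp_complete:
  fixes f :: "nat \<Rightarrow> 'a \<Rightarrow> 'b::euclidean_space"
  assumes r: "0 < r" and f: "\<And>n. f n \<in> Lp r M"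
    and cauchy: "\<And>e. 0 < e \<Longrightarrow> \<exists>N. \<forall>m\<ge>N. \<forall>n\<ge>N. (\<integral>x. norm (f m x - f n x) powr r \<partial>M) \<le> e"
  obtains g where "g \<in> Lp r M" "(\<lambda>n. \<integral>x. norm (g x - f n x) powr r \<partial>M) \<longlonglongrightarrow> 0"
proof -
  note [measurable] = LpD(1)[OF f]
  have nn: "(\<integral>\<^sup>+x. ennreal (norm (f m x - f n x) powr r) \<partial>M) = ennreal (\<integral>x. norm (f m x - f n x) powr r \<partial>M)" for m n
    by (intro nn_integral_eq_integral LpD(2)[OF Lp_diff] r f) auto
  \<comment> \<open>With increments of size 2^(-j) 2^(-j r), the series with weights 2^(j r) has
    finite integral. Hence almost everywhere the j-th increment is at most a constant times 2^(-j),
    and the series of increments converges absolutely.\<close>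
  define c where "c j = (1 / 2) ^ j * ((1 / 2) ^ j) powr r" for j :: nat
  have c: "0 < c j" for j by (simp add: c_def)
  define N where "N j = (SOME N. \<forall>m\<ge>N. \<forall>n\<ge>N. (\<integral>x. norm (f m x - f n x) powr r \<partial>M) \<le> c j)" for j
  have N: "(\<integral>x. norm (f m x - f n x) powr r \<partial>M) \<le> c j" if "N j \<le> m" "N j \<le> n" for m n j
    using someI_ex[OF cauchy[OF c[of j]]] that unfolding N_def by blast
  \<comment> \<open>The index \<open>k j\<close> is at least every \<open>N i\<close> with i <= j,
    so \<open>k j\<close> and \<open>k (Suc j)\<close> both lie beyond \<open>N j\<close>; it is
    also at least j, hence tends to infinity.\<close>
  define k where "k j = j + Max (N ` {..j})" for j
  have k: "N j \<le> k i" if "j \<le> i" for i j using that by (auto simp: k_def intro!: trans_le_add2 Max_ge)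
  have kj: "j \<le> k j" for j by (simp add: k_def)
  define d where "d j x = norm (f (k (Suc j)) x - f (k j) x)" for j x
  have [measurable]: "d j \<in> borel_measurable M" for j unfolding d_def by measurable
  have "(\<integral>\<^sup>+x. (\<Sum>j. ennreal ((2 ^ j) powr r * d j x powr r)) \<partial>M) = (\<Sum>j. \<integral>\<^sup>+x. ennreal ((2 ^ j) powr r * d j x powr r) \<partial>M)"
    by (rule nn_integral_suminf) measurable
  also have "\<dots> \<le> (\<Sum>j. ennreal ((1 / 2) ^ j))"
  proof (rule suminf_le)
    fix j
    have "(\<integral>\<^sup>+x. ennreal ((2 ^ j) powr r * d j x powr r) \<partial>M) = ennreal ((2 ^ j) powr r) * (\<integral>\<^sup>+x. ennreal (d j x powr r) \<partial>M)"
      by (simp add: ennreal_mult nn_integral_cmult)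
    also have "(\<integral>\<^sup>+x. ennreal (d j x powr r) \<partial>M) \<le> ennreal (c j)"
      unfolding d_def nn by (intro ennreal_leI N k) auto
    also have "ennreal ((2 ^ j) powr r) * ennreal (c j) = ennreal ((2 ^ j) powr r * c j)" using c[of j] by (simp add: ennreal_mult)
    also have "(2 ^ j) powr r * c j = (1 / 2) ^ j * (2 ^ j * (1 / 2) ^ j) powr r" by (simp only: c_def powr_mult mult_ac)
    also have "\<dots> = (1 / 2) ^ j" by (simp flip: power_mult_distrib)
    finally show "(\<integral>\<^sup>+x. ennreal ((2 ^ j) powr r * d j x powr r) \<partial>M) \<le> ennreal ((1 / 2) ^ j)"
      by (simp add: mult_left_mono)
  qed auto
  also have "\<dots> = ennreal (\<Sum>j. (1 / 2) ^ j)" by (intro suminf_ennreal2) (auto intro: summable_geometric)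
  also have "\<dots> < \<infinity>" by simp
  finally have "AE x in M. (\<Sum>j. ennreal ((2 ^ j) powr r * d j x powr r)) \<noteq> \<infinity>"
    by (intro nn_integral_noteq_infinite) auto
  then have conv: "AE x in M. convergent (\<lambda>j. f (k j) x)"
  proof eventually_elim
    case (elim x)
    then have "(\<Sum>j. ennreal ((2 ^ j) powr r * d j x powr r)) < top" by (simp only: less_top infinity_ennreal_def)
    then obtain S where S: "0 \<le> S" "(\<Sum>j. ennreal ((2 ^ j) powr r * d j x powr r)) = ennreal S"
      unfolding less_top_ennreal by blast
    have "d j x \<le> S powr (1 / r) * (1 / 2) ^ j" for j
    proof -
      have "ennreal ((2 ^ j) powr r * d j x powr r) = (\<Sum>j\<in>{j}. ennreal ((2 ^ j) powr r * d j x powr r))" by simp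
      also have "\<dots> \<le> ennreal S" unfolding S(2)[symmetric] by (rule sum_le_suminf) auto
      finally have "(2 ^ j * d j x) powr r \<le> S" using S(1) by (simp add: powr_mult)
      then have "((2 ^ j * d j x) powr r) powr (1 / r) \<le> S powr (1 / r)" using r by (intro powr_mono2) auto
      then have "2 ^ j * d j x \<le> S powr (1 / r)" using r by (simp add: powr_powr d_def)
      then show ?thesis by (simp add: field_simps power_one_over)
    qed
    moreover have "summable (\<lambda>j. S powr (1 / r) * (1 / 2) ^ j)"
      by (intro summable_mult summable_geometric) simp
    ultimately have "summable (\<lambda>j. f (k (Suc j)) x - f (k j) x)"
      using summable_comparison_test'[of "\<lambda>j. S powr (1 / r) * (1 / 2) ^ j" 0 "\<lambda>j. f (k (Suc j)) x - f (k j) x"]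
      unfolding d_def by blast
    then have "convergent (\<lambda>n. \<Sum>j<n. f (k (Suc j)) x - f (k j) x)" by (simp only: summable_iff_convergent)
    then have "convergent (\<lambda>n. f (k n) x - f (k 0) x)" using sum_lessThan_telescope[of "\<lambda>j. f (k j) x"] by simp
    then show ?case by (simp add: convergent_diff_const_right_iff)
  qed
  define g where "g x = lim (\<lambda>j. f (k j) x)" for x
  have [measurable]: "g \<in> borel_measurable M" unfolding g_def by measurable
  have lim: "AE x in M. (\<lambda>j. f (k j) x) \<longlonglongrightarrow> g x"
    using conv by eventually_elim (simp add: g_def convergent_LIMSEQ_iff)
  \<comment> \<open>Fatou's lemma carries the Cauchy estimate along the subsequence over to its
    pointwise limit.\<close>
  have fatou: "(\<integral>\<^sup>+x. ennreal (norm (g x - f n x) powr r) \<partial>M) \<le> ennreal e"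
    if ev: "\<forall>\<^sub>F j in sequentially. (\<integral>x. norm (f (k j) x - f n x) powr r \<partial>M) \<le> e" for n e
  proof -
    have "(\<integral>\<^sup>+x. ennreal (norm (g x - f n x) powr r) \<partial>M) = (\<integral>\<^sup>+x. liminf (\<lambda>j. ennreal (norm (f (k j) x - f n x) powr r)) \<partial>M)"
    proof (rule nn_integral_cong_AE)
      show "AE x in M. ennreal (norm (g x - f n x) powr r) = liminf (\<lambda>j. ennreal (norm (f (k j) x - f n x) powr r))"
        using lim
      proof eventually_elim
        case (elim x)
        have "(\<lambda>j. ennreal (norm (f (k j) x - f n x) powr r)) \<longlonglongrightarrow> ennreal (norm (g x - f n x) powr r)"
          using r by (intro tendsto_ennrealI tendsto_powr' tendsto_norm tendsto_diff elim tendsto_const) auto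
        then show ?case by (intro lim_imp_Liminf[symmetric]) auto
      qed
    qed
    also have "\<dots> \<le> liminf (\<lambda>j. \<integral>\<^sup>+x. ennreal (norm (f (k j) x - f n x) powr r) \<partial>M)"
      by (rule nn_integral_liminf) measurable
    also have "\<dots> \<le> ennreal e"
    proof (rule Liminf_le)
      show "\<forall>\<^sub>F j in sequentially. (\<integral>\<^sup>+x. ennreal (norm (f (k j) x - f n x) powr r) \<partial>M) \<le> ennreal e"
        using ev by eventually_elim (simp add: nn ennreal_leI)
    qed simp
    finally show ?thesis .
  qed
  have small: "\<exists>n0. \<forall>n\<ge>n0. (\<lambda>x. g x - f n x) \<in> Lp r M \<and> (\<integral>x. norm (g x - f n x) powr r \<partial>M) \<le> e" if e: "0 < e" for e
  proof -
    from cauchy[OF e] obtain n0 where n0: "\<And>m n. n0 \<le> m \<Longrightarrow> n0 \<le> n \<Longrightarrow> (\<integral>x. norm (f m x - f n x) powr r \<partial>M) \<le> e" by blast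
    show ?thesis
    proof (intro exI[of _ n0] allI impI)
      fix n assume n: "n0 \<le> n"
      have "\<forall>\<^sub>F j in sequentially. (\<integral>x. norm (f (k j) x - f n x) powr r \<partial>M) \<le> e"
        using eventually_ge_at_top[of n0] by eventually_elim (use n0 n kj le_trans in blast)
      from nn_integral_powr_finite_Lp[OF _ fatou[OF this]] e
      show "(\<lambda>x. g x - f n x) \<in> Lp r M \<and> (\<integral>x. norm (g x - f n x) powr r \<partial>M) \<le> e" by simp
    qed
  qed
  show thesis
  proof (rule that)
    from small[of 1] obtain n where "(\<lambda>x. g x - f n x) \<in> Lp r M" by auto
    from Lp_add[OF r this f[of n]] show "g \<in> Lp r M" by simp
    show "(\<lambda>n. \<integral>x. norm (g x - f n x) powr r \<partial>M) \<longlonglongrightarrow> 0"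
    proof (rule LIMSEQ_I)
      fix e :: real assume e: "0 < e"
      then obtain n0 where n0: "\<And>n. n0 \<le> n \<Longrightarrow> (\<integral>x. norm (g x - f n x) powr r \<partial>M) \<le> e / 2"
        using small[of "e / 2"] by auto
      have "norm ((\<integral>x. norm (g x - f n x) powr r \<partial>M) - 0) < e" if "n0 \<le> n" for n
        using n0[OF that] e by simp
      then show "\<exists>no. \<forall>n\<ge>no. norm ((\<integral>x. norm (g x - f n x) powr r \<partial>M) - 0) < e" by blast
    qed
  qed
qed

lemma Lp_limit_unique:
  fixes f :: "nat \<Rightarrow> 'a \<Rightarrow> 'b::euclidean_space"
  assumes r: "0 < r" and f: "\<And>n. f n \<in> Lp r M" and gh: "g \<in> Lp r M" "h \<in> Lp r M"
    and lim: "(\<lambda>n. \<integral>x. norm (g x - f n x) powr r \<partial>M) \<longlonglongrightarrow> 0" "(\<lambda>n. \<integral>x. norm (h x - f n x) powr r \<partial>M) \<longlonglongrightarrow> 0"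
  shows "AE x in M. g x = h x"
proof -
  have "(\<lambda>n. \<integral>x. norm ((g x - f n x) + (f n x - h x)) powr r \<partial>M) \<longlonglongrightarrow> 0"
    by (rule powr_add_tendsto_0[OF r]) (use lim r f gh in \<open>auto intro!: always_eventually Lp_diff simp: norm_minus_commute\<close>)
  then have "(\<integral>x. norm (g x - h x) powr r \<partial>M) = 0" by (simp add: LIMSEQ_const_iff)
  then have "AE x in M. g x - h x = 0" by (intro integral_powr_eq_0_AE[of _ r] Lp_diff r gh)
  then show ?thesis by simp
qed

section \<open>Approximation by test functions and weak gradients\<close>

lemma bounded_open_finite_measure:
  fixes \<Omega> :: "'a::euclidean_space set"
  assumes "open \<Omega>" "bounded \<Omega>"
  shows "finite_measure (lebesgue_on \<Omega>)"
  using assms by (intro finite_measure_lebesgue_on lmeasurable_open) auto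

text \<open>Zero extension turns integrals over the domain into integrals over the whole space,
  where translations act.\<close>

lemma lebesgue_on_eq_lborel:
  fixes f :: "'a::euclidean_space \<Rightarrow> 'b::euclidean_space"
  assumes "open \<Omega>" "f \<in> borel_measurable borel" "\<And>x. x \<notin> \<Omega> \<Longrightarrow> f x = 0"
  shows "integrable (lebesgue_on \<Omega>) f \<longleftrightarrow> integrable lborel f"
    and "(\<integral>x. f x \<partial>lebesgue_on \<Omega>) = (\<integral>x. f x \<partial>lborel)"
proof -
  have eq: "(\<lambda>x. indicator \<Omega> x *\<^sub>R f x) = f" using assms(3) by (auto simp: indicator_def)
  have \<Omega>: "\<Omega> \<inter> space lebesgue \<in> sets lebesgue" using assms(1) by simp
  show "integrable (lebesgue_on \<Omega>) f \<longleftrightarrow> integrable lborel f"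
    using integrable_restrict_space[OF \<Omega>, of f] integrable_completion[of f lborel] assms(2) by (simp add: eq)
  show "(\<integral>x. f x \<partial>lebesgue_on \<Omega>) = (\<integral>x. f x \<partial>lborel)"
    using integral_restrict_space[OF \<Omega>, of f] integral_completion[of f lborel] assms(2) by (simp add: eq)
qed

lemma borel_measurable_lebesgue_onI:
  "f \<in> borel_measurable borel \<Longrightarrow> f \<in> borel_measurable (lebesgue_on \<Omega>)"
  by (intro measurable_restrict_space1 measurable_completion) simp

text \<open>A measurable function is an almost everywhere limit of continuous functions. Clamping
  keeps these bounded, and Stone-Weierstrass on the compact closure replaces them by polynomials
  within 1/(n+1). The uniform bound prepares dominated convergence.\<close>

lemma polynomial_approximation:
  fixes g :: "'a::euclidean_space \<Rightarrow> real"
  assumes \<Omega>: "open \<Omega>" "bounded \<Omega>" and g: "g \<in> borel_measurable (lebesgue_on \<Omega>)"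
    and B: "\<And>x. x \<in> \<Omega> \<Longrightarrow> \<bar>g x\<bar> \<le> B"
  obtains P where "\<And>n k. C_k k (P n)" "\<And>n. P n \<in> borel_measurable borel" "\<And>n x. x \<in> \<Omega> \<Longrightarrow> \<bar>P n x\<bar> \<le> \<bar>B\<bar> + 1"
    "AE x in lebesgue_on \<Omega>. (\<lambda>n. P n x) \<longlonglongrightarrow> g x"
proof -
  have "g measurable_on \<Omega>"
    using g \<Omega>(1) by (simp add: measurable_on_iff_borel_measurable)
  then obtain N h where N: "negligible N" and h: "\<And>n. continuous_on UNIV (h n)"
    "\<And>x. x \<notin> N \<Longrightarrow> (\<lambda>n. h n x) \<longlonglongrightarrow> (if x \<in> \<Omega> then g x else 0)"
    unfolding measurable_on_def by blast
  define c where "c n x = max (- \<bar>B\<bar>) (min \<bar>B\<bar> (h n x))" for n :: nat and x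
  have "\<exists>P. real_polynomial_function P \<and> (\<forall>x\<in>closure \<Omega>. \<bar>c n x - P x\<bar> < inverse (real (Suc n)))" for n
  proof -
    have "continuous_on (closure \<Omega>) (c n)"
      unfolding c_def using continuous_on_subset[OF h(1)] by (intro continuous_intros) auto
    moreover have "compact (closure \<Omega>)" using \<Omega> by (simp add: compact_closure)
    ultimately show ?thesis
      by (metis Stone_Weierstrass_real_polynomial_function inverse_positive_iff_positive of_nat_0_less_iff zero_less_Suc)
  qed
  then obtain P where P: "\<And>n. real_polynomial_function (P n)"
    "\<And>n x. x \<in> closure \<Omega> \<Longrightarrow> \<bar>c n x - P n x\<bar> < inverse (real (Suc n))" by metis
  show thesis
  proof (rule that)
    show "C_k k (P n)" for k n by (rule C_k_real_polynomial_function[OF P(1)])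
    then show "P n \<in> borel_measurable borel" for n
      by (intro borel_measurable_continuous_onI) (metis C_k.simps(1))
    show "\<bar>P n x\<bar> \<le> \<bar>B\<bar> + 1" if "x \<in> \<Omega>" for n x
    proof -
      have "\<bar>c n x - P n x\<bar> < inverse (real (Suc n))" using that closure_subset by (intro P(2)) blast
      moreover have "inverse (real (Suc n)) \<le> 1" by (simp add: field_simps)
      moreover have "\<bar>c n x\<bar> \<le> \<bar>B\<bar>" by (auto simp: c_def)
      ultimately show ?thesis by linarith
    qed
    have "AE x in lebesgue_on \<Omega>. x \<notin> N"
    proof -
      have "AE x in lebesgue. x \<notin> N" using N by (intro AE_not_in) (simp add: negligible_iff_null_sets)
      then show ?thesis using \<Omega>(1) by (subst AE_restrict_space_iff) auto
    qed
    moreover have "AE x in lebesgue_on \<Omega>. x \<in> \<Omega>" by (rule AE_I2) simp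
    ultimately show "AE x in lebesgue_on \<Omega>. (\<lambda>n. P n x) \<longlonglongrightarrow> g x"
    proof eventually_elim
      case (elim x)
      then have "(\<lambda>n. h n x) \<longlonglongrightarrow> g x" using h(2)[of x] by simp
      then have "(\<lambda>n. c n x) \<longlonglongrightarrow> max (- \<bar>B\<bar>) (min \<bar>B\<bar> (g x))"
        unfolding c_def by (intro tendsto_intros)
      also have "max (- \<bar>B\<bar>) (min \<bar>B\<bar> (g x)) = g x" using B[of x] elim by (auto simp: abs_le_iff)
      finally have "(\<lambda>n. c n x) \<longlonglongrightarrow> g x" .
      moreover have "(\<lambda>n. c n x - P n x) \<longlonglongrightarrow> 0"
      proof (rule Lim_null_comparison[OF _ LIMSEQ_inverse_real_of_nat])
        show "\<forall>\<^sub>F n in sequentially. norm (c n x - P n x) \<le> inverse (real (Suc n))"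
          using P(2)[of x] elim closure_subset by (auto intro!: always_eventually less_imp_le)
      qed
      ultimately have "(\<lambda>n. c n x - (c n x - P n x)) \<longlonglongrightarrow> g x - 0" by (rule tendsto_diff)
      then show ?case by simp
    qed
  qed
qed

lemma flat_exp_bounds: "0 \<le> flat_exp 0 t" "flat_exp 0 t \<le> 1" "0 < t \<Longrightarrow> 0 < flat_exp 0 t"
  by (auto simp: flat_exp_def)

lemma integrable_on_compact:
  fixes f :: "'a::euclidean_space \<Rightarrow> 'b::euclidean_space" and g :: "'a \<Rightarrow> 'c::euclidean_space"
  assumes \<Omega>: "open \<Omega>" and K: "compact K" "K \<subseteq> \<Omega>" and f: "integrable (lebesgue_on K) f"
    and g: "g \<in> borel_measurable (lebesgue_on \<Omega>)" and le: "\<And>x. x \<in> \<Omega> \<Longrightarrow> norm (g x) \<le> C * indicator K x * norm (f x)"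
  shows "integrable (lebesgue_on \<Omega>) g"
proof -
  have s: "\<Omega> \<inter> space lebesgue \<in> sets lebesgue" "K \<inter> space lebesgue \<in> sets lebesgue"
    using \<Omega> K compact_imp_closed[OF K(1)] by auto
  have "integrable lebesgue (\<lambda>x. indicator K x *\<^sub>R f x)"
    using f integrable_restrict_space[OF s(2), of f] by simp
  then have "integrable lebesgue (\<lambda>x. norm (indicator K x *\<^sub>R f x))" by (rule integrable_norm)
  then have "integrable lebesgue (\<lambda>x. indicator \<Omega> x *\<^sub>R (C * indicator K x * norm (f x)))"
    by (rule Bochner_Integration.integrable_cong[OF refl, THEN iffD1, rotated, OF integrable_mult_right[of C]])
      (use K(2) in \<open>auto simp: indicator_def\<close>)
  then have "integrable (lebesgue_on \<Omega>) (\<lambda>x. C * indicator K x * norm (f x))"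
    using integrable_restrict_space[OF s(1)] by blast
  then show ?thesis
    by (rule Bochner_Integration.integrable_bound[OF _ g])
      (use le in \<open>auto intro!: AE_I2 intro: order_trans[OF _ abs_ge_self]\<close>)
qed

lemma C_k_measurable: "C_k k f \<Longrightarrow> f \<in> borel_measurable borel"
proof (induction k)
  case 0
  then show ?case by (simp add: borel_measurable_continuous_onI)
next
  case (Suc k)
  then show ?case using C_k_SucD by blast
qed

text \<open>Lindelof's theorem leaves countably many balls, so the exceptional null sets can be
  united.\<close>

lemma cover_by_balls_AE:
  fixes \<Omega> :: "'a::euclidean_space set"
  assumes \<Omega>: "open \<Omega>" and P: "\<And>c r. 0 < r \<Longrightarrow> cball c r \<subseteq> \<Omega> \<Longrightarrow> AE x in lebesgue_on \<Omega>. x \<in> ball c r \<longrightarrow> P x"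
  shows "AE x in lebesgue_on \<Omega>. P x"
proof -
  have "\<exists>r>0. cball x r \<subseteq> \<Omega>" if "x \<in> \<Omega>" for x using that \<Omega> open_contains_cball by blast
  then obtain r where r: "\<And>x. x \<in> \<Omega> \<Longrightarrow> 0 < r x" "\<And>x. x \<in> \<Omega> \<Longrightarrow> cball x (r x) \<subseteq> \<Omega>" by metis
  obtain \<F> where F: "\<F> \<subseteq> (\<lambda>x. ball x (r x)) ` \<Omega>" "countable \<F>" "\<Union>\<F> = \<Union>((\<lambda>x. ball x (r x)) ` \<Omega>)"
    using Lindelof[of "(\<lambda>x. ball x (r x)) ` \<Omega>"] by (metis (no_types, lifting) imageE open_ball)
  have "AE x in lebesgue_on \<Omega>. \<forall>B\<in>\<F>. x \<in> B \<longrightarrow> P x"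
  proof (rule AE_ball_countable')
    fix B assume "B \<in> \<F>"
    then obtain c where "c \<in> \<Omega>" "B = ball c (r c)" using F(1) by blast
    then show "AE x in lebesgue_on \<Omega>. x \<in> B \<longrightarrow> P x" using P r by simp
  qed fact
  moreover have "AE x in lebesgue_on \<Omega>. x \<in> \<Omega>" by (rule AE_I2) simp
  ultimately show ?thesis
  proof eventually_elim
    case (elim x)
    then have "x \<in> \<Union>\<F>" unfolding F(3) using r(1)[of x] by force
    then show ?case using elim by blast
  qed
qed

text \<open>Test with \<open>\<beta> P\<^sub>n\<close>, where \<open>\<beta>\<close> is a bump and the polynomials \<open>P\<^sub>n\<close> approximate
  the sign of \<open>g\<close>.\<close>
lemma AE_eq_0_of_test_functions:
  fixes g :: "'a::euclidean_space \<Rightarrow> real"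
  assumes \<Omega>: "open \<Omega>" "bounded \<Omega>" and g: "locally_integrable \<Omega> g"
    and test: "\<And>\<phi>. \<phi> \<in> test_functions \<Omega> \<Longrightarrow> (\<integral>x. \<phi> x * g x \<partial>lebesgue_on \<Omega>) = 0"
  shows "AE x in lebesgue_on \<Omega>. g x = 0"
proof (rule cover_by_balls_AE[OF \<Omega>(1)])
  fix c :: 'a and r :: real assume r: "0 < r" and cb: "cball c r \<subseteq> \<Omega>"
  have gm [measurable]: "g \<in> borel_measurable (lebesgue_on \<Omega>)" using g by (simp add: locally_integrable_def)
  obtain P where P: "\<And>n k. C_k k (P n)" "\<And>n. P n \<in> borel_measurable borel" "\<And>n x. x \<in> \<Omega> \<Longrightarrow> \<bar>P n x\<bar> \<le> \<bar>1\<bar> + 1"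
    "AE x in lebesgue_on \<Omega>. (\<lambda>n. P n x) \<longlonglongrightarrow> sgn (g x)"
  proof (rule polynomial_approximation[OF \<Omega>, of "\<lambda>x. sgn (g x)" 1])
    show "(\<lambda>x. sgn (g x)) \<in> borel_measurable (lebesgue_on \<Omega>)" by measurable
    show "\<bar>sgn (g x)\<bar> \<le> 1" for x by (simp add: sgn_if)
  qed blast
  define \<beta> where "\<beta> x = flat_exp 0 (1 * (r\<^sup>2 - (norm (x - c))\<^sup>2))" for x
  have \<beta>: "\<beta> \<in> test_functions \<Omega>" unfolding \<beta>_def[abs_def] using r cb by (intro test_functions_bump) auto
  have \<beta>m [measurable]: "\<beta> \<in> borel_measurable (lebesgue_on \<Omega>)" and Pm [measurable]: "P n \<in> borel_measurable (lebesgue_on \<Omega>)" for n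
    using P(2) \<beta> C_k_measurable by (auto intro!: borel_measurable_lebesgue_onI simp: test_functions_def)
  have \<beta>0: "\<beta> x = 0" if "x \<notin> cball c r" for x
  proof -
    have "r < norm (x - c)" using that by (simp add: dist_norm norm_minus_commute)
    then have "r\<^sup>2 < (norm (x - c))\<^sup>2" using r by (intro power_strict_mono) auto
    then show ?thesis by (simp add: \<beta>_def flat_exp_def)
  qed
  have \<beta>b: "0 \<le> \<beta> x" "\<beta> x \<le> 1" for x unfolding \<beta>_def by (rule flat_exp_bounds)+
  have gi: "integrable (lebesgue_on (cball c r)) g" using g cb by (simp add: locally_integrable_def)
  have dom: "integrable (lebesgue_on \<Omega>) (\<lambda>x. 2 * (\<beta> x * \<bar>g x\<bar>))"
  proof (rule integrable_on_compact[OF \<Omega>(1) compact_cball cb gi])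
    show "norm (2 * (\<beta> x * \<bar>g x\<bar>)) \<le> 2 * indicator (cball c r) x * norm (g x)" for x
    proof (cases "x \<in> cball c r")
      case True
      then show ?thesis using \<beta>b[of x] mult_right_mono[OF \<beta>b(2)[of x], of "\<bar>g x\<bar>"] by (simp add: abs_mult)
    qed (simp add: \<beta>0)
  qed measurable
  have "(\<lambda>n. \<integral>x. (P n x * \<beta> x) * g x \<partial>lebesgue_on \<Omega>) \<longlonglongrightarrow> (\<integral>x. \<beta> x * \<bar>g x\<bar> \<partial>lebesgue_on \<Omega>)"
  proof (rule integral_dominated_convergence[OF _ _ dom])
    show "AE x in lebesgue_on \<Omega>. (\<lambda>n. P n x * \<beta> x * g x) \<longlonglongrightarrow> \<beta> x * \<bar>g x\<bar>"
      using P(4)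
    proof eventually_elim
      case (elim x)
      then have "(\<lambda>n. P n x * \<beta> x * g x) \<longlonglongrightarrow> sgn (g x) * \<beta> x * g x" by (intro tendsto_intros)
      moreover have "sgn (g x) * \<beta> x * g x = \<beta> x * \<bar>g x\<bar>" by (simp add: sgn_if)
      ultimately show ?case by simp
    qed
    show "AE x in lebesgue_on \<Omega>. norm (P n x * \<beta> x * g x) \<le> 2 * (\<beta> x * \<bar>g x\<bar>)" for n
    proof (rule AE_I2)
      fix x assume "x \<in> space (lebesgue_on \<Omega>)"
      then have "\<bar>P n x\<bar> \<le> 2" using P(3)[of x n] by simp
      then have "\<bar>P n x\<bar> * (\<beta> x * \<bar>g x\<bar>) \<le> 2 * (\<beta> x * \<bar>g x\<bar>)" using \<beta>b by (intro mult_right_mono) auto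
      then show "norm (P n x * \<beta> x * g x) \<le> 2 * (\<beta> x * \<bar>g x\<bar>)" using \<beta>b[of x] by (simp add: abs_mult mult.assoc)
    qed
  qed measurable
  moreover have "(\<integral>x. (P n x * \<beta> x) * g x \<partial>lebesgue_on \<Omega>) = 0" for n
    by (intro test test_functions_mult_smooth \<beta> P(1))
  ultimately have z: "(\<integral>x. \<beta> x * \<bar>g x\<bar> \<partial>lebesgue_on \<Omega>) = 0" by (simp add: LIMSEQ_const_iff)
  have "integrable (lebesgue_on \<Omega>) (\<lambda>x. \<beta> x * \<bar>g x\<bar>)" using dom by simp
  then have "AE x in lebesgue_on \<Omega>. \<beta> x * \<bar>g x\<bar> = 0"
    using z \<beta>b by (subst (asm) integral_nonneg_eq_0_iff_AE) auto
  then show "AE x in lebesgue_on \<Omega>. x \<in> ball c r \<longrightarrow> g x = 0"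
  proof eventually_elim
    case (elim x)
    have "0 < \<beta> x" if "x \<in> ball c r"
    proof -
      have "norm (x - c) < r" using that by (simp add: dist_norm norm_minus_commute)
      then have "(norm (x - c))\<^sup>2 < r\<^sup>2" by (intro power_strict_mono) auto
      then show ?thesis unfolding \<beta>_def by (intro flat_exp_bounds) simp
    qed
    then show ?case using elim by auto
  qed
qed

section \<open>Weak gradients\<close>

lemma test_function_integrable:
  fixes f :: "'a::euclidean_space \<Rightarrow> 'b::euclidean_space"
  assumes \<Omega>: "open \<Omega>" and f: "locally_integrable \<Omega> f" and \<phi>: "\<phi> \<in> test_functions \<Omega>"
  shows "integrable (lebesgue_on \<Omega>) (\<lambda>x. \<phi> x *\<^sub>R f x)"
proof -
  from \<phi> obtain K where K: "\<And>k. C_k k \<phi>" "compact K" "K \<subseteq> \<Omega>" "\<And>x. x \<notin> K \<Longrightarrow> \<phi> x = 0"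
    by (rule test_functionsE) (rule that)
  have [measurable]: "\<phi> \<in> borel_measurable (lebesgue_on \<Omega>)" "f \<in> borel_measurable (lebesgue_on \<Omega>)"
    using f K(1) by (auto simp: locally_integrable_def intro: borel_measurable_lebesgue_onI C_k_measurable)
  obtain C where C: "0 \<le> C" "\<And>x. norm (\<phi> x) \<le> C"
    using compact_support_bounded[of \<phi> K] C1c_continuous(1)[OF test_functions_C1c[OF \<phi>]] K by blast
  show ?thesis
  proof (rule integrable_on_compact[OF \<Omega> K(2,3)])
    show "integrable (lebesgue_on K) f" using f K by (simp add: locally_integrable_def)
    show "norm (\<phi> x *\<^sub>R f x) \<le> C * indicator K x * norm (f x)" for x
      using C(2)[of x] K(4)[of x] by (cases "x \<in> K") (auto intro: mult_right_mono)
  qed measurable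
qed

lemma test_function_grad_integrable:
  fixes f :: "'a::euclidean_space \<Rightarrow> real"
  assumes \<Omega>: "open \<Omega>" and f: "locally_integrable \<Omega> f" and \<phi>: "\<phi> \<in> test_functions \<Omega>"
  shows "integrable (lebesgue_on \<Omega>) (\<lambda>x. f x *\<^sub>R grad \<phi> x)"
proof -
  from \<phi> obtain K where K: "\<And>k. C_k k \<phi>" "compact K" "K \<subseteq> \<Omega>" "\<And>x. x \<notin> K \<Longrightarrow> \<phi> x = 0"
    by (rule test_functionsE) (rule that)
  have g0: "grad \<phi> x = 0" if "x \<notin> K" for x
    by (rule grad_eq_0_outside[of K]) (use K that in \<open>auto simp: compact_imp_closed\<close>)
  have c: "continuous_on UNIV (grad \<phi>)" by (rule C1c_continuous[OF test_functions_C1c[OF \<phi>]])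
  have [measurable]: "grad \<phi> \<in> borel_measurable (lebesgue_on \<Omega>)" "f \<in> borel_measurable (lebesgue_on \<Omega>)"
    using f c by (auto simp: locally_integrable_def intro: borel_measurable_lebesgue_onI borel_measurable_continuous_onI)
  obtain C where C: "0 \<le> C" "\<And>x. norm (grad \<phi> x) \<le> C"
    using compact_support_bounded[of "grad \<phi>" K] c K(2) g0 by blast
  show ?thesis
  proof (rule integrable_on_compact[OF \<Omega> K(2,3)])
    show "integrable (lebesgue_on K) f" using f K by (simp add: locally_integrable_def)
    show "norm (f x *\<^sub>R grad \<phi> x) \<le> C * indicator K x * norm (f x)" for x
      using mult_right_mono[OF C(2)[of x], of "\<bar>f x\<bar>"] g0[of x] by (cases "x \<in> K") (auto simp: mult.commute)
  qed measurable
qed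

text \<open>Subtracting the two defining identities shows that each component of the difference
  vanishes against all test functions.\<close>

lemma has_weak_gradient_unique:
  assumes \<Omega>: "open \<Omega>" "bounded \<Omega>" and G: "has_weak_gradient \<Omega> u G" and H: "has_weak_gradient \<Omega> u H"
  shows "AE x in lebesgue_on \<Omega>. G x = H x"
proof -
  have li: "locally_integrable \<Omega> G" "locally_integrable \<Omega> H" using G H by (auto simp: has_weak_gradient_def)
  have "AE x in lebesgue_on \<Omega>. (G x - H x) \<bullet> i = 0" if i: "i \<in> Basis" for i
  proof (rule AE_eq_0_of_test_functions[OF \<Omega>])
    show "locally_integrable \<Omega> (\<lambda>x. (G x - H x) \<bullet> i)"
      using li unfolding locally_integrable_def by (auto intro!: integrable_inner_left)
    fix \<phi> assume \<phi>: "\<phi> \<in> test_functions \<Omega>"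
    note D = C1c_GDERIV[OF test_functions_C1c[OF \<phi>]]
    have e: "(\<integral>x. \<phi> x *\<^sub>R G x \<partial>lebesgue_on \<Omega>) = (\<integral>x. \<phi> x *\<^sub>R H x \<partial>lebesgue_on \<Omega>)"
    proof -
      have "(\<integral>x. u x *\<^sub>R grad \<phi> x \<partial>lebesgue_on \<Omega>) = - (\<integral>x. \<phi> x *\<^sub>R G x \<partial>lebesgue_on \<Omega>)"
        "(\<integral>x. u x *\<^sub>R grad \<phi> x \<partial>lebesgue_on \<Omega>) = - (\<integral>x. \<phi> x *\<^sub>R H x \<partial>lebesgue_on \<Omega>)"
        using G H \<phi> D unfolding has_weak_gradient_def by blast+
      then show ?thesis by simp
    qed
    note i1 = test_function_integrable[OF \<Omega>(1) li(1) \<phi>] and i2 = test_function_integrable[OF \<Omega>(1) li(2) \<phi>]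
    have "(\<integral>x. \<phi> x * ((G x - H x) \<bullet> i) \<partial>lebesgue_on \<Omega>) = (\<integral>x. (\<phi> x *\<^sub>R G x - \<phi> x *\<^sub>R H x) \<bullet> i \<partial>lebesgue_on \<Omega>)"
      by (simp add: inner_diff_left algebra_simps)
    also have "\<dots> = ((\<integral>x. \<phi> x *\<^sub>R G x \<partial>lebesgue_on \<Omega>) - (\<integral>x. \<phi> x *\<^sub>R H x \<partial>lebesgue_on \<Omega>)) \<bullet> i"
      using i1 i2 by (subst integral_inner_left) auto
    finally show "(\<integral>x. \<phi> x * ((G x - H x) \<bullet> i) \<partial>lebesgue_on \<Omega>) = 0" using e by simp
  qed
  then have "AE x in lebesgue_on \<Omega>. \<forall>i\<in>Basis. (G x - H x) \<bullet> i = 0"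
    by (intro AE_finite_allI) auto
  then show ?thesis by eventually_elim (metis euclidean_eqI inner_zero_left right_minus_eq)
qed

lemma weak_gradientI:
  assumes "has_weak_gradient \<Omega> u G"
  shows "has_weak_gradient \<Omega> u (weak_gradient \<Omega> u)"
  unfolding weak_gradient_def by (rule someI[of "has_weak_gradient \<Omega> u", OF assms])

lemma has_weak_gradient_diff:
  assumes \<Omega>: "open \<Omega>" and G: "has_weak_gradient \<Omega> u G" and H: "has_weak_gradient \<Omega> v H"
  shows "has_weak_gradient \<Omega> (\<lambda>x. u x - v x) (\<lambda>x. G x - H x)"
proof -
  have li: "locally_integrable \<Omega> G" "locally_integrable \<Omega> H" "locally_integrable \<Omega> u" "locally_integrable \<Omega> v"
    using G H by (auto simp: has_weak_gradient_def)
  have "(\<integral>x. (u x - v x) *\<^sub>R D x \<partial>lebesgue_on \<Omega>) = - (\<integral>x. \<phi> x *\<^sub>R (G x - H x) \<partial>lebesgue_on \<Omega>)"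
    if \<phi>: "\<phi> \<in> test_functions \<Omega>" and D: "\<forall>x. GDERIV \<phi> x :> D x" for \<phi> D
  proof -
    have "D = grad \<phi>" using D by (auto intro!: grad_eqI[symmetric])
    have "(\<integral>x. u x *\<^sub>R D x \<partial>lebesgue_on \<Omega>) = - (\<integral>x. \<phi> x *\<^sub>R G x \<partial>lebesgue_on \<Omega>)"
      "(\<integral>x. v x *\<^sub>R D x \<partial>lebesgue_on \<Omega>) = - (\<integral>x. \<phi> x *\<^sub>R H x \<partial>lebesgue_on \<Omega>)"
      using G H \<phi> D unfolding has_weak_gradient_def by blast+
    then show ?thesis
      unfolding \<open>D = grad \<phi>\<close>
      using test_function_grad_integrable[OF \<Omega> li(3) \<phi>] test_function_grad_integrable[OF \<Omega> li(4) \<phi>]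
       test_function_integrable[OF \<Omega> li(1) \<phi>] test_function_integrable[OF \<Omega> li(2) \<phi>]
      by (simp add: scaleR_diff_left scaleR_diff_right)
  qed
  then show ?thesis using li unfolding has_weak_gradient_def locally_integrable_def by auto
qed

lemma Lp_locally_integrable:
  fixes f :: "'a::euclidean_space \<Rightarrow> 'b::euclidean_space"
  assumes \<Omega>: "open \<Omega>" "bounded \<Omega>" and p: "1 \<le> p" and f: "f \<in> Lp p (lebesgue_on \<Omega>)"
  shows "locally_integrable \<Omega> f"
proof -
  have i: "integrable (lebesgue_on \<Omega>) f"
    by (rule Lp_integrable[OF bounded_open_finite_measure[OF \<Omega>] p f])
  have "integrable (lebesgue_on K) f" if K: "compact K" "K \<subseteq> \<Omega>" for K
  proof -
    have s: "\<Omega> \<inter> space lebesgue \<in> sets lebesgue" "K \<inter> space lebesgue \<in> sets lebesgue"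
      using \<Omega> K compact_imp_closed[OF K(1)] by auto
    have "integrable lebesgue (\<lambda>x. indicator \<Omega> x *\<^sub>R f x)"
      using i integrable_restrict_space[OF s(1), of f] by simp
    then have "integrable lebesgue (\<lambda>x. indicator K x *\<^sub>R (indicator \<Omega> x *\<^sub>R f x))"
      by (rule integrable_mult_indicator[rotated]) (use s(2) in auto)
    moreover have "(\<lambda>x. indicator K x *\<^sub>R (indicator \<Omega> x *\<^sub>R f x)) = (\<lambda>x. indicator K x *\<^sub>R f x)"
      using K(2) by (auto simp: indicator_def fun_eq_iff)
    ultimately show ?thesis using integrable_restrict_space[OF s(2), of f] by simp
  qed
  then show ?thesis using i by (auto simp: locally_integrable_def)
qed

lemma test_functions_Lp:
  fixes \<phi> :: "'a::euclidean_space \<Rightarrow> real"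
  assumes \<Omega>: "open \<Omega>" and \<phi>: "\<phi> \<in> test_functions \<Omega>" and r: "0 < r"
  shows "\<phi> \<in> Lp r (lebesgue_on \<Omega>)" "grad \<phi> \<in> Lp r (lebesgue_on \<Omega>)"
    "(\<integral>x. norm (\<phi> x) powr r \<partial>lebesgue_on \<Omega>) = (\<integral>x. norm (\<phi> x) powr r \<partial>lborel)"
    "(\<integral>x. norm (grad \<phi> x) powr r \<partial>lebesgue_on \<Omega>) = (\<integral>x. norm (grad \<phi> x) powr r \<partial>lborel)"
proof -
  note c = test_functions_C1c[OF \<phi>]
  have m [measurable]: "\<phi> \<in> borel_measurable borel" "grad \<phi> \<in> borel_measurable borel" using c by (auto dest: C1c_measurable)
  note * = lebesgue_on_eq_lborel[OF \<Omega>, of "\<lambda>x. norm (\<phi> x) powr r"] lebesgue_on_eq_lborel[OF \<Omega>, of "\<lambda>x. norm (grad \<phi> x) powr r"]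
  show "\<phi> \<in> Lp r (lebesgue_on \<Omega>)" "grad \<phi> \<in> Lp r (lebesgue_on \<Omega>)"
    using * C1c_integrable(3,4)[OF c r] test_functions_outside[OF \<phi>] m
    by (auto simp: Lp_def intro: borel_measurable_lebesgue_onI)
  show "(\<integral>x. norm (\<phi> x) powr r \<partial>lebesgue_on \<Omega>) = (\<integral>x. norm (\<phi> x) powr r \<partial>lborel)"
    "(\<integral>x. norm (grad \<phi> x) powr r \<partial>lebesgue_on \<Omega>) = (\<integral>x. norm (grad \<phi> x) powr r \<partial>lborel)"
    using * test_functions_outside[OF \<phi>] by auto
qed

section \<open>The closure of the test functions\<close>

text \<open>The closure of the graph of the gradient on test functions, with the approximating
  sequence as an explicit witness. With \<open>weak_gradient\<close> in place of G it describes
  \<open>W1p_0\<close>, see \<open>W1p_0_W0\<close> and \<open>W0_W1p_0\<close>; keeping G as an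
  argument lets limits be taken before any weak gradient is chosen.\<close>

definition W0 :: "real \<Rightarrow> 'a::euclidean_space set \<Rightarrow> ('a \<Rightarrow> real) \<Rightarrow> ('a \<Rightarrow> 'a) \<Rightarrow> (nat \<Rightarrow> 'a \<Rightarrow> real) \<Rightarrow> bool" where
  "W0 p \<Omega> u G \<phi> \<longleftrightarrow> u \<in> Lp p (lebesgue_on \<Omega>) \<and> G \<in> Lp p (lebesgue_on \<Omega>) \<and> (\<forall>n. \<phi> n \<in> test_functions \<Omega>) \<and>
     (\<lambda>n. \<integral>x. norm (u x - \<phi> n x) powr p \<partial>lebesgue_on \<Omega>) \<longlonglongrightarrow> 0 \<and>
     (\<lambda>n. \<integral>x. norm (G x - grad (\<phi> n) x) powr p \<partial>lebesgue_on \<Omega>) \<longlonglongrightarrow> 0"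

text \<open>Stated for a general bilinear product so that it covers both sides of integration by
  parts: the converging factor is a scalar on one side and a vector on the other.\<close>

lemma integral_scaleR_tendsto:
  fixes f :: "nat \<Rightarrow> 'a \<Rightarrow> 'b::euclidean_space" and h :: "'a \<Rightarrow> 'c::euclidean_space"
  assumes M: "finite_measure M" and p: "1 \<le> p" and f: "\<And>n. f n \<in> Lp p M" "g \<in> Lp p M"
    and lim: "(\<lambda>n. \<integral>x. norm (g x - f n x) powr p \<partial>M) \<longlonglongrightarrow> 0"
    and bl: "bounded_bilinear (prd :: 'b \<Rightarrow> 'c \<Rightarrow> 'd::euclidean_space)"
    and h: "h \<in> borel_measurable M" "\<And>x. norm (h x) \<le> C"
    and m: "\<And>f. f \<in> borel_measurable M \<Longrightarrow> (\<lambda>x. prd (f x) (h x)) \<in> borel_measurable M"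
  shows "(\<lambda>n. \<integral>x. prd (f n x) (h x) \<partial>M) \<longlonglongrightarrow> (\<integral>x. prd (g x) (h x) \<partial>M)"
proof -
  interpret bounded_bilinear prd by fact
  obtain K where K: "0 \<le> K" "\<And>a b. norm (prd a b) \<le> norm a * norm b * K" using nonneg_bounded by blast
  have i: "integrable M (\<lambda>x. prd (f x) (h x))" if "f \<in> Lp p M" for f
  proof (rule Bochner_Integration.integrable_bound)
    have "integrable M f" by (rule Lp_integrable[OF M p that])
    then show "integrable M (\<lambda>x. C * K * norm (f x))" by simp
    show "(\<lambda>x. prd (f x) (h x)) \<in> borel_measurable M" using LpD(1)[OF that] by (rule m)
    show "AE x in M. norm (prd (f x) (h x)) \<le> norm (C * K * norm (f x))"
    proof (rule AE_I2)
      fix x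
      have "norm (prd (f x) (h x)) \<le> norm (f x) * norm (h x) * K" by (rule K)
      also have "\<dots> \<le> norm (f x) * C * K" using h(2) K(1) by (intro mult_right_mono mult_left_mono) auto
      finally show "norm (prd (f x) (h x)) \<le> norm (C * K * norm (f x))"
        by (auto simp: mult_ac intro: order_trans[OF _ abs_ge_self])
    qed
  qed
  have L1: "(\<lambda>n. \<integral>x. norm (g x - f n x) powr 1 \<partial>M) \<longlonglongrightarrow> 0"
    by (rule Lp_tendsto_mono[OF M _ p _ lim]) (use f p in \<open>auto intro!: always_eventually Lp_diff\<close>)
  have "(\<lambda>n. (\<integral>x. prd (f n x) (h x) \<partial>M) - (\<integral>x. prd (g x) (h x) \<partial>M)) \<longlonglongrightarrow> 0"
  proof (rule Lim_null_comparison)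
    show "(\<lambda>n. C * K * (\<integral>x. norm (g x - f n x) powr 1 \<partial>M)) \<longlonglongrightarrow> 0" using tendsto_mult_left[OF L1, of "C * K"] by simp
    show "\<forall>\<^sub>F n in sequentially. norm ((\<integral>x. prd (f n x) (h x) \<partial>M) - (\<integral>x. prd (g x) (h x) \<partial>M)) \<le> C * K * (\<integral>x. norm (g x - f n x) powr 1 \<partial>M)"
    proof (intro always_eventually allI)
      fix n
      have d: "integrable M (\<lambda>x. g x - f n x)" using f p by (intro Lp_integrable[OF M p] Lp_diff) auto
      have "(\<integral>x. prd (f n x) (h x) \<partial>M) - (\<integral>x. prd (g x) (h x) \<partial>M) = (\<integral>x. prd (f n x) (h x) - prd (g x) (h x) \<partial>M)"
        using i f by simp
      then have "norm ((\<integral>x. prd (f n x) (h x) \<partial>M) - (\<integral>x. prd (g x) (h x) \<partial>M)) \<le> (\<integral>x. norm (prd (f n x) (h x) - prd (g x) (h x)) \<partial>M)"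
        by simp
      also have "\<dots> \<le> (\<integral>x. C * K * norm (g x - f n x) \<partial>M)"
      proof (rule integral_mono)
        show "norm (prd (f n x) (h x) - prd (g x) (h x)) \<le> C * K * norm (g x - f n x)" for x
        proof -
          have "norm (prd (f n x) (h x) - prd (g x) (h x)) = norm (prd (f n x - g x) (h x))" by (simp add: diff_left)
          also have "\<dots> \<le> norm (f n x - g x) * norm (h x) * K" by (rule K)
          also have "\<dots> \<le> norm (f n x - g x) * C * K" using h(2) K(1) by (intro mult_right_mono mult_left_mono) auto
          finally show ?thesis by (simp add: mult_ac norm_minus_commute)
        qed
      qed (use i f d in auto)
      finally show "norm ((\<integral>x. prd (f n x) (h x) \<partial>M) - (\<integral>x. prd (g x) (h x) \<partial>M)) \<le> C * K * (\<integral>x. norm (g x - f n x) powr 1 \<partial>M)" by simp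
    qed
  qed
  then show ?thesis by (simp add: LIM_zero_iff)
qed

text \<open>Integration by parts holds for the approximating test functions; against a fixed test
  function both sides pass to the limit.\<close>

lemma W0_has_weak_gradient:
  assumes \<Omega>: "open \<Omega>" "bounded \<Omega>" and p: "1 < p" and W: "W0 p \<Omega> u G \<phi>"
  shows "has_weak_gradient \<Omega> u G"
proof -
  note M = bounded_open_finite_measure[OF \<Omega>]
  have u: "u \<in> Lp p (lebesgue_on \<Omega>)" "G \<in> Lp p (lebesgue_on \<Omega>)" and \<phi>: "\<And>n. \<phi> n \<in> test_functions \<Omega>"
    and lim: "(\<lambda>n. \<integral>x. norm (u x - \<phi> n x) powr p \<partial>lebesgue_on \<Omega>) \<longlonglongrightarrow> 0"
     "(\<lambda>n. \<integral>x. norm (G x - grad (\<phi> n) x) powr p \<partial>lebesgue_on \<Omega>) \<longlonglongrightarrow> 0"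
    using W by (auto simp: W0_def)
  have "(\<integral>x. u x *\<^sub>R D x \<partial>lebesgue_on \<Omega>) = - (\<integral>x. \<psi> x *\<^sub>R G x \<partial>lebesgue_on \<Omega>)"
    if \<psi>: "\<psi> \<in> test_functions \<Omega>" and D: "\<forall>x. GDERIV \<psi> x :> D x" for \<psi> D
  proof -
    have Dg: "D = grad \<psi>" using D by (auto intro!: grad_eqI[symmetric])
    note c = test_functions_C1c[OF \<psi>]
    obtain K where K: "compact K" "\<And>x. x \<notin> K \<Longrightarrow> \<psi> x = 0 \<and> grad \<psi> x = 0" using c by (auto simp: C1c_def)
    obtain C1 where C1: "\<And>x. norm (\<psi> x) \<le> C1"
      using compact_support_bounded[of \<psi> K] C1c_continuous[OF c] K by blast
    obtain C2 where C2: "\<And>x. norm (grad \<psi> x) \<le> C2"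
      using compact_support_bounded[of "grad \<psi>" K] C1c_continuous[OF c] K by blast
    have [measurable]: "\<psi> \<in> borel_measurable (lebesgue_on \<Omega>)" "grad \<psi> \<in> borel_measurable (lebesgue_on \<Omega>)"
      using c by (auto intro: borel_measurable_lebesgue_onI dest: C1c_measurable)
    have Lp: "\<phi> n \<in> Lp p (lebesgue_on \<Omega>)" "grad (\<phi> n) \<in> Lp p (lebesgue_on \<Omega>)" for n
      using test_functions_Lp[OF \<Omega>(1) \<phi>] p by auto
    have 1: "(\<lambda>n. \<integral>x. \<phi> n x *\<^sub>R grad \<psi> x \<partial>lebesgue_on \<Omega>) \<longlonglongrightarrow> (\<integral>x. u x *\<^sub>R grad \<psi> x \<partial>lebesgue_on \<Omega>)"
      by (rule integral_scaleR_tendsto[OF M _ Lp(1) u(1) lim(1) bounded_bilinear_scaleR _ C2]) (use p in auto)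
    have 2: "(\<lambda>n. \<integral>x. \<psi> x *\<^sub>R grad (\<phi> n) x \<partial>lebesgue_on \<Omega>) \<longlonglongrightarrow> (\<integral>x. \<psi> x *\<^sub>R G x \<partial>lebesgue_on \<Omega>)"
      by (rule integral_scaleR_tendsto[OF M _ Lp(2) u(2) lim(2) bounded_bilinear.flip[OF bounded_bilinear_scaleR] _ C1]) (use p in auto)
    have 3: "(\<integral>x. \<phi> n x *\<^sub>R grad \<psi> x \<partial>lebesgue_on \<Omega>) = - (\<integral>x. \<psi> x *\<^sub>R grad (\<phi> n) x \<partial>lebesgue_on \<Omega>)" for n
    proof -
      note cn = test_functions_C1c[OF \<phi>[of n]]
      have [measurable]: "\<psi> \<in> borel_measurable borel" "grad \<psi> \<in> borel_measurable borel"
         "\<phi> n \<in> borel_measurable borel" "grad (\<phi> n) \<in> borel_measurable borel"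
        using c cn by (auto dest: C1c_measurable)
      show ?thesis
        using C1c_integration_by_parts[OF cn c] test_functions_outside[OF \<psi>]
        by (subst (1 2) lebesgue_on_eq_lborel(2)[OF \<Omega>(1)]) auto
    qed
    have "(\<lambda>n. \<integral>x. \<phi> n x *\<^sub>R grad \<psi> x \<partial>lebesgue_on \<Omega>) \<longlonglongrightarrow> - (\<integral>x. \<psi> x *\<^sub>R G x \<partial>lebesgue_on \<Omega>)"
      unfolding 3 by (intro tendsto_minus 2)
    with 1 show ?thesis unfolding Dg by (rule LIMSEQ_unique)
  qed
  then show ?thesis
    unfolding has_weak_gradient_def using Lp_locally_integrable[OF \<Omega> _ u(1)] Lp_locally_integrable[OF \<Omega> _ u(2)] p by auto
qed

lemma W0_test_function:
  assumes "open \<Omega>" "0 < p" "\<phi> \<in> test_functions \<Omega>"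
  shows "W0 p \<Omega> \<phi> (grad \<phi>) (\<lambda>n. \<phi>)"
  using assms test_functions_Lp[OF assms(1,3,2)] by (simp add: W0_def)

text \<open>The unspecified choice in \<open>weak_gradient\<close> agrees almost everywhere with any
  known gradient, so its integrals may be computed from that one.\<close>

lemma weak_gradient_Lp:
  assumes \<Omega>: "open \<Omega>" "bounded \<Omega>" and u: "has_weak_gradient \<Omega> u G" "G \<in> Lp p (lebesgue_on \<Omega>)"
  shows "weak_gradient \<Omega> u \<in> Lp p (lebesgue_on \<Omega>)"
    "(\<integral>x. norm (weak_gradient \<Omega> u x) powr p \<partial>lebesgue_on \<Omega>) = (\<integral>x. norm (G x) powr p \<partial>lebesgue_on \<Omega>)"
proof -
  have [measurable]: "weak_gradient \<Omega> u \<in> borel_measurable (lebesgue_on \<Omega>)" "G \<in> borel_measurable (lebesgue_on \<Omega>)"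
    using weak_gradientI[OF u(1)] LpD(1)[OF u(2)] by (auto simp: has_weak_gradient_def locally_integrable_def)
  have AE: "AE x in lebesgue_on \<Omega>. G x = weak_gradient \<Omega> u x"
    by (rule has_weak_gradient_unique[OF \<Omega> u(1) weak_gradientI[OF u(1)]])
  show "weak_gradient \<Omega> u \<in> Lp p (lebesgue_on \<Omega>)" by (rule Lp_cong_AE[OF u(2) _ AE]) measurable
  show "(\<integral>x. norm (weak_gradient \<Omega> u x) powr p \<partial>lebesgue_on \<Omega>) = (\<integral>x. norm (G x) powr p \<partial>lebesgue_on \<Omega>)"
    by (rule integral_cong_AE) (use AE in auto)
qed

lemma W1p_norm_powr:
  assumes "0 < p"
  shows "W1p_norm p \<Omega> u powr p = (\<integral>x. norm (u x) powr p \<partial>lebesgue_on \<Omega>) + (\<integral>x. norm (weak_gradient \<Omega> u x) powr p \<partial>lebesgue_on \<Omega>)"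
  using assms by (simp add: W1p_norm_def powr_powr)

lemma W1p_norm_nonneg: "0 \<le> W1p_norm p \<Omega> u"
  by (simp add: W1p_norm_def)

lemma W1p_0_W0:
  assumes \<Omega>: "open \<Omega>" "bounded \<Omega>" and p: "1 < p" and u: "u \<in> W1p_0 p \<Omega>"
  shows "\<exists>\<phi>. W0 p \<Omega> u (weak_gradient \<Omega> u) \<phi>"
proof -
  from u obtain G where G: "u \<in> Lp p (lebesgue_on \<Omega>)" "has_weak_gradient \<Omega> u G" "G \<in> Lp p (lebesgue_on \<Omega>)"
    by (auto simp: W1p_0_def W1p_def)
  note wg = weak_gradientI[OF G(2)] and wL = weak_gradient_Lp[OF \<Omega> G(2,3)]
  have "\<exists>\<phi>\<in>test_functions \<Omega>. W1p_norm p \<Omega> (\<lambda>x. u x - \<phi> x) < inverse (real (Suc n))" for n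
    using u by (simp add: W1p_0_def)
  then obtain \<phi> where \<phi>: "\<And>n. \<phi> n \<in> test_functions \<Omega>" "\<And>n. W1p_norm p \<Omega> (\<lambda>x. u x - \<phi> n x) < inverse (real (Suc n))"
    by metis
  define a where "a n = (\<integral>x. norm (u x - \<phi> n x) powr p \<partial>lebesgue_on \<Omega>)" for n
  define b where "b n = (\<integral>x. norm (weak_gradient \<Omega> u x - grad (\<phi> n) x) powr p \<partial>lebesgue_on \<Omega>)" for n
  have ab: "0 \<le> a n" "0 \<le> b n" for n by (auto simp: a_def b_def)
  have le: "a n + b n \<le> inverse (real (Suc n)) powr p" for n
  proof -
    have g: "has_weak_gradient \<Omega> (\<phi> n) (grad (\<phi> n))"
      using p by (intro W0_has_weak_gradient[OF \<Omega> p W0_test_function[OF \<Omega>(1) _ \<phi>(1)]]) auto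
    have "grad (\<phi> n) \<in> Lp p (lebesgue_on \<Omega>)" using test_functions_Lp[OF \<Omega>(1) \<phi>(1)] p by auto
    then have "(\<lambda>x. weak_gradient \<Omega> u x - grad (\<phi> n) x) \<in> Lp p (lebesgue_on \<Omega>)"
      using p by (intro Lp_diff wL) auto
    from weak_gradient_Lp(2)[OF \<Omega> has_weak_gradient_diff[OF \<Omega>(1) wg g] this]
    have "W1p_norm p \<Omega> (\<lambda>x. u x - \<phi> n x) powr p = a n + b n"
      using p by (simp add: W1p_norm_powr a_def b_def)
    moreover have "W1p_norm p \<Omega> (\<lambda>x. u x - \<phi> n x) powr p \<le> inverse (real (Suc n)) powr p"
      using \<phi>(2)[of n] p by (intro powr_mono2 W1p_norm_nonneg) auto
    ultimately show ?thesis by simp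
  qed
  have "(\<lambda>n. inverse (real (Suc n)) powr p) \<longlonglongrightarrow> 0 powr p"
    using p by (intro tendsto_powr' LIMSEQ_inverse_real_of_nat tendsto_const) auto
  then have z: "(\<lambda>n. inverse (real (Suc n)) powr p) \<longlonglongrightarrow> 0" by simp
  have "a \<longlonglongrightarrow> 0" "b \<longlonglongrightarrow> 0"
    by (rule Lim_null_comparison[OF always_eventually z]; use ab le in \<open>simp add: add_increasing add_increasing2\<close>;
      smt (verit) ab le)+
  then show ?thesis using G(1) wL \<phi>(1) unfolding W0_def a_def b_def by blast
qed

lemma W0_W1p_0:
  assumes \<Omega>: "open \<Omega>" "bounded \<Omega>" and p: "1 < p" and W: "W0 p \<Omega> u G \<phi>"
  shows "u \<in> W1p_0 p \<Omega>"
proof -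
  have u: "u \<in> Lp p (lebesgue_on \<Omega>)" "G \<in> Lp p (lebesgue_on \<Omega>)" and \<phi>: "\<And>n. \<phi> n \<in> test_functions \<Omega>"
    and lim: "(\<lambda>n. \<integral>x. norm (u x - \<phi> n x) powr p \<partial>lebesgue_on \<Omega>) \<longlonglongrightarrow> 0"
     "(\<lambda>n. \<integral>x. norm (G x - grad (\<phi> n) x) powr p \<partial>lebesgue_on \<Omega>) \<longlonglongrightarrow> 0"
    using W by (auto simp: W0_def)
  note G = W0_has_weak_gradient[OF assms]
  have n: "W1p_norm p \<Omega> (\<lambda>x. u x - \<phi> n x) = ((\<integral>x. norm (u x - \<phi> n x) powr p \<partial>lebesgue_on \<Omega>)
      + (\<integral>x. norm (G x - grad (\<phi> n) x) powr p \<partial>lebesgue_on \<Omega>)) powr (1 / p)" for n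
  proof -
    have g: "has_weak_gradient \<Omega> (\<phi> n) (grad (\<phi> n))"
      using p by (intro W0_has_weak_gradient[OF \<Omega> p W0_test_function[OF \<Omega>(1) _ \<phi>]]) auto
    have "grad (\<phi> n) \<in> Lp p (lebesgue_on \<Omega>)" using test_functions_Lp[OF \<Omega>(1) \<phi>] p by auto
    then have "(\<lambda>x. G x - grad (\<phi> n) x) \<in> Lp p (lebesgue_on \<Omega>)"
      using p u by (intro Lp_diff) auto
    from weak_gradient_Lp(2)[OF \<Omega> has_weak_gradient_diff[OF \<Omega>(1) G g] this]
    show ?thesis by (simp add: W1p_norm_def)
  qed
  have "(\<lambda>n. W1p_norm p \<Omega> (\<lambda>x. u x - \<phi> n x)) \<longlonglongrightarrow> (0 + 0) powr (1 / p)"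
    unfolding n using p by (intro tendsto_powr' tendsto_add lim tendsto_const) auto
  then have z: "(\<lambda>n. W1p_norm p \<Omega> (\<lambda>x. u x - \<phi> n x)) \<longlonglongrightarrow> 0" by simp
  have "\<exists>\<phi>\<in>test_functions \<Omega>. W1p_norm p \<Omega> (\<lambda>x. u x - \<phi> x) < e" if "0 < e" for e
    using order_tendstoD(2)[OF z that] \<phi> by (auto simp: eventually_sequentially)
  then show ?thesis using u G by (auto simp: W1p_0_def W1p_def)
qed

lemma W0_add_cmult:
  assumes \<Omega>: "open \<Omega>" and p: "0 < p" and W: "W0 p \<Omega> u G \<phi>" "W0 p \<Omega> v H \<psi>"
  shows "W0 p \<Omega> (\<lambda>x. u x + c * v x) (\<lambda>x. G x + c *\<^sub>R H x) (\<lambda>n x. \<phi> n x + c * \<psi> n x)"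
proof -
  have u: "u \<in> Lp p (lebesgue_on \<Omega>)" "G \<in> Lp p (lebesgue_on \<Omega>)" "\<And>n. \<phi> n \<in> test_functions \<Omega>"
     "(\<lambda>n. \<integral>x. norm (u x - \<phi> n x) powr p \<partial>lebesgue_on \<Omega>) \<longlonglongrightarrow> 0"
     "(\<lambda>n. \<integral>x. norm (G x - grad (\<phi> n) x) powr p \<partial>lebesgue_on \<Omega>) \<longlonglongrightarrow> 0"
    and v: "v \<in> Lp p (lebesgue_on \<Omega>)" "H \<in> Lp p (lebesgue_on \<Omega>)" "\<And>n. \<psi> n \<in> test_functions \<Omega>"
     "(\<lambda>n. \<integral>x. norm (v x - \<psi> n x) powr p \<partial>lebesgue_on \<Omega>) \<longlonglongrightarrow> 0"
     "(\<lambda>n. \<integral>x. norm (H x - grad (\<psi> n) x) powr p \<partial>lebesgue_on \<Omega>) \<longlonglongrightarrow> 0"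
    using W by (auto simp: W0_def)
  note C = test_functions_C1c
  have g: "grad (\<lambda>x. \<phi> n x + c * \<psi> n x) x = grad (\<phi> n) x + c *\<^sub>R grad (\<psi> n) x" for n x
    using grad_add[OF C[OF u(3)] C[OF test_functions_cmult[OF v(3)]]] grad_cmult[OF C[OF v(3)]] by simp
  have Lp: "\<phi> n \<in> Lp p (lebesgue_on \<Omega>)" "grad (\<phi> n) \<in> Lp p (lebesgue_on \<Omega>)"
     "\<psi> n \<in> Lp p (lebesgue_on \<Omega>)" "grad (\<psi> n) \<in> Lp p (lebesgue_on \<Omega>)" for n
    using test_functions_Lp[OF \<Omega> u(3) p] test_functions_Lp[OF \<Omega> v(3) p] by auto
  have cv: "(\<lambda>n. \<integral>x. norm (c *\<^sub>R (f n x)) powr p \<partial>lebesgue_on \<Omega>) \<longlonglongrightarrow> 0"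
    if "(\<lambda>n. \<integral>x. norm (f n x) powr p \<partial>lebesgue_on \<Omega>) \<longlonglongrightarrow> 0" for f :: "nat \<Rightarrow> 'a \<Rightarrow> 'c::euclidean_space"
    using tendsto_mult_left[OF that, of "\<bar>c\<bar> powr p"] by (simp add: powr_mult)
  have "(\<lambda>n. \<integral>x. norm ((u x - \<phi> n x) + c *\<^sub>R (v x - \<psi> n x)) powr p \<partial>lebesgue_on \<Omega>) \<longlonglongrightarrow> 0"
    by (rule powr_add_tendsto_0[OF p _ _ u(4) cv[OF v(4)]])
      (use u v Lp p in \<open>auto intro!: always_eventually Lp_cmult Lp_diff\<close>)
  moreover have "(\<lambda>n. \<integral>x. norm ((G x - grad (\<phi> n) x) + c *\<^sub>R (H x - grad (\<psi> n) x)) powr p \<partial>lebesgue_on \<Omega>) \<longlonglongrightarrow> 0"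
    by (rule powr_add_tendsto_0[OF p _ _ u(5) cv[OF v(5)]])
      (use u v Lp p in \<open>auto intro!: always_eventually Lp_scaleR Lp_diff\<close>)
  ultimately show ?thesis
    unfolding W0_def g using u v p
    by (auto intro!: Lp_add Lp_cmult Lp_scaleR test_functions_add test_functions_cmult simp: algebra_simps scaleR_diff_right)
qed

section \<open>The energy functional\<close>

text \<open>This room above g is what allows convergence in L^p to be upgraded to L^g by
  interpolation with a bounded norm.\<close>

lemma critical_exponent_gap:
  assumes "ereal g < critical_exponent p N"
  obtains g' where "g < g'" "ereal g' < critical_exponent p N"
  using ereal_dense2[OF assms] by (metis less_ereal.simps(1) that)

text \<open>The gradient is a separate argument, so that test functions and weak limits can be inserted
  without reference to the choice made in \<^const>\<open>weak_gradient\<close>.\<close>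
definition energy ::
  "real \<Rightarrow> real \<Rightarrow> real \<Rightarrow> 'a::euclidean_space set \<Rightarrow> ('a \<Rightarrow> real) \<Rightarrow> ('a \<Rightarrow> real) \<Rightarrow>
   real \<Rightarrow> real \<Rightarrow> ('a \<Rightarrow> real) \<Rightarrow> ('a \<Rightarrow> 'a) \<Rightarrow> real" where
  "energy p q g \<Omega> a b \<alpha> \<beta> u G =
     1 / p * (\<integral>x. norm (G x) powr p \<partial>lebesgue_on \<Omega>)
     - \<alpha> / q * (\<integral>x. a x * norm (u x) powr q \<partial>lebesgue_on \<Omega>)
     + \<beta> / g * (\<integral>x. b x * norm (u x) powr g \<partial>lebesgue_on \<Omega>)"

text \<open>K is any positive upper bound of the norm of h. Young's inequality applied to h/K makes
  the mixed term |f|^(r-1) |h| linear in K, and the remaining K^r is K times K^(r-1), which is small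
  for K < \<delta>.\<close>

lemma second_difference_integral:
  fixes f :: "'a \<Rightarrow> 'b::euclidean_space"
  assumes r: "1 < r" and f: "f \<in> Lp r M" and w: "w \<in> Linfty M" "AE x in M. 0 \<le> w x" and \<epsilon>: "0 < \<epsilon>"
  shows "\<exists>\<delta>>0. \<forall>K h. 0 < K \<longrightarrow> K < \<delta> \<longrightarrow> h \<in> Lp r M \<longrightarrow> (\<integral>x. norm (h x) powr r \<partial>M) \<le> K powr r \<longrightarrow>
    (\<integral>x. w x * norm (f x + h x) powr r \<partial>M) + (\<integral>x. w x * norm (f x - h x) powr r \<partial>M)
      - 2 * (\<integral>x. w x * norm (f x) powr r \<partial>M) \<le> \<epsilon> * K"
proof -
  from w(1) obtain W where W: "0 < W" "w \<in> borel_measurable M" "AE x in M. \<bar>w x\<bar> \<le> W" by (rule LinftyE)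
  define I where "I = (\<integral>x. norm (f x) powr r \<partial>M)"
  have I: "0 \<le> I" by (simp add: I_def)
  \<comment> \<open>\<open>e\<close> and \<delta> are chosen so that the mixed term and the
    remainder each contribute at most \<epsilon> K / 2.\<close>
  define e where "e = \<epsilon> / (2 * W * (I + 1))"
  have e: "0 < e" using \<epsilon> W I by (simp add: e_def)
  from norm_powr_second_difference[OF r e, where ?'b='b] obtain C where C: "0 \<le> C"
    "\<And>x y::'b. norm (x + y) powr r + norm (x - y) powr r - 2 * norm x powr r \<le> e * (norm x powr (r - 1) * norm y) + C * norm y powr r"
    by blast
  define \<delta> where "\<delta> = (\<epsilon> / (2 * W * (C + 1))) powr (1 / (r - 1))"
  have \<delta>: "0 < \<delta>" "\<delta> powr (r - 1) = \<epsilon> / (2 * W * (C + 1))" using \<epsilon> W C r by (auto simp: \<delta>_def powr_powr)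
  have "(\<integral>x. w x * norm (f x + h x) powr r \<partial>M) + (\<integral>x. w x * norm (f x - h x) powr r \<partial>M)
      - 2 * (\<integral>x. w x * norm (f x) powr r \<partial>M) \<le> \<epsilon> * K"
    if K: "0 < K" "K < \<delta>" and h: "h \<in> Lp r M" "(\<integral>x. norm (h x) powr r \<partial>M) \<le> K powr r" for K h
  proof -
    have L: "(\<lambda>x. f x + h x) \<in> Lp r M" "(\<lambda>x. f x - h x) \<in> Lp r M" using f h r by (auto intro: Lp_add Lp_diff)
    note wi = Linfty_weighted_integrable[OF w(1)]
    have i: "integrable M (\<lambda>x. w x * norm (f x + h x) powr r)" "integrable M (\<lambda>x. w x * norm (f x - h x) powr r)"
      "integrable M (\<lambda>x. w x * norm (f x) powr r)"
      using L f by (auto intro: wi)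
    define X where "X x = W * (e * (K * (norm (f x) powr r + norm (h x) powr r / K powr r)) + C * norm (h x) powr r)" for x
    have iX: "integrable M X" unfolding X_def using LpD(2)[OF f] LpD(2)[OF h(1)] by simp
    have "(\<integral>x. w x * norm (f x + h x) powr r \<partial>M) + (\<integral>x. w x * norm (f x - h x) powr r \<partial>M)
      - 2 * (\<integral>x. w x * norm (f x) powr r \<partial>M)
      = (\<integral>x. w x * norm (f x + h x) powr r + w x * norm (f x - h x) powr r - 2 * (w x * norm (f x) powr r) \<partial>M)"
      using i by simp
    also have "\<dots> \<le> (\<integral>x. X x \<partial>M)"
    proof (rule integral_mono_AE)
      show "AE x in M. w x * norm (f x + h x) powr r + w x * norm (f x - h x) powr r - 2 * (w x * norm (f x) powr r) \<le> X x"
        using W(3) w(2)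
      proof eventually_elim
        case (elim x)
        define Z where "Z = norm (f x + h x) powr r + norm (f x - h x) powr r - 2 * norm (f x) powr r"
        have "norm (f x) powr (r - 1) * norm (h x) = K * (norm (f x) powr (r - 1) * (norm (h x) / K))"
          using K by simp
        also have "\<dots> \<le> K * (norm (f x) powr r + (norm (h x) / K) powr r)"
          using K r by (intro mult_left_mono powr_diff_one_mult_le) auto
        finally have y: "norm (f x) powr (r - 1) * norm (h x) \<le> K * (norm (f x) powr r + norm (h x) powr r / K powr r)"
          by (simp add: powr_divide)
        have "Z \<le> e * (norm (f x) powr (r - 1) * norm (h x)) + C * norm (h x) powr r"
          unfolding Z_def by (rule C(2))
        also have "\<dots> \<le> e * (K * (norm (f x) powr r + norm (h x) powr r / K powr r)) + C * norm (h x) powr r"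
          using e y by (intro add_right_mono mult_left_mono) auto
        finally have Z: "Z \<le> e * (K * (norm (f x) powr r + norm (h x) powr r / K powr r)) + C * norm (h x) powr r" .
        have "w x * Z \<le> w x * (e * (K * (norm (f x) powr r + norm (h x) powr r / K powr r)) + C * norm (h x) powr r)"
          using elim Z by (intro mult_left_mono) auto
        also have "\<dots> \<le> X x" unfolding X_def using elim e K C(1)
          by (intro mult_right_mono add_nonneg_nonneg mult_nonneg_nonneg divide_nonneg_nonneg) auto
        finally show ?case by (simp add: Z_def algebra_simps)
      qed
    qed (use i iX in auto)
    also have "\<dots> = W * (e * (K * (I + (\<integral>x. norm (h x) powr r \<partial>M) / K powr r)) + C * (\<integral>x. norm (h x) powr r \<partial>M))"
      unfolding X_def I_def using LpD(2)[OF f] LpD(2)[OF h(1)] by simp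
    also have "\<dots> \<le> W * (e * (K * (I + 1)) + C * K powr r)"
    proof -
      have "(\<integral>x. norm (h x) powr r \<partial>M) / K powr r \<le> 1" using h(2) K by simp
      then show ?thesis using W e K C h(2)
        by (intro mult_left_mono add_mono order_refl) auto
    qed
    also have "C * K powr r \<le> (C + 1) * (K * \<delta> powr (r - 1))"
    proof -
      have "K powr r = K * K powr (r - 1)" using powr_mult_base[of K "r - 1"] K by simp
      also have "\<dots> \<le> K * \<delta> powr (r - 1)" using K r by (intro mult_left_mono powr_mono2) auto
      finally show ?thesis using C K by (intro mult_mono) auto
    qed
    also have "W * (e * (K * (I + 1)) + (C + 1) * (K * \<delta> powr (r - 1))) = \<epsilon> * K"
    proof -
      have A: "W * (e * (K * (I + 1))) = \<epsilon> / 2 * K" unfolding e_def using W I by simp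
      have B: "W * ((C + 1) * (K * \<delta> powr (r - 1))) = \<epsilon> / 2 * K"
        unfolding \<delta> using W C by simp
      show ?thesis by (subst distrib_left) (use A B in linarith)
    qed
    finally show ?thesis using W by simp
  qed
  then show ?thesis using \<delta>(1) by blast
qed

lemma convexity_integral:
  fixes f :: "'a \<Rightarrow> 'b::euclidean_space"
  assumes r: "1 < r" and f: "f \<in> Lp r M" "h \<in> Lp r M" and w: "w \<in> Linfty M" "AE x in M. 0 \<le> w x"
  shows "2 * (\<integral>x. w x * norm (f x) powr r \<partial>M)
    \<le> (\<integral>x. w x * norm (f x + h x) powr r \<partial>M) + (\<integral>x. w x * norm (f x - h x) powr r \<partial>M)"
proof -
  have L: "(\<lambda>x. f x + h x) \<in> Lp r M" "(\<lambda>x. f x - h x) \<in> Lp r M" using f r by (auto intro: Lp_add Lp_diff)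
  note wi = Linfty_weighted_integrable[OF w(1)]
  have i: "integrable M (\<lambda>x. w x * norm (f x + h x) powr r)" "integrable M (\<lambda>x. w x * norm (f x - h x) powr r)"
    "integrable M (\<lambda>x. w x * norm (f x) powr r)"
    using L f by (auto intro: wi)
  have "(\<integral>x. 2 * (w x * norm (f x) powr r) \<partial>M) \<le> (\<integral>x. w x * norm (f x + h x) powr r + w x * norm (f x - h x) powr r \<partial>M)"
  proof (rule integral_mono_AE)
    show "AE x in M. 2 * (w x * norm (f x) powr r) \<le> w x * norm (f x + h x) powr r + w x * norm (f x - h x) powr r"
      using w(2)
    proof eventually_elim
      case (elim x)
      have "(f x + h x + (f x - h x)) /\<^sub>R 2 = f x" by (simp flip: scaleR_2)
      then have "2 * norm (f x) powr r \<le> norm (f x + h x) powr r + norm (f x - h x) powr r"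
        using norm_powr_midpoint[OF r, of "f x + h x" "f x - h x"] by simp
      from mult_left_mono[OF this elim] show ?case by (simp add: algebra_simps)
    qed
  qed (use i in auto)
  then show ?thesis using i by simp
qed

section \<open>The energy under the standing assumptions\<close>

locale p_laplace_problem =
  fixes \<Omega> :: "'a::euclidean_space set" and p q g \<sigma> :: real and a b :: "'a \<Rightarrow> real"
  assumes \<Omega>: "open \<Omega>" "bounded \<Omega>"
    and exponents: "1 < p" "p < q" "q < g" "ereal g < critical_exponent p DIM('a)"
    and coefficients: "a \<in> Linfty (lebesgue_on \<Omega>)" "b \<in> Linfty (lebesgue_on \<Omega>)"
      "AE x in lebesgue_on \<Omega>. 0 \<le> a x" "0 < \<sigma>" "AE x in lebesgue_on \<Omega>. \<sigma> \<le> b x"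
begin

abbreviation M where "M \<equiv> lebesgue_on \<Omega>"
abbreviation J where "J \<equiv> energy p q g \<Omega> a b"

lemma finite_M: "finite_measure M"
  by (rule bounded_open_finite_measure[OF \<Omega>])

lemma b_nonneg: "AE x in M. 0 \<le> b x"
  using coefficients(5) by eventually_elim (use coefficients(4) in simp)

lemma radius: obtains R where "0 < R" "\<And>\<phi> x. \<phi> \<in> test_functions \<Omega> \<Longrightarrow> R < norm x \<Longrightarrow> \<phi> x = 0"
proof -
  obtain R where "0 < R" "\<And>x. x \<in> \<Omega> \<Longrightarrow> norm x \<le> R" using \<Omega>(2) bounded_pos by metis
  then show ?thesis using that[of R] test_functions_outside(1) by (metis not_less)
qed

lemma test_Lp:
  assumes "\<phi> \<in> test_functions \<Omega>" "0 < r"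
  shows "\<phi> \<in> Lp r M" "grad \<phi> \<in> Lp r M"
  using test_functions_Lp[OF \<Omega>(1) assms] by auto

lemma sobolev_test:
  assumes "p \<le> s" "ereal s < critical_exponent p DIM('a)"
  obtains C where "0 \<le> C" "\<And>\<phi> k. \<phi> \<in> test_functions \<Omega> \<Longrightarrow> 0 < k \<Longrightarrow>
    (\<integral>x. norm (\<phi> x) powr p \<partial>M) + (\<integral>x. norm (grad \<phi> x) powr p \<partial>M) \<le> k powr p \<Longrightarrow>
    (\<integral>x. norm (\<phi> x) powr s \<partial>M) \<le> C * k powr s"
proof -
  obtain R where R: "0 < R" "\<And>\<phi> x. \<phi> \<in> test_functions \<Omega> \<Longrightarrow> R < norm x \<Longrightarrow> \<phi> x = 0" using radius by blast
  have "1 \<le> p" using exponents by simp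
  from sobolev_inequality[OF this assms, of R] obtain C where C: "0 \<le> C"
    "\<forall>f::'a \<Rightarrow> real. \<forall>k>0. C1c f \<longrightarrow> (\<forall>x. R < norm x \<longrightarrow> f x = 0) \<longrightarrow>
      (\<integral>x. \<bar>f x\<bar> powr p \<partial>lborel) + (\<integral>x. norm (grad f x) powr p \<partial>lborel) \<le> k powr p \<longrightarrow>
      (\<integral>x. \<bar>f x\<bar> powr s \<partial>lborel) \<le> C * k powr s"
    by (elim exE conjE) (rule that)
  show thesis
  proof (rule that[OF C(1)])
    fix \<phi> k assume \<phi>: "\<phi> \<in> test_functions \<Omega>" and k: "0 < (k::real)"
      and le: "(\<integral>x. norm (\<phi> x) powr p \<partial>M) + (\<integral>x. norm (grad \<phi> x) powr p \<partial>M) \<le> k powr p"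
    note t = test_functions_Lp(3,4)[OF \<Omega>(1) \<phi>]
    show "(\<integral>x. norm (\<phi> x) powr s \<partial>M) \<le> C * k powr s"
      using C(2)[rule_format, OF k test_functions_C1c[OF \<phi>]] R(2)[OF \<phi>] le t exponents assms(1) by simp
  qed
qed

text \<open>The Sobolev inequality for differences of the approximating functions gives a limit in
  L^g, and comparison in L^p identifies it with u.\<close>

lemma sobolev_W0:
  "\<exists>C\<ge>0. \<forall>u G \<phi>. W0 p \<Omega> u G \<phi> \<longrightarrow>
      u \<in> Lp g M \<and> (\<lambda>n. \<integral>x. norm (u x - \<phi> n x) powr g \<partial>M) \<longlonglongrightarrow> 0 \<and>
      (\<forall>k>0. (\<integral>x. norm (u x) powr p \<partial>M) + (\<integral>x. norm (G x) powr p \<partial>M) \<le> k powr p \<longrightarrow>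
         (\<integral>x. norm (u x) powr g \<partial>M) \<le> C * k powr g)"
proof -
  have pg: "p \<le> g" "0 < p" "0 < g" using exponents by auto
  from sobolev_test[OF pg(1) exponents(4)] obtain C where C: "0 \<le> C" "\<And>\<phi> k. \<phi> \<in> test_functions \<Omega> \<Longrightarrow> 0 < k \<Longrightarrow>
    (\<integral>x. norm (\<phi> x) powr p \<partial>M) + (\<integral>x. norm (grad \<phi> x) powr p \<partial>M) \<le> k powr p \<Longrightarrow>
    (\<integral>x. norm (\<phi> x) powr g \<partial>M) \<le> C * k powr g" by blast
  show ?thesis
  proof (intro exI[of _ "C * 2 powr g"] conjI[OF mult_nonneg_nonneg[OF C(1) powr_ge_zero]] allI impI)
    fix u G \<phi> assume W: "W0 p \<Omega> u G \<phi>"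
    then have u: "u \<in> Lp p M" "G \<in> Lp p M" and \<phi>: "\<And>n. \<phi> n \<in> test_functions \<Omega>"
      and lim: "(\<lambda>n. \<integral>x. norm (u x - \<phi> n x) powr p \<partial>M) \<longlonglongrightarrow> 0"
       "(\<lambda>n. \<integral>x. norm (G x - grad (\<phi> n) x) powr p \<partial>M) \<longlonglongrightarrow> 0"
      by (auto simp: W0_def)
    note tL = test_Lp[OF \<phi>]
    let ?F = "sequentially \<times>\<^sub>F sequentially"
    have d1: "((\<lambda>z. \<integral>x. norm ((u x - \<phi> (snd z) x) + (\<phi> (fst z) x - u x)) powr p \<partial>M) \<longlongrightarrow> 0) ?F"
      by (rule powr_add_tendsto_0[OF pg(2)])
        (use u tL pg filterlim_compose[OF lim(1) filterlim_fst] filterlim_compose[OF lim(1) filterlim_snd]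
          in \<open>auto intro!: always_eventually Lp_diff simp: norm_minus_commute abs_minus_commute\<close>)
    have d2: "((\<lambda>z. \<integral>x. norm ((G x - grad (\<phi> (snd z)) x) + (grad (\<phi> (fst z)) x - G x)) powr p \<partial>M) \<longlongrightarrow> 0) ?F"
      by (rule powr_add_tendsto_0[OF pg(2)])
        (use u tL pg filterlim_compose[OF lim(2) filterlim_fst] filterlim_compose[OF lim(2) filterlim_snd]
          in \<open>auto intro!: always_eventually Lp_diff simp: norm_minus_commute abs_minus_commute\<close>)
    have cauchy: "\<exists>N. \<forall>m\<ge>N. \<forall>n\<ge>N. (\<integral>x. norm (\<phi> m x - \<phi> n x) powr g \<partial>M) \<le> e" if e: "0 < e" for e
    proof -
      define k where "k = (e / (C + 1)) powr (1 / g)"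
      have k: "0 < k" "k powr g = e / (C + 1)" using e C pg by (auto simp: k_def powr_powr)
      have "((\<lambda>z. (\<integral>x. norm (\<phi> (fst z) x - \<phi> (snd z) x) powr p \<partial>M) + (\<integral>x. norm (grad (\<phi> (fst z)) x - grad (\<phi> (snd z)) x) powr p \<partial>M)) \<longlongrightarrow> 0 + 0) ?F"
        using d1 d2 by (intro tendsto_add) (simp_all add: algebra_simps)
      then have "\<forall>\<^sub>F z in ?F. (\<integral>x. norm (\<phi> (fst z) x - \<phi> (snd z) x) powr p \<partial>M) + (\<integral>x. norm (grad (\<phi> (fst z)) x - grad (\<phi> (snd z)) x) powr p \<partial>M) < k powr p"
        by (rule order_tendstoD) (use k in simp)
      then obtain N where N: "\<And>m n. N \<le> m \<Longrightarrow> N \<le> n \<Longrightarrow> (\<integral>x. norm (\<phi> m x - \<phi> n x) powr p \<partial>M) + (\<integral>x. norm (grad (\<phi> m) x - grad (\<phi> n) x) powr p \<partial>M) < k powr p"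
        unfolding eventually_prod_sequentially by auto
      show ?thesis
      proof (intro exI[of _ N] allI impI)
        fix m n assume mn: "N \<le> m" "N \<le> n"
        have "(\<integral>x. norm (\<phi> m x - \<phi> n x) powr g \<partial>M) \<le> C * k powr g"
          using N[OF mn] grad_diff[OF test_functions_C1c[OF \<phi>] test_functions_C1c[OF \<phi>]]
          by (intro C(2) test_functions_diff \<phi> k(1)) simp
        also have "\<dots> = e * (C / (C + 1))" unfolding k by simp
        also have "\<dots> \<le> e * 1" using e C by (intro mult_left_mono) auto
        finally show "(\<integral>x. norm (\<phi> m x - \<phi> n x) powr g \<partial>M) \<le> e" by simp
      qed
    qed
    obtain v where v: "v \<in> Lp g M" "(\<lambda>n. \<integral>x. norm (v x - \<phi> n x) powr g \<partial>M) \<longlonglongrightarrow> 0"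
      using Lp_complete[of g \<phi> M] cauchy tL(1) pg by blast
    have vp: "v \<in> Lp p M" by (rule Lp_mono[OF finite_M pg(2,1) v(1)])
    have "(\<lambda>n. \<integral>x. norm (v x - \<phi> n x) powr p \<partial>M) \<longlonglongrightarrow> 0"
      by (rule Lp_tendsto_mono[OF finite_M pg(2,1) _ v(2)]) (use v tL pg in \<open>auto intro!: always_eventually Lp_diff\<close>)
    from Lp_limit_unique[OF pg(2) tL(1)[OF pg(2)] vp u(1) this lim(1)] have AE: "AE x in M. v x = u x" .
    have [measurable]: "u \<in> borel_measurable M" "v \<in> borel_measurable M" "\<phi> n \<in> borel_measurable M" for n
      using LpD(1) u v tL(1)[OF pg(2)] by blast+
    have ug: "u \<in> Lp g M" by (rule Lp_cong_AE[OF v(1) _ AE]) measurable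
    have "(\<integral>x. norm (u x - \<phi> n x) powr g \<partial>M) = (\<integral>x. norm (v x - \<phi> n x) powr g \<partial>M)" for n
      by (rule integral_cong_AE) (use AE in auto)
    then have ul: "(\<lambda>n. \<integral>x. norm (u x - \<phi> n x) powr g \<partial>M) \<longlonglongrightarrow> 0" using v(2) by simp
    have "(\<integral>x. norm (u x) powr g \<partial>M) \<le> C * 2 powr g * k powr g"
      if k: "0 < k" "(\<integral>x. norm (u x) powr p \<partial>M) + (\<integral>x. norm (G x) powr p \<partial>M) \<le> k powr p" for k
    proof -
      have "(\<lambda>n. (\<integral>x. norm (\<phi> n x) powr p \<partial>M) + (\<integral>x. norm (grad (\<phi> n) x) powr p \<partial>M))
         \<longlonglongrightarrow> (\<integral>x. norm (u x) powr p \<partial>M) + (\<integral>x. norm (G x) powr p \<partial>M)"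
        using lim u tL pg by (intro tendsto_add powr_tendsto) auto
      \<comment> \<open>The approximating norms need not be below k when their limit is; they are
        eventually below 2k, which costs the factor 2^g.\<close>
      moreover have "(\<integral>x. norm (u x) powr p \<partial>M) + (\<integral>x. norm (G x) powr p \<partial>M) < (2 * k) powr p"
        using k pg powr_less_mono2[of p k "2 * k"] by simp
      ultimately have "\<forall>\<^sub>F n in sequentially. (\<integral>x. norm (\<phi> n x) powr p \<partial>M) + (\<integral>x. norm (grad (\<phi> n) x) powr p \<partial>M) < (2 * k) powr p"
        by (rule order_tendstoD)
      then have "\<forall>\<^sub>F n in sequentially. (\<integral>x. norm (\<phi> n x) powr g \<partial>M) \<le> C * (2 * k) powr g"
      proof eventually_elim
        case (elim n)
        then show ?case using C(2)[OF \<phi>, of "2 * k" n] k by simp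
      qed
      moreover have "(\<lambda>n. \<integral>x. norm (\<phi> n x) powr g \<partial>M) \<longlonglongrightarrow> (\<integral>x. norm (u x) powr g \<partial>M)"
        using ul ug tL pg by (intro powr_tendsto) auto
      ultimately have "(\<integral>x. norm (u x) powr g \<partial>M) \<le> C * (2 * k) powr g"
        using tendsto_upperbound sequentially_bot by blast
      then show ?thesis by (simp add: powr_mult mult.assoc)
    qed
    then show "u \<in> Lp g M \<and> (\<lambda>n. \<integral>x. norm (u x - \<phi> n x) powr g \<partial>M) \<longlonglongrightarrow> 0 \<and>
      (\<forall>k>0. (\<integral>x. norm (u x) powr p \<partial>M) + (\<integral>x. norm (G x) powr p \<partial>M) \<le> k powr p \<longrightarrow>
         (\<integral>x. norm (u x) powr g \<partial>M) \<le> C * 2 powr g * k powr g)" using ug ul by blast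
  qed
qed

lemma W0_Lp:
  assumes "W0 p \<Omega> u G \<phi>"
  shows "u \<in> Lp p M" "G \<in> Lp p M" "u \<in> Lp g M" "u \<in> Lp q M" "\<phi> n \<in> test_functions \<Omega>"
    "(\<lambda>n. \<integral>x. norm (u x - \<phi> n x) powr g \<partial>M) \<longlonglongrightarrow> 0"
proof -
  show "u \<in> Lp p M" "G \<in> Lp p M" "\<phi> n \<in> test_functions \<Omega>" using assms by (auto simp: W0_def)
  show ug: "u \<in> Lp g M" "(\<lambda>n. \<integral>x. norm (u x - \<phi> n x) powr g \<partial>M) \<longlonglongrightarrow> 0" using sobolev_W0 assms by blast+
  show "u \<in> Lp q M" using exponents by (intro Lp_mono[OF finite_M _ _ ug(1)]) auto
qed

text \<open>The sign is that of the negative of the lower-order part of the energy. The filter is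
  arbitrary because the lemma serves sequences and also midpoints indexed by pairs.\<close>

lemma lower_order_tendsto:
  fixes u :: "'a \<Rightarrow> real" and f :: "'i \<Rightarrow> 'a \<Rightarrow> real"
  assumes u: "u \<in> Lp g M" and f: "\<And>i. f i \<in> Lp g M" and lim: "((\<lambda>i. \<integral>x. norm (u x - f i x) powr g \<partial>M) \<longlongrightarrow> 0) F"
  shows "((\<lambda>i. \<alpha> / q * (\<integral>x. a x * norm (f i x) powr q \<partial>M) - \<beta> / g * (\<integral>x. b x * norm (f i x) powr g \<partial>M))
    \<longlongrightarrow> \<alpha> / q * (\<integral>x. a x * norm (u x) powr q \<partial>M) - \<beta> / g * (\<integral>x. b x * norm (u x) powr g \<partial>M)) F"
proof -
  have e: "0 < q" "0 < g" "q \<le> g" using exponents by auto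
  have "((\<lambda>i. \<integral>x. norm (u x - f i x) powr q \<partial>M) \<longlongrightarrow> 0) F"
    by (rule Lp_tendsto_mono[OF finite_M e(1,3) _ lim]) (use u f e in \<open>auto intro!: always_eventually Lp_diff\<close>)
  moreover have "u \<in> Lp q M" "f i \<in> Lp q M" for i using u f Lp_mono[OF finite_M e(1,3)] by auto
  ultimately show ?thesis
    using u f lim e coefficients by (intro tendsto_intros weighted_powr_tendsto) auto
qed

lemma energy_tendsto:
  assumes "W0 p \<Omega> u G \<phi>"
  shows "(\<lambda>n. J \<alpha> \<beta> (\<phi> n) (grad (\<phi> n))) \<longlonglongrightarrow> J \<alpha> \<beta> u G"
proof -
  have e: "0 < p" "0 < g" using exponents by auto
  note W = W0_Lp[OF assms]
  have "(\<lambda>n. \<integral>x. norm (G x - grad (\<phi> n) x) powr p \<partial>M) \<longlonglongrightarrow> 0" using assms by (auto simp: W0_def)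
  then have "(\<lambda>n. \<integral>x. norm (grad (\<phi> n) x) powr p \<partial>M) \<longlonglongrightarrow> (\<integral>x. norm (G x) powr p \<partial>M)"
    using W test_Lp e by (intro powr_tendsto) auto
  from tendsto_diff[OF tendsto_mult_left[OF this, of "1 / p"] lower_order_tendsto[OF W(3) test_Lp(1)[OF W(5) e(2)] W(6)]]
  show ?thesis unfolding energy_def by (simp add: algebra_simps)
qed

lemma energy_coercive:
  assumes "0 < \<alpha>" "0 < \<beta>"
  obtains c K where "0 < c" "\<And>u G. u \<in> Lp g M \<Longrightarrow>
    1 / p * (\<integral>x. norm (G x) powr p \<partial>M) + c * (\<integral>x. norm (u x) powr g \<partial>M) - K \<le> J \<alpha> \<beta> u G"
proof -
  interpret finite_measure M by (rule finite_M)
  have e: "0 < q" "0 < g" "q \<le> g" "q < g" using exponents by auto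
  from coefficients(1) obtain A where A: "0 < A" "a \<in> borel_measurable M" "AE x in M. \<bar>a x\<bar> \<le> A" by (rule LinftyE)
  \<comment> \<open>\<open>c\<close> is half of what the lower bound of b provides. \<open>T\<close>
    is tuned so that, up to the constant \<open>K\<close>, the a-term consumes exactly
    \<open>c\<close> times the integral of |u|^g.\<close>
  define c where "c = \<beta> * \<sigma> / (2 * g)"
  have c: "0 < c" using assms coefficients e by (simp add: c_def)
  define T where "T = (c * q / (\<alpha> * A)) powr (1 / (q - g))"
  have T: "0 < T" "T powr (q - g) = c * q / (\<alpha> * A)"
    using c e assms A by (auto simp: T_def powr_powr)
  define K where "K = \<alpha> / q * A * T powr q * measure M (space M)"
  show thesis
  proof (rule that[OF c, of K])
    fix u :: "'a \<Rightarrow> real" and G :: "'a \<Rightarrow> 'a" assume u: "u \<in> Lp g M"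
    have uq: "u \<in> Lp q M" by (rule Lp_mono[OF finite_M e(1,3) u])
    have ia: "integrable M (\<lambda>x. a x * norm (u x) powr q)" "integrable M (\<lambda>x. b x * norm (u x) powr g)"
      "integrable M (\<lambda>x. norm (u x) powr g)"
      using Linfty_weighted_integrable[OF coefficients(1) uq] Linfty_weighted_integrable[OF coefficients(2) u] LpD(2)[OF u]
      by auto
    have "\<alpha> / q * (\<integral>x. a x * norm (u x) powr q \<partial>M) = (\<integral>x. \<alpha> / q * (a x * norm (u x) powr q) \<partial>M)" by simp
    also have "\<dots> \<le> (\<integral>x. \<alpha> / q * A * T powr q + c * norm (u x) powr g \<partial>M)"
    proof (rule integral_mono_AE)
      show "AE x in M. \<alpha> / q * (a x * norm (u x) powr q) \<le> \<alpha> / q * A * T powr q + c * norm (u x) powr g"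
        using A(3)
      proof eventually_elim
        case (elim x)
        have "\<alpha> / q * (a x * norm (u x) powr q) \<le> \<alpha> / q * (A * norm (u x) powr q)"
          using elim assms e by (intro mult_left_mono mult_right_mono) auto
        also have "\<dots> \<le> \<alpha> / q * (A * (T powr q + T powr (q - g) * norm (u x) powr g))"
          using assms e A T by (intro mult_left_mono powr_le_threshold) auto
        also have "\<dots> = \<alpha> / q * A * T powr q + c * norm (u x) powr g"
          unfolding T(2) using assms e A by (simp add: field_simps)
        finally show ?case .
      qed
    qed (use ia in auto)
    also have "\<dots> = K + c * (\<integral>x. norm (u x) powr g \<partial>M)" using ia by (simp add: K_def)
    finally have 1: "\<alpha> / q * (\<integral>x. a x * norm (u x) powr q \<partial>M) \<le> K + c * (\<integral>x. norm (u x) powr g \<partial>M)" .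
    have "2 * c * (\<integral>x. norm (u x) powr g \<partial>M) = \<beta> / g * (\<integral>x. \<sigma> * norm (u x) powr g \<partial>M)"
      using e by (simp add: c_def)
    also have "\<dots> \<le> \<beta> / g * (\<integral>x. b x * norm (u x) powr g \<partial>M)"
    proof (intro mult_left_mono integral_mono_AE)
      show "AE x in M. \<sigma> * norm (u x) powr g \<le> b x * norm (u x) powr g"
        using coefficients(5) by eventually_elim (auto intro: mult_right_mono)
    qed (use ia e assms in auto)
    finally have 2: "2 * c * (\<integral>x. norm (u x) powr g \<partial>M) \<le> \<beta> / g * (\<integral>x. b x * norm (u x) powr g \<partial>M)" .
    show "1 / p * (\<integral>x. norm (G x) powr p \<partial>M) + c * (\<integral>x. norm (u x) powr g \<partial>M) - K \<le> J \<alpha> \<beta> u G"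
      unfolding energy_def using 1 2 by linarith
  qed
qed

end

section \<open>Existence of a global minimizer\<close>

context p_laplace_problem begin

text \<open>Sobolev bounds the L^s integrals of the differences for some s above g. The threshold
  \<open>T\<close> first makes the L^s term at most e/2; the Cauchy property in L^p then handles the
  other term.\<close>

lemma interpolation_cauchy:
  assumes \<psi>: "\<And>n. \<psi> n \<in> test_functions \<Omega>"
    and B: "\<And>n. (\<integral>x. norm (\<psi> n x) powr p \<partial>M) + (\<integral>x. norm (grad (\<psi> n) x) powr p \<partial>M) \<le> B"
    and cauchy: "\<And>e. 0 < e \<Longrightarrow> \<exists>N. \<forall>m\<ge>N. \<forall>n\<ge>N. (\<integral>x. norm (\<psi> m x - \<psi> n x) powr p \<partial>M) \<le> e"
    and e: "0 < e"
  shows "\<exists>N. \<forall>m\<ge>N. \<forall>n\<ge>N. (\<integral>x. norm (\<psi> m x - \<psi> n x) powr g \<partial>M) \<le> e"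
proof -
  have ex: "0 < p" "p \<le> g" "0 < g" using exponents by auto
  obtain s where s: "g < s" "ereal s < critical_exponent p DIM('a)"
    using critical_exponent_gap[OF exponents(4)] by blast
  have ps: "p \<le> s" using s ex by simp
  obtain C where C: "0 \<le> C" "\<And>\<phi> k. \<phi> \<in> test_functions \<Omega> \<Longrightarrow> 0 < k \<Longrightarrow>
    (\<integral>x. norm (\<phi> x) powr p \<partial>M) + (\<integral>x. norm (grad \<phi> x) powr p \<partial>M) \<le> k powr p \<Longrightarrow>
    (\<integral>x. norm (\<phi> x) powr s \<partial>M) \<le> C * k powr s" by (rule sobolev_test[OF ps s(2)]) (rule that)
  define k where "k = (\<bar>B\<bar> + 1) powr (1 / p)"
  have k: "0 < k" "k powr p = \<bar>B\<bar> + 1" using ex by (auto simp: k_def powr_powr)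
  have bs: "(\<integral>x. norm (\<psi> n x) powr s \<partial>M) \<le> C * k powr s" for n
    using C(2)[OF \<psi> k(1)] B[of n] k(2) by simp
  define D where "D = 2 powr s * (C * k powr s + C * k powr s)"
  have D: "0 \<le> D" using C by (simp add: D_def)
  have s0: "0 < s" using ps ex by simp
  note tL = test_Lp(1)[OF \<psi>]
  have ds: "(\<integral>x. norm (\<psi> m x - \<psi> n x) powr s \<partial>M) \<le> D" for m n
  proof -
    have "(\<integral>x. norm (\<psi> m x - \<psi> n x) powr s \<partial>M) \<le> (\<integral>x. 2 powr s * (norm (\<psi> m x) powr s + norm (\<psi> n x) powr s) \<partial>M)"
      using LpD(2)[OF tL[OF s0]] LpD(2)[OF Lp_diff[OF s0 tL[OF s0] tL[OF s0]]] norm_add_powr_le[OF s0, of _ "- \<psi> n _"]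
      by (intro integral_mono) auto
    also have "\<dots> = 2 powr s * ((\<integral>x. norm (\<psi> m x) powr s \<partial>M) + (\<integral>x. norm (\<psi> n x) powr s \<partial>M))"
      using LpD(2)[OF tL[OF s0]] by simp
    also have "\<dots> \<le> D" unfolding D_def by (intro mult_left_mono add_mono bs) auto
    finally show ?thesis .
  qed
  define T where "T = (2 * (D + 1) / e) powr (1 / (s - g))"
  have T: "0 < T" "T powr (g - s) = e / (2 * (D + 1))"
  proof -
    show "0 < T" using D e by (simp add: T_def)
    have "1 / (s - g) * (g - s) = - 1" using s by (simp add: field_simps)
    then have "T powr (g - s) = (2 * (D + 1) / e) powr (- 1)" by (simp only: T_def powr_powr)
    also have "\<dots> = e / (2 * (D + 1))" using D e by (simp add: powr_minus_divide)
    finally show "T powr (g - s) = e / (2 * (D + 1))" .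
  qed
  define \<eta> where "\<eta> = e / (2 * T powr (g - p))"
  have \<eta>: "0 < \<eta>" using e T by (simp add: \<eta>_def)
  from cauchy[OF \<eta>] obtain N where N: "\<And>m n. N \<le> m \<Longrightarrow> N \<le> n \<Longrightarrow> (\<integral>x. norm (\<psi> m x - \<psi> n x) powr p \<partial>M) \<le> \<eta>" by blast
  show ?thesis
  proof (intro exI[of _ N] allI impI)
    fix m n assume mn: "N \<le> m" "N \<le> n"
    have L: "(\<lambda>x. \<psi> m x - \<psi> n x) \<in> Lp r M" if "0 < r" for r using that by (intro Lp_diff tL)
    have "(\<integral>x. norm (\<psi> m x - \<psi> n x) powr g \<partial>M)
       \<le> (\<integral>x. T powr (g - p) * norm (\<psi> m x - \<psi> n x) powr p + T powr (g - s) * norm (\<psi> m x - \<psi> n x) powr s \<partial>M)"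
      using T ex s LpD(2)[OF L[OF ex(1)]] LpD(2)[OF L[OF s0]] LpD(2)[OF L[OF ex(3)]]
      by (intro integral_mono powr_le_interpolate) auto
    also have "\<dots> = T powr (g - p) * (\<integral>x. norm (\<psi> m x - \<psi> n x) powr p \<partial>M) + T powr (g - s) * (\<integral>x. norm (\<psi> m x - \<psi> n x) powr s \<partial>M)"
      using LpD(2)[OF L[OF ex(1)]] LpD(2)[OF L[OF s0]] by simp
    also have "\<dots> \<le> T powr (g - p) * \<eta> + T powr (g - s) * D"
      by (intro add_mono mult_left_mono N mn ds) auto
    also have "\<dots> \<le> e / 2 + e / 2 * 1"
    proof (intro add_mono)
      show "T powr (g - p) * \<eta> \<le> e / 2" using T by (simp add: \<eta>_def)
      have "T powr (g - s) * D = e / 2 * (D / (D + 1))" unfolding T by simp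
      also have "\<dots> \<le> e / 2 * 1" using e D by (intro mult_left_mono) auto
      finally show "T powr (g - s) * D \<le> e / 2 * 1" .
    qed
    finally show "(\<integral>x. norm (\<psi> m x - \<psi> n x) powr g \<partial>M) \<le> e" by simp
  qed
qed

text \<open>The midpoint of two late members is a test function, so its energy is at least m, while
  its lower-order part is close to that of u. Its gradient integral is thus nearly as large as
  theirs, and uniform convexity forces the two gradients together.\<close>

lemma gradient_cauchy:
  assumes \<psi>: "\<And>n. \<psi> n \<in> test_functions \<Omega>" and u: "u \<in> Lp g M"
    and lim: "(\<lambda>n. \<integral>x. norm (u x - \<psi> n x) powr g \<partial>M) \<longlonglongrightarrow> 0"
    and m: "\<And>\<phi>. \<phi> \<in> test_functions \<Omega> \<Longrightarrow> m \<le> J \<alpha> \<beta> \<phi> (grad \<phi>)"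
    and J: "(\<lambda>n. J \<alpha> \<beta> (\<psi> n) (grad (\<psi> n))) \<longlonglongrightarrow> m"
    and e: "0 < e"
  shows "\<exists>N. \<forall>i\<ge>N. \<forall>j\<ge>N. (\<integral>x. norm (grad (\<psi> i) x - grad (\<psi> j) x) powr p \<partial>M) \<le> e"
proof -
  have ex: "0 < p" "0 < g" "1 < p" using exponents by auto
  let ?F = "sequentially \<times>\<^sub>F sequentially"
  define Q where "Q v = \<alpha> / q * (\<integral>x. a x * norm (v x) powr q \<partial>M) - \<beta> / g * (\<integral>x. b x * norm (v x) powr g \<partial>M)"
    for v :: "'a \<Rightarrow> real"
  define I where "I n = (\<integral>x. norm (grad (\<psi> n) x) powr p \<partial>M)" for n
  have JQ: "J \<alpha> \<beta> v G = 1 / p * (\<integral>x. norm (G x) powr p \<partial>M) - Q v" for v G by (simp add: energy_def Q_def)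
  note tL = test_Lp[OF \<psi>]
  \<comment> \<open>The limit of the gradient integrals, as forced by the limits of the energy and
    of its lower-order part.\<close>
  define L where "L = p * (m + Q u)"
  have Qn: "(\<lambda>n. Q (\<psi> n)) \<longlonglongrightarrow> Q u"
    unfolding Q_def by (rule lower_order_tendsto[OF u tL(1)[OF ex(2)] lim])
  have "(\<lambda>n. p * (J \<alpha> \<beta> (\<psi> n) (grad (\<psi> n)) + Q (\<psi> n))) \<longlonglongrightarrow> L"
    unfolding L_def by (intro tendsto_intros J Qn)
  then have I: "I \<longlonglongrightarrow> L" using ex by (simp add: JQ I_def[abs_def])
  have L0: "0 \<le> L" by (rule tendsto_lowerbound[OF I]) (auto simp: I_def)
  define mid where "mid z x = (1 / 2) * \<psi> (fst z) x + (1 / 2) * \<psi> (snd z) x" for z x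
  have mt: "mid z \<in> test_functions \<Omega>" for z
    unfolding mid_def[abs_def] by (intro test_functions_add test_functions_cmult \<psi>)
  have gm: "grad (mid z) x = (grad (\<psi> (fst z)) x + grad (\<psi> (snd z)) x) /\<^sub>R 2" for z x
    unfolding mid_def[abs_def] grad_add[OF test_functions_C1c[OF test_functions_cmult[OF \<psi>]] test_functions_C1c[OF test_functions_cmult[OF \<psi>]]]
      grad_cmult[OF test_functions_C1c[OF \<psi>]] by (simp add: scaleR_add_right)
  have half: "(\<lambda>n. \<integral>x. norm ((1 / 2) * (u x - \<psi> n x)) powr g \<partial>M) \<longlonglongrightarrow> 0"
    using tendsto_mult_left[OF lim, of "(1 / 2) powr g"] by (simp add: abs_mult powr_mult powr_divide)
  have "((\<lambda>z. \<integral>x. norm ((1 / 2) * (u x - \<psi> (fst z) x) + (1 / 2) * (u x - \<psi> (snd z) x)) powr g \<partial>M) \<longlongrightarrow> 0) ?F"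
    by (rule powr_add_tendsto_0[OF ex(2)])
      (use u tL ex filterlim_compose[OF half filterlim_fst] filterlim_compose[OF half filterlim_snd]
        in \<open>auto intro!: always_eventually Lp_cmult[where c="1/2", simplified] Lp_diff\<close>)
  moreover have "(1 / 2) * (u x - \<psi> (fst z) x) + (1 / 2) * (u x - \<psi> (snd z) x) = u x - mid z x" for z x
    by (simp add: mid_def field_simps)
  ultimately have "((\<lambda>z. \<integral>x. norm (u x - mid z x) powr g \<partial>M) \<longlongrightarrow> 0) ?F" by simp
  from lower_order_tendsto[OF u test_Lp(1)[OF mt ex(2)] this, of \<alpha> \<beta>]
  have Qm: "((\<lambda>z. Q (mid z)) \<longlongrightarrow> Q u) ?F" by (simp add: Q_def)
  define \<epsilon> where "\<epsilon> = e / (4 * (L + 1))"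
  have \<epsilon>: "0 < \<epsilon>" using e L0 by (simp add: \<epsilon>_def)
  from norm_powr_uniformly_convex[OF ex(3) \<epsilon>, where ?'b='a] obtain C where C: "0 \<le> C"
    "\<And>x y::'a. norm (x - y) powr p \<le> \<epsilon> * (norm x powr p + norm y powr p) + C * ((norm x powr p + norm y powr p) / 2 - norm ((x + y) /\<^sub>R 2) powr p)"
    by blast
  \<comment> \<open>\<open>S\<close> bounds the gradient difference by means of the energy bound at
    the midpoint. In the limit the bracket multiplied by \<open>C\<close> becomes L - p (m + Q u) =
    0, so only the term with \<epsilon> survives.\<close>
  define S where "S z = \<epsilon> * (I (fst z) + I (snd z)) + C * ((I (fst z) + I (snd z)) / 2 - p * (m + Q (mid z)))" for z
  have "(S \<longlongrightarrow> \<epsilon> * (L + L) + C * ((L + L) / 2 - p * (m + Q u))) ?F"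
    unfolding S_def by (intro tendsto_intros Qm filterlim_compose[OF I filterlim_fst] filterlim_compose[OF I filterlim_snd]) simp
  moreover have "\<epsilon> * (L + L) + C * ((L + L) / 2 - p * (m + Q u)) < e"
  proof -
    have "\<epsilon> * (L + L) = e / 2 * (L / (L + 1))" using L0 by (simp add: \<epsilon>_def field_simps)
    also have "\<dots> \<le> e / 2 * 1" using e L0 by (intro mult_left_mono) auto
    finally show ?thesis using e by (simp add: L_def)
  qed
  ultimately have "\<forall>\<^sub>F z in ?F. S z < e" by (rule order_tendstoD)
  then obtain N where N: "\<And>i j. N \<le> i \<Longrightarrow> N \<le> j \<Longrightarrow> S (i, j) < e"
    unfolding eventually_prod_sequentially by auto
  show ?thesis
  proof (intro exI[of _ N] allI impI)
    fix i j assume ij: "N \<le> i" "N \<le> j"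
    have i1: "integrable M (\<lambda>x. norm (grad (\<psi> n) x) powr p)" for n using LpD(2)[OF tL(2)[OF ex(1)]] .
    have i2: "integrable M (\<lambda>x. norm ((grad (\<psi> i) x + grad (\<psi> j) x) /\<^sub>R 2) powr p)"
      using LpD(2)[OF test_Lp(2)[OF mt[of "(i, j)"] ex(1)]] by (simp only: gm fst_conv snd_conv)
    have "(\<integral>x. norm (grad (\<psi> i) x - grad (\<psi> j) x) powr p \<partial>M)
      \<le> (\<integral>x. \<epsilon> * (norm (grad (\<psi> i) x) powr p + norm (grad (\<psi> j) x) powr p)
        + C * ((norm (grad (\<psi> i) x) powr p + norm (grad (\<psi> j) x) powr p) / 2 - norm ((grad (\<psi> i) x + grad (\<psi> j) x) /\<^sub>R 2) powr p) \<partial>M)"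
      using i1 i2 LpD(2)[OF Lp_diff[OF ex(1) tL(2)[OF ex(1)] tL(2)[OF ex(1)]]] by (intro integral_mono C(2)) auto
    also have "\<dots> = \<epsilon> * (I i + I j) + C * ((I i + I j) / 2 - (\<integral>x. norm ((grad (\<psi> i) x + grad (\<psi> j) x) /\<^sub>R 2) powr p \<partial>M))"
      using i1 i2 by (simp add: I_def del: norm_scaleR)
    also have "\<dots> \<le> S (i, j)"
    proof -
      have "m \<le> 1 / p * (\<integral>x. norm (grad (mid (i, j)) x) powr p \<partial>M) - Q (mid (i, j))"
        using m[OF mt] by (simp only: JQ)
      then have "p * (m + Q (mid (i, j))) \<le> (\<integral>x. norm ((grad (\<psi> i) x + grad (\<psi> j) x) /\<^sub>R 2) powr p \<partial>M)"
        using ex by (simp only: gm fst_conv snd_conv) (simp add: field_simps)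
      then show ?thesis unfolding S_def using C(1) by (simp add: mult_left_mono)
    qed
    finally show "(\<integral>x. norm (grad (\<psi> i) x - grad (\<psi> j) x) powr p \<partial>M) \<le> e" using N[OF ij] by simp
  qed
qed

lemma energy_minimum_attained:
  assumes \<alpha>\<beta>: "0 < \<alpha>" "0 < \<beta>"
  obtains u G \<phi> where "W0 p \<Omega> u G \<phi>" "\<And>v H \<psi>. W0 p \<Omega> v H \<psi> \<Longrightarrow> J \<alpha> \<beta> u G \<le> J \<alpha> \<beta> v H"
proof -
  interpret finite_measure M by (rule finite_M)
  have ex: "0 < p" "0 < g" "1 < p" "p \<le> g" using exponents by auto
  obtain c K where c: "0 < c" "\<And>u G. u \<in> Lp g M \<Longrightarrow>
    1 / p * (\<integral>x. norm (G x) powr p \<partial>M) + c * (\<integral>x. norm (u x) powr g \<partial>M) - K \<le> J \<alpha> \<beta> u G"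
    using energy_coercive[OF \<alpha>\<beta>] by blast
  \<comment> \<open>The infimum is taken over test functions alone; convergence of the energy along
    approximating sequences extends the lower bound to all of \<open>W0\<close>.\<close>
  define V where "V = (\<lambda>\<phi>. J \<alpha> \<beta> \<phi> (grad \<phi>)) ` test_functions \<Omega>"
  have low: "- K \<le> J \<alpha> \<beta> u G" if "u \<in> Lp g M" for u G
  proof -
    have "0 \<le> 1 / p * (\<integral>x. norm (G x) powr p \<partial>M) + c * (\<integral>x. norm (u x) powr g \<partial>M)" using c ex by simp
    then show ?thesis using c(2)[OF that, of G] by linarith
  qed
  have bV: "bdd_below V" unfolding V_def using low test_Lp ex by (intro bdd_belowI2[of _ "- K"]) auto
  have nV: "V \<noteq> {}" unfolding V_def using test_functions_zero by blast
  define m where "m = Inf V"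
  have m: "m \<le> J \<alpha> \<beta> \<phi> (grad \<phi>)" if "\<phi> \<in> test_functions \<Omega>" for \<phi>
    unfolding m_def using that bV by (intro cInf_lower) (auto simp: V_def)
  have "\<exists>\<phi>\<in>test_functions \<Omega>. J \<alpha> \<beta> \<phi> (grad \<phi>) < m + inverse (real (Suc n))" for n
    using cInf_less_iff[OF nV bV, of "m + inverse (real (Suc n))"] by (auto simp: V_def m_def)
  then obtain f where f: "\<And>n. f n \<in> test_functions \<Omega>" "\<And>n. J \<alpha> \<beta> (f n) (grad (f n)) < m + inverse (real (Suc n))"
    by metis
  have inv1: "inverse (real (Suc n)) \<le> 1" for n by (simp add: field_simps)
  \<comment> \<open>All energies are below m + 1, so coercivity bounds the gradient integral and the
    L^g integral by multiples of m + 1 + K; the measure of the domain enters through t^p <= 1 +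
    t^g.\<close>
  define Y where "Y = measure M (space M) + (m + 1 + K) / c + p * (m + 1 + K)"
  have bound: "(\<integral>x. norm (f n x) powr p \<partial>M) + (\<integral>x. norm (grad (f n) x) powr p \<partial>M) \<le> Y" for n
  proof -
    define A where "A = (\<integral>x. norm (grad (f n) x) powr p \<partial>M)"
    define B where "B = (\<integral>x. norm (f n x) powr g \<partial>M)"
    have AB: "0 \<le> A" "0 \<le> B" by (auto simp: A_def B_def)
    have "1 / p * A + c * B \<le> m + 1 + K"
      using c(2)[OF test_Lp(1)[OF f(1)[of n] ex(2)], of "grad (f n)"] f(2)[of n] inv1[of n] by (simp add: A_def B_def)
    moreover have "0 \<le> 1 / p * A" "0 \<le> c * B" using AB c ex by auto
    ultimately have "1 / p * A \<le> m + 1 + K" "c * B \<le> m + 1 + K" by linarith+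
    then have A: "A \<le> p * (m + 1 + K)" and B: "B \<le> (m + 1 + K) / c" using ex c by (auto simp: field_simps)
    have "(\<integral>x. norm (f n x) powr p \<partial>M) \<le> (\<integral>x. 1 powr p + 1 powr (p - g) * norm (f n x) powr g \<partial>M)"
      using ex LpD(2)[OF test_Lp(1)[OF f(1)[of n] ex(2)]] LpD(2)[OF test_Lp(1)[OF f(1)[of n] ex(1)]]
      by (intro integral_mono powr_le_threshold) auto
    also have "\<dots> = measure M (space M) + B"
      using LpD(2)[OF test_Lp(1)[OF f(1)[of n] ex(2)]] by (simp add: B_def)
    finally show ?thesis using A B unfolding Y_def A_def by linarith
  qed
  obtain R where R: "0 < R" "\<And>\<phi> x. \<phi> \<in> test_functions \<Omega> \<Longrightarrow> R < norm x \<Longrightarrow> \<phi> x = 0" using radius by blast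
  obtain k :: "nat \<Rightarrow> nat" where k: "strict_mono k"
    "\<And>e. 0 < e \<Longrightarrow> \<exists>N. \<forall>m\<ge>N. \<forall>n\<ge>N. (\<integral>x. \<bar>f (k m) x - f (k n) x\<bar> powr p \<partial>lborel) \<le> e"
  proof (rule rellich[of p f R Y])
    show "(\<integral>x. \<bar>f n x\<bar> powr p \<partial>lborel) + (\<integral>x. norm (grad (f n) x) powr p \<partial>lborel) \<le> Y" for n
      using bound[of n] test_functions_Lp(3,4)[OF \<Omega>(1) f(1) ex(1)] by simp
  qed (use ex test_functions_C1c[OF f(1)] R(2)[OF f(1)] in auto)
  define \<psi> where "\<psi> n = f (k n)" for n
  have \<psi>: "\<psi> n \<in> test_functions \<Omega>" for n by (simp add: \<psi>_def f)
  have cp: "\<exists>N. \<forall>m\<ge>N. \<forall>n\<ge>N. (\<integral>x. norm (\<psi> m x - \<psi> n x) powr p \<partial>M) \<le> e" if "0 < e" for e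
    using k(2)[OF that] test_functions_Lp(3)[OF \<Omega>(1) test_functions_diff[OF \<psi> \<psi>] ex(1)] by (simp add: \<psi>_def)
  have cg: "\<exists>N. \<forall>m\<ge>N. \<forall>n\<ge>N. (\<integral>x. norm (\<psi> m x - \<psi> n x) powr g \<partial>M) \<le> e" if "0 < e" for e
    by (rule interpolation_cauchy[OF \<psi> _ cp that, of Y]) (use bound in \<open>simp add: \<psi>_def\<close>)
  obtain u where u: "u \<in> Lp g M" "(\<lambda>n. \<integral>x. norm (u x - \<psi> n x) powr g \<partial>M) \<longlonglongrightarrow> 0"
    using Lp_complete[of g \<psi> M] cg test_Lp(1)[OF \<psi>] ex by blast
  have Jm: "(\<lambda>n. J \<alpha> \<beta> (\<psi> n) (grad (\<psi> n))) \<longlonglongrightarrow> m"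
  proof (rule tendsto_sandwich[OF _ _ tendsto_const])
    show "\<forall>\<^sub>F n in sequentially. m \<le> J \<alpha> \<beta> (\<psi> n) (grad (\<psi> n))" using m \<psi> by simp
    show "\<forall>\<^sub>F n in sequentially. J \<alpha> \<beta> (\<psi> n) (grad (\<psi> n)) \<le> m + inverse (real (Suc n))"
    proof (intro always_eventually allI)
      fix n
      have "n \<le> k n" by (rule seq_suble[OF k(1)])
      then have "inverse (real (Suc (k n))) \<le> inverse (real (Suc n))" by (intro le_imp_inverse_le) auto
      then show "J \<alpha> \<beta> (\<psi> n) (grad (\<psi> n)) \<le> m + inverse (real (Suc n))" using f(2)[of "k n"] unfolding \<psi>_def by linarith
    qed
    show "(\<lambda>n. m + inverse (real (Suc n))) \<longlonglongrightarrow> m"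
      using tendsto_add[OF tendsto_const LIMSEQ_inverse_real_of_nat, of m] by simp
  qed
  have cgr: "\<exists>N. \<forall>i\<ge>N. \<forall>j\<ge>N. (\<integral>x. norm (grad (\<psi> i) x - grad (\<psi> j) x) powr p \<partial>M) \<le> e" if "0 < e" for e
    by (rule gradient_cauchy[OF \<psi> u m Jm that])
  obtain G where G: "G \<in> Lp p M" "(\<lambda>n. \<integral>x. norm (G x - grad (\<psi> n) x) powr p \<partial>M) \<longlonglongrightarrow> 0"
    using Lp_complete[of p "\<lambda>n. grad (\<psi> n)" M] cgr test_Lp(2)[OF \<psi>] ex by blast
  have up: "u \<in> Lp p M" by (rule Lp_mono[OF finite_M ex(1,4) u(1)])
  have "(\<lambda>n. \<integral>x. norm (u x - \<psi> n x) powr p \<partial>M) \<longlonglongrightarrow> 0"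
    by (rule Lp_tendsto_mono[OF finite_M ex(1,4) _ u(2)])
      (use u test_Lp(1)[OF \<psi>] ex in \<open>auto intro!: always_eventually Lp_diff\<close>)
  then have W: "W0 p \<Omega> u G \<psi>" using up G \<psi> by (simp add: W0_def)
  have Ju: "J \<alpha> \<beta> u G = m" using energy_tendsto[OF W] Jm by (rule LIMSEQ_unique)
  show thesis
  proof (rule that[OF W])
    fix v H \<phi> assume W: "W0 p \<Omega> v H \<phi>"
    have "m \<le> J \<alpha> \<beta> v H"
      by (rule tendsto_lowerbound[OF energy_tendsto[OF W]]) (use m W0_Lp(5)[OF W] in auto)
    then show "J \<alpha> \<beta> u G \<le> J \<alpha> \<beta> v H" by (simp add: Ju)
  qed
qed

section \<open>Ground states are the global minimizers\<close>

abbreviation E where "E \<alpha> \<beta> u \<equiv> J \<alpha> \<beta> u (weak_gradient \<Omega> u)"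

definition minimizer :: "real \<Rightarrow> real \<Rightarrow> ('a \<Rightarrow> real) \<Rightarrow> bool" where
  "minimizer \<alpha> \<beta> u \<longleftrightarrow> u \<in> W1p_0 p \<Omega> \<and> (\<forall>v\<in>W1p_0 p \<Omega>. E \<alpha> \<beta> u \<le> E \<alpha> \<beta> v)"

lemma energy_weak_gradient:
  assumes "W0 p \<Omega> u G \<phi>"
  shows "E \<alpha> \<beta> u = J \<alpha> \<beta> u G"
  using weak_gradient_Lp(2)[OF \<Omega> W0_has_weak_gradient[OF \<Omega> exponents(1) assms] W0_Lp(2)[OF assms]]
  by (simp add: energy_def)

lemma minimizer_exists:
  assumes "0 < \<alpha>" "0 < \<beta>"
  shows "\<exists>u. minimizer \<alpha> \<beta> u"
proof -
  obtain u G \<phi> where u: "W0 p \<Omega> u G \<phi>" "\<And>v H \<psi>. W0 p \<Omega> v H \<psi> \<Longrightarrow> J \<alpha> \<beta> u G \<le> J \<alpha> \<beta> v H"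
    using energy_minimum_attained[OF assms] by blast
  have "E \<alpha> \<beta> u \<le> E \<alpha> \<beta> v" if v: "v \<in> W1p_0 p \<Omega>" for v
    using W1p_0_W0[OF \<Omega> exponents(1) v] u(2) unfolding energy_weak_gradient[OF u(1)] by blast
  then have "minimizer \<alpha> \<beta> u"
    unfolding minimizer_def using W0_W1p_0[OF \<Omega> exponents(1) u(1)] by blast
  then show ?thesis by blast
qed

lemma minimizer_critical_point:
  assumes \<alpha>\<beta>: "0 < \<alpha>" "0 < \<beta>" and u: "minimizer \<alpha> \<beta> u"
  shows "critical_point p \<Omega> (E \<alpha> \<beta>) u"
  unfolding critical_point_def
proof (intro conjI allI impI)
  have ex: "0 < p" "0 < g" "1 < p" "1 < g" "1 < q" "0 < q" using exponents by auto
  show u0: "u \<in> W1p_0 p \<Omega>" using u by (simp add: minimizer_def)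
  fix \<epsilon> :: real assume \<epsilon>: "0 < \<epsilon>"
  define G where "G = weak_gradient \<Omega> u"
  obtain \<phi> where W: "W0 p \<Omega> u G \<phi>" using W1p_0_W0[OF \<Omega> ex(3) u0] by (auto simp: G_def)
  note uL = W0_Lp[OF W]
  obtain C where C: "0 \<le> C" "\<forall>u G \<phi>. W0 p \<Omega> u G \<phi> \<longrightarrow>
      u \<in> Lp g M \<and> (\<lambda>n. \<integral>x. norm (u x - \<phi> n x) powr g \<partial>M) \<longlonglongrightarrow> 0 \<and>
      (\<forall>k>0. (\<integral>x. norm (u x) powr p \<partial>M) + (\<integral>x. norm (G x) powr p \<partial>M) \<le> k powr p \<longrightarrow>
         (\<integral>x. norm (u x) powr g \<partial>M) \<le> C * k powr g)"
    using sobolev_W0 by blast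
  \<comment> \<open>If the Sobolev norm of v is at most K, its L^g norm is at most S K;
    \<open>d\<close> is chosen accordingly so that both second-difference estimates apply.\<close>
  define S where "S = (C + 1) powr (1 / g)"
  have S: "0 < S" "S powr g = C + 1" using C ex by (auto simp: S_def powr_powr)
  \<comment> \<open>In the energy these tolerances are multiplied by 1/p and \<beta>/g, the second
    one with S K in place of K, and then contribute \<epsilon> K / 2 each.\<close>
  have "0 < p * \<epsilon> / 2" "0 < g * \<epsilon> / (2 * \<beta> * S)" using \<epsilon> ex \<alpha>\<beta> S by auto
  from second_difference_integral[OF ex(3) uL(2) Linfty_1 _ this(1)] second_difference_integral[OF ex(4) uL(3) coefficients(2) b_nonneg this(2)]
  obtain d1 d2 where d1: "0 < d1" "\<And>K h. 0 < K \<Longrightarrow> K < d1 \<Longrightarrow> h \<in> Lp p M \<Longrightarrow> (\<integral>x. norm (h x) powr p \<partial>M) \<le> K powr p \<Longrightarrow>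
      (\<integral>x. 1 * norm (G x + h x) powr p \<partial>M) + (\<integral>x. 1 * norm (G x - h x) powr p \<partial>M) - 2 * (\<integral>x. 1 * norm (G x) powr p \<partial>M) \<le> p * \<epsilon> / 2 * K"
    and d2: "0 < d2" "\<And>K h. 0 < K \<Longrightarrow> K < d2 \<Longrightarrow> h \<in> Lp g M \<Longrightarrow> (\<integral>x. norm (h x) powr g \<partial>M) \<le> K powr g \<Longrightarrow>
      (\<integral>x. b x * norm (u x + h x) powr g \<partial>M) + (\<integral>x. b x * norm (u x - h x) powr g \<partial>M) - 2 * (\<integral>x. b x * norm (u x) powr g \<partial>M) \<le> g * \<epsilon> / (2 * \<beta> * S) * K"
    by auto
  define d where "d = min d1 (d2 / S)"
  have d: "0 < d" "d \<le> d1" "d * S \<le> d2" using d1 d2 S by (auto simp: d_def min_def field_simps)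
  show "\<exists>\<delta>>0. \<forall>v\<in>W1p_0 p \<Omega>. W1p_norm p \<Omega> v < \<delta> \<longrightarrow> \<bar>E \<alpha> \<beta> (\<lambda>x. u x + v x) - E \<alpha> \<beta> u\<bar> \<le> \<epsilon> * W1p_norm p \<Omega> v"
  proof (intro exI[of _ d] conjI ballI impI d(1))
    fix v assume v0: "v \<in> W1p_0 p \<Omega>" and vd: "W1p_norm p \<Omega> v < d"
    define H where "H = weak_gradient \<Omega> v"
    obtain \<psi> where V: "W0 p \<Omega> v H \<psi>" using W1p_0_W0[OF \<Omega> ex(3) v0] by (auto simp: H_def)
    note vL = W0_Lp[OF V]
    note plus = W0_add_cmult[OF \<Omega>(1) ex(1) W V, of 1, simplified]
    note minus = W0_add_cmult[OF \<Omega>(1) ex(1) W V, of "-1", simplified]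
    have Ep: "E \<alpha> \<beta> (\<lambda>x. u x + v x) = J \<alpha> \<beta> (\<lambda>x. u x + v x) (\<lambda>x. G x + H x)" by (rule energy_weak_gradient[OF plus])
    have Em: "E \<alpha> \<beta> (\<lambda>x. u x - v x) = J \<alpha> \<beta> (\<lambda>x. u x - v x) (\<lambda>x. G x - H x)" by (rule energy_weak_gradient[OF minus])
    have lower: "E \<alpha> \<beta> u \<le> E \<alpha> \<beta> (\<lambda>x. u x + v x)" "E \<alpha> \<beta> u \<le> E \<alpha> \<beta> (\<lambda>x. u x - v x)"
      using u W0_W1p_0[OF \<Omega> ex(3) plus] W0_W1p_0[OF \<Omega> ex(3) minus] by (auto simp: minimizer_def)
    \<comment> \<open>Stated for positive K at least the norm, because functions vanishing almost
      everywhere have norm 0; for norm 0, K is sent to 0 afterwards.\<close>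
    have upper: "E \<alpha> \<beta> (\<lambda>x. u x + v x) - E \<alpha> \<beta> u \<le> \<epsilon> * K" if K: "W1p_norm p \<Omega> v \<le> K" "0 < K" "K < d" for K
    proof -
      have n: "(\<integral>x. norm (v x) powr p \<partial>M) + (\<integral>x. norm (H x) powr p \<partial>M) \<le> K powr p"
        unfolding H_def W1p_norm_powr[OF ex(1), symmetric] using K ex by (intro powr_mono2 W1p_norm_nonneg) auto
      have n0: "0 \<le> (\<integral>x. norm (v x) powr p \<partial>M)" by simp
      have "(\<integral>x. norm (v x) powr g \<partial>M) \<le> C * K powr g" using C(2) V n K by blast
      also have "\<dots> \<le> (S * K) powr g" unfolding powr_mult S(2) by (intro mult_right_mono) auto
      finally have ng: "(\<integral>x. norm (v x) powr g \<partial>M) \<le> (S * K) powr g" .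
      have SK: "S * K < d2"
      proof -
        have "S * K < S * d" using K S by simp
        then show ?thesis using d by (simp add: mult.commute)
      qed
      have 1: "(\<integral>x. norm (G x + H x) powr p \<partial>M) + (\<integral>x. norm (G x - H x) powr p \<partial>M) - 2 * (\<integral>x. norm (G x) powr p \<partial>M) \<le> p * \<epsilon> / 2 * K"
        using d1(2)[of K H] K d vL n n0 by simp
      have 2: "(\<integral>x. b x * norm (u x + v x) powr g \<partial>M) + (\<integral>x. b x * norm (u x - v x) powr g \<partial>M) - 2 * (\<integral>x. b x * norm (u x) powr g \<partial>M) \<le> g * \<epsilon> / (2 * \<beta> * S) * (S * K)"
        using d2(2)[of "S * K" v] K S SK vL ng by simp
      have 3: "2 * (\<integral>x. a x * norm (u x) powr q \<partial>M) \<le> (\<integral>x. a x * norm (u x + v x) powr q \<partial>M) + (\<integral>x. a x * norm (u x - v x) powr q \<partial>M)"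
        by (rule convexity_integral[OF ex(5) uL(4) vL(4) coefficients(1,3)])
      have h1: "1 / p * ((\<integral>x. norm (G x + H x) powr p \<partial>M) + (\<integral>x. norm (G x - H x) powr p \<partial>M) - 2 * (\<integral>x. norm (G x) powr p \<partial>M)) \<le> \<epsilon> / 2 * K"
        using mult_left_mono[OF 1, of "1 / p"] ex by simp
      have h2: "\<beta> / g * ((\<integral>x. b x * norm (u x + v x) powr g \<partial>M) + (\<integral>x. b x * norm (u x - v x) powr g \<partial>M) - 2 * (\<integral>x. b x * norm (u x) powr g \<partial>M)) \<le> \<epsilon> / 2 * K"
        using mult_left_mono[OF 2, of "\<beta> / g"] ex \<alpha>\<beta> S by simp
      have h3: "\<alpha> / q * (2 * (\<integral>x. a x * norm (u x) powr q \<partial>M)) \<le> \<alpha> / q * ((\<integral>x. a x * norm (u x + v x) powr q \<partial>M) + (\<integral>x. a x * norm (u x - v x) powr q \<partial>M))"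
        using 3 ex \<alpha>\<beta> by (intro mult_left_mono) auto
      have "E \<alpha> \<beta> (\<lambda>x. u x + v x) + E \<alpha> \<beta> (\<lambda>x. u x - v x) - 2 * E \<alpha> \<beta> u \<le> \<epsilon> * K"
        unfolding Ep Em G_def[symmetric] using h1 h2 h3 unfolding energy_def by (simp only: distrib_left right_diff_distrib)
      \<comment> \<open>E(u - v) >= E(u) turns the bound on the second difference into one on E(u +
        v) - E(u).\<close>
      then show ?thesis using lower(2) by linarith
    qed
    have "E \<alpha> \<beta> (\<lambda>x. u x + v x) - E \<alpha> \<beta> u \<le> \<epsilon> * W1p_norm p \<Omega> v"
    proof (cases "W1p_norm p \<Omega> v = 0")
      case False
      then show ?thesis using upper[of "W1p_norm p \<Omega> v"] vd W1p_norm_nonneg[of p \<Omega> v] by simp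
    next
      case True
      have "E \<alpha> \<beta> (\<lambda>x. u x + v x) - E \<alpha> \<beta> u \<le> 0 + e" if e: "0 < e" for e
      proof -
        define K where "K = min (d / 2) (e / \<epsilon>)"
        have K: "0 < K" "K < d" "K \<le> e / \<epsilon>" using d e \<epsilon> by (auto simp: K_def)
        have "E \<alpha> \<beta> (\<lambda>x. u x + v x) - E \<alpha> \<beta> u \<le> \<epsilon> * K" using K True by (intro upper) auto
        also have "\<dots> \<le> e" using K(3) \<epsilon> by (simp add: field_simps)
        finally show ?thesis by simp
      qed
      then have "E \<alpha> \<beta> (\<lambda>x. u x + v x) - E \<alpha> \<beta> u \<le> 0" by (rule field_le_epsilon)
      then show ?thesis using True by simp
    qed
    then show "\<bar>E \<alpha> \<beta> (\<lambda>x. u x + v x) - E \<alpha> \<beta> u\<bar> \<le> \<epsilon> * W1p_norm p \<Omega> v" using lower(1) by simp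
  qed
qed

text \<open>A minimizer exists and is itself a critical point, so a critical point of least energy
  cannot lie above the global minimum.\<close>

lemma ground_state_iff_minimizer:
  assumes "0 < \<alpha>" "0 < \<beta>"
  shows "critical_point p \<Omega> (E \<alpha> \<beta>) u \<and> (\<forall>v. critical_point p \<Omega> (E \<alpha> \<beta>) v \<longrightarrow> E \<alpha> \<beta> u \<le> E \<alpha> \<beta> v) \<longleftrightarrow> minimizer \<alpha> \<beta> u"
    (is "?L \<longleftrightarrow> ?R")
proof
  assume L: ?L
  obtain w where w: "minimizer \<alpha> \<beta> w" using minimizer_exists[OF assms] by blast
  then have "E \<alpha> \<beta> u \<le> E \<alpha> \<beta> w" using L minimizer_critical_point[OF assms] by blast
  moreover have "u \<in> W1p_0 p \<Omega>" using L by (simp add: critical_point_def)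
  ultimately show ?R using w by (force simp: minimizer_def)
next
  assume R: ?R
  then show ?L using minimizer_critical_point[OF assms R] by (auto simp: minimizer_def critical_point_def)
qed

lemma ground_state_Q_iff: "0 < l \<Longrightarrow> ground_state_Q p q g \<Omega> a b l u \<longleftrightarrow> minimizer l 1 u"
proof -
  assume l: "0 < l"
  have "energy_Q p q g \<Omega> a b l = E l 1" by (rule ext) (simp add: energy_Q_def energy_def)
  then show ?thesis
    using ground_state_iff_minimizer[OF l zero_less_one, of u] by (simp add: ground_state_Q_def weak_solution_Q_def)
qed

lemma ground_state_R_iff: "0 < \<nu> \<Longrightarrow> ground_state_R p q g \<Omega> a b \<nu> u \<longleftrightarrow> minimizer 1 \<nu> u"
proof -
  assume l: "0 < \<nu>"
  have "energy_R p q g \<Omega> a b \<nu> = E 1 \<nu>" by (rule ext) (simp add: energy_R_def energy_def)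
  then show ?thesis
    using ground_state_iff_minimizer[OF zero_less_one l, of u] by (simp add: ground_state_R_def weak_solution_R_def)
qed

end

section \<open>Density of the test functions\<close>

text \<open>The recursion encodes \<open>1 - cutoff f n = \<Prod>k<n. 1 - f k\<close>.\<close>
primrec cutoff :: "(nat \<Rightarrow> 'a \<Rightarrow> real) \<Rightarrow> nat \<Rightarrow> 'a \<Rightarrow> real" where
  "cutoff f 0 x = 0"
| "cutoff f (Suc n) x = cutoff f n x + (f n x - cutoff f n x * f n x)"

text \<open>The complement 1 - cutoff is a product of factors in [0, 1], hence at most each of
  them.\<close>

lemma cutoff_bounds:
  assumes "\<And>k. 0 \<le> f k x" "\<And>k. f k x \<le> 1"
  shows "0 \<le> cutoff f n x" "cutoff f n x \<le> 1" "k < n \<Longrightarrow> f k x \<le> cutoff f n x"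
proof -
  have eq: "1 - cutoff f (Suc n) x = (1 - cutoff f n x) * (1 - f n x)" for n by (simp add: algebra_simps)
  have b: "0 \<le> 1 - cutoff f n x \<and> 1 - cutoff f n x \<le> 1" for n
  proof (induction n)
    case (Suc n)
    have "(1 - cutoff f n x) * (1 - f n x) \<le> 1 * 1" using Suc assms by (intro mult_mono) auto
    then show ?case unfolding eq using Suc assms by auto
  qed simp
  then show "0 \<le> cutoff f n x" "cutoff f n x \<le> 1" using b[of n] by auto
  show "f k x \<le> cutoff f n x" if "k < n"
    using that
  proof (induction n)
    case (Suc n)
    have "(1 - cutoff f n x) * (1 - f n x) \<le> 1 - f k x"
    proof (cases "k = n")
      case True
      have "(1 - cutoff f n x) * (1 - f n x) \<le> 1 * (1 - f n x)" using b[of n] assms by (intro mult_right_mono) auto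
      then show ?thesis using True by simp
    next
      case False
      then have "1 - cutoff f n x \<le> 1 - f k x" using Suc by simp
      moreover have "(1 - cutoff f n x) * (1 - f n x) \<le> (1 - cutoff f n x) * 1" using b[of n] assms by (intro mult_left_mono) auto
      ultimately show ?thesis by simp
    qed
    then show ?case using eq[of n] by linarith
  qed simp
qed

lemma test_functions_cutoff:
  assumes "\<And>k. f k \<in> test_functions \<Omega>"
  shows "cutoff f n \<in> test_functions \<Omega>"
proof (induction n)
  case 0
  then show ?case using test_functions_zero by (simp add: fun_eq_iff[symmetric] eta_contract_eq)
next
  case (Suc n)
  have "(\<lambda>x. cutoff f n x * f n x) \<in> test_functions \<Omega>"
    using Suc assms by (intro test_functions_mult_smooth) (auto simp: test_functions_def)
  then have "(\<lambda>x. cutoff f n x + (f n x - cutoff f n x * f n x)) \<in> test_functions \<Omega>"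
    using Suc assms by (intro test_functions_add[of "cutoff f n", simplified] test_functions_diff[of "f n", simplified])
  moreover have "cutoff f (Suc n) = (\<lambda>x. cutoff f n x + (f n x - cutoff f n x * f n x))" by auto
  ultimately show ?case by simp
qed

text \<open>Countably many balls cover the domain. The single index n both counts the bumps that are
  combined and sharpens them through the factor n + 1; at a point of the k-th ball the value for n >
  k lies between the sharpened k-th bump and 1.\<close>

lemma test_functions_exhaustion:
  fixes \<Omega> :: "'a::euclidean_space set"
  assumes \<Omega>: "open \<Omega>"
  obtains \<eta> where "\<And>n. \<eta> n \<in> test_functions \<Omega>" "\<And>n x. 0 \<le> \<eta> n x" "\<And>n x. \<eta> n x \<le> 1"
    "\<And>x. x \<in> \<Omega> \<Longrightarrow> (\<lambda>n. \<eta> n x) \<longlonglongrightarrow> 1"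
proof (cases "\<Omega> = {}")
  case True
  show ?thesis by (rule that[of "\<lambda>n x. 0"]) (use True test_functions_zero in auto)
next
  case False
  have "\<exists>r>0. cball x r \<subseteq> \<Omega>" if "x \<in> \<Omega>" for x using that \<Omega> open_contains_cball by blast
  then obtain r where r: "\<And>x. x \<in> \<Omega> \<Longrightarrow> 0 < r x" "\<And>x. x \<in> \<Omega> \<Longrightarrow> cball x (r x) \<subseteq> \<Omega>" by metis
  obtain \<F> where F: "\<F> \<subseteq> (\<lambda>x. ball x (r x)) ` \<Omega>" "countable \<F>" "\<Union>\<F> = \<Union>((\<lambda>x. ball x (r x)) ` \<Omega>)"
    using Lindelof[of "(\<lambda>x. ball x (r x)) ` \<Omega>"] by (metis (no_types, lifting) imageE open_ball)
  have cover: "\<exists>B\<in>\<F>. x \<in> B" if "x \<in> \<Omega>" for x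
  proof -
    have "x \<in> \<Union>\<F>" unfolding F(3) using r(1)[OF that] that by force
    then show ?thesis by blast
  qed
  then have "\<F> \<noteq> {}" using False by auto
  define B where "B = from_nat_into \<F>"
  have B: "range B = \<F>" unfolding B_def using F(2) \<open>\<F> \<noteq> {}\<close> by (simp add: range_from_nat_into)
  have "\<exists>c\<in>\<Omega>. B k = ball c (r c)" for k using F(1) B by blast
  then obtain c where c: "\<And>k. c k \<in> \<Omega>" "\<And>k. B k = ball (c k) (r (c k))" by metis
  define f where "f n k x = flat_exp 0 (real (Suc n) * ((r (c k))\<^sup>2 - (norm (x - c k))\<^sup>2))" for n k x
  have ft: "f n k \<in> test_functions \<Omega>" for n k
    unfolding f_def[abs_def] using r c by (intro test_functions_bump) (auto intro: less_imp_le)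
  have fb: "0 \<le> f n k x" "f n k x \<le> 1" for n k x unfolding f_def by (rule flat_exp_bounds)+
  show ?thesis
  proof (rule that[of "\<lambda>n. cutoff (f n) n"])
    show "cutoff (f n) n \<in> test_functions \<Omega>" for n by (rule test_functions_cutoff[OF ft])
    show "0 \<le> cutoff (f n) n x" "cutoff (f n) n x \<le> 1" for n x using cutoff_bounds(1,2)[of "f n" x n] fb by blast+
    fix x assume "x \<in> \<Omega>"
    then obtain k where k: "x \<in> ball (c k) (r (c k))" using cover B c by (metis rangeE)
    define t where "t = (r (c k))\<^sup>2 - (norm (x - c k))\<^sup>2"
    have t: "0 < t"
    proof -
      have "norm (x - c k) < r (c k)" using k by (simp add: dist_norm norm_minus_commute)
      then show ?thesis unfolding t_def using power_strict_mono[of "norm (x - c k)" "r (c k)" 2] by simp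
    qed
    have "(\<lambda>n. exp (- (inverse (real (Suc n)) * inverse t))) \<longlonglongrightarrow> exp (- (0 * inverse t))"
      by (intro tendsto_intros LIMSEQ_inverse_real_of_nat)
    moreover have "f n k x = exp (- (inverse (real (Suc n)) * inverse t))" for n
      using t by (simp add: f_def flat_exp_def t_def[symmetric] inverse_mult_distrib del: of_nat_Suc)
    ultimately have l: "(\<lambda>n. f n k x) \<longlonglongrightarrow> 1" by simp
    show "(\<lambda>n. cutoff (f n) n x) \<longlonglongrightarrow> 1"
    proof (rule tendsto_sandwich[OF _ _ l tendsto_const])
      show "\<forall>\<^sub>F n in sequentially. f n k x \<le> cutoff (f n) n x"
        using eventually_gt_at_top[of k] by eventually_elim (rule cutoff_bounds(3), rule fb, rule fb)
      show "\<forall>\<^sub>F n in sequentially. cutoff (f n) n x \<le> 1"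
        by (intro always_eventually allI cutoff_bounds(2)) (rule fb)+
    qed
  qed
qed

text \<open>Polynomials approximate f almost everywhere with a uniform bound; multiplied by the
  exhaustion they become test functions, and on a finite measure space the bound makes the
  convergence dominated.\<close>

lemma test_functions_dense:
  fixes f :: "'a::euclidean_space \<Rightarrow> real"
  assumes \<Omega>: "open \<Omega>" "bounded \<Omega>" and f: "f \<in> borel_measurable (lebesgue_on \<Omega>)"
    and B: "AE x in lebesgue_on \<Omega>. \<bar>f x\<bar> \<le> B" and r: "0 < r"
  obtains \<phi> where "\<And>n. \<phi> n \<in> test_functions \<Omega>" "(\<lambda>n. \<integral>x. norm (f x - \<phi> n x) powr r \<partial>lebesgue_on \<Omega>) \<longlonglongrightarrow> 0"
proof -
  interpret finite_measure "lebesgue_on \<Omega>" by (rule bounded_open_finite_measure[OF \<Omega>])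
  define h where "h x = max (- \<bar>B\<bar>) (min \<bar>B\<bar> (f x))" for x
  note [measurable] = f
  have hm: "h \<in> borel_measurable (lebesgue_on \<Omega>)" unfolding h_def[abs_def] by measurable
  obtain P where P: "\<And>n k. C_k k (P n)" "\<And>n. P n \<in> borel_measurable borel" "\<And>n x. x \<in> \<Omega> \<Longrightarrow> \<bar>P n x\<bar> \<le> \<bar>\<bar>B\<bar>\<bar> + 1"
    "AE x in lebesgue_on \<Omega>. (\<lambda>n. P n x) \<longlonglongrightarrow> h x"
    by (rule polynomial_approximation[OF \<Omega> hm, of "\<bar>B\<bar>"]) (auto simp: h_def)
  obtain \<eta> where \<eta>: "\<And>n. \<eta> n \<in> test_functions \<Omega>" "\<And>n x. 0 \<le> \<eta> n x" "\<And>n x. \<eta> n x \<le> 1"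
    "\<And>x. x \<in> \<Omega> \<Longrightarrow> (\<lambda>n. \<eta> n x) \<longlonglongrightarrow> 1"
    using test_functions_exhaustion[OF \<Omega>(1)] by blast
  define \<phi> where "\<phi> n x = P n x * \<eta> n x" for n x
  have \<phi>: "\<phi> n \<in> test_functions \<Omega>" for n
    unfolding \<phi>_def[abs_def] by (rule test_functions_mult_smooth[OF \<eta>(1) P(1)])
  have [measurable]: "\<phi> n \<in> borel_measurable (lebesgue_on \<Omega>)" for n
    using \<phi>[of n] by (auto simp: test_functions_def intro: borel_measurable_lebesgue_onI C_k_measurable)
  have "(\<lambda>n. \<integral>x. norm (f x - \<phi> n x) powr r \<partial>lebesgue_on \<Omega>) \<longlonglongrightarrow> (\<integral>x. 0 \<partial>lebesgue_on \<Omega>)"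
  proof (rule integral_dominated_convergence[where w="\<lambda>x. (2 * \<bar>B\<bar> + 1) powr r"])
    show "AE x in lebesgue_on \<Omega>. norm (norm (f x - \<phi> n x) powr r) \<le> (2 * \<bar>B\<bar> + 1) powr r" for n
      using B AE_space
    proof eventually_elim
      case (elim x)
      have "\<bar>\<phi> n x\<bar> \<le> (\<bar>B\<bar> + 1) * 1"
        unfolding \<phi>_def abs_mult using P(3)[of x n] \<eta>(2,3)[of n x] elim(2) by (intro mult_mono) auto
      then have "norm (f x - \<phi> n x) \<le> 2 * \<bar>B\<bar> + 1" using elim(1) by (simp add: abs_le_iff)
      then show ?case using r by (auto intro!: powr_mono2)
    qed
    show "AE x in lebesgue_on \<Omega>. (\<lambda>n. norm (f x - \<phi> n x) powr r) \<longlonglongrightarrow> 0"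
      using P(4) B AE_space
    proof eventually_elim
      case (elim x)
      have "h x = f x" using elim(2) by (auto simp: h_def abs_le_iff)
      then have "(\<lambda>n. \<phi> n x) \<longlonglongrightarrow> f x * 1"
        unfolding \<phi>_def using elim \<eta>(4) by (intro tendsto_mult) auto
      then have "(\<lambda>n. norm (f x - \<phi> n x)) \<longlonglongrightarrow> norm (f x - f x)"
        by (intro tendsto_norm tendsto_diff tendsto_const) simp
      then have "(\<lambda>n. norm (f x - \<phi> n x) powr r) \<longlonglongrightarrow> 0 powr r"
        using r by (intro tendsto_powr' tendsto_const) auto
      then show ?case by simp
    qed
  qed auto
  then show thesis using that[OF \<phi>] by simp
qed

section \<open>Asymptotics of the minimizers\<close>

text \<open>This is the tangent inequality at 1 for y = t^q with exponent g/q.\<close>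

lemma profile_strict_min:
  fixes t :: real
  assumes "0 < q" "q < g" "0 \<le> t" "t \<noteq> 1"
  shows "1 / g - 1 / q < t powr g / g - t powr q / q"
proof -
  have "t powr q \<noteq> 1"
  proof
    assume "t powr q = 1"
    then have "(t powr q) powr (1 / q) = 1" by simp
    then show False using assms by (simp add: powr_powr)
  qed
  then have "1 + g / q * (t powr q - 1) < (t powr q) powr (g / q)"
    using assms by (intro powr_greater_tangent) auto
  also have "\<dots> = t powr g" using assms by (simp add: powr_powr)
  finally have "(1 + g / q * (t powr q - 1)) / g < t powr g / g"
    using assms by (intro divide_strict_right_mono) auto
  moreover have "(1 + g / q * (t powr q - 1)) / g = 1 / g + (t powr q / q - 1 / q)"
    using assms by (simp add: add_divide_distrib diff_divide_distrib)
  ultimately show ?thesis by linarith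
qed

text \<open>Near t = 1 the left side is below \<delta>; on the rest of [0, T] the excess has a
  positive minimum; beyond T it is at least a multiple of t^g.\<close>

lemma profile_coercive:
  fixes q g \<delta> :: real
  assumes qg: "0 < q" "q < g" and \<delta>: "0 < \<delta>"
  shows "\<exists>C\<ge>0. \<forall>t\<ge>0. \<bar>t - 1\<bar> powr g \<le> \<delta> + C * ((t powr g / g - t powr q / q) - (1 / g - 1 / q))"
proof -
  define h where "h t = (t powr g / g - t powr q / q) - (1 / g - 1 / q)" for t :: real
  have h0: "0 \<le> h t" if "0 \<le> t" for t using profile_strict_min[OF qg that] by (cases "t = 1") (auto simp: h_def)
  \<comment> \<open>Beyond \<open>T\<close> the q-term is at most half of the g-term.\<close>
  define T where "T = max 1 ((q / (2 * g)) powr (1 / (q - g)))"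
  have T: "1 \<le> T" "T powr (q - g) \<le> q / (2 * g)"
  proof -
    show "1 \<le> T" by (simp add: T_def)
    have "T powr (q - g) \<le> ((q / (2 * g)) powr (1 / (q - g))) powr (q - g)"
      using qg by (intro powr_mono2') (auto simp: T_def)
    also have "\<dots> = q / (2 * g)" using qg by (simp add: powr_powr)
    finally show "T powr (q - g) \<le> q / (2 * g)" .
  qed
  define S where "S = {t\<in>{0..T}. \<delta> \<le> \<bar>t - 1\<bar> powr g}"
  have ch: "continuous_on {0..T} h" unfolding h_def using qg by (auto intro!: continuous_intros continuous_on_powr')
  have cn: "continuous_on {0..T} (\<lambda>t. \<bar>t - 1\<bar> powr g)" using qg by (auto intro!: continuous_intros continuous_on_powr')
  have S: "S = {0..T} \<inter> (\<lambda>t. \<bar>t - 1\<bar> powr g) -` {\<delta>..}" by (auto simp: S_def)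
  have "closed S" unfolding S by (rule continuous_closed_preimage[OF cn closed_atLeastAtMost closed_atLeast])
  moreover have "{0..T} \<inter> S = S" by (auto simp: S)
  ultimately have "compact S" using compact_Int_closed[of "{0..T}" S] by simp
  obtain c where c: "0 < c" "\<And>t. t \<in> S \<Longrightarrow> c \<le> h t"
  proof (cases "S = {}")
    case True then show ?thesis using that[of 1] by simp
  next
    case False
    have "continuous_on S h" by (rule continuous_on_subset[OF ch]) (auto simp: S_def)
    from continuous_attains_inf[OF \<open>compact S\<close> False this] obtain t0 where t0: "t0 \<in> S" "\<forall>t\<in>S. h t0 \<le> h t" by auto
    have "t0 \<noteq> 1" using t0 \<delta> qg by (auto simp: S_def)
    then have "0 < h t0" using profile_strict_min[OF qg, of t0] t0 by (auto simp: h_def S_def)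
    then show ?thesis using that[of "h t0"] t0 by auto
  qed
  \<comment> \<open>The first entry serves [0, T], where |t - 1| <= T because T >= 1; the second
    serves t > T, where the excess is at least t^g/(2g).\<close>
  define C where "C = max (T powr g / c) (2 * g)"
  have C: "0 \<le> C" using qg by (simp add: C_def)
  have "\<bar>t - 1\<bar> powr g \<le> \<delta> + C * h t" if t: "0 \<le> t" for t
  proof (cases "t \<le> T")
    case True
    show ?thesis
    proof (cases "\<delta> \<le> \<bar>t - 1\<bar> powr g")
      case True
      then have "c \<le> h t" using c \<open>t \<le> T\<close> t by (simp add: S_def)
      have "\<bar>t - 1\<bar> powr g \<le> T powr g" using t \<open>t \<le> T\<close> T qg by (intro powr_mono2) auto
      also have "\<dots> = T powr g / c * c" using c by simp
      also have "\<dots> \<le> C * h t" using \<open>c \<le> h t\<close> C c by (intro mult_mono) (auto simp: C_def)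
      finally show ?thesis using \<delta> by simp
    next
      case False
      then show ?thesis using mult_nonneg_nonneg[OF C h0[OF t]] by simp
    qed
  next
    case False
    have t1: "1 \<le> t" using False T by simp
    have "t powr q = t powr (q - g) * t powr g" using t1 by (simp flip: powr_add)
    also have "\<dots> \<le> T powr (q - g) * t powr g" using False T qg by (intro mult_right_mono powr_mono2') auto
    also have "\<dots> \<le> q / (2 * g) * t powr g" using T by (intro mult_right_mono) auto
    finally have "t powr q / q \<le> t powr g / (2 * g)" using qg by (simp add: field_simps)
    moreover have "1 / g - 1 / q < 0" using qg by (simp add: field_simps)
    moreover have "t powr g / g = t powr g / (2 * g) + t powr g / (2 * g)" by simp
    ultimately have "t powr g / (2 * g) \<le> h t" unfolding h_def by linarith
    then have "t powr g \<le> 2 * g * h t" using qg by (simp add: field_simps)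
    also have "\<dots> \<le> C * h t" using h0[OF t] by (intro mult_right_mono) (auto simp: C_def)
    finally have "t powr g \<le> C * h t" .
    moreover have "\<bar>t - 1\<bar> powr g \<le> t powr g" using t1 qg by (intro powr_mono2) auto
    ultimately show ?thesis using \<delta> by simp
  qed
  then show ?thesis using C unfolding h_def by blast
qed

section \<open>The limit functional and the rescaled minimizers\<close>

context p_laplace_problem begin

definition u0 :: "'a \<Rightarrow> real" where "u0 = u0_bar q g a b"

definition \<Phi> :: "('a \<Rightarrow> real) \<Rightarrow> real" where
  "\<Phi> w = 1 / g * (\<integral>x. b x * norm (w x) powr g \<partial>M) - 1 / q * (\<integral>x. a x * norm (w x) powr q \<partial>M)"

lemma u0_measurable [measurable]: "u0 \<in> borel_measurable M"
proof -
  have [measurable]: "a \<in> borel_measurable M" "b \<in> borel_measurable M"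
    using coefficients by (auto simp: Linfty_def)
  show ?thesis unfolding u0_def u0_bar_def[abs_def] by measurable
qed

lemma u0_bounded: obtains B where "AE x in M. \<bar>u0 x\<bar> \<le> B"
proof -
  from coefficients(1) obtain A where A: "0 < A" "a \<in> borel_measurable M" "AE x in M. \<bar>a x\<bar> \<le> A" by (rule LinftyE)
  have "AE x in M. \<bar>u0 x\<bar> \<le> (A / \<sigma>) powr (1 / (g - q))"
    using A(3) coefficients(3,5)
  proof eventually_elim
    case (elim x)
    have "a x / b x \<le> A / \<sigma>" using elim coefficients(4) by (intro frac_le) auto
    then have "(a x / b x) powr (1 / (g - q)) \<le> (A / \<sigma>) powr (1 / (g - q))"
      using elim exponents coefficients(4) by (intro powr_mono2) auto
    then show ?case by (simp add: u0_def u0_bar_def)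
  qed
  then show thesis by (rule that)
qed

lemma u0_Lp:
  assumes "0 < r"
  shows "u0 \<in> Lp r M"
proof -
  interpret finite_measure M by (rule finite_M)
  obtain B where B: "AE x in M. \<bar>u0 x\<bar> \<le> B" by (rule u0_bounded)
  have "integrable M (\<lambda>x. norm (u0 x) powr r)"
  proof (rule integrable_const_bound)
    show "AE x in M. norm (norm (u0 x) powr r) \<le> B powr r"
      using B by eventually_elim (use assms in \<open>auto intro!: powr_mono2\<close>)
  qed measurable
  then show ?thesis by (simp add: Lp_def)
qed

text \<open>With U = \<open>u0 x\<close> one has a = b U^(g-q), so for w = U t the excess of the
  integrand over its value at \<open>u0\<close> equals b U^g times the scalar excess at t.
  Positivity of a makes U > 0 and t meaningful, and b >= \<sigma> removes the weight.\<close>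

lemma \<Phi>_coercive:
  assumes w: "w \<in> Lp g M" "AE x in M. 0 \<le> w x" and \<delta>: "0 < \<delta>" and pos: "AE x in M. 0 < a x"
    and C: "0 \<le> C" "\<And>t. 0 \<le> t \<Longrightarrow> \<bar>t - 1\<bar> powr g \<le> \<delta> + C * ((t powr g / g - t powr q / q) - (1 / g - 1 / q))"
  shows "(\<integral>x. norm (w x - u0 x) powr g \<partial>M) \<le> \<delta> * (\<integral>x. norm (u0 x) powr g \<partial>M) + C / \<sigma> * (\<Phi> w - \<Phi> u0)"
proof -
  have e: "0 < q" "0 < g" "q \<le> g" "q < g" using exponents by auto
  have L: "w \<in> Lp q M" "u0 \<in> Lp q M" "u0 \<in> Lp g M"
    using w u0_Lp e Lp_mono[OF finite_M e(1,3)] by auto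
  have i: "integrable M (\<lambda>x. b x * norm (w x) powr g)" "integrable M (\<lambda>x. a x * norm (w x) powr q)"
    "integrable M (\<lambda>x. b x * norm (u0 x) powr g)" "integrable M (\<lambda>x. a x * norm (u0 x) powr q)"
    using Linfty_weighted_integrable[OF coefficients(1) L(1)] Linfty_weighted_integrable[OF coefficients(1) L(2)]
      Linfty_weighted_integrable[OF coefficients(2) w(1)] Linfty_weighted_integrable[OF coefficients(2) L(3)] by auto
  define H where "H x = 1 / g * (b x * norm (w x) powr g) - 1 / q * (a x * norm (w x) powr q)
     - (1 / g * (b x * norm (u0 x) powr g) - 1 / q * (a x * norm (u0 x) powr q))" for x
  have iH: "integrable M H" "(\<integral>x. H x \<partial>M) = \<Phi> w - \<Phi> u0" unfolding H_def \<Phi>_def using i by auto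
  have "(\<integral>x. norm (w x - u0 x) powr g \<partial>M) \<le> (\<integral>x. \<delta> * norm (u0 x) powr g + C / \<sigma> * H x \<partial>M)"
  proof (rule integral_mono_AE)
    show "integrable M (\<lambda>x. norm (w x - u0 x) powr g)" by (rule LpD(2)[OF Lp_diff[OF e(2) w(1) L(3)]])
    show "integrable M (\<lambda>x. \<delta> * norm (u0 x) powr g + C / \<sigma> * H x)" using LpD(2)[OF L(3)] iH by simp
    show "AE x in M. norm (w x - u0 x) powr g \<le> \<delta> * norm (u0 x) powr g + C / \<sigma> * H x"
      using w(2) pos coefficients(5)
    proof eventually_elim
      case (elim x)
      have bx: "0 < b x" using elim(3) coefficients(4) by simp
      define U where "U = u0 x"
      have U: "0 < U" using elim bx by (simp add: U_def u0_def u0_bar_def)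
      have "U powr (g - q) = a x / b x" using elim bx e by (simp add: U_def u0_def u0_bar_def powr_powr)
      then have ax: "a x = b x * U powr (g - q)" using bx by (simp add: field_simps)
      define t where "t = w x / U"
      have t: "0 \<le> t" "w x = U * t" using U elim by (auto simp: t_def)
      have Uq: "U powr (g - q) * U powr q = U powr g" using U by (simp flip: powr_add)
      define h where "h = (t powr g / g - t powr q / q) - (1 / g - 1 / q)"
      have hh: "H x = b x * (U powr g * h)"
      proof -
        have e1: "a x * norm (w x) powr q = b x * (U powr g * t powr q)"
          using U t by (simp add: ax abs_mult powr_mult Uq[symmetric])
        have e2: "b x * norm (w x) powr g = b x * (U powr g * t powr g)"
          using U t by (simp add: abs_mult powr_mult)
        have e3: "a x * norm (u0 x) powr q = b x * U powr g"
          using U by (simp add: ax U_def[symmetric] Uq[symmetric])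
        have e4: "b x * norm (u0 x) powr g = b x * U powr g" using U by (simp add: U_def[symmetric])
        show ?thesis unfolding H_def h_def e1 e2 e3 e4 by (simp add: algebra_simps)
      qed
      have h0: "0 \<le> h" using profile_strict_min[OF e(1,4) t(1)] by (cases "t = 1") (auto simp: h_def)
      have "w x - u0 x = U * (t - 1)" using t by (simp add: U_def[symmetric] algebra_simps)
      then have "norm (w x - u0 x) powr g = U powr g * \<bar>t - 1\<bar> powr g" using U by (simp add: abs_mult powr_mult)
      also have "\<dots> \<le> U powr g * (\<delta> + C * h)" unfolding h_def by (intro mult_left_mono C t) auto
      also have "\<dots> = \<delta> * U powr g + C * (U powr g * h)" by (simp add: algebra_simps)
      also have "C * (U powr g * h) \<le> C / \<sigma> * (b x * (U powr g * h))"
      proof -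
        have "1 \<le> b x / \<sigma>" using elim(3) coefficients(4) by simp
        then have "C * (U powr g * h) * 1 \<le> C * (U powr g * h) * (b x / \<sigma>)"
          using C h0 by (intro mult_left_mono mult_nonneg_nonneg) auto
        then show ?thesis by (simp add: mult_ac)
      qed
      finally show ?case using U hh by (simp add: U_def)
    qed
  qed
  also have "\<dots> = \<delta> * (\<integral>x. norm (u0 x) powr g \<partial>M) + C / \<sigma> * (\<Phi> w - \<Phi> u0)"
    using LpD(2)[OF L(3)] iH by simp
  finally show ?thesis .
qed

text \<open>The relation between s, \<alpha> and \<beta> equalizes the coefficients of the two
  lower-order terms, so \<alpha> s^q factors out and the gradient keeps the coefficient
  s^(p-q)/\<alpha>.\<close>

lemma energy_scale:
  assumes "0 < \<alpha>" "0 < \<beta>" "0 < s" "\<beta> * s powr g = \<alpha> * s powr q"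
  shows "J \<alpha> \<beta> (\<lambda>x. s * w x) (\<lambda>x. s *\<^sub>R G x)
    = \<alpha> * s powr q * (s powr (p - q) / \<alpha> * (1 / p * (\<integral>x. norm (G x) powr p \<partial>M)) + \<Phi> w)"
proof -
  have n: "(\<integral>x. norm (s *\<^sub>R G x) powr p \<partial>M) = s powr p * (\<integral>x. norm (G x) powr p \<partial>M)"
    using assms by (simp add: powr_mult)
  have A: "(\<integral>x. a x * norm (s * w x) powr q \<partial>M) = s powr q * (\<integral>x. a x * norm (w x) powr q \<partial>M)"
  proof -
    have "a x * norm (s * w x) powr q = s powr q * (a x * norm (w x) powr q)" for x
      using assms by (simp add: abs_mult powr_mult)
    then show ?thesis by (simp only: integral_mult_right_zero)
  qed
  have B: "(\<integral>x. b x * norm (s * w x) powr g \<partial>M) = s powr g * (\<integral>x. b x * norm (w x) powr g \<partial>M)"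
  proof -
    have "b x * norm (s * w x) powr g = s powr g * (b x * norm (w x) powr g)" for x
      using assms by (simp add: abs_mult powr_mult)
    then show ?thesis by (simp only: integral_mult_right_zero)
  qed
  have s: "s powr q * s powr (p - q) = s powr p" using assms by (simp flip: powr_add)
  have "J \<alpha> \<beta> (\<lambda>x. s * w x) (\<lambda>x. s *\<^sub>R G x) = s powr p * (1 / p * (\<integral>x. norm (G x) powr p \<partial>M))
     - \<alpha> * s powr q * (1 / q * (\<integral>x. a x * norm (w x) powr q \<partial>M)) + \<beta> * s powr g * (1 / g * (\<integral>x. b x * norm (w x) powr g \<partial>M))"
    unfolding energy_def n A B by simp
  also have "\<dots> = \<alpha> * s powr q * (s powr (p - q) / \<alpha> * (1 / p * (\<integral>x. norm (G x) powr p \<partial>M)) + \<Phi> w)"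
    unfolding assms(4) \<Phi>_def s[symmetric] using assms(1) by (simp add: algebra_simps)
  finally show ?thesis .
qed

lemma minimizer_asymptotics:
  fixes u :: "'i \<Rightarrow> 'a \<Rightarrow> real"
  assumes pos: "AE x in M. 0 < a x"
    and u: "\<forall>\<^sub>F i in F. 0 < \<alpha> i \<and> 0 < \<beta> i \<and> 0 < s i \<and> \<beta> i * s i powr g = \<alpha> i * s i powr q \<and>
       minimizer (\<alpha> i) (\<beta> i) (u i) \<and> (AE x in M. 0 < u i x)"
    and \<epsilon>: "((\<lambda>i. s i powr (p - q) / \<alpha> i) \<longlongrightarrow> 0) F"
  shows "\<forall>\<^sub>F i in F. (\<lambda>x. inverse (s i) * u i x - u0 x) \<in> Lp g M"
    "((\<lambda>i. \<integral>x. norm (inverse (s i) * u i x - u0 x) powr g \<partial>M) \<longlongrightarrow> 0) F"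
proof -
  have e: "0 < q" "0 < g" "q < g" "1 < p" "0 < p" using exponents by auto
  define w where "w i x = inverse (s i) * u i x" for i x
  have wL: "w i \<in> Lp g M" if min: "minimizer (\<alpha> i) (\<beta> i) (u i)" for i
  proof -
    obtain \<phi> where "W0 p \<Omega> (u i) (weak_gradient \<Omega> (u i)) \<phi>"
      using W1p_0_W0[OF \<Omega> e(4)] min by (auto simp: minimizer_def)
    from W0_Lp(3)[OF this] show ?thesis unfolding w_def[abs_def] by (rule Lp_cmult)
  qed
  show "\<forall>\<^sub>F i in F. (\<lambda>x. inverse (s i) * u i x - u0 x) \<in> Lp g M"
    using u by eventually_elim (use wL u0_Lp[OF e(2)] e in \<open>auto intro!: Lp_diff simp: w_def[abs_def]\<close>)
  have le: "\<Phi> (w i) \<le> s i powr (p - q) / \<alpha> i * (1 / p * (\<integral>x. norm (grad \<phi> x) powr p \<partial>M)) + \<Phi> \<phi>"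
    if i: "0 < \<alpha> i \<and> 0 < \<beta> i \<and> 0 < s i \<and> \<beta> i * s i powr g = \<alpha> i * s i powr q \<and>
       minimizer (\<alpha> i) (\<beta> i) (u i) \<and> (AE x in M. 0 < u i x)" and \<phi>: "\<phi> \<in> test_functions \<Omega>" for i \<phi>
  proof -
    define G where "G x = inverse (s i) *\<^sub>R weak_gradient \<Omega> (u i) x" for x
    have W: "W0 p \<Omega> (\<lambda>x. s i * \<phi> x) (grad (\<lambda>x. s i * \<phi> x)) (\<lambda>n x. s i * \<phi> x)"
      by (rule W0_test_function[OF \<Omega>(1) e(5) test_functions_cmult[OF \<phi>]])
    have gr: "grad (\<lambda>x. s i * \<phi> x) = (\<lambda>x. s i *\<^sub>R grad \<phi> x)"
      using grad_cmult[OF test_functions_C1c[OF \<phi>]] by blast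
    have us: "(\<lambda>x. s i * w i x) = u i" "(\<lambda>x. s i *\<^sub>R G x) = weak_gradient \<Omega> (u i)"
      using i by (auto simp: w_def G_def)
    have "E (\<alpha> i) (\<beta> i) (u i) \<le> E (\<alpha> i) (\<beta> i) (\<lambda>x. s i * \<phi> x)"
      using i W0_W1p_0[OF \<Omega> e(4) W] by (simp add: minimizer_def)
    also have "\<dots> = J (\<alpha> i) (\<beta> i) (\<lambda>x. s i * \<phi> x) (\<lambda>x. s i *\<^sub>R grad \<phi> x)"
      using energy_weak_gradient[OF W] by (simp add: gr)
    finally have "J (\<alpha> i) (\<beta> i) (\<lambda>x. s i * w i x) (\<lambda>x. s i *\<^sub>R G x) \<le> J (\<alpha> i) (\<beta> i) (\<lambda>x. s i * \<phi> x) (\<lambda>x. s i *\<^sub>R grad \<phi> x)"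
      unfolding us .
    then have "\<alpha> i * s i powr q * (s i powr (p - q) / \<alpha> i * (1 / p * (\<integral>x. norm (G x) powr p \<partial>M)) + \<Phi> (w i))
      \<le> \<alpha> i * s i powr q * (s i powr (p - q) / \<alpha> i * (1 / p * (\<integral>x. norm (grad \<phi> x) powr p \<partial>M)) + \<Phi> \<phi>)"
      using i by (simp only: energy_scale)
    then have "s i powr (p - q) / \<alpha> i * (1 / p * (\<integral>x. norm (G x) powr p \<partial>M)) + \<Phi> (w i)
      \<le> s i powr (p - q) / \<alpha> i * (1 / p * (\<integral>x. norm (grad \<phi> x) powr p \<partial>M)) + \<Phi> \<phi>"
      using i by (simp add: mult_le_cancel_left_pos)
    moreover have "0 \<le> s i powr (p - q) / \<alpha> i * (1 / p * (\<integral>x. norm (G x) powr p \<partial>M))"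
      using i e by (intro mult_nonneg_nonneg divide_nonneg_nonneg) auto
    ultimately show ?thesis by linarith
  qed
  \<comment> \<open>The test function is fixed before i varies: its gradient integral may be large,
    but it stays constant while its coefficient tends to 0.\<close>
  have key: "\<forall>\<^sub>F i in F. \<Phi> (w i) - \<Phi> u0 < \<eta>" if \<eta>: "0 < \<eta>" for \<eta>
  proof -
    obtain B where B: "AE x in M. \<bar>u0 x\<bar> \<le> B" by (rule u0_bounded)
    obtain \<phi> where \<phi>: "\<And>n. \<phi> n \<in> test_functions \<Omega>" "(\<lambda>n. \<integral>x. norm (u0 x - \<phi> n x) powr g \<partial>M) \<longlonglongrightarrow> 0"
      using test_functions_dense[OF \<Omega> u0_measurable B e(2)] by blast
    have "(\<lambda>n. 1 / q * (\<integral>x. a x * norm (\<phi> n x) powr q \<partial>M) - 1 / g * (\<integral>x. b x * norm (\<phi> n x) powr g \<partial>M))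
      \<longlonglongrightarrow> 1 / q * (\<integral>x. a x * norm (u0 x) powr q \<partial>M) - 1 / g * (\<integral>x. b x * norm (u0 x) powr g \<partial>M)"
      by (rule lower_order_tendsto[OF u0_Lp[OF e(2)] test_Lp(1)[OF \<phi>(1) e(2)] \<phi>(2)])
    from tendsto_minus[OF this] have "(\<lambda>n. \<Phi> (\<phi> n)) \<longlonglongrightarrow> \<Phi> u0" by (simp add: \<Phi>_def)
    then have "\<forall>\<^sub>F n in sequentially. \<Phi> (\<phi> n) < \<Phi> u0 + \<eta> / 2" by (rule order_tendstoD) (use \<eta> in simp)
    then obtain n where n: "\<Phi> (\<phi> n) < \<Phi> u0 + \<eta> / 2" by (auto dest: eventually_happens)
    define D where "D = 1 / p * (\<integral>x. norm (grad (\<phi> n) x) powr p \<partial>M)"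
    have "((\<lambda>i. s i powr (p - q) / \<alpha> i * D) \<longlongrightarrow> 0 * D) F" by (intro tendsto_intros \<epsilon>)
    then have "\<forall>\<^sub>F i in F. s i powr (p - q) / \<alpha> i * D < \<eta> / 2" by (rule order_tendstoD) (use \<eta> in simp)
    with u show ?thesis
    proof eventually_elim
      case (elim i)
      then show ?case using le[OF elim(1) \<phi>(1), of n] n unfolding D_def by linarith
    qed
  qed
  show "((\<lambda>i. \<integral>x. norm (inverse (s i) * u i x - u0 x) powr g \<partial>M) \<longlongrightarrow> 0) F"
  proof (rule tendstoI)
    fix \<eta> :: real assume \<eta>: "0 < \<eta>"
    define I where "I = (\<integral>x. norm (u0 x) powr g \<partial>M)"
    have I: "0 \<le> I" by (simp add: I_def)
    define \<delta> where "\<delta> = \<eta> / (2 * (I + 1))"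
    have \<delta>: "0 < \<delta>" "\<delta> * I \<le> \<eta> / 2"
    proof -
      show "0 < \<delta>" using \<eta> I by (simp add: \<delta>_def)
      have "\<delta> * I = \<eta> / 2 * (I / (I + 1))" by (simp add: \<delta>_def)
      also have "\<dots> \<le> \<eta> / 2 * 1" using \<eta> I by (intro mult_left_mono) auto
      finally show "\<delta> * I \<le> \<eta> / 2" by simp
    qed
    from profile_coercive[OF e(1,3) \<delta>(1)] obtain C where C: "0 \<le> C"
      "\<And>t. 0 \<le> t \<Longrightarrow> \<bar>t - 1\<bar> powr g \<le> \<delta> + C * ((t powr g / g - t powr q / q) - (1 / g - 1 / q))" by blast
    \<comment> \<open>The added 1 keeps \<open>D\<close> positive when C = 0 and makes the final
      estimate strict.\<close>
    define D where "D = C / \<sigma> + 1"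
    have D: "0 < D" using C coefficients(4) by (simp add: D_def add_nonneg_pos)
    have "0 < \<eta> / (2 * D)" using \<eta> D by simp
    from key[OF this] u
    show "\<forall>\<^sub>F i in F. dist (\<integral>x. norm (inverse (s i) * u i x - u0 x) powr g \<partial>M) 0 < \<eta>"
    proof eventually_elim
      case (elim i)
      have w0: "AE x in M. 0 \<le> w i x"
      proof -
        have "AE x in M. 0 < u i x" using elim(2) by blast
        then show ?thesis by eventually_elim (use elim(2) in \<open>simp add: w_def\<close>)
      qed
      have le: "(\<integral>x. norm (w i x - u0 x) powr g \<partial>M) \<le> \<delta> * I + C / \<sigma> * (\<Phi> (w i) - \<Phi> u0)"
        unfolding I_def using elim(2) by (intro \<Phi>_coercive wL w0 \<delta> pos C) auto
      have "C / \<sigma> * (\<Phi> (w i) - \<Phi> u0) \<le> C / \<sigma> * (\<eta> / (2 * D))"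
        using elim(1) C coefficients(4) by (intro mult_left_mono) auto
      also have "\<dots> < D * (\<eta> / (2 * D))" using \<eta> D by (intro mult_strict_right_mono) (auto simp: D_def)
      also have "\<dots> = \<eta> / 2" using D by simp
      finally have "(\<integral>x. norm (w i x - u0 x) powr g \<partial>M) < \<eta>" using le \<delta>(2) by linarith
      then show ?case by (simp add: w_def dist_real_def)
    qed
  qed
qed

section \<open>The extremal constant\<close>

lemma poincare_W0:
  obtains C where "0 < C" "\<And>u G \<phi>. W0 p \<Omega> u G \<phi> \<Longrightarrow> (\<integral>x. norm (u x) powr p \<partial>M) \<le> C * (\<integral>x. norm (G x) powr p \<partial>M)"
proof -
  have e: "0 < p" "1 \<le> p" using exponents by auto
  obtain R where R: "0 < R" "\<And>\<phi> x. \<phi> \<in> test_functions \<Omega> \<Longrightarrow> R < norm x \<Longrightarrow> \<phi> x = 0" using radius by blast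
  show thesis
  proof (rule that[of "(2 * R + 1) powr p"])
    show "0 < (2 * R + 1) powr p" using R by simp
    fix u G \<phi> assume W: "W0 p \<Omega> u G \<phi>"
    note L = W0_Lp[OF W]
    have lim: "(\<lambda>n. \<integral>x. norm (\<phi> n x) powr p \<partial>M) \<longlonglongrightarrow> (\<integral>x. norm (u x) powr p \<partial>M)"
      "(\<lambda>n. \<integral>x. norm (grad (\<phi> n) x) powr p \<partial>M) \<longlonglongrightarrow> (\<integral>x. norm (G x) powr p \<partial>M)"
      using W L(1,2) test_Lp[OF L(5)] e by (auto simp: W0_def intro!: powr_tendsto simp del: real_norm_def)
    show "(\<integral>x. norm (u x) powr p \<partial>M) \<le> (2 * R + 1) powr p * (\<integral>x. norm (G x) powr p \<partial>M)"
    proof (rule LIMSEQ_le[OF lim(1) tendsto_mult_left[OF lim(2)]])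
      have "(\<integral>x. norm (\<phi> n x) powr p \<partial>M) \<le> (2 * R + 1) powr p * (\<integral>x. norm (grad (\<phi> n) x) powr p \<partial>M)" for n
        using C1c_poincare[OF test_functions_C1c[OF L(5)] e(2) R(1) R(2)[OF L(5)]] test_functions_Lp(3,4)[OF \<Omega>(1) L(5) e(1)] by simp
      then show "\<exists>N. \<forall>n\<ge>N. (\<integral>x. norm (\<phi> n x) powr p \<partial>M) \<le> (2 * R + 1) powr p * (\<integral>x. norm (grad (\<phi> n) x) powr p \<partial>M)" by blast
    qed
  qed
qed

text \<open>The threshold (Y/X)^(1/(g-p)) makes the two terms of the interpolation inequality equal;
  the exponents are those for which both sides scale alike under multiples of u.\<close>

lemma interpolation:
  assumes "u \<in> Lp p M" "u \<in> Lp g M" and P: "0 < (\<integral>x. norm (u x) powr p \<partial>M)" and G: "0 < (\<integral>x. norm (u x) powr g \<partial>M)"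
  shows "(\<integral>x. norm (u x :: real) powr q \<partial>M) powr ((g - p) / (g - q))
    \<le> 2 powr ((g - p) / (g - q)) * ((\<integral>x. norm (u x) powr p \<partial>M) * (\<integral>x. norm (u x) powr g \<partial>M) powr ((q - p) / (g - q)))"
proof -
  define X where "X = (\<integral>x. norm (u x) powr p \<partial>M)"
  define Y where "Y = (\<integral>x. norm (u x) powr g \<partial>M)"
  have XY: "0 < X" "0 < Y" using P G by (auto simp: X_def Y_def)
  have e: "0 < p" "p < q" "q < g" "0 < q" using exponents by auto
  define T where "T = (Y / X) powr (1 / (g - p))"
  have T: "0 < T" using XY by (simp add: T_def)
  have uq: "u \<in> Lp q M" using e by (intro Lp_mono[OF finite_M _ _ assms(2)]) auto
  have "(\<integral>x. norm (u x) powr q \<partial>M) \<le> (\<integral>x. T powr (q - p) * norm (u x) powr p + T powr (q - g) * norm (u x) powr g \<partial>M)"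
    using LpD(2)[OF assms(1)] LpD(2)[OF assms(2)] LpD(2)[OF uq] T e by (intro integral_mono powr_le_interpolate) auto
  also have "\<dots> = T powr (q - p) * X + T powr (q - g) * Y"
    using LpD(2)[OF assms(1)] LpD(2)[OF assms(2)] by (simp add: X_def Y_def)
  also have "T powr (q - g) * Y = T powr (q - p) * X"
  proof -
    have "T powr (g - p) = Y / X" using XY e by (simp add: T_def powr_powr)
    moreover have "T powr (q - p) = T powr (q - g) * T powr (g - p)" using T by (simp flip: powr_add)
    ultimately show ?thesis using XY by simp
  qed
  finally have "(\<integral>x. norm (u x) powr q \<partial>M) \<le> 2 * (T powr (q - p) * X)" by linarith
  then have "(\<integral>x. norm (u x) powr q \<partial>M) powr ((g - p) / (g - q)) \<le> (2 * (T powr (q - p) * X)) powr ((g - p) / (g - q))"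
    using e by (intro powr_mono2) auto
  also have "\<dots> = 2 powr ((g - p) / (g - q)) * (X * Y powr ((q - p) / (g - q)))"
  proof -
    define r where "r = (g - p) / (g - q)"
    have "1 / (g - p) * (q - p) * r = (q - p) / (g - q)" using e by (simp add: r_def)
    then have "(T powr (q - p)) powr r = (Y / X) powr ((q - p) / (g - q))" by (simp only: T_def powr_powr)
    then have "(T powr (q - p) * X) powr r = Y powr ((q - p) / (g - q)) * (X powr r / X powr ((q - p) / (g - q)))"
      by (simp add: powr_mult powr_divide)
    also have "X powr r / X powr ((q - p) / (g - q)) = X powr (r - (q - p) / (g - q))" by (simp add: powr_diff)
    also have "r - (q - p) / (g - q) = 1" unfolding r_def diff_divide_distrib[symmetric] using e by simp
    finally show ?thesis using XY unfolding r_def[symmetric] powr_mult by (simp add: powr_mult mult_ac)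
  qed
  finally show ?thesis by (simp add: X_def Y_def)
qed

text \<open>Interpolation and the Poincare inequality bound the quotients, so the supremum in the
  reals dominates each of them. Positivity then follows from a single admissible function, a test
  function close to the constant 1.\<close>

lemma eps_e_pos:
  assumes a: "\<not> (AE x in M. a x = 0)"
  shows "0 < eps_e p q g \<Omega> a b"
proof -
  have e: "0 < p" "p < q" "q < g" "0 < q" "0 < g" "1 < p" using exponents by auto
  define Qt where "Qt u = (\<integral>x. a x * \<bar>u x\<bar> powr q \<partial>M) powr ((g - p) / (g - q)) /
        ((\<integral>x. norm (weak_gradient \<Omega> u x) powr p \<partial>M) * (\<integral>x. b x * \<bar>u x\<bar> powr g \<partial>M) powr ((q - p) / (g - q)))" for u
  from coefficients(1) obtain A where A: "0 < A" "a \<in> borel_measurable M" "AE x in M. \<bar>a x\<bar> \<le> A" by (rule LinftyE)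
  obtain C where C: "0 < C" "\<And>u G \<phi>. W0 p \<Omega> u G \<phi> \<Longrightarrow> (\<integral>x. norm (u x) powr p \<partial>M) \<le> C * (\<integral>x. norm (G x) powr p \<partial>M)"
    using poincare_W0 by blast
  define r where "r = (g - p) / (g - q)"
  define t where "t = (q - p) / (g - q)"
  have rt: "0 < r" "0 < t" using e by (auto simp: r_def t_def)
  \<comment> \<open>\<open>A\<close> bounds a, 2^r comes from interpolation, \<open>C\<close> from
    the Poincare inequality, and 1/\<sigma> from the lower bound of b.\<close>
  define B where "B = A powr r * (2 powr r * (C * (1 / \<sigma>) powr t))"
  have est: "0 < Qt u \<and> Qt u \<le> B" if u: "u \<in> D_set p q \<Omega> a" for u
  proof -
    have u0: "u \<in> W1p_0 p \<Omega>" and pos: "0 < (\<integral>x. a x * \<bar>u x\<bar> powr q \<partial>M)" using u by (auto simp: D_set_def)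
    obtain \<phi> where W: "W0 p \<Omega> u (weak_gradient \<Omega> u) \<phi>" using W1p_0_W0[OF \<Omega> e(6) u0] by blast
    note L = W0_Lp[OF W]
    define X where "X = (\<integral>x. norm (u x) powr p \<partial>M)"
    define Y where "Y = (\<integral>x. norm (u x) powr g \<partial>M)"
    define G where "G = (\<integral>x. norm (weak_gradient \<Omega> u x) powr p \<partial>M)"
    define Z where "Z = (\<integral>x. b x * \<bar>u x\<bar> powr g \<partial>M)"
    define S where "S = (\<integral>x. a x * \<bar>u x\<bar> powr q \<partial>M)"
    have nz: "\<not> (AE x in M. u x = 0)"
    proof
      assume "AE x in M. u x = 0"
      then have "(\<integral>x. a x * \<bar>u x\<bar> powr q \<partial>M) = 0"
        by (intro integral_eq_zero_AE) (auto elim: eventually_mono)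
      then show False using pos by simp
    qed
    have "X \<noteq> 0" "Y \<noteq> 0" using nz integral_powr_eq_0_AE[OF L(1)] integral_powr_eq_0_AE[OF L(3)] by (auto simp: X_def Y_def)
    then have XY: "0 < X" "0 < Y" by (simp_all add: X_def Y_def less_le)
    have XG: "X \<le> C * G" using C(2)[OF W] by (simp add: X_def G_def)
    then have "0 < C * G" using XY by linarith
    then have G: "0 < G" using C(1) by (rule zero_less_mult_pos)
    have YZ: "\<sigma> * Y \<le> Z"
    proof -
      have "\<sigma> * Y = (\<integral>x. \<sigma> * norm (u x) powr g \<partial>M)" by (simp add: Y_def)
      also have "\<dots> \<le> Z" unfolding Z_def
      proof (rule integral_mono_AE)
        show "AE x in M. \<sigma> * norm (u x) powr g \<le> b x * \<bar>u x\<bar> powr g"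
          using coefficients(5) by eventually_elim (auto intro: mult_right_mono)
      qed (use LpD(2)[OF L(3)] Linfty_weighted_integrable[OF coefficients(2) L(3)] in auto)
      finally show ?thesis .
    qed
    then have Z: "0 < Z" using XY coefficients(4) by (smt (verit) mult_pos_pos)
    have "S \<le> A * (\<integral>x. norm (u x) powr q \<partial>M)"
    proof -
      have "S \<le> (\<integral>x. A * norm (u x) powr q \<partial>M)" unfolding S_def
      proof (rule integral_mono_AE)
        show "AE x in M. a x * \<bar>u x\<bar> powr q \<le> A * norm (u x) powr q"
          using A(3) by eventually_elim (auto intro: mult_right_mono)
      qed (use LpD(2)[OF L(4)] Linfty_weighted_integrable[OF coefficients(1) L(4)] in auto)
      then show ?thesis by simp
    qed
    then have "S powr r \<le> (A * (\<integral>x. norm (u x) powr q \<partial>M)) powr r"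
      using pos rt by (intro powr_mono2) (auto simp: S_def)
    also have "\<dots> = A powr r * (\<integral>x. norm (u x) powr q \<partial>M) powr r" by (simp add: powr_mult)
    also have "\<dots> \<le> A powr r * (2 powr r * (X * Y powr t))"
      unfolding X_def Y_def r_def t_def using XY by (intro mult_left_mono interpolation L) (auto simp: X_def Y_def)
    also have "\<dots> \<le> A powr r * (2 powr r * ((C * G) * (Z / \<sigma>) powr t))"
      using XG YZ XY rt coefficients(4) C G by (intro mult_left_mono mult_mono powr_mono2) (auto simp: field_simps)
    also have "\<dots> = B * (G * Z powr t)" by (simp add: B_def powr_divide)
    finally have "S powr r \<le> B * (G * Z powr t)" .
    moreover have "0 < G * Z powr t" using G Z by simp
    moreover have "0 < S powr r" using pos by (simp add: S_def)
    ultimately show ?thesis unfolding Qt_def r_def[symmetric] t_def[symmetric] S_def[symmetric] G_def[symmetric] Z_def[symmetric]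
      by (simp add: pos_divide_le_eq)
  qed
  \<comment> \<open>Along test functions tending to 1 in L^q these integrals tend to the integral of
    a, which is positive because a is nonnegative and not almost everywhere zero.\<close>
  have "\<exists>\<phi>\<in>test_functions \<Omega>. 0 < (\<integral>x. a x * norm (\<phi> x) powr q \<partial>M)"
  proof -
    interpret finite_measure M by (rule finite_M)
    have one: "(\<lambda>x. 1::real) \<in> Lp q M" by (simp add: Lp_def)
    obtain \<phi> where \<phi>: "\<And>n. \<phi> n \<in> test_functions \<Omega>" "(\<lambda>n. \<integral>x. norm (1 - \<phi> n x) powr q \<partial>M) \<longlonglongrightarrow> 0"
      using test_functions_dense[OF \<Omega>, of "\<lambda>x. 1" 1 q] e by auto
    have "(\<lambda>n. \<integral>x. a x * norm (\<phi> n x) powr q \<partial>M) \<longlonglongrightarrow> (\<integral>x. a x * norm (1::real) powr q \<partial>M)"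
      using \<phi> test_Lp e by (intro weighted_powr_tendsto coefficients one) auto
    moreover have "0 < (\<integral>x. a x * norm (1::real) powr q \<partial>M)"
    proof -
      have ia: "integrable M a" using Linfty_weighted_integrable[OF coefficients(1) one] by simp
      have "(\<integral>x. a x \<partial>M) \<noteq> 0"
        using integral_nonneg_eq_0_iff_AE[OF ia coefficients(3)] a by simp
      moreover have "0 \<le> (\<integral>x. a x \<partial>M)" by (rule integral_nonneg_AE[OF coefficients(3)])
      ultimately show ?thesis by simp
    qed
    ultimately have "\<forall>\<^sub>F n in sequentially. 0 < (\<integral>x. a x * norm (\<phi> n x) powr q \<partial>M)" by (rule order_tendstoD)
    then have "\<exists>n. 0 < (\<integral>x. a x * norm (\<phi> n x) powr q \<partial>M)" by (rule eventually_happens'[OF sequentially_bot])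
    then show ?thesis using \<phi>(1) by blast
  qed
  then obtain \<phi> where \<phi>: "\<phi> \<in> test_functions \<Omega>" "0 < (\<integral>x. a x * norm (\<phi> x) powr q \<partial>M)" by blast
  have "\<phi> \<in> D_set p q \<Omega> a"
  proof -
    have "\<phi> \<in> W1p_0 p \<Omega>" by (rule W0_W1p_0[OF \<Omega> e(6) W0_test_function[OF \<Omega>(1) e(1) \<phi>(1)]])
    moreover have "\<not> (AE x in M. \<phi> x = 0)"
    proof
      assume "AE x in M. \<phi> x = 0"
      then have "(\<integral>x. a x * norm (\<phi> x) powr q \<partial>M) = 0"
        by (intro integral_eq_zero_AE) (auto elim: eventually_mono)
      then show False using \<phi> by simp
    qed
    ultimately show ?thesis using \<phi> by (simp add: D_set_def)
  qed
  moreover have "bdd_above (Qt ` D_set p q \<Omega> a)" using est by (intro bdd_aboveI2[of _ _ B]) blast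
  ultimately have "Qt \<phi> \<le> (SUP u\<in>D_set p q \<Omega> a. Qt u)" by (intro cSUP_upper) auto
  then have "0 < (SUP u\<in>D_set p q \<Omega> a. Qt u)" using est \<open>\<phi> \<in> D_set p q \<Omega> a\<close> by force
  moreover have "0 < c_e p q g" using e by (simp add: c_e_def)
  ultimately show ?thesis unfolding eps_e_def Qt_def by (rule mult_pos_pos[rotated])
qed

end

section \<open>Modes of convergence\<close>

lemma weakly_tendsto_LpI:
  fixes f :: "'i \<Rightarrow> 'a \<Rightarrow> real"
  assumes "tendsto_Lp r M F f (\<lambda>x. 0)"
  shows "weakly_tendsto_Lp r M F f (\<lambda>x. 0)"
  unfolding weakly_tendsto_Lp_def
proof (intro conjI ballI)
  show z: "(\<lambda>x. 0::real) \<in> Lp r M" and f: "\<forall>\<^sub>F i in F. f i \<in> Lp r M" using assms by (auto simp: tendsto_Lp_def)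
  have lim: "((\<lambda>i. Lp_norm r M (f i)) \<longlongrightarrow> 0) F" using assms by (auto simp: tendsto_Lp_def)
  fix \<Lambda> assume \<Lambda>: "\<Lambda> \<in> Lp_dual r M"
  then obtain C where C: "\<And>f. f \<in> Lp r M \<Longrightarrow> \<bar>\<Lambda> f\<bar> \<le> C * Lp_norm r M f" unfolding Lp_dual_def by blast
  have "\<forall>c. \<forall>f\<in>Lp r M. \<Lambda> (\<lambda>x. c * f x) = c * \<Lambda> f" using \<Lambda> by (simp add: Lp_dual_def)
  \<comment> \<open>Homogeneity with factor 0 yields the value of the functional at the zero
    function.\<close>
  from this[rule_format, OF z, of 0] have L0: "\<Lambda> (\<lambda>x. 0) = 0" by simp
  have "((\<lambda>i. \<Lambda> (f i)) \<longlongrightarrow> 0) F"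
  proof (rule Lim_null_comparison)
    show "\<forall>\<^sub>F i in F. norm (\<Lambda> (f i)) \<le> C * Lp_norm r M (f i)" using f by eventually_elim (use C in simp)
    show "((\<lambda>i. C * Lp_norm r M (f i)) \<longlongrightarrow> 0) F" using tendsto_mult_left[OF lim, of C] by simp
  qed
  then show "((\<lambda>i. \<Lambda> (f i)) \<longlongrightarrow> \<Lambda> (\<lambda>x. 0)) F" by (simp add: L0)
qed

text \<open>Markov's inequality for the r-th power of the difference.\<close>

lemma tendsto_in_measureI:
  fixes f :: "'i \<Rightarrow> 'a \<Rightarrow> real"
  assumes r: "0 < r" and f: "\<forall>\<^sub>F i in F. f i \<in> borel_measurable M" "h \<in> borel_measurable M"
    and Lp: "\<forall>\<^sub>F i in F. (\<lambda>x. f i x - h x) \<in> Lp r M"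
    and lim: "((\<lambda>i. \<integral>x. norm (f i x - h x) powr r \<partial>M) \<longlongrightarrow> 0) F"
  shows "tendsto_in_measure M F f h"
  unfolding tendsto_in_measure_def
proof (intro conjI allI impI f)
  fix \<delta> :: real assume \<delta>: "0 < \<delta>"
  show "((\<lambda>i. emeasure M {x \<in> space M. \<delta> \<le> \<bar>f i x - h x\<bar>}) \<longlongrightarrow> 0) F"
  proof (rule tendsto_sandwich[OF _ _ tendsto_const])
    have "((\<lambda>i. ennreal (inverse (\<delta> powr r) * (\<integral>x. norm (f i x - h x) powr r \<partial>M))) \<longlongrightarrow> ennreal (inverse (\<delta> powr r) * 0)) F"
      by (intro tendsto_intros lim)
    then show "((\<lambda>i. ennreal (inverse (\<delta> powr r) * (\<integral>x. norm (f i x - h x) powr r \<partial>M))) \<longlongrightarrow> 0) F" by simp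
    show "\<forall>\<^sub>F i in F. emeasure M {x \<in> space M. \<delta> \<le> \<bar>f i x - h x\<bar>} \<le> ennreal (inverse (\<delta> powr r) * (\<integral>x. norm (f i x - h x) powr r \<partial>M))"
      using Lp
    proof eventually_elim
      case (elim i)
      note [measurable] = LpD(1)[OF elim]
      have "{x \<in> space M. \<delta> \<le> \<bar>f i x - h x\<bar>} \<subseteq> {x \<in> space M. 1 \<le> ennreal (inverse (\<delta> powr r)) * ennreal (norm (f i x - h x) powr r)}"
      proof clarsimp
        fix x assume "\<delta> \<le> \<bar>f i x - h x\<bar>"
        then have "\<delta> powr r \<le> \<bar>f i x - h x\<bar> powr r" using \<delta> r by (intro powr_mono2) auto
        then have "1 \<le> inverse (\<delta> powr r) * \<bar>f i x - h x\<bar> powr r" using \<delta> by (simp add: field_simps)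
        then show "1 \<le> ennreal (inverse (\<delta> powr r)) * ennreal (\<bar>f i x - h x\<bar> powr r)"
          by (simp add: ennreal_mult[symmetric] del: ennreal_1 add: ennreal_1[symmetric])
      qed
      then have "emeasure M {x \<in> space M. \<delta> \<le> \<bar>f i x - h x\<bar>} \<le> emeasure M {x \<in> space M. 1 \<le> ennreal (inverse (\<delta> powr r)) * ennreal (norm (f i x - h x) powr r)}"
        by (rule emeasure_mono) measurable
      also have "\<dots> \<le> ennreal (inverse (\<delta> powr r)) * (\<integral>\<^sup>+x. ennreal (norm (f i x - h x) powr r) * indicator (space M) x \<partial>M)"
        by (rule nn_integral_Markov_inequality) measurable
      also have "(\<integral>\<^sup>+x. ennreal (norm (f i x - h x) powr r) * indicator (space M) x \<partial>M) = (\<integral>\<^sup>+x. ennreal (norm (f i x - h x) powr r) \<partial>M)"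
        by (rule nn_integral_cong) simp
      also have "\<dots> = ennreal (\<integral>x. norm (f i x - h x) powr r \<partial>M)"
        using LpD(2)[OF elim] by (intro nn_integral_eq_integral) auto
      finally show ?case by (simp add: ennreal_mult)
    qed
  qed simp
qed

text \<open>The finite measure passes strong convergence in L^g down to smaller exponents, and each
  weak statement follows from the strong one with the same exponent.\<close>

lemma all_modes_of_convergence:
  fixes f :: "'i \<Rightarrow> 'a \<Rightarrow> real"
  assumes M: "finite_measure M" and g: "1 < g" and h: "h \<in> borel_measurable M"
    and Lp: "\<forall>\<^sub>F i in F. (\<lambda>x. f i x - h x) \<in> Lp g M"
    and lim: "((\<lambda>i. \<integral>x. norm (f i x - h x) powr g \<partial>M) \<longlongrightarrow> 0) F"
  shows "tendsto_in_measure M F f h"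
    "1 \<le> r \<Longrightarrow> r \<le> g \<Longrightarrow> tendsto_Lp r M F (\<lambda>i x. f i x - h x) (\<lambda>x. 0)"
    "1 \<le> r \<Longrightarrow> r \<le> g \<Longrightarrow> weakly_tendsto_Lp r M F (\<lambda>i x. f i x - h x) (\<lambda>x. 0)"
proof -
  have "\<forall>\<^sub>F i in F. f i \<in> borel_measurable M"
    using Lp
  proof eventually_elim
    case (elim i)
    have "(\<lambda>x. (f i x - h x) + h x) \<in> borel_measurable M" using LpD(1)[OF elim] h by (rule borel_measurable_add)
    then show ?case by simp
  qed
  then show "tendsto_in_measure M F f h" using g h Lp lim by (intro tendsto_in_measureI[of g]) auto
  have T: "tendsto_Lp r M F (\<lambda>i x. f i x - h x) (\<lambda>x. 0)" if r: "1 \<le> r" "r \<le> g" for r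
    unfolding tendsto_Lp_def
  proof (intro conjI)
    have r0: "0 < r" using r by simp
    show "(\<lambda>x. 0::real) \<in> Lp r M" by (simp add: Lp_def)
    show "\<forall>\<^sub>F i in F. (\<lambda>x. f i x - h x) \<in> Lp r M"
      using Lp by eventually_elim (rule Lp_mono[OF M r0 r(2)])
    have "((\<lambda>i. \<integral>x. norm (f i x - h x) powr r \<partial>M) \<longlongrightarrow> 0) F" by (rule Lp_tendsto_mono[OF M r0 r(2) Lp lim])
    then have "((\<lambda>i. (\<integral>x. norm (f i x - h x) powr r \<partial>M) powr (1 / r)) \<longlongrightarrow> 0 powr (1 / r)) F"
      using r0 by (intro tendsto_powr' tendsto_const) auto
    then show "((\<lambda>i. Lp_norm r M (\<lambda>x. f i x - h x - 0)) \<longlongrightarrow> 0) F" by (simp add: Lp_norm_def)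
  qed
  then show "1 \<le> r \<Longrightarrow> r \<le> g \<Longrightarrow> tendsto_Lp r M F (\<lambda>i x. f i x - h x) (\<lambda>x. 0)" .
  show "1 \<le> r \<Longrightarrow> r \<le> g \<Longrightarrow> weakly_tendsto_Lp r M F (\<lambda>i x. f i x - h x) (\<lambda>x. 0)"
    by (intro weakly_tendsto_LpI T)
qed

context p_laplace_problem begin

lemma scaled_ground_states_converge:
  fixes u :: "'i \<Rightarrow> 'a \<Rightarrow> real"
  assumes pos: "0 < \<sigma>a" "AE x in M. \<sigma>a \<le> a x"
    and u: "\<forall>\<^sub>F i in F. 0 < \<alpha> i \<and> 0 < \<beta> i \<and> 0 < s i \<and> \<beta> i * s i powr g = \<alpha> i * s i powr q \<and>
       minimizer (\<alpha> i) (\<beta> i) (u i) \<and> positive_on \<Omega> (u i)"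
    and \<epsilon>: "((\<lambda>i. s i powr (p - q) / \<alpha> i) \<longlongrightarrow> 0) F"
    and w: "w = (\<lambda>i x. inverse (s i) * u i x)"
  shows "tendsto_in_measure M F w (u0_bar q g a b) \<and>
    (\<forall>r. 1 \<le> r \<and> r < g \<longrightarrow> tendsto_Lp r M F (\<lambda>i x. w i x - u0_bar q g a b x) (\<lambda>x. 0)) \<and>
    weakly_tendsto_Lp g M F (\<lambda>i x. w i x - u0_bar q g a b x) (\<lambda>x. 0) \<and>
    (\<forall>r. 1 < r \<and> r \<le> g \<longrightarrow> weakly_tendsto_Lp r M F (\<lambda>i x. w i x - u0_bar q g a b x) (\<lambda>x. 0))"
proof -
  have a0: "AE x in M. 0 < a x" using pos(2) by eventually_elim (use pos(1) in simp)
  have g: "1 < g" using exponents by simp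
  have c: "\<forall>\<^sub>F i in F. (\<lambda>x. w i x - u0 x) \<in> Lp g M" "((\<lambda>i. \<integral>x. norm (w i x - u0 x) powr g \<partial>M) \<longlongrightarrow> 0) F"
    unfolding w by (rule minimizer_asymptotics[OF a0 u[unfolded positive_on_def] \<epsilon>])+
  note all_modes_of_convergence[OF finite_M g u0_measurable c]
  then show ?thesis using g unfolding u0_def by auto
qed

end

section \<open>The two parameter limits\<close>

theorem corollary1p2:
  fixes \<Omega> :: "'a::euclidean_space set"
    and p q \<gamma> \<sigma>b :: real
    and a b :: "'a \<Rightarrow> real"
  assumes "bounded_C1_domain \<Omega>"
    and "1 < p" "p < q" "q < \<gamma>" "ereal \<gamma> < critical_exponent p DIM('a)"
    and "a \<in> Linfty (lebesgue_on \<Omega>)" "b \<in> Linfty (lebesgue_on \<Omega>)"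
    and "AE x in lebesgue_on \<Omega>. a x \<ge> 0"
    and "\<sigma>b > 0" "AE x in lebesgue_on \<Omega>. b x \<ge> \<sigma>b"
    and "\<not> (AE x in lebesgue_on \<Omega>. a x = 0)"
  shows
    "(\<forall>l>lambda_e p q \<gamma> \<Omega> a b. \<exists>u. ground_state_Q p q \<gamma> \<Omega> a b l u) \<and>
     (\<forall>\<nu>. 0 < \<nu> \<and> \<nu> < nu_e p q \<gamma> \<Omega> a b \<longrightarrow> (\<exists>u. ground_state_R p q \<gamma> \<Omega> a b \<nu> u)) \<and>
     (\<forall>\<sigma>a>0. (AE x in lebesgue_on \<Omega>. a x \<ge> \<sigma>a) \<longrightarrow>
        (\<forall>u :: real \<Rightarrow> 'a \<Rightarrow> real.
           (\<forall>l>lambda_e p q \<gamma> \<Omega> a b.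
              ground_state_Q p q \<gamma> \<Omega> a b l (u l) \<and> positive_on \<Omega> (u l)) \<longrightarrow>
           tendsto_in_measure (lebesgue_on \<Omega>) at_top
             (\<lambda>l x. l powr (- 1 / (\<gamma> - q)) * u l x) (u0_bar q \<gamma> a b) \<and>
           (\<forall>r. 1 \<le> r \<and> r < \<gamma> \<longrightarrow>
              tendsto_Lp r (lebesgue_on \<Omega>) at_top
                (\<lambda>l x. l powr (- 1 / (\<gamma> - q)) * u l x - u0_bar q \<gamma> a b x) (\<lambda>x. 0)) \<and>
           weakly_tendsto_Lp \<gamma> (lebesgue_on \<Omega>) at_top
             (\<lambda>l x. l powr (- 1 / (\<gamma> - q)) * u l x - u0_bar q \<gamma> a b x) (\<lambda>x. 0) \<and>
           (\<forall>r. 1 < r \<and> r \<le> \<gamma> \<longrightarrow>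
              weakly_tendsto_Lp r (lebesgue_on \<Omega>) at_top
                (\<lambda>l x. l powr (- 1 / (\<gamma> - q)) * u l x - u0_bar q \<gamma> a b x) (\<lambda>x. 0))) \<and>
        (\<forall>u :: real \<Rightarrow> 'a \<Rightarrow> real.
           (\<forall>\<nu>. 0 < \<nu> \<and> \<nu> < nu_e p q \<gamma> \<Omega> a b \<longrightarrow>
              ground_state_R p q \<gamma> \<Omega> a b \<nu> (u \<nu>) \<and> positive_on \<Omega> (u \<nu>)) \<longrightarrow>
           tendsto_in_measure (lebesgue_on \<Omega>) (at_right 0)
             (\<lambda>\<nu> x. \<nu> powr (1 / (\<gamma> - q)) * u \<nu> x) (u0_bar q \<gamma> a b) \<and>
           (\<forall>r. 1 \<le> r \<and> r < \<gamma> \<longrightarrow>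
              tendsto_Lp r (lebesgue_on \<Omega>) (at_right 0)
                (\<lambda>\<nu> x. \<nu> powr (1 / (\<gamma> - q)) * u \<nu> x - u0_bar q \<gamma> a b x) (\<lambda>x. 0)) \<and>
           weakly_tendsto_Lp \<gamma> (lebesgue_on \<Omega>) (at_right 0)
             (\<lambda>\<nu> x. \<nu> powr (1 / (\<gamma> - q)) * u \<nu> x - u0_bar q \<gamma> a b x) (\<lambda>x. 0) \<and>
           (\<forall>r. 1 < r \<and> r \<le> \<gamma> \<longrightarrow>
              weakly_tendsto_Lp r (lebesgue_on \<Omega>) (at_right 0)
                (\<lambda>\<nu> x. \<nu> powr (1 / (\<gamma> - q)) * u \<nu> x - u0_bar q \<gamma> a b x) (\<lambda>x. 0))))"
proof -
  interpret p_laplace_problem \<Omega> p q \<gamma> \<sigma>b a b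
    using assms by unfold_locales (auto simp: bounded_C1_domain_def)
  \<comment> \<open>\<open>lambda_e\<close> is a value of \<open>powr\<close>, hence
    nonnegative.\<close>
  have l0: "0 < l" if "lambda_e p q \<gamma> \<Omega> a b < l" for l
    using that powr_ge_zero[of "eps_e p q \<gamma> \<Omega> a b" "- (\<gamma> - q) / (\<gamma> - p)"] unfolding lambda_e_def by linarith
  \<comment> \<open>The admissible parameters thus fill a right neighbourhood of 0, and what holds
    for all of them holds eventually at 0 from the right.\<close>
  have \<nu>0: "0 < nu_e p q \<gamma> \<Omega> a b"
    using eps_e_pos[OF assms(11)] by (simp add: nu_e_def)
  have \<gamma>q: "0 < \<gamma> - q" using assms by simp
  have Q: "\<forall>l>lambda_e p q \<gamma> \<Omega> a b. \<exists>u. ground_state_Q p q \<gamma> \<Omega> a b l u"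
    using minimizer_exists[OF l0 zero_less_one] ground_state_Q_iff[OF l0] by blast
  have R: "\<forall>\<nu>. 0 < \<nu> \<and> \<nu> < nu_e p q \<gamma> \<Omega> a b \<longrightarrow> (\<exists>u. ground_state_R p q \<gamma> \<Omega> a b \<nu> u)"
    using minimizer_exists[OF zero_less_one] ground_state_R_iff by blast
  show ?thesis
  proof (rule conjI[OF Q conjI[OF R]], intro allI impI, rule conjI; intro allI impI)
    fix \<sigma>a :: real and u :: "real \<Rightarrow> 'a \<Rightarrow> real"
    assume \<sigma>a: "0 < \<sigma>a" "AE x in lebesgue_on \<Omega>. \<sigma>a \<le> a x"
      and u: "\<forall>l>lambda_e p q \<gamma> \<Omega> a b. ground_state_Q p q \<gamma> \<Omega> a b l (u l) \<and> positive_on \<Omega> (u l)"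
    \<comment> \<open>The choice is \<alpha> = l, \<beta> = 1 and s = l^(1/(\<gamma>-q)), for which
      s^\<gamma> = l s^q.\<close>
    have ev: "\<forall>\<^sub>F l in at_top. 0 < l \<and> 0 < (1::real) \<and> 0 < l powr (1 / (\<gamma> - q)) \<and>
        1 * (l powr (1 / (\<gamma> - q))) powr \<gamma> = l * (l powr (1 / (\<gamma> - q))) powr q \<and> minimizer l 1 (u l) \<and> positive_on \<Omega> (u l)"
      using eventually_gt_at_top[of "lambda_e p q \<gamma> \<Omega> a b"]
    proof eventually_elim
      case (elim l)
      note l = l0[OF elim]
      have "l powr (\<gamma> / (\<gamma> - q)) = l powr (1 + q / (\<gamma> - q))" using \<gamma>q by (simp add: field_simps)
      then have "(l powr (1 / (\<gamma> - q))) powr \<gamma> = l * (l powr (1 / (\<gamma> - q))) powr q"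
        using l by (simp add: powr_powr powr_add)
      moreover have "minimizer l 1 (u l)" "positive_on \<Omega> (u l)" using u elim ground_state_Q_iff[OF l] by blast+
      ultimately show ?case using l by simp
    qed
    \<comment> \<open>The coefficient is the power of l with exponent (p - q)/(\<gamma> - q) - 1,
      which is negative.\<close>
    have lim: "((\<lambda>l. (l powr (1 / (\<gamma> - q))) powr (p - q) / l) \<longlongrightarrow> 0) at_top"
    proof (rule Lim_transform_eventually)
      show "((\<lambda>l. l powr ((p - q) / (\<gamma> - q) - 1)) \<longlongrightarrow> 0) at_top"
        using assms \<gamma>q by (intro tendsto_neg_powr filterlim_ident) (simp add: divide_less_0_iff less_trans[of _ 0 1])
      show "\<forall>\<^sub>F l in at_top. l powr ((p - q) / (\<gamma> - q) - 1) = (l powr (1 / (\<gamma> - q))) powr (p - q) / l"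
        using eventually_gt_at_top[of 0] by eventually_elim (simp add: powr_powr powr_diff diff_divide_distrib)
    qed
    have w: "(\<lambda>l x. l powr (- 1 / (\<gamma> - q)) * u l x) = (\<lambda>l x. inverse (l powr (1 / (\<gamma> - q))) * u l x)"
      by (simp add: powr_minus[symmetric])
    show "tendsto_in_measure (lebesgue_on \<Omega>) at_top (\<lambda>l x. l powr (- 1 / (\<gamma> - q)) * u l x) (u0_bar q \<gamma> a b) \<and>
        (\<forall>r. 1 \<le> r \<and> r < \<gamma> \<longrightarrow> tendsto_Lp r (lebesgue_on \<Omega>) at_top
          (\<lambda>l x. l powr (- 1 / (\<gamma> - q)) * u l x - u0_bar q \<gamma> a b x) (\<lambda>x. 0)) \<and>
        weakly_tendsto_Lp \<gamma> (lebesgue_on \<Omega>) at_top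
          (\<lambda>l x. l powr (- 1 / (\<gamma> - q)) * u l x - u0_bar q \<gamma> a b x) (\<lambda>x. 0) \<and>
        (\<forall>r. 1 < r \<and> r \<le> \<gamma> \<longrightarrow> weakly_tendsto_Lp r (lebesgue_on \<Omega>) at_top
          (\<lambda>l x. l powr (- 1 / (\<gamma> - q)) * u l x - u0_bar q \<gamma> a b x) (\<lambda>x. 0))"
      by (rule scaled_ground_states_converge[OF \<sigma>a ev lim w])
  next
    fix \<sigma>a :: real and u :: "real \<Rightarrow> 'a \<Rightarrow> real"
    assume \<sigma>a: "0 < \<sigma>a" "AE x in lebesgue_on \<Omega>. \<sigma>a \<le> a x"
      and u: "\<forall>\<nu>. 0 < \<nu> \<and> \<nu> < nu_e p q \<gamma> \<Omega> a b \<longrightarrow> ground_state_R p q \<gamma> \<Omega> a b \<nu> (u \<nu>) \<and> positive_on \<Omega> (u \<nu>)"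
    \<comment> \<open>Here \<alpha> = 1, \<beta> = \<nu> and s = \<nu>^(-1/(\<gamma>-q)); the
      gradient coefficient becomes \<nu>^((q-p)/(\<gamma>-q)), which has a positive
      exponent.\<close>
    have ev: "\<forall>\<^sub>F \<nu> in at_right 0. 0 < (1::real) \<and> 0 < \<nu> \<and> 0 < \<nu> powr (- 1 / (\<gamma> - q)) \<and>
        \<nu> * (\<nu> powr (- 1 / (\<gamma> - q))) powr \<gamma> = 1 * (\<nu> powr (- 1 / (\<gamma> - q))) powr q \<and> minimizer 1 \<nu> (u \<nu>) \<and> positive_on \<Omega> (u \<nu>)"
      using eventually_at_right_less[of 0] eventually_at_right_real[OF \<nu>0]
    proof eventually_elim
      case (elim \<nu>)
      then have \<nu>: "0 < \<nu>" "\<nu> < nu_e p q \<gamma> \<Omega> a b" by auto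
      have "1 + - \<gamma> / (\<gamma> - q) = - q / (\<gamma> - q)" using \<gamma>q by (simp add: field_simps)
      then have "\<nu> powr (1 + - \<gamma> / (\<gamma> - q)) = \<nu> powr (- q / (\<gamma> - q))" by simp
      then have "\<nu> * (\<nu> powr (- 1 / (\<gamma> - q))) powr \<gamma> = (\<nu> powr (- 1 / (\<gamma> - q))) powr q"
        using \<nu> unfolding powr_add by (simp add: powr_powr)
      moreover have "minimizer 1 \<nu> (u \<nu>)" "positive_on \<Omega> (u \<nu>)" using u \<nu> ground_state_R_iff[OF \<nu>(1)] by blast+
      ultimately show ?case using \<nu> by simp
    qed
    have lim: "((\<lambda>\<nu>. (\<nu> powr (- 1 / (\<gamma> - q))) powr (p - q) / 1) \<longlongrightarrow> 0) (at_right 0)"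
    proof -
      have pos: "0 < (q - p) / (\<gamma> - q)" using assms by simp
      have "((\<lambda>\<nu>::real. \<nu> powr ((q - p) / (\<gamma> - q))) \<longlongrightarrow> 0 powr ((q - p) / (\<gamma> - q))) (at_right 0)"
        using pos by (intro tendsto_powr' tendsto_ident_at tendsto_const) (auto simp: eventually_at_filter)
      moreover have "- 1 / (\<gamma> - q) * (p - q) = (q - p) / (\<gamma> - q)" using \<gamma>q by (simp add: field_simps)
      ultimately show ?thesis by (simp only: powr_powr div_by_1 powr_0)
    qed
    have w: "(\<lambda>\<nu> x. \<nu> powr (1 / (\<gamma> - q)) * u \<nu> x) = (\<lambda>\<nu> x. inverse (\<nu> powr (- 1 / (\<gamma> - q))) * u \<nu> x)"
      by (simp add: powr_minus[symmetric])
    show "tendsto_in_measure (lebesgue_on \<Omega>) (at_right 0) (\<lambda>\<nu> x. \<nu> powr (1 / (\<gamma> - q)) * u \<nu> x) (u0_bar q \<gamma> a b) \<and>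
        (\<forall>r. 1 \<le> r \<and> r < \<gamma> \<longrightarrow> tendsto_Lp r (lebesgue_on \<Omega>) (at_right 0)
          (\<lambda>\<nu> x. \<nu> powr (1 / (\<gamma> - q)) * u \<nu> x - u0_bar q \<gamma> a b x) (\<lambda>x. 0)) \<and>
        weakly_tendsto_Lp \<gamma> (lebesgue_on \<Omega>) (at_right 0)
          (\<lambda>\<nu> x. \<nu> powr (1 / (\<gamma> - q)) * u \<nu> x - u0_bar q \<gamma> a b x) (\<lambda>x. 0) \<and>
        (\<forall>r. 1 < r \<and> r \<le> \<gamma> \<longrightarrow> weakly_tendsto_Lp r (lebesgue_on \<Omega>) (at_right 0)
          (\<lambda>\<nu> x. \<nu> powr (1 / (\<gamma> - q)) * u \<nu> x - u0_bar q \<gamma> a b x) (\<lambda>x. 0))"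
      by (rule scaled_ground_states_converge[OF \<sigma>a ev lim w])
  qed
qed

end
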